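(* Let $f(\bm x)=\bm x^TF\bm x\in\mathbb{Z}[x_1,\dots,x_s]$ be a non-singular quadratic form satisfying Condition $\mathrm{L}_1$ such that $f(\bm x)=0$ has a solution in $\mathbb{R}_{>0}^s$, let $t\in\mathbb{Z}$, and let $\mathcal A$ be a sequence of non-negative reals with $A(X)\to\infty$ satisfying Conditions C, D, K and $\mathrm{L}_2$, such that $A(X)$ is smoothly approximable. Let $K>0$. Then there are compact sets $\mathfrak C_1\subset\mathfrak C_2\subset\mathbb{R}_{>0}^s$ such that for each (sufficiently large) $X$ there exists a compact box $\mathfrak B$ with $\mathfrak C_1\subset\mathfrak B\subset\mathfrak C_2$ for which $$R_{f,t}(X,\mathcal A,\mathfrak B)=\mathfrak S\,\mathfrak I_{\mathfrak B}(X)+O\big(A(X)^sX^{-2}L^{-K}\big),$$ where $\mathfrak S=\sum_{q\ge1}B(q)$ is the same constant as in the unboxed count. Furthermore $A(X)^sX^{-2}\ll\mathfrak I_{\mathfrak B}(X)\ll A(X)^sX^{-2}$, and $\frac{X^2}{A(X)^s}\mathfrak I_{\mathfrak B}(X)$ can be interpreted as a (weighted) local density of real solutions inside $\mathfrak B$.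
   Context: Notation: $e(z)=e^{2\pi iz}$, $L=\log X$. $F$ is the symmetric matrix with $f(\bm x)=\sum_{i,j}F_{i,j}x_ix_j$; $n=\lfloor s/2\rfloor$; $F_2$ is the submatrix of rows $1..n$, columns $n+1..s$. Condition $\mathrm{L}_1$: after some permutation of the variables, $\operatorname{rank}F_2\ge5$. $\mathcal A=(a_x)_{x\in\mathbb N}$, $a_x\ge0$, $A(X)=\sum_{1\le x\le X}a_x$, $A(q,h;X)=\sum_{x\le X,x\equiv h(q)}a_x$; $a_{\bm x}=\prod a_{x_i}$, $\kappa(q,\bm h)=\prod\kappa(q,h_i)$. Condition $\mathrm{L}_2$: some $c\ge0$ with $\sum_{x\le X}a_x^2\ll A(X)^2X^{-1}L^c$ for all $X\ge1$. Condition D: for an increasing $Q_D(X)$, for all $X>1$, $q\le Q_D$, $h$ mod $q$ there is $\kappa(q,h)\ge0$ with $A(q,h;X)=\kappa(q,h)A(X)+O_m(A(X)L^{-m})$ for every $m$. Condition C: $\kappa(qq',qh'+q'h)=\kappa(q,q'h)\kappa(q',qh')$ for coprime $q,q'$ with $qq'<Q_D$. Condition K: $\kappa(q,h)\ll(\log q)^c/q$ for some $c\ge0$ independent of $q$. Smoothly approximable: for every $m\in\mathbb N$ there is smooth $\Psi$, $\psi=\Psi'$, with $\Psi(X)=A(X)+O(A(X)L^{-m})$, $\psi(X)\asymp A(X)/X$, and $\int_{yX}^{zX}|\psi'(u)|du\ll_{y,z}A(X)/X$ for all $y,z>0$. For compact $\mathfrak B\subset\mathbb{R}^s_{>0}$: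 $R_{f,t}(X,\mathcal A,\mathfrak B)=\sum_{\bm x\in\mathbb{Z}^s\cap X\mathfrak B}\mathbf 1_{[f(\bm x)=t]}a_{\bm x}$, $X\mathfrak B=\{X\bm v:\bm v\in\mathfrak B\}$. $S(q,a)=\sum_{\bm h\bmod q}\kappa(q,\bm h)e(\tfrac aq f(\bm h))$, $B(q)=\sum_{1\le a\le q,(a,q)=1}S(q,a)e(-\tfrac aqt)$. With $P=L^B$ ($B$ sufficiently large depending on $K,c$), $t_0=t/X^2$, and $\psi$ the derivative of a smooth approximation of $A$: $\mathfrak I_{\mathfrak B}(X)=X^{s-2}\int_{-P}^{P}\int_{\mathfrak B}\psi(X\bm u)e(\gamma f(\bm u))e(-\gamma t_0)\,d\bm u\,d\gamma$, where $\psi(X\bm u)=\prod_i\psi(Xu_i)$.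
   Formalization: Condition D is required with Q_D(X) ≥ (log X)^B for all large X (B as in P = L^B), since for bounded or very slowly growing Q_D the constant 𝔖 is undefined or the formula fails; K is required for q ≥ 2 and L_2 for X ≥ 2. *)

theory Defs
  imports "HOL-Analysis.Analysis" "HOL-Number_Theory.Cong" "HOL-Library.Landau_Symbols"
begin

definition e :: "real \<Rightarrow> complex" where
  "e x = exp (2 * complex_of_real pi * \<i> * complex_of_real x)"

text \<open>
  Quadratic forms in \<open>s = CARD('n)\<close> variables.  The variables are indexed by the finite type \<open>'n\<close>;
  the form is given by its symmetric matrix \<open>F\<close>, which may have half-integers off the diagonal.
\<close>

definition qform :: "real^'n^'n \<Rightarrow> real^'n \<Rightarrow> real" where
  "qform F x = (\<Sum>i\<in>UNIV. \<Sum>j\<in>UNIV. F $ i $ j * x $ i * x $ j)"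

definition integer_form :: "real^'n^'n \<Rightarrow> bool" where
  "integer_form F \<longleftrightarrow> transpose F = F \<and> (\<forall>i. F $ i $ i \<in> \<int>) \<and>
     (\<forall>i j. i \<noteq> j \<longrightarrow> F $ i $ j + F $ j $ i \<in> \<int>)"

definition ivec :: "int^'n \<Rightarrow> real^'n" where
  "ivec x = (\<chi> i. of_int (x $ i))"

text \<open>
  The bijection \<open>\<sigma>\<close> numbers the variables by \<open>1, \<dots>, s\<close>, i.e. it is the permutation of the
  variables.  The block \<open>F\<^sub>2\<close> (rows \<open>1..n\<close>, columns \<open>n+1..s\<close>, where \<open>n = \<lfloor>s/2\<rfloor>\<close>) is padded with zeros to an
  \<open>s \<times> s\<close> matrix, which does not change its rank.
\<close>

definition F2_block :: "(nat \<Rightarrow> 'n) \<Rightarrow> real^'n^'n \<Rightarrow> real^'n^'n" where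
  "F2_block \<sigma> F = (\<chi> i j.
     if i \<in> \<sigma> ` {1..CARD('n) div 2} \<and> j \<in> \<sigma> ` {CARD('n) div 2 + 1..CARD('n)}
     then F $ i $ j else 0)"

definition cond_L1 :: "real^'n^'n \<Rightarrow> bool" where
  "cond_L1 F \<longleftrightarrow> (\<exists>\<sigma>. bij_betw \<sigma> {1..CARD('n)} (UNIV :: 'n set) \<and> rank (F2_block \<sigma> F) \<ge> 5)"

text \<open>
  The sequence \<open>\<A> = (a\<^sub>x)\<close> is indexed by \<open>x \<ge> 1\<close>; the value \<open>a 0\<close> is never used.
\<close>

definition A :: "(nat \<Rightarrow> real) \<Rightarrow> real \<Rightarrow> real" where
  "A a X = (\<Sum>x | 1 \<le> x \<and> real x \<le> X. a x)"

definition A_res :: "(nat \<Rightarrow> real) \<Rightarrow> nat \<Rightarrow> int \<Rightarrow> real \<Rightarrow> real" where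
  "A_res a q h X = (\<Sum>x | 1 \<le> x \<and> real x \<le> X \<and> [int x = h] (mod int q). a x)"

text \<open>
  The bound is required for \<open>X \<ge> 2\<close>: at \<open>X = 1\<close> the factor \<open>(log X)\<^sup>c\<close> vanishes.
  For \<open>X \<ge> 2\<close> this is the same as requiring it for all sufficiently large \<open>X\<close>.
\<close>

definition cond_L2 :: "(nat \<Rightarrow> real) \<Rightarrow> real \<Rightarrow> bool" where
  "cond_L2 a c \<longleftrightarrow> (\<exists>C. \<forall>X\<ge>2.
     (\<Sum>x | 1 \<le> x \<and> real x \<le> X. (a x)\<^sup>2) \<le> C * ((A a X)\<^sup>2 / X * ln X powr c))"

text \<open>
  A residue class modulo \<open>q\<close> is given by any integer representing it.  Since the condition is
  imposed for every integer \<open>h\<close>, it makes \<open>\<kappa> q\<close> periodic modulo \<open>q\<close> as soon as \<open>A(X) \<rightarrow> \<infinity>\<close> and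
  \<open>q \<le> Q(X)\<close> for some \<open>X\<close>.  The implied constants depend on \<open>m\<close> only.
\<close>

definition cond_D :: "(nat \<Rightarrow> real) \<Rightarrow> (real \<Rightarrow> real) \<Rightarrow> (nat \<Rightarrow> int \<Rightarrow> real) \<Rightarrow> bool" where
  "cond_D a Q \<kappa> \<longleftrightarrow> mono_on {1<..} Q \<and>
     (\<forall>X>1. \<forall>q\<ge>1. \<forall>h. real q \<le> Q X \<longrightarrow> 0 \<le> \<kappa> q h) \<and>
     (\<forall>m::nat. \<exists>C. \<forall>X>1. \<forall>q\<ge>1. \<forall>h. real q \<le> Q X \<longrightarrow>
        \<bar>A_res a q h X - \<kappa> q h * A a X\<bar> \<le> C * (A a X / ln X ^ m))"

definition cond_C :: "(real \<Rightarrow> real) \<Rightarrow> (nat \<Rightarrow> int \<Rightarrow> real) \<Rightarrow> bool" where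
  "cond_C Q \<kappa> \<longleftrightarrow> (\<forall>q\<ge>1. \<forall>q'\<ge>1. \<forall>h h'.
     coprime q q' \<and> (\<exists>X>1. real (q * q') < Q X) \<longrightarrow>
     \<kappa> (q * q') (int q * h' + int q' * h) = \<kappa> q (int q' * h) * \<kappa> q' (int q * h'))"

text \<open>
  The modulus \<open>q = 1\<close> is excluded, because \<open>log 1 = 0\<close> while \<open>\<kappa> 1 h = 1\<close>.
\<close>

definition cond_K :: "(nat \<Rightarrow> int \<Rightarrow> real) \<Rightarrow> real \<Rightarrow> bool" where
  "cond_K \<kappa> c \<longleftrightarrow> (\<exists>C. \<forall>q\<ge>2. \<forall>h. \<kappa> q h \<le> C * (ln (real q) powr c / real q))"

definition smooth_pos :: "(real \<Rightarrow> real) \<Rightarrow> bool" where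
  "smooth_pos \<Psi> \<longleftrightarrow> (\<forall>k. \<forall>x>0. (deriv ^^ k) \<Psi> differentiable (at x))"

text \<open>
  All estimates are as \<open>X \<rightarrow> \<infinity>\<close>.  They could not be required for all \<open>X > 1\<close>: if \<open>A\<close> vanishes on an initial
  interval, a continuous \<open>\<psi>\<close> is not of exact order \<open>A(X)/X\<close> across its first jump.
\<close>

definition smooth_approximation :: "(nat \<Rightarrow> real) \<Rightarrow> nat \<Rightarrow> (real \<Rightarrow> real) \<Rightarrow> bool" where
  "smooth_approximation a m \<Psi> \<longleftrightarrow> smooth_pos \<Psi> \<and>
     (\<lambda>X. \<Psi> X - A a X) \<in> O[at_top](\<lambda>X. A a X / ln X ^ m) \<and>
     (\<exists>k>0. \<exists>k'. \<forall>\<^sub>F X in at_top. k * (A a X / X) \<le> deriv \<Psi> X \<and> deriv \<Psi> X \<le> k' * (A a X / X)) \<and>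
     (\<forall>y>0. \<forall>z>0. (\<lambda>X. integral {y * X..z * X} (\<lambda>u. \<bar>deriv (deriv \<Psi>) u\<bar>)) \<in> O[at_top](\<lambda>X. A a X / X))"

definition smoothly_approximable :: "(nat \<Rightarrow> real) \<Rightarrow> bool" where
  "smoothly_approximable a \<longleftrightarrow> (\<forall>m. \<exists>\<Psi>. smooth_approximation a m \<Psi>)"

definition pos_orthant :: "(real^'n) set" where
  "pos_orthant = {x. \<forall>i. 0 < x $ i}"

definition R_count :: "real^'n^'n \<Rightarrow> int \<Rightarrow> (nat \<Rightarrow> real) \<Rightarrow> real \<Rightarrow> (real^'n) set \<Rightarrow> real" where
  "R_count F t a X \<BB> =
     (\<Sum>x | ivec x \<in> (\<lambda>v. X *\<^sub>R v) ` \<BB> \<and> qform F (ivec x) = of_int t. \<Prod>i\<in>UNIV. a (nat (x $ i)))"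

definition S_sum :: "real^'n^'n \<Rightarrow> (nat \<Rightarrow> int \<Rightarrow> real) \<Rightarrow> nat \<Rightarrow> nat \<Rightarrow> complex" where
  "S_sum F \<kappa> q b = (\<Sum>h | \<forall>i. 0 \<le> h $ i \<and> h $ i < int q.
     complex_of_real (\<Prod>i\<in>UNIV. \<kappa> q (h $ i)) * e (real b / real q * qform F (ivec h)))"

definition B_term :: "real^'n^'n \<Rightarrow> int \<Rightarrow> (nat \<Rightarrow> int \<Rightarrow> real) \<Rightarrow> nat \<Rightarrow> complex" where
  "B_term F t \<kappa> q = (\<Sum>b | 1 \<le> b \<and> b \<le> q \<and> coprime b q.
     S_sum F \<kappa> q b * e (- (real b / real q * of_int t)))"

definition sing_series :: "real^'n^'n \<Rightarrow> int \<Rightarrow> (nat \<Rightarrow> int \<Rightarrow> real) \<Rightarrow> complex" where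
  "sing_series F t \<kappa> = (\<Sum>q. B_term F t \<kappa> (Suc q))"

definition sing_integral ::
  "real^'n^'n \<Rightarrow> int \<Rightarrow> (real \<Rightarrow> real) \<Rightarrow> real \<Rightarrow> (real^'n) set \<Rightarrow> real \<Rightarrow> complex" where
  "sing_integral F t \<psi> B \<BB> X = complex_of_real (X ^ CARD('n) / X\<^sup>2) *
     integral {- (ln X powr B)..ln X powr B} (\<lambda>\<gamma>. integral \<BB> (\<lambda>u.
       complex_of_real (\<Prod>i\<in>UNIV. \<psi> (X * u $ i)) * e (\<gamma> * qform F u) * e (- (\<gamma> * (of_int t / X\<^sup>2)))))"

text \<open>
  The density \<open>lim\<^sub>\<epsilon>\<^sub>\<rightarrow>\<^sub>0 (2\<epsilon>)\<^sup>-\<^sup>1 \<integral> w\<close>, taken over \<open>{u \<in> \<BB>. \<bar>f(u) - t\<^sub>0\<bar> \<le> \<epsilon>}\<close>, of real solutions of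
  \<open>f(u) = t\<^sub>0\<close> in \<open>\<BB>\<close> with respect to the weight \<open>w\<close>.
\<close>

definition has_real_density ::
  "real^'n^'n \<Rightarrow> real \<Rightarrow> (real^'n \<Rightarrow> real) \<Rightarrow> (real^'n) set \<Rightarrow> real \<Rightarrow> bool" where
  "has_real_density F t\<^sub>0 w \<BB> d \<longleftrightarrow>
     ((\<lambda>\<epsilon>. integral {u \<in> \<BB>. \<bar>qform F u - t\<^sub>0\<bar> \<le> \<epsilon>} w / (2 * \<epsilon>)) \<longlongrightarrow> d) (at_right 0)"

text \<open>The normalised weight; it is bounded above and below on compact subsets of the open orthant.\<close>

definition weight :: "(nat \<Rightarrow> real) \<Rightarrow> (real \<Rightarrow> real) \<Rightarrow> real \<Rightarrow> real^'n \<Rightarrow> real" where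
  "weight a \<psi> X u = (\<Prod>i\<in>UNIV. X * \<psi> (X * u $ i) / A a X)"

end

theory Submission
  imports Defs "HOL-Probability.Probability"
begin

text \<open>
  The proof is by the circle method with major arcs of logarithmic size.  Condition \<open>L\<^sub>1\<close> yields disjoint sets
  \<open>I\<close>, \<open>J\<close> of five variables such that the block of \<open>F\<close> with rows \<open>I\<close> and columns \<open>J\<close> is invertible.  With the
  remaining variables fixed, Cauchy--Schwarz in the variables of \<open>I\<close> and \<open>J\<close> reduces the exponential sum at
  \<open>a/q + \<beta>\<close> to the fifth power of a sum of geometric series.  The bound \<open>N\<^sup>2 W\<^sup>-\<^sup>9\<^sup>/\<^sup>1\<^sup>0\<close> for the latter, where
  \<open>W = q (1 + N\<^sup>2 |\<beta>|)\<close>, gives a saving of \<open>W\<^sup>-\<^sup>9\<^sup>/\<^sup>4\<close> at the cost of \<open>\<Sum> a\<^sub>x\<^sup>2\<close>, which is controlled by condition \<open>L\<^sub>2\<close>.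
  Since \<open>9/4 > 2\<close>, this bound is summable over all Farey arcs and disposes of the minor arcs.

  The same estimate also gives convergence of the singular series (compared with the major arc
  approximation at \<open>a/q\<close>) and decay \<open>|\<gamma>|\<^sup>-\<^sup>9\<^sup>/\<^sup>4\<close> of the Fourier transform of the weight along \<open>f\<close> (as a limit of Weyl
  sums).  Hence that transform is integrable, and Levy's inversion formula identifies the singular
  integral with the real density.  The density is bounded above and below because the gradient of \<open>f\<close> does
  not vanish at the given positive zero; the box is a small cube around this zero, independent of \<open>X\<close>.
\<close>

subsection \<open>Condition \<open>L\<^sub>1\<close> and bilinear sums\<close>

text \<open>The weights are arbitrary non-negative reals, so there is nothing to difference in them;
  Cauchy--Schwarz strips them off as coefficients, and only the sum of their squares survives. Rank
  five is what makes the exponents close: each of the five linear forms saves W to the power 9/10,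
  and the square root from Cauchy--Schwarz leaves 5 * 9/20 = 9/4. Four forms could save at most W to
  the power 2, which gives nothing over the minor arcs. The surplus 1/4 beyond 2 becomes a factor
  \<open>P powr (-(1/4))\<close> off the major arcs. All losses there are powers of ln X, so a large
  power of ln X is enough for \<open>P\<close>; hence \<open>B\<close> is chosen after
  \<open>K\<close> and the exponent of condition L2. On the major arcs the box is cut into cells and
  residue classes. Their number is a power of ln X whose exponent depends on \<open>B\<close>, and
  each contributes an equidistribution error with denominator \<open>ln X ^ m\<close>; hence
  \<open>m\<close> is chosen after \<open>B\<close>.\<close>

lemma exists_independent_indexed:
  fixes f :: "'i \<Rightarrow> 'v::euclidean_space"
  assumes "k \<le> dim (range f)"
  obtains I where "card I = k" "finite I" "inj_on f I" "independent (f ` I)"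
proof -
  obtain S where S: "S \<subseteq> range f" "independent S" "card S = dim (range f)"
    by (metis basis_exists)
  obtain R where R: "R \<subseteq> S" "card R = k"
    using assms S(3) obtain_subset_with_card_n by metis
  have indR: "independent R" using S(2) R(1) independent_mono by blast
  have "finite R" using indR independent_imp_finite by blast
  define g where "g r = (SOME i. f i = r)" for r
  have g: "f (g r) = r" if "r \<in> R" for r
    unfolding g_def by (rule someI_ex) (use that R(1) S(1) in blast)
  have "inj_on g R" by (metis g inj_onI)
  moreover have "f ` g ` R = R" using g by (force simp: image_iff)
  moreover have "inj_on f (g ` R)" using g by (auto intro!: inj_onI)
  ultimately show ?thesis using that[of "g ` R"] R(2) indR \<open>finite R\<close> by (auto simp: card_image)
qed

text \<open>Rank at least five gives five independent rows \<open>I\<close>; the matrix cut down to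
  these rows still has rank at least five, so it has five independent columns \<open>J\<close>. Rows
  of the block vanish outside the first half of the variables and columns outside the second, so
  \<open>I\<close> and \<open>J\<close> are disjoint. Invertibility is phrased as injectivity on
  vectors supported on \<open>J\<close>, because it will be applied to differences of such
  vectors.\<close>

lemma cond_L1_blocks:
  fixes F :: "real^'n^'n"
  assumes "cond_L1 F"
  obtains I J :: "'n set" where "card I = 5" "card J = 5" "I \<inter> J = {}"
    "\<And>v. (\<And>k. k \<notin> J \<Longrightarrow> v $ k = 0) \<Longrightarrow> (\<And>i. i \<in> I \<Longrightarrow> (F *v v) $ i = 0) \<Longrightarrow> v = 0"
proof -
  obtain \<sigma> :: "nat \<Rightarrow> 'n" where bij: "bij_betw \<sigma> {1..CARD('n)} (UNIV :: 'n set)"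
    and rk: "rank (F2_block \<sigma> F) \<ge> 5"
    using assms unfolding cond_L1_def by blast
  define P1 where "P1 = \<sigma> ` {1..CARD('n) div 2}"
  define P2 where "P2 = \<sigma> ` {CARD('n) div 2 + 1..CARD('n)}"
  have disj: "P1 \<inter> P2 = {}"
  proof -
    have "inj_on \<sigma> {1..CARD('n)}" using bij by (rule bij_betw_imp_inj_on)
    then have "\<sigma> ` {1..CARD('n) div 2} \<inter> \<sigma> ` {CARD('n) div 2 + 1..CARD('n)}
        = \<sigma> ` ({1..CARD('n) div 2} \<inter> {CARD('n) div 2 + 1..CARD('n)})"
      by (subst inj_on_image_Int[of _ "{1..CARD('n)}"]) auto
    then show ?thesis unfolding P1_def P2_def by simp
  qed
  define G where "G = F2_block \<sigma> F"
  have G: "G $ i $ j = (if i \<in> P1 \<and> j \<in> P2 then F $ i $ j else 0)" for i j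
    by (simp add: G_def F2_block_def P1_def P2_def)
  have "range (\<lambda>i. row i G) = rows G" by (auto simp: rows_def)
  then have "5 \<le> dim (range (\<lambda>i. row i G))" using rk by (simp add: row_rank_def G_def)
  then obtain I where I: "card I = 5" "finite I" "inj_on (\<lambda>i. row i G) I" "independent ((\<lambda>i. row i G) ` I)"
    by (rule exists_independent_indexed)
  have IP: "I \<subseteq> P1"
  proof
    fix i assume "i \<in> I"
    then have "row i G \<noteq> 0" using I(4) dependent_zero by (metis imageI)
    then show "i \<in> P1" using G by (auto simp: row_def vec_eq_iff split: if_splits)
  qed
  \<comment> \<open>Zeroing the other rows ensures that the columns chosen next are independent
    already on the rows \<open>I\<close>.\<close>
  define G' where "G' = (\<chi> i. if i \<in> I then G $ i else 0)"
  have "(\<lambda>i. row i G) ` I \<subseteq> rows G'"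
  proof
    fix r assume "r \<in> (\<lambda>i. row i G) ` I"
    then obtain i where i: "i \<in> I" "r = row i G" by blast
    then have "r = row i G'" by (simp add: row_def G'_def)
    then show "r \<in> rows G'" by (auto simp: rows_def)
  qed
  then have "card ((\<lambda>i. row i G) ` I) \<le> dim (rows G')"
    using I(4) independent_card_le_dim by blast
  then have "5 \<le> rank G'" using I by (simp add: card_image row_rank_def)
  moreover have "range (\<lambda>i. column i G') = columns G'" by (auto simp: columns_def)
  ultimately have "5 \<le> dim (range (\<lambda>i. column i G'))" by (simp add: column_rank_def)
  then obtain J where J: "card J = 5" "finite J" "inj_on (\<lambda>i. column i G') J" "independent ((\<lambda>i. column i G') ` J)"
    by (rule exists_independent_indexed)
  have JP: "J \<subseteq> P2"
  proof
    fix i assume "i \<in> J"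
    then have "column i G' \<noteq> 0" using J(4) dependent_zero by (metis imageI)
    then show "i \<in> P2" using G by (auto simp: column_def G'_def vec_eq_iff split: if_splits)
  qed
  have "v = 0" if v: "\<And>k. k \<notin> J \<Longrightarrow> v $ k = 0" "\<And>i. i \<in> I \<Longrightarrow> (F *v v) $ i = 0" for v
  proof -
    have "(G' *v v) $ i = 0" for i
    proof (cases "i \<in> I")
      case True
      have "(G' *v v) $ i = (\<Sum>j\<in>UNIV. G $ i $ j * v $ j)"
        using True by (simp add: matrix_vector_mult_def G'_def)
      also have "\<dots> = (\<Sum>j\<in>UNIV. F $ i $ j * v $ j)"
        using True IP JP v(1) by (intro sum.cong) (auto simp: G)
      also have "\<dots> = (F *v v) $ i" by (simp add: matrix_vector_mult_def)
      finally show ?thesis using v(2) True by simp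
    next
      case False
      then show ?thesis by (simp add: matrix_vector_mult_def G'_def)
    qed
    then have "G' *v v = 0" by (simp add: vec_eq_iff)
    then have "(\<Sum>j\<in>UNIV. v $ j *\<^sub>R column j G') = 0"
      by (simp add: matrix_mult_sum scalar_mult_eq_scaleR)
    moreover have "(\<Sum>j\<in>UNIV. v $ j *\<^sub>R column j G') = (\<Sum>j\<in>J. v $ j *\<^sub>R column j G')"
      by (rule sum.mono_neutral_right) (auto simp: v(1))
    ultimately have s0: "(\<Sum>j\<in>J. v $ j *\<^sub>R column j G') = 0" by simp
    \<comment> \<open>Independence concerns the set of columns, so the coefficients are transported
      from indices to vectors; this is where injectivity on \<open>J\<close> enters.\<close>
    define c where "c w = v $ (the_inv_into J (\<lambda>i. column i G') w)" for w
    have c: "c (column j G') = v $ j" if "j \<in> J" for j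
      using the_inv_into_f_f[OF J(3) that] by (simp add: c_def)
    have "(\<Sum>w\<in>(\<lambda>i. column i G') ` J. c w *\<^sub>R w) = 0"
      using s0 by (subst sum.reindex[OF J(3)]) (simp add: c cong: sum.cong)
    then have "c w = 0" if "w \<in> (\<lambda>i. column i G') ` J" for w
      using independentD[OF J(4), of "(\<lambda>i. column i G') ` J" c w] J(2) that by auto
    then have "v $ j = 0" if "j \<in> J" for j using c that by force
    then show "v = 0" using v(1) by (auto simp: vec_eq_iff)
  qed
  moreover have "I \<inter> J = {}" using IP JP disj by blast
  ultimately show ?thesis using that[of I J] I(1) J(1) by blast
qed
text \<open>Coordinates outside \<open>S\<close> are set to zero rather than omitted, so that a
  vector is literally the sum of its parts on disjoint sets of variables and all parts live in the
  same type.\<close>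

definition vbox :: "'n::finite set \<Rightarrow> ('n \<Rightarrow> 'a set) \<Rightarrow> ('a::zero^'n) set" where
  "vbox S T = {x. (\<forall>i\<in>S. x $ i \<in> T i) \<and> (\<forall>i. i \<notin> S \<longrightarrow> x $ i = 0)}"

lemma vbox_bij: "bij_betw (\<lambda>g. \<chi> i. if i \<in> S then g i else 0) (Pi\<^sub>E S T) (vbox S T)"
  by (rule bij_betwI[where g = "\<lambda>x. restrict (\<lambda>i. x $ i) S"])
     (auto simp: vbox_def vec_eq_iff PiE_iff extensional_def fun_eq_iff)

lemma finite_vbox [intro]:
  assumes "\<And>i. i \<in> S \<Longrightarrow> finite (T i)"
  shows "finite (vbox S T :: ('a::zero^'n) set)"
  using bij_betw_finite[OF vbox_bij[of S T]] finite_PiE[of S T] assms by simp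

lemma sum_vbox_prod:
  fixes g :: "'n::finite \<Rightarrow> 'a::zero \<Rightarrow> 'b::comm_semiring_1"
  assumes "\<And>i. i \<in> S \<Longrightarrow> finite (T i)"
  shows "(\<Sum>x\<in>vbox S T. \<Prod>i\<in>S. g i (x $ i)) = (\<Prod>i\<in>S. \<Sum>n\<in>T i. g i n)"
proof -
  have "(\<Sum>x\<in>vbox S T. \<Prod>i\<in>S. g i (x $ i)) = (\<Sum>h\<in>Pi\<^sub>E S T. \<Prod>i\<in>S. g i (h i))"
    by (subst sum.reindex_bij_betw[OF vbox_bij, symmetric]) simp
  also have "\<dots> = (\<Prod>i\<in>S. \<Sum>n\<in>T i. g i n)"
    using assms by (subst prod_sum_PiE) auto
  finally show ?thesis .
qed

lemma sum_vbox_union: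
  fixes h :: "'a::comm_monoid_add^'n \<Rightarrow> 'b::comm_monoid_add"
  assumes "S \<inter> S' = {}"
  shows "(\<Sum>x\<in>vbox (S \<union> S') T. h x) = (\<Sum>x\<in>vbox S T. \<Sum>y\<in>vbox S' T. h (x + y))"
proof -
  have "(\<Sum>x\<in>vbox S T. \<Sum>y\<in>vbox S' T. h (x + y)) = (\<Sum>(x, y)\<in>vbox S T \<times> vbox S' T. h (x + y))"
    by (rule sum.cartesian_product)
  also have "\<dots> = (\<Sum>x\<in>vbox (S \<union> S') T. h x)"
  proof (rule sum.reindex_bij_witness[of _ "\<lambda>x. (\<chi> i. if i \<in> S then x $ i else 0, \<chi> i. if i \<in> S' then x $ i else 0)" "\<lambda>(x, y). x + y"])
    fix p :: "('a^'n) \<times> ('a^'n)" assume p: "p \<in> vbox S T \<times> vbox S' T"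
    obtain x y where xy: "p = (x, y)" "x \<in> vbox S T" "y \<in> vbox S' T" using p by auto
    have x: "x $ i = 0" if "i \<in> S'" for i using xy assms that by (auto simp: vbox_def)
    have y: "y $ i = 0" if "i \<in> S" for i using xy assms that by (auto simp: vbox_def)
    show "(case p of (x, y) \<Rightarrow> x + y) \<in> vbox (S \<union> S') T"
      using xy x y by (auto simp: vbox_def)
    show "(\<chi> i. if i \<in> S then (case p of (x, y) \<Rightarrow> x + y) $ i else 0,
           \<chi> i. if i \<in> S' then (case p of (x, y) \<Rightarrow> x + y) $ i else 0) = p"
      using xy x y by (auto simp: vbox_def vec_eq_iff)
    show "h (case p of (x, y) \<Rightarrow> x + y) = (case p of (x, y) \<Rightarrow> h (x + y))" by (simp add: xy)
  next
    fix x :: "'a^'n" assume x: "x \<in> vbox (S \<union> S') T"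
    show "(\<chi> i. if i \<in> S then x $ i else 0, \<chi> i. if i \<in> S' then x $ i else 0) \<in> vbox S T \<times> vbox S' T"
      using x by (auto simp: vbox_def)
    show "(case (\<chi> i. if i \<in> S then x $ i else 0, \<chi> i. if i \<in> S' then x $ i else 0) of (x, y) \<Rightarrow> x + y) = x"
      using x assms by (auto simp: vbox_def vec_eq_iff)
  qed
  finally show ?thesis by simp
qed

text \<open>Cauchy--Schwarz in \<open>x\<close>, then Schur's test for the kernel that arises.\<close>

lemma bilinear_bound:
  fixes p :: "'a \<Rightarrow> complex" and r :: "'b \<Rightarrow> complex" and k :: "'a \<Rightarrow> 'b \<Rightarrow> complex"
  assumes fin: "finite U" "finite V"
    and G: "\<And>y. y \<in> V \<Longrightarrow> (\<Sum>y'\<in>V. norm (\<Sum>x\<in>U. k x y * cnj (k x y'))) \<le> G"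
  shows "(norm (\<Sum>x\<in>U. \<Sum>y\<in>V. p x * r y * k x y))\<^sup>2
     \<le> (\<Sum>x\<in>U. (norm (p x))\<^sup>2) * (\<Sum>y\<in>V. (norm (r y))\<^sup>2) * G"
proof -
  define g where "g y y' = norm (\<Sum>x\<in>U. k x y * cnj (k x y'))" for y y'
  have gsym: "g y y' = g y' y" for y y'
  proof -
    have "g y' y = norm (cnj (\<Sum>x\<in>U. k x y * cnj (k x y')))" by (simp add: g_def mult.commute)
    then show ?thesis by (simp only: complex_mod_cnj g_def)
  qed
  define w where "w x = (\<Sum>y\<in>V. r y * k x y)" for x
  have "norm (\<Sum>x\<in>U. \<Sum>y\<in>V. p x * r y * k x y) = norm (\<Sum>x\<in>U. p x * w x)"
    by (simp add: w_def sum_distrib_left mult.assoc)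
  also have "\<dots> \<le> (\<Sum>x\<in>U. norm (p x) * norm (w x))" by (rule norm_sum[THEN order_trans]) (simp add: norm_mult)
  finally have "(norm (\<Sum>x\<in>U. \<Sum>y\<in>V. p x * r y * k x y))\<^sup>2 \<le> (\<Sum>x\<in>U. norm (p x) * norm (w x))\<^sup>2"
    by (intro power_mono) auto
  also have "\<dots> \<le> (\<Sum>x\<in>U. (norm (p x))\<^sup>2) * (\<Sum>x\<in>U. (norm (w x))\<^sup>2)" by (rule Cauchy_Schwarz_ineq_sum)
  finally have 1: "(norm (\<Sum>x\<in>U. \<Sum>y\<in>V. p x * r y * k x y))\<^sup>2 \<le> (\<Sum>x\<in>U. (norm (p x))\<^sup>2) * (\<Sum>x\<in>U. (norm (w x))\<^sup>2)" .
  have "of_real (\<Sum>x\<in>U. (norm (w x))\<^sup>2) = (\<Sum>x\<in>U. w x * cnj (w x))"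
    by (simp add: complex_norm_square del: of_real_power)
  also have "\<dots> = (\<Sum>x\<in>U. \<Sum>y\<in>V. \<Sum>y'\<in>V. (r y * cnj (r y')) * (k x y * cnj (k x y')))"
    by (simp add: w_def sum_product mult_ac)
  also have "\<dots> = (\<Sum>y\<in>V. \<Sum>y'\<in>V. \<Sum>x\<in>U. (r y * cnj (r y')) * (k x y * cnj (k x y')))"
    by (subst sum.swap, intro sum.cong refl, rule sum.swap)
  also have "\<dots> = (\<Sum>y\<in>V. \<Sum>y'\<in>V. (r y * cnj (r y')) * (\<Sum>x\<in>U. k x y * cnj (k x y')))"
    by (simp add: sum_distrib_left)
  finally have "norm (complex_of_real (\<Sum>x\<in>U. (norm (w x))\<^sup>2)) = norm (\<Sum>y\<in>V. \<Sum>y'\<in>V. (r y * cnj (r y')) * (\<Sum>x\<in>U. k x y * cnj (k x y')))"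
    by simp
  also have "\<dots> \<le> (\<Sum>y\<in>V. \<Sum>y'\<in>V. (norm (r y) * norm (r y')) * g y y')"
    by (intro order_trans[OF norm_sum] sum_mono order_trans[OF norm_sum]) (simp add: norm_mult g_def)
  also have "\<dots> \<le> (\<Sum>y\<in>V. \<Sum>y'\<in>V. ((norm (r y))\<^sup>2 / 2 + (norm (r y'))\<^sup>2 / 2) * g y y')"
  proof (intro sum_mono mult_right_mono)
    fix y y'
    show "norm (r y) * norm (r y') \<le> (norm (r y))\<^sup>2 / 2 + (norm (r y'))\<^sup>2 / 2"
      using sum_squares_bound[of "norm (r y)" "norm (r y')"] by simp
  qed (simp add: g_def)
  also have "\<dots> = (\<Sum>y\<in>V. \<Sum>y'\<in>V. (norm (r y))\<^sup>2 / 2 * g y y') + (\<Sum>y\<in>V. \<Sum>y'\<in>V. (norm (r y'))\<^sup>2 / 2 * g y y')"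
    by (simp add: distrib_right sum.distrib)
  also have "(\<Sum>y\<in>V. \<Sum>y'\<in>V. (norm (r y'))\<^sup>2 / 2 * g y y') = (\<Sum>y\<in>V. \<Sum>y'\<in>V. (norm (r y))\<^sup>2 / 2 * g y y')"
    by (subst sum.swap) (simp add: gsym)
  also have "(\<Sum>y\<in>V. \<Sum>y'\<in>V. (norm (r y))\<^sup>2 / 2 * g y y') + (\<Sum>y\<in>V. \<Sum>y'\<in>V. (norm (r y))\<^sup>2 / 2 * g y y')
     = (\<Sum>y\<in>V. (norm (r y))\<^sup>2 * (\<Sum>y'\<in>V. g y y'))"
    unfolding sum.distrib[symmetric] sum_distrib_left distrib_right[symmetric] by simp
  also have "\<dots> \<le> (\<Sum>y\<in>V. (norm (r y))\<^sup>2 * G)"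
    by (intro sum_mono mult_left_mono) (auto simp: g_def G)
  also have "\<dots> = (\<Sum>y\<in>V. (norm (r y))\<^sup>2) * G" by (simp add: sum_distrib_right)
  finally have "(\<Sum>x\<in>U. (norm (w x))\<^sup>2) \<le> (\<Sum>y\<in>V. (norm (r y))\<^sup>2) * G"
    unfolding norm_of_real by (simp only: abs_of_nonneg sum_nonneg zero_le_power2)
  then have "(\<Sum>x\<in>U. (norm (p x))\<^sup>2) * (\<Sum>x\<in>U. (norm (w x))\<^sup>2) \<le> (\<Sum>x\<in>U. (norm (p x))\<^sup>2) * ((\<Sum>y\<in>V. (norm (r y))\<^sup>2) * G)"
    by (intro mult_left_mono) (auto simp: sum_nonneg)
  then show ?thesis using 1 by (simp add: mult.assoc)
qed

section \<open>Polarisation of the form and the additive character \<open>e\<close>\<close>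

lemma qform_inner: "qform F x = x \<bullet> (F *v x)"
  by (simp add: qform_def inner_vec_def matrix_vector_mult_def sum_distrib_left mult_ac)

lemma inner_symmetric_matrix:
  fixes F :: "real^'n^'n"
  assumes "transpose F = F"
  shows "x \<bullet> (F *v y) = y \<bullet> (F *v x)"
  by (metis assms dot_lmul_matrix inner_commute transpose_matrix_vector)

text \<open>Separates the phase for Cauchy--Schwarz: with \<open>z\<close> fixed, the only term that
  couples \<open>x\<close> and \<open>y\<close> is bilinear.\<close>

lemma qform_add3:
  fixes F :: "real^'n^'n"
  assumes "transpose F = F"
  shows "qform F (z + x + y) = qform F (z + x) + (qform F (z + y) - qform F z) + 2 * (x \<bullet> (F *v y))"
  using inner_symmetric_matrix[OF assms, of x y] inner_symmetric_matrix[OF assms, of z y] inner_symmetric_matrix[OF assms, of z x]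
  by (simp add: qform_inner matrix_vector_right_distrib inner_add_left inner_add_right algebra_simps)

lemma ivec_add: "ivec (x + y) = ivec x + ivec y"
  by (simp add: ivec_def vec_eq_iff)

lemma ivec_diff: "ivec (x - y) = ivec x - ivec y"
  by (simp add: ivec_def vec_eq_iff)

lemma ivec_nth [simp]: "ivec x $ i = of_int (x $ i)"
  by (simp add: ivec_def)

lemma e_add: "e (x + y) = e x * e y"
  by (simp add: e_def ring_distribs exp_add)

lemma e_diff: "e (x - y) = e x * e (- y)"
  using e_add[of x "- y"] by simp

lemma e_0 [simp]: "e 0 = 1"
  by (simp add: e_def)

lemma norm_e [simp]: "norm (e x) = 1"
  by (simp add: e_def)

lemma e_neg: "e (- x) = cnj (e x)"
  by (simp add: e_def exp_cnj)

lemma e_of_nat_mult: "e (real n * x) = e x ^ n"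
  by (simp add: e_def exp_of_nat_mult[symmetric] mult_ac)

lemma e_eq_cis: "e x = cis (2 * pi * x)"
  by (simp add: e_def cis_conv_exp mult_ac)

lemma e_int [simp]: "e (of_int k) = 1"
  by (simp add: e_eq_cis complex_eq_iff)

lemma e_sum: "finite S \<Longrightarrow> e (\<Sum>i\<in>S. g i) = (\<Prod>i\<in>S. e (g i))"
  by (induction S rule: finite_induct) (auto simp: e_add)

lemma continuous_e: "continuous_on S f \<Longrightarrow> continuous_on S (\<lambda>x. e (f x))"
  unfolding e_def by (intro continuous_intros)

lemma e_lipschitz: "norm (e x - e y) \<le> 2 * pi * \<bar>x - y\<bar>"
proof -
  have "norm (e x - e y) = norm (e y * (e (x - y) - 1))"
    using e_add[of y "x - y"] by (simp add: algebra_simps)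
  also have "\<dots> = norm (cis (2 * pi * (x - y)) - 1)"
    by (simp add: norm_mult e_eq_cis)
  also have "\<dots> = 2 * \<bar>sin (pi * (x - y))\<bar>"
  proof -
    have "norm (cis (2 * pi * (x - y)) - 1) = 2 * \<bar>sin (2 * pi * (x - y) / 2)\<bar>"
      using dist_exp_i_1[of "2 * pi * (x - y)"] by (simp add: cis_conv_exp dist_norm)
    then show ?thesis by (simp add: mult.assoc)
  qed
  also have "\<dots> \<le> 2 * \<bar>pi * (x - y)\<bar>" using abs_sin_x_le_abs_x by simp
  finally show ?thesis by (simp add: abs_mult)
qed

text \<open>The chord has length 2 sin (pi t), and sin (pi t) is at least t on the first half of the
  interval: for pi t at most 2 the cubic Taylor bound gives at least pi t / 3. The other half
  follows by symmetry. The optimal constant would be 4.\<close>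

lemma norm_1_minus_e:
  assumes "0 \<le> t" "t \<le> 1"
  shows "2 * min t (1 - t) \<le> norm (1 - e (of_int k + t))"
proof -
  have half: "t \<le> sin (pi * t)" if "0 \<le> t" "t \<le> 1/2" for t :: real
  proof -
    have "\<bar>sin (pi * t) - (\<Sum>m<3. sin_coeff m * (pi * t) ^ m)\<bar> \<le> inverse (fact 3) * \<bar>pi * t\<bar> ^ 3"
      by (rule Maclaurin_sin_bound)
    then have "\<bar>sin (pi * t) - pi * t\<bar> \<le> (pi * t) ^ 3 / 6"
      using that by (simp add: numeral_eq_Suc sin_coeff_def field_simps fact_numeral)
    moreover have "(pi * t) ^ 3 \<le> (pi * t) * 4"
    proof -
      have "pi * t \<le> 4 * (1/2)" using that pi_less_4 by (intro mult_mono) auto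
      then have "(pi * t)^2 \<le> 2^2" using that by (intro power_mono) auto
      then show ?thesis using that by (simp add: power3_eq_cube power2_eq_square mult_left_mono)
    qed
    moreover have "3 * t \<le> pi * t" using that pi_gt3 by (intro mult_right_mono) auto
    ultimately show ?thesis by linarith
  qed
  have "min t (1 - t) \<le> sin (pi * t)"
  proof (cases "t \<le> 1/2")
    case True
    then show ?thesis using half[of t] assms by simp
  next
    case False
    have "sin (pi * (1 - t)) = sin (pi * t)" by (simp add: right_diff_distrib)
    then show ?thesis using half[of "1 - t"] assms False by simp
  qed
  moreover have "norm (1 - e (of_int k + t)) = 2 * \<bar>sin (pi * t)\<bar>"
    using dist_exp_i_1[of "2 * pi * t"]
    by (simp add: e_add e_eq_cis[of t] cis_conv_exp dist_norm norm_minus_commute mult.assoc)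
  moreover have "0 \<le> sin (pi * t)" using assms by (intro sin_ge_zero) (auto simp: mult_left_le)
  ultimately show ?thesis by (simp add: abs_of_nonneg)
qed

subsection \<open>Sums of the geometric kernel\<close>

definition geom_kernel :: "nat \<Rightarrow> real \<Rightarrow> real" where
  "geom_kernel N x = norm (\<Sum>n=1..N. e (real n * x))"

lemma geom_kernel_nonneg: "0 \<le> geom_kernel N x"
  by (simp add: geom_kernel_def)

lemma geom_kernel_le: "geom_kernel N x \<le> real N"
  unfolding geom_kernel_def by (rule order_trans[OF norm_sum]) simp

lemma geom_kernel_minus [simp]: "geom_kernel N (- x) = geom_kernel N x"
proof -
  have "(\<Sum>n=1..N. e (real n * - x)) = cnj (\<Sum>n=1..N. e (real n * x))"
    by (simp add: e_neg)
  then show ?thesis by (simp only: geom_kernel_def complex_mod_cnj)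
qed

text \<open>The nontrivial half of the classical bound min (N, 1/||x||), as
  \<open>min t (1 - t)\<close> is the distance of \<open>k + t\<close> to the nearest integer. The
  product form covers integers without an exception.\<close>

lemma geom_kernel_mult_le:
  assumes "0 \<le> t" "t \<le> 1"
  shows "geom_kernel N (of_int k + t) * min t (1 - t) \<le> 1"
proof -
  define z where "z = e (of_int k + t)"
  have "(1 - z) * (\<Sum>n=1..N. z ^ n) = z - z ^ Suc N"
  proof (induction N)
    case (Suc N)
    have "(1 - z) * (\<Sum>n=1..Suc N. z ^ n) = (1 - z) * (\<Sum>n=1..N. z ^ n) + (1 - z) * z ^ Suc N"
      by (simp add: distrib_left)
    also have "\<dots> = (z - z ^ Suc N) + (1 - z) * z ^ Suc N" by (simp only: Suc.IH)
    also have "\<dots> = z - z ^ Suc (Suc N)" by (simp add: algebra_simps)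
    finally show ?case .
  qed auto
  then have "norm (1 - z) * geom_kernel N (of_int k + t) = norm (z - z ^ Suc N)"
    by (simp only: geom_kernel_def e_of_nat_mult flip: z_def norm_mult)
  also have "\<dots> \<le> 2"
    using norm_triangle_ineq4[of z "z ^ Suc N"] by (simp add: z_def norm_power norm_mult)
  finally have "norm (1 - z) * geom_kernel N (of_int k + t) \<le> 2" .
  moreover have "2 * min t (1 - t) * geom_kernel N (of_int k + t) \<le> norm (1 - z) * geom_kernel N (of_int k + t)"
    unfolding z_def by (intro mult_right_mono norm_1_minus_e assms geom_kernel_nonneg)
  ultimately show ?thesis by (simp add: mult_ac)
qed

text \<open>A number below both \<open>y\<close> and \<open>1 / z\<close> is below their weighted
  geometric mean. It is used with weight 9/10 because the exponent 1 would produce harmonic sums and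
  logarithms. In principle any weight between 4/5 and 1 would do, since five forms under a square
  root must save more than the power 2.\<close>

lemma interpolate_powr:
  fixes x y z \<theta> :: real
  assumes "0 \<le> x" "x \<le> y" "0 < z" "x * z \<le> 1" "0 \<le> \<theta>" "\<theta> \<le> 1"
  shows "x \<le> y powr (1 - \<theta>) * z powr (- \<theta>)"
proof (cases "x = 0")
  case False
  then have x: "x > 0" using assms by simp
  have "x = x powr (1 - \<theta>) * x powr \<theta>" using x by (simp flip: powr_add)
  also have "\<dots> \<le> y powr (1 - \<theta>) * (1 / z) powr \<theta>"
    using assms x by (intro mult_mono powr_mono2) (auto simp: field_simps)
  also have "(1 / z) powr \<theta> = z powr (- \<theta>)"
    using assms by (simp add: powr_divide powr_minus_divide)
  finally show ?thesis .
qed auto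

text \<open>Instead of comparing with an integral, the induction uses tenth roots \<open>b\<close>
  and \<open>c\<close> of n and n + 1: Bernoulli's inequality for \<open>b / c\<close> gives 1 =
  c^10 - b^10 \<le> 10 (c - b) c^9.\<close>

lemma sum_powr_le: "(\<Sum>k=1..n. real k powr (-(9/10))) \<le> 10 * real n powr (1/10)"
proof (induction n)
  case (Suc n)
  define b where "b = real n powr (1/10)"
  define c where "c = real (Suc n) powr (1/10)"
  have c: "c > 0" by (simp add: c_def)
  have b10: "b ^ 10 = n"
    by (cases "n = 0") (simp_all add: b_def powr_powr flip: powr_realpow)
  have c10: "c ^ 10 = Suc n"
    by (simp add: c_def powr_powr flip: powr_realpow del: of_nat_Suc)
  have c9: "c ^ 9 = Suc n powr (9/10)"
    by (simp add: c_def powr_powr flip: powr_realpow del: of_nat_Suc)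
  define v where "v = b / c"
  have b: "b = v * c" using c by (simp add: v_def)
  have "0 \<le> v" using c by (simp add: v_def b_def)
  then have "1 + real 10 * (v - 1) \<le> (1 + (v - 1)) ^ 10"
    by (intro Bernoulli_inequality) simp
  then have "(1 + 10 * (v - 1)) * c ^ 10 \<le> v ^ 10 * c ^ 10"
    using c by (intro mult_right_mono) auto
  then have "c ^ 10 - b ^ 10 \<le> 10 * (c - b) * c ^ 9"
    unfolding b by (simp add: algebra_simps power_mult_distrib eval_nat_numeral)
  then have "1 \<le> 10 * (c - b) * c ^ 9" by (simp add: b10 c10)
  then have "1 / c ^ 9 \<le> 10 * (c - b)" using c by (simp add: field_simps)
  moreover have "1 / c ^ 9 = Suc n powr (-(9/10))" by (simp only: c9 powr_minus_divide)
  ultimately show ?case using Suc by (simp add: b_def c_def)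
qed auto
lemma geom_kernel_powr_le:
  assumes "0 < t" "t < 1"
  shows "geom_kernel N (of_int k + t) \<le> real N powr (1/10) * (t powr (-(9/10)) + (1 - t) powr (-(9/10)))"
proof -
  have "geom_kernel N (of_int k + t) \<le> real N powr (1 - 9/10) * (min t (1 - t)) powr (- (9/10))"
    using assms geom_kernel_mult_le[of t N k] geom_kernel_nonneg geom_kernel_le
    by (intro interpolate_powr) auto
  also have "(min t (1 - t)) powr (- (9/10)) \<le> t powr (-(9/10)) + (1 - t) powr (-(9/10))"
    by (auto simp: min_def)
  finally show ?thesis by (simp add: mult_left_mono)
qed

text \<open>Multiplication by \<open>a\<close> is injective modulo \<open>q\<close>, so each block
  of \<open>q\<close> consecutive integers contains at most one such \<open>m\<close>.\<close>

lemma card_residue_class_le: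
  fixes a :: int
  assumes "coprime a (int q)" "q \<ge> 1"
  shows "card {m \<in> {1..M}. (a * int m) mod int q = r} \<le> M div q + 1"
proof -
  have "inj_on (\<lambda>m. m div q) {m \<in> {1..M}. (a * int m) mod int q = r}"
  proof (rule inj_onI)
    fix m m' assume m: "m \<in> {m \<in> {1..M}. (a * int m) mod int q = r}"
      and m': "m' \<in> {m \<in> {1..M}. (a * int m) mod int q = r}" and eq: "m div q = m' div q"
    have "[a * int m = a * int m'] (mod int q)" using m m' by (simp add: cong_def)
    then have "[int m = int m'] (mod int q)" using assms(1) by (simp add: cong_mult_lcancel)
    then have "[m = m'] (mod q)" by (simp only: cong_int_iff)
    then have "m mod q = m' mod q" by (simp add: cong_def)
    then show "m = m'" using eq by (metis div_mult_mod_eq)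
  qed
  moreover have "(\<lambda>m. m div q) ` {m \<in> {1..M}. (a * int m) mod int q = r} \<subseteq> {..M div q}"
    by (auto intro: div_le_mono)
  ultimately have "card {m \<in> {1..M}. (a * int m) mod int q = r} \<le> card {..M div q}"
    by (intro card_inj_on_le) auto
  then show ?thesis by simp
qed

text \<open>For these \<open>m\<close> the residue r of a m modulo \<open>q\<close> is not zero, and
  the perturbation \<beta> m is at most 1/(2q). It therefore takes away at most half of the
  distances r/q and 1 - r/q to the neighbouring integers. Each residue occurs at most M/q + 1 times,
  and the sum over residues costs a factor q.\<close>

lemma geom_kernel_sum_nondvd:
  fixes a :: int and N M q :: nat
  assumes q: "coprime a (int q)" "q \<ge> 1" and M: "M \<ge> 1"
    and \<beta>: "\<bar>\<beta>\<bar> \<le> 1 / (2 * real M * real q)"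
  shows "(\<Sum>m | m \<in> {1..M} \<and> \<not> q dvd m. geom_kernel N ((of_int a / real q + \<beta>) * real m))
    \<le> 40 * (real M + real q) * real N powr (1/10)"
proof -
  define S where "S = {m. m \<in> {1..M} \<and> \<not> q dvd m}"
  define \<rho> where "\<rho> m = (a * int m) mod int q" for m
  define g where "g r = 2 * real q powr (9/10) * (real_of_int r powr (-(9/10)) + (real q - real_of_int r) powr (-(9/10)))" for r
  have g0: "g r \<ge> 0" for r by (simp add: g_def)
  have \<rho>: "\<rho> m \<in> {1..int q - 1}" if "m \<in> S" for m
  proof -
    have "\<not> int q dvd a * int m"
      using that q(1) by (auto simp: S_def coprime_dvd_mult_right_iff coprime_commute)
    then have "\<rho> m \<noteq> 0" by (auto simp: \<rho>_def)
    moreover have "0 \<le> \<rho> m" "\<rho> m < int q" using q(2) by (auto simp: \<rho>_def)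
    ultimately show ?thesis by auto
  qed
  have bnd: "geom_kernel N ((of_int a / real q + \<beta>) * real m) \<le> real N powr (1/10) * g (\<rho> m)" if m: "m \<in> S" for m
  proof -
    define r where "r = real_of_int (\<rho> m)"
    define t where "t = r / real q + \<beta> * real m"
    have r: "1 \<le> r" "r \<le> real q - 1" using \<rho>[OF m] by (auto simp: r_def)
    have qpos: "real q > 0" using q(2) by simp
    have "a * int m = (a * int m div int q) * int q + \<rho> m" by (simp add: \<rho>_def)
    then have "real_of_int (a * int m) = real_of_int (a * int m div int q) * real q + r"
      unfolding r_def by (metis of_int_add of_int_mult of_int_of_nat_eq)
    then have am: "(of_int a / real q + \<beta>) * real m = of_int (a * int m div int q) + t"
      using qpos by (simp add: t_def field_simps)
    have "\<bar>\<beta> * real m\<bar> \<le> 1 / (2 * real M * real q) * real M"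
      unfolding abs_mult using m \<beta> by (intro mult_mono) (auto simp: S_def)
    then have bm: "\<bar>\<beta> * real m\<bar> \<le> (1/2) / real q" using M by simp
    have e1: "r / real q \<ge> 1 / real q" using r qpos by (simp add: divide_right_mono)
    have e2: "(real q - r) / real q \<ge> 1 / real q" using r qpos by (simp add: divide_right_mono)
    have e3: "(real q - r) / real q = 1 - r / real q" using qpos by (simp add: field_simps)
    have iq: "1 / real q > 0" using qpos by simp
    have t1: "t \<ge> r / (2 * real q)" using bm e1 by (simp add: t_def abs_le_iff)
    have t2: "1 - t \<ge> (real q - r) / (2 * real q)"
    proof -
      have "(real q - r) / (2 * real q) = ((real q - r) / real q) / 2" by simp
      then show ?thesis using bm e2 e3 iq by (simp add: t_def abs_le_iff)
    qed
    have p1: "r / (2 * real q) > 0" using r qpos by simp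
    have p2: "(real q - r) / (2 * real q) > 0" using r qpos by simp
    have dp: "(x / (2 * real q)) powr (-(9/10)) \<le> 2 * real q powr (9/10) * x powr (-(9/10))" if "x > 0" for x
    proof -
      have "(x / (2 * real q)) powr (-(9/10)) = x powr (-(9/10)) * (2 powr (9/10) * real q powr (9/10))"
        using that qpos by (simp add: powr_divide powr_mult powr_minus field_simps)
      moreover have "2 powr (9/10) \<le> (2::real) powr 1" by (intro powr_mono) auto
      ultimately show ?thesis
        using mult_right_mono[of "2 powr (9/10)" 2 "real q powr (9/10) * x powr (-(9/10))"] by (simp add: mult_ac)
    qed
    have "t powr (-(9/10)) \<le> (r / (2 * real q)) powr (-(9/10))"
      using t1 p1 by (intro powr_mono2') auto
    also have "\<dots> \<le> 2 * real q powr (9/10) * r powr (-(9/10))" using r by (intro dp) auto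
    finally have f1: "t powr (-(9/10)) \<le> 2 * real q powr (9/10) * r powr (-(9/10))" .
    have "(1 - t) powr (-(9/10)) \<le> ((real q - r) / (2 * real q)) powr (-(9/10))"
      using t2 p2 by (intro powr_mono2') auto
    also have "\<dots> \<le> 2 * real q powr (9/10) * (real q - r) powr (-(9/10))" using r by (intro dp) auto
    finally have f2: "(1 - t) powr (-(9/10)) \<le> 2 * real q powr (9/10) * (real q - r) powr (-(9/10))" .
    have "geom_kernel N (of_int (a * int m div int q) + t)
      \<le> real N powr (1/10) * (t powr (-(9/10)) + (1 - t) powr (-(9/10)))"
      using t1 t2 p1 p2 by (intro geom_kernel_powr_le) linarith+
    also have "\<dots> \<le> real N powr (1/10) * g (\<rho> m)"
      using f1 f2 by (intro mult_left_mono) (auto simp: g_def r_def ring_distribs)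
    finally show ?thesis by (simp add: am)
  qed
  have sumr: "(\<Sum>r\<in>{1..int q - 1}. real_of_int r powr (-(9/10))) \<le> 10 * real q powr (1/10)"
  proof -
    have "(\<Sum>r\<in>{1..int q - 1}. real_of_int r powr (-(9/10))) = (\<Sum>k\<in>{1..q-1}. real k powr (-(9/10)))"
      by (rule sum.reindex_bij_witness[of _ int nat]) auto
    also have "\<dots> \<le> 10 * real (q - 1) powr (1/10)" by (rule sum_powr_le)
    also have "\<dots> \<le> 10 * real q powr (1/10)" by (intro mult_left_mono powr_mono2) auto
    finally show ?thesis .
  qed
  have sumr': "(\<Sum>r\<in>{1..int q - 1}. (real q - real_of_int r) powr (-(9/10))) = (\<Sum>r\<in>{1..int q - 1}. real_of_int r powr (-(9/10)))"
    by (rule sum.reindex_bij_witness[of _ "\<lambda>r. int q - r" "\<lambda>r. int q - r"]) auto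
  have sumg: "(\<Sum>r\<in>{1..int q - 1}. g r) \<le> 40 * real q"
  proof -
    have "(\<Sum>r\<in>{1..int q - 1}. g r) = 2 * real q powr (9/10) *
       ((\<Sum>r\<in>{1..int q - 1}. real_of_int r powr (-(9/10))) + (\<Sum>r\<in>{1..int q - 1}. (real q - real_of_int r) powr (-(9/10))))"
      by (simp add: g_def sum_distrib_left sum.distrib[symmetric])
    also have "\<dots> \<le> 2 * real q powr (9/10) * (20 * real q powr (1/10))"
      using sumr sumr' by (intro mult_left_mono) auto
    also have "\<dots> = 40 * real q" using q(2) by (simp flip: powr_add)
    finally show ?thesis .
  qed
  have finS: "finite S" unfolding S_def by (rule finite_subset[of _ "{1..M}"]) auto
  have "(\<Sum>m\<in>S. g (\<rho> m)) = (\<Sum>r\<in>{1..int q - 1}. \<Sum>m\<in>{m \<in> S. \<rho> m = r}. g (\<rho> m))"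
    by (rule sum.group[symmetric]) (use finS \<rho> in auto)
  also have "\<dots> = (\<Sum>r\<in>{1..int q - 1}. real (card {m \<in> S. \<rho> m = r}) * g r)" by simp
  also have "\<dots> \<le> (\<Sum>r\<in>{1..int q - 1}. (real M / real q + 1) * g r)"
  proof (intro sum_mono mult_right_mono g0)
    fix r
    have "card {m \<in> S. \<rho> m = r} \<le> card {m \<in> {1..M}. (a * int m) mod int q = r}"
      by (intro card_mono) (auto simp: S_def \<rho>_def)
    also have "\<dots> \<le> M div q + 1" by (rule card_residue_class_le[OF q])
    finally have "real (card {m \<in> S. \<rho> m = r}) \<le> real (M div q) + 1" by linarith
    also have "real (M div q) \<le> real M / real q" by (rule of_nat_div_le_of_nat)
    finally show "real (card {m \<in> S. \<rho> m = r}) \<le> real M / real q + 1" by simp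
  qed
  also have "\<dots> = (real M / real q + 1) * (\<Sum>r\<in>{1..int q - 1}. g r)" by (simp add: sum_distrib_left)
  also have "\<dots> \<le> (real M / real q + 1) * (40 * real q)" using sumg by (intro mult_left_mono) auto
  also have "\<dots> = 40 * (real M + real q)" using q(2) by (simp add: field_simps)
  finally have gsum: "(\<Sum>m\<in>S. g (\<rho> m)) \<le> 40 * (real M + real q)" .
  have "(\<Sum>m\<in>S. geom_kernel N ((of_int a / real q + \<beta>) * real m)) \<le> (\<Sum>m\<in>S. real N powr (1/10) * g (\<rho> m))"
    by (intro sum_mono bnd)
  also have "\<dots> = real N powr (1/10) * (\<Sum>m\<in>S. g (\<rho> m))" by (simp add: sum_distrib_left)
  also have "\<dots> \<le> real N powr (1/10) * (40 * (real M + real q))"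
    using gsum by (intro mult_left_mono) auto
  finally show ?thesis unfolding S_def by (simp only: mult.commute)
qed
text \<open>For m = q k the fraction contributes an integer, so only \<beta> q k remains. By the
  second claim this argument, taken in absolute value, does not exceed 1/2 and so equals its
  distance to the nearest integer.\<close>

lemma geom_kernel_sum_dvd:
  fixes a :: int and N M q :: nat
  assumes q: "q \<ge> 1" and M: "M \<ge> 1"
    and \<beta>: "\<bar>\<beta>\<bar> \<le> 1 / (2 * real M * real q)"
  shows "(\<Sum>m | m \<in> {1..M} \<and> q dvd m. geom_kernel N ((of_int a / real q + \<beta>) * real m))
    \<le> (\<Sum>k=1..M div q. geom_kernel N (\<bar>\<beta>\<bar> * real q * real k))"
    and "k \<in> {1..M div q} \<Longrightarrow> \<bar>\<beta>\<bar> * real q * real k \<le> 1/2"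
proof -
  have per: "geom_kernel N (of_int l + x) = geom_kernel N x" for l x
  proof -
    have "e (real n * (of_int l + x)) = e (real n * x)" for n
      using e_int[of "int n * l"] by (simp add: ring_distribs e_add)
    then show ?thesis by (simp add: geom_kernel_def)
  qed
  have "(\<Sum>m | m \<in> {1..M} \<and> q dvd m. geom_kernel N ((of_int a / real q + \<beta>) * real m))
     = (\<Sum>k=1..M div q. geom_kernel N ((of_int a / real q + \<beta>) * real (q * k)))"
  proof (rule sum.reindex_bij_witness[of _ "\<lambda>k. q * k" "\<lambda>m. m div q"])
    fix m assume "m \<in> {m \<in> {1..M}. q dvd m}"
    then show "m div q \<in> {1..M div q}"
      using q by (auto simp: div_le_mono elim!: dvdE)
  next
    fix k assume k: "k \<in> {1..M div q}"
    then have "q * k \<le> q * (M div q)" by simp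
    also have "\<dots> \<le> M" by simp
    finally show "q * k \<in> {m \<in> {1..M}. q dvd m}" using k q by (auto simp: Suc_le_eq)
  qed (use q in auto)
  also have "\<dots> = (\<Sum>k=1..M div q. geom_kernel N (\<bar>\<beta>\<bar> * real q * real k))"
  proof (rule sum.cong[OF refl])
    fix k assume "k \<in> {1..M div q}"
    have "(of_int a / real q + \<beta>) * real (q * k) = of_int (a * int k) + \<beta> * real q * real k"
      using q by (simp add: field_simps)
    then have "geom_kernel N ((of_int a / real q + \<beta>) * real (q * k)) = geom_kernel N (\<beta> * real q * real k)"
      by (simp only: per)
    also have "\<dots> = geom_kernel N (\<bar>\<beta>\<bar> * real q * real k)"
      using geom_kernel_minus[of N "\<beta> * real q * real k"] by (cases "\<beta> \<ge> 0") auto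
    finally show "geom_kernel N ((of_int a / real q + \<beta>) * real (q * k)) = geom_kernel N (\<bar>\<beta>\<bar> * real q * real k)" .
  qed
  finally show "(\<Sum>m | m \<in> {1..M} \<and> q dvd m. geom_kernel N ((of_int a / real q + \<beta>) * real m))
    \<le> (\<Sum>k=1..M div q. geom_kernel N (\<bar>\<beta>\<bar> * real q * real k))" by simp
next
  assume k: "k \<in> {1..M div q}"
  then have "q * k \<le> q * (M div q)" by simp
  also have "\<dots> \<le> M" by simp
  finally have "real (q * k) \<le> real M" by (rule of_nat_mono)
  then have "\<bar>\<beta>\<bar> * (real q * real k) \<le> 1 / (2 * real M * real q) * real M"
    using \<beta> by (intro mult_mono) auto
  also have "\<dots> \<le> 1/2" using M q by (simp add: field_simps)
  finally show "\<bar>\<beta>\<bar> * real q * real k \<le> 1/2" by (simp add: mult.assoc)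
qed

text \<open>Multiples of \<open>q\<close> carry the dependence on \<beta>; all other terms only
  contribute about H N to the power 11/10, which is acceptable because \<open>W\<close> is at most
  of order H N.\<close>

lemma geom_kernel_sum:
  fixes a :: int and H N q :: nat and \<beta> :: real
  assumes q: "coprime a (int q)" "q \<ge> 1" and H: "H \<ge> 1" and N: "N \<ge> 1"
    and qle: "q \<le> 2 * H * N"
    and \<beta>: "\<bar>\<beta>\<bar> \<le> 1 / (2 * real (H * N) * real q)"
  shows "(\<Sum>m\<in>{-int (H * N)..int (H * N)}. geom_kernel N ((of_int a / real q + \<beta>) * of_int m))
    \<le> 1000 * real H ^ 2 * real N ^ 2 * (real q * (1 + real N ^ 2 * \<bar>\<beta>\<bar>)) powr (-(9/10))"
proof -
  define M where "M = H * N"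
  define \<alpha> where "\<alpha> = of_int a / real q + \<beta>"
  define W where "W = real q * (1 + real N ^ 2 * \<bar>\<beta>\<bar>)"
  define V where "V = W powr (-(9/10))"
  have M: "M \<ge> 1" using H N by (simp add: M_def)
  have qpos: "real q > 0" and q1: "real q \<ge> 1" using q(2) by auto
  have rH: "real H \<ge> 1" and rN: "real N \<ge> 1" using H N by auto
  have HH: "real H \<le> real H ^ 2" using rH by (simp add: power2_eq_square)
  have Wpos: "W > 0" and W1: "W \<ge> real q" using qpos by (auto simp: W_def add_pos_nonneg algebra_simps)
  have \<beta>M: "\<bar>\<beta>\<bar> \<le> 1 / (2 * real M * real q)" using \<beta> by (simp add: M_def)
  have qle': "real q \<le> 2 * real H * real N" using qle by (metis of_nat_le_iff of_nat_mult of_nat_numeral)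
  \<comment> \<open>Both range conditions enter here: q \<le> 2HN bounds the first summand of
    \<open>W\<close>, and the bound for \<beta> the second. This converts a power saving in N into
    one in \<open>W\<close>.\<close>
  have W3: "W \<le> 3 * real H * real N"
  proof -
    have "real q * (real N ^ 2 * \<bar>\<beta>\<bar>) \<le> real q * (real N ^ 2 * (1 / (2 * real M * real q)))"
      using \<beta>M by (intro mult_left_mono) auto
    also have "\<dots> = real N / (2 * real H)" using qpos rH rN by (simp add: M_def field_simps power2_eq_square)
    also have "\<dots> \<le> real N" using rH rN by (simp add: field_simps)
    also have "\<dots> \<le> real H * real N" using rH rN by (simp add: mult_right_mono)
    finally have "real q * (real N ^ 2 * \<bar>\<beta>\<bar>) \<le> real H * real N" .
    then show ?thesis using qle' by (simp add: W_def algebra_simps)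
  qed
  have NV: "real N powr (-(9/10)) \<le> 3 * real H * V"
  proof -
    have "(3 * real H * real N) powr (-(9/10)) \<le> V" unfolding V_def using W3 Wpos by (intro powr_mono2') auto
    moreover have "(3 * real H * real N) powr (-(9/10)) = (3 * real H) powr (-(9/10)) * real N powr (-(9/10))"
      using rH by (simp add: powr_mult)
    moreover have "(3 * real H) powr (-(9/10)) \<ge> (3 * real H) powr (-1)" using rH by (intro powr_mono) auto
    moreover have "(3 * real H) powr (-1) = 1 / (3 * real H)" using rH by (simp add: powr_minus_divide)
    ultimately have "1 / (3 * real H) * real N powr (-(9/10)) \<le> V"
      using mult_right_mono[of "1 / (3 * real H)" "(3 * real H) powr (-(9/10))" "real N powr (-(9/10))"] by simp
    then show ?thesis using rH by (simp add: field_simps)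
  qed
  have N11: "real N * real N powr (1/10) = real N ^ 2 * real N powr (-(9/10))"
  proof -
    have "real N * real N powr (1/10) = real N powr 1 * real N powr (1/10)" using rN by simp
    also have "\<dots> = real N powr 2 * real N powr (-(9/10))" unfolding powr_add[symmetric] by simp
    finally have "real N * real N powr (1/10) = real N powr 2 * real N powr (-(9/10))" .
    moreover have "real N powr 2 = real N ^ 2" using rN by simp
    ultimately show ?thesis by (simp only:)
  qed
  have partA: "(\<Sum>m | m \<in> {1..M} \<and> \<not> q dvd m. geom_kernel N (\<alpha> * real m)) \<le> 360 * real H ^ 2 * real N ^ 2 * V"
  proof -
    have "(\<Sum>m | m \<in> {1..M} \<and> \<not> q dvd m. geom_kernel N (\<alpha> * real m)) \<le> 40 * (real M + real q) * real N powr (1/10)"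
      unfolding \<alpha>_def by (rule geom_kernel_sum_nondvd[OF q M \<beta>M])
    also have "\<dots> \<le> 40 * (3 * real H * real N) * real N powr (1/10)"
      using qle' by (intro mult_right_mono mult_left_mono) (auto simp: M_def)
    also have "\<dots> = 120 * real H * (real N ^ 2 * real N powr (-(9/10)))"
      by (simp flip: N11)
    also have "\<dots> \<le> 120 * real H * (real N ^ 2 * (3 * real H * V))"
      using NV by (intro mult_left_mono) auto
    finally show ?thesis by (simp add: power2_eq_square mult_ac)
  qed
  have partB: "(\<Sum>m | m \<in> {1..M} \<and> q dvd m. geom_kernel N (\<alpha> * real m)) \<le> 20 * real H ^ 2 * real N ^ 2 * V"
  proof -
    define K where "K = M div q"
    have K: "real K \<le> real H * real N / real q" unfolding K_def M_def
      using of_nat_div_le_of_nat[of "H * N" q] by simp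
    have le: "(\<Sum>m | m \<in> {1..M} \<and> q dvd m. geom_kernel N (\<alpha> * real m)) \<le> (\<Sum>k=1..K. geom_kernel N (\<bar>\<beta>\<bar> * real q * real k))"
      unfolding \<alpha>_def K_def by (rule geom_kernel_sum_dvd(1)[OF q(2) M \<beta>M])
    \<comment> \<open>If N^2 |\<beta>| \<le> 1, then \<open>W\<close> is of order q and bounding
      each of the M/q terms by N is enough. Otherwise \<open>W\<close> is of order q N^2 |\<beta>|
      and the decay of the kernel in k has to be summed.\<close>
    show ?thesis
    proof (cases "real N ^ 2 * \<bar>\<beta>\<bar> \<le> 1")
      case True
      then have "W \<le> 2 * real q" unfolding W_def using qpos by (simp add: mult_left_mono)
      then have "(2 * real q) powr (-(9/10)) \<le> V" unfolding V_def using Wpos by (intro powr_mono2') auto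
      moreover have "(2 * real q) powr (-1) \<le> (2 * real q) powr (-(9/10))" using q1 by (intro powr_mono) auto
      moreover have "(2 * real q) powr (-1) = 1 / (2 * real q)" using qpos by (simp add: powr_minus_divide)
      ultimately have V: "1 / real q \<le> 2 * V" by simp
      have "(\<Sum>k=1..K. geom_kernel N (\<bar>\<beta>\<bar> * real q * real k)) \<le> (\<Sum>k=1..K. real N)"
        by (intro sum_mono geom_kernel_le)
      also have "\<dots> = real K * real N" by simp
      also have "\<dots> \<le> real H * real N / real q * real N" using K by (intro mult_right_mono) auto
      also have "\<dots> = real H * real N ^ 2 * (1 / real q)" by (simp add: power2_eq_square)
      also have "\<dots> \<le> real H ^ 2 * real N ^ 2 * (2 * V)" using V HH by (intro mult_mono) (auto simp: V_def)
      also have "\<dots> \<le> 20 * real H ^ 2 * real N ^ 2 * V" by (simp add: V_def mult_right_mono)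
      finally show ?thesis using le by linarith
    next
      case False
      then have b1: "real N ^ 2 * \<bar>\<beta>\<bar> \<ge> 1" by simp
      then have bpos: "\<bar>\<beta>\<bar> > 0" by (cases "\<beta> = 0") auto
      define Z where "Z = real q * (real N ^ 2 * \<bar>\<beta>\<bar>)"
      have Zpos: "Z > 0" using qpos bpos rN by (simp add: Z_def)
      have "W \<le> 2 * Z" using mult_left_mono[OF b1, of "real q"] qpos by (simp add: W_def Z_def algebra_simps)
      then have "(2 * Z) powr (-(9/10)) \<le> V" unfolding V_def using Wpos by (intro powr_mono2') auto
      moreover have "(2 * Z) powr (-(9/10)) = 2 powr (-(9/10)) * Z powr (-(9/10))" using Zpos by (simp add: powr_mult)
      moreover have "2 powr (-(9/10)) \<ge> (2::real) powr (-1)" by (intro powr_mono) auto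
      moreover have "2 powr (-1) = (1/2::real)" by (simp add: powr_minus_divide)
      ultimately have ZV: "Z powr (-(9/10)) \<le> 2 * V"
        using mult_right_mono[of "1/2" "2 powr (-(9/10))" "Z powr (-(9/10))"] by simp
      define c where "c = real N powr (1/10) * (\<bar>\<beta>\<bar> * real q) powr (-(9/10))"
      have "geom_kernel N (\<bar>\<beta>\<bar> * real q * real k) \<le> c * real k powr (-(9/10))" if k: "k \<in> {1..K}" for k
      proof -
        define z where "z = \<bar>\<beta>\<bar> * real q * real k"
        have z: "z > 0" "z \<le> 1/2" using geom_kernel_sum_dvd(2)[OF q(2) M \<beta>M] k bpos qpos by (auto simp: z_def K_def)
        have "geom_kernel N z * z \<le> 1" using geom_kernel_mult_le[of z N 0] z by simp
        then have "geom_kernel N z \<le> real N powr (1 - 9/10) * z powr (-(9/10))"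
          using z geom_kernel_nonneg geom_kernel_le by (intro interpolate_powr) auto
        then show ?thesis using bpos qpos by (simp add: z_def c_def powr_mult mult_ac)
      qed
      then have "(\<Sum>k=1..K. geom_kernel N (\<bar>\<beta>\<bar> * real q * real k)) \<le> (\<Sum>k=1..K. c * real k powr (-(9/10)))"
        by (intro sum_mono)
      also have "\<dots> = c * (\<Sum>k=1..K. real k powr (-(9/10)))" by (simp add: sum_distrib_left)
      also have "\<dots> \<le> c * (10 * real K powr (1/10))" by (intro mult_left_mono sum_powr_le) (simp add: c_def)
      also have "\<dots> \<le> c * (10 * (real H * real N / real q) powr (1/10))"
        using K by (intro mult_left_mono powr_mono2) (auto simp: c_def)
      \<comment> \<open>N gets 1/10 from the kernel and 1/10 from the number of terms; q gets -9/10
        and -1/10 from the same two sources.\<close>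
      also have "\<dots> = 10 * real H powr (1/10) * (real N powr (1/5) * (\<bar>\<beta>\<bar> powr (-(9/10)) * real q powr (-1)))"
        using qpos bpos rN rH by (simp add: c_def powr_mult powr_divide powr_minus field_simps flip: powr_add)
      also have "\<dots> \<le> 10 * real H * (real N ^ 2 * (2 * V))"
      proof (rule mult_mono)
        show "10 * real H powr (1/10) \<le> 10 * real H" using powr_mono[of "1/10" 1 "real H"] rH by simp
        have "real N powr (1/5) * (\<bar>\<beta>\<bar> powr (-(9/10)) * real q powr (-1)) \<le>
             real N powr (1/5) * (\<bar>\<beta>\<bar> powr (-(9/10)) * real q powr (-(9/10)))"
          using q1 by (intro mult_left_mono powr_mono) auto
        also have "\<dots> = real N ^ 2 * Z powr (-(9/10))"
        proof -
          have "(real N ^ 2) powr (-(9/10)) = (real N powr 2) powr (-(9/10))" using rN by simp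
          also have "\<dots> = real N powr (-(9/5))" unfolding powr_powr by simp
          finally have "Z powr (-(9/10)) = real q powr (-(9/10)) * real N powr (-(9/5)) * \<bar>\<beta>\<bar> powr (-(9/10))"
            by (simp add: Z_def powr_mult)
          moreover have "real N ^ 2 = real N powr 2" using rN by simp
          moreover have "real N powr (1/5) = real N powr 2 * real N powr (-(9/5))" unfolding powr_add[symmetric] by simp
          ultimately show ?thesis by simp
        qed
        also have "\<dots> \<le> real N ^ 2 * (2 * V)" using ZV by (intro mult_left_mono) auto
        finally show "real N powr (1/5) * (\<bar>\<beta>\<bar> powr (-(9/10)) * real q powr (-1)) \<le> real N ^ 2 * (2 * V)" .
      qed auto
      also have "\<dots> \<le> 20 * real H ^ 2 * real N ^ 2 * V"
        using mult_right_mono[OF HH, of "20 * real N ^ 2 * V"] by (simp add: V_def mult_ac)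
      finally show ?thesis using le by linarith
    qed
  qed
  have pos: "(\<Sum>m\<in>{1..M}. geom_kernel N (\<alpha> * real m)) \<le> 380 * real H ^ 2 * real N ^ 2 * V"
  proof -
    have "(\<Sum>m\<in>{1..M}. geom_kernel N (\<alpha> * real m)) =
      (\<Sum>m | m \<in> {1..M} \<and> q dvd m. geom_kernel N (\<alpha> * real m)) + (\<Sum>m | m \<in> {1..M} \<and> \<not> q dvd m. geom_kernel N (\<alpha> * real m))"
      by (subst sum.union_disjoint[symmetric]) (auto intro: sum.cong)
    then show ?thesis using partA partB by linarith
  qed
  have zero: "geom_kernel N (\<alpha> * 0) \<le> 3 * real H ^ 2 * real N ^ 2 * V"
  proof -
    have "geom_kernel N (\<alpha> * 0) \<le> real N powr 1" using geom_kernel_le rN by simp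
    also have "\<dots> \<le> real N powr (11/10)" using rN by (intro powr_mono) auto
    also have "\<dots> = real N * real N powr (1/10)" using powr_add[of "real N" 1 "1/10"] rN by simp
    also have "\<dots> = real N ^ 2 * real N powr (-(9/10))" by (rule N11)
    also have "\<dots> \<le> real N ^ 2 * (3 * real H * V)" using NV by (intro mult_left_mono) auto
    also have "\<dots> \<le> 3 * real H ^ 2 * real N ^ 2 * V"
      using mult_right_mono[OF HH, of "3 * real N ^ 2 * V"] by (simp add: V_def mult_ac)
    finally show ?thesis .
  qed
  have "(\<Sum>m\<in>{-int M..int M}. geom_kernel N (\<alpha> * of_int m)) =
    (\<Sum>m\<in>{-int M..-1}. geom_kernel N (\<alpha> * of_int m)) + geom_kernel N (\<alpha> * 0) + (\<Sum>m\<in>{1..int M}. geom_kernel N (\<alpha> * of_int m))"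
  proof -
    have "{-int M..int M} = {-int M..-1} \<union> ({0} \<union> {1..int M})" by auto
    then have "(\<Sum>m\<in>{-int M..int M}. geom_kernel N (\<alpha> * of_int m)) =
      (\<Sum>m\<in>{-int M..-1}. geom_kernel N (\<alpha> * of_int m)) + (\<Sum>m\<in>{0} \<union> {1..int M}. geom_kernel N (\<alpha> * of_int m))"
      by (simp only:) (rule sum.union_disjoint, auto)
    also have "(\<Sum>m\<in>{0} \<union> {1..int M}. geom_kernel N (\<alpha> * of_int m)) = geom_kernel N (\<alpha> * 0) + (\<Sum>m\<in>{1..int M}. geom_kernel N (\<alpha> * of_int m))"
      by (subst sum.union_disjoint) auto
    finally show ?thesis by simp
  qed
  also have "(\<Sum>m\<in>{-int M..-1}. geom_kernel N (\<alpha> * of_int m)) = (\<Sum>m\<in>{1..M}. geom_kernel N (\<alpha> * real m))"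
  proof (rule sum.reindex_bij_witness[of _ "\<lambda>m. - int m" "\<lambda>m. nat (- m)"])
    fix m assume "m \<in> {-int M..-1}"
    then show "geom_kernel N (\<alpha> * real (nat (- m))) = geom_kernel N (\<alpha> * of_int m)"
      using geom_kernel_minus[of N "\<alpha> * of_int m"] by simp
  qed auto
  also have "(\<Sum>m\<in>{1..int M}. geom_kernel N (\<alpha> * of_int m)) = (\<Sum>m\<in>{1..M}. geom_kernel N (\<alpha> * real m))"
    by (rule sum.reindex_bij_witness[of _ int nat]) auto
  \<comment> \<open>763 = 2 * 380 + 3, from positive, negative and zero arguments.\<close>
  finally have "(\<Sum>m\<in>{-int M..int M}. geom_kernel N (\<alpha> * of_int m)) \<le> 763 * (real H ^ 2 * real N ^ 2 * V)"
    using pos zero by linarith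
  also have "\<dots> \<le> 1000 * (real H ^ 2 * real N ^ 2 * V)" by (simp add: V_def)
  finally show ?thesis by (simp add: M_def \<alpha>_def V_def W_def mult.assoc)
qed
lemma sum_int_geom_kernel: "norm (\<Sum>n\<in>{1..int N}. e (of_int n * x)) = geom_kernel N x"
proof -
  have "(\<Sum>n\<in>{1..int N}. e (of_int n * x)) = (\<Sum>n=1..N. e (real n * x))"
    by (rule sum.reindex_bij_witness[of _ int nat]) auto
  then show ?thesis by (simp add: geom_kernel_def)
qed

subsection \<open>Weyl sums of quadratic forms\<close>

text \<open>The weights may depend on the variable, so that boxes can be encoded by zero weights.
  Without the last factor the bound is the trivial one with the mass of ten variables replaced
  through D1^2 \<le> N D2. The ranges of \<open>q\<close> and \<open>\<beta>\<close> are those of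
  Dirichlet approximation with denominators up to 2HN, hence every real number is covered.\<close>

definition weyl_estimate :: "real^'n^'n \<Rightarrow> real \<Rightarrow> nat \<Rightarrow> bool" where
  "weyl_estimate F C H \<longleftrightarrow> (\<forall>N b D1 D2 a q \<beta>. N \<ge> 1 \<longrightarrow> (\<forall>i n. 0 \<le> b i n) \<longrightarrow> (\<forall>i. (\<Sum>n\<in>{1..int N}. b i n) \<le> D1) \<longrightarrow>
      (\<forall>i. (\<Sum>n\<in>{1..int N}. (b i n)\<^sup>2) \<le> D2) \<longrightarrow> coprime a (int q) \<longrightarrow> q \<ge> 1 \<longrightarrow> q \<le> 2 * H * N \<longrightarrow>
      \<bar>\<beta>\<bar> \<le> 1 / (2 * real (H * N) * real q) \<longrightarrow>
      norm (\<Sum>x\<in>vbox UNIV (\<lambda>_. {1..int N}). of_real (\<Prod>i\<in>UNIV. b i (x $ i)) * e ((of_int a / real q + \<beta>) * qform F (ivec x)))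
      \<le> C * D1 ^ (CARD('n) - 10) * D2 ^ 5 * real N ^ 5 * (real q * (1 + real N ^ 2 * \<bar>\<beta>\<bar>)) powr (-(9/4)))"

lemma weyl_estimateD:
  fixes F :: "real^'n^'n"
  assumes "weyl_estimate F C H" "N \<ge> 1" "\<And>i n. 0 \<le> b i n" "\<And>i. (\<Sum>n\<in>{1..int N}. b i n) \<le> D1"
    "\<And>i. (\<Sum>n\<in>{1..int N}. (b i n)\<^sup>2) \<le> D2" "coprime a (int q)" "q \<ge> 1" "q \<le> 2 * H * N"
    "\<bar>\<beta>\<bar> \<le> 1 / (2 * real (H * N) * real q)"
  shows "norm (\<Sum>x\<in>vbox UNIV (\<lambda>_. {1..int N}). of_real (\<Prod>i\<in>UNIV. b i (x $ i)) * e ((of_int a / real q + \<beta>) * qform F (ivec x)))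
      \<le> C * D1 ^ (CARD('n) - 10) * D2 ^ 5 * real N ^ 5 * (real q * (1 + real N ^ 2 * \<bar>\<beta>\<bar>)) powr (-(9/4))"
  using assms unfolding weyl_estimate_def by blast

text \<open>After Cauchy--Schwarz the inner sum over the variables of \<open>I\<close> is a product
  of five geometric sums whose frequencies are the integers 2 (F y)_i for a difference y supported
  on \<open>J\<close>. These five integers determine y and are bounded by H N, so the sum over y is
  at most the sum over all integer five-tuples, which factorises.\<close>

lemma weyl_bound:
  fixes F :: "real^'n^'n"
  assumes F: "integer_form F" and L1: "cond_L1 F"
  obtains C :: real and H :: nat where "C \<ge> 0" "H \<ge> 1" "weyl_estimate F C H"
proof -
  have sym: "transpose F = F" using F by (simp add: integer_form_def)
  obtain I J :: "'n set" where cI: "card I = 5" and cJ: "card J = 5" and IJ: "I \<inter> J = {}" and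
    inj: "\<And>v. (\<And>k. k \<notin> J \<Longrightarrow> v $ k = 0) \<Longrightarrow> (\<And>i. i \<in> I \<Longrightarrow> (F *v v) $ i = 0) \<Longrightarrow> v = 0"
    using cond_L1_blocks[OF L1] by blast
  define R where "R = - (I \<union> J)"
  have cR: "card R = CARD('n) - 10"
  proof -
    have "card (I \<union> J) = 10" using cI cJ IJ by (simp add: card_Un_disjoint)
    then show ?thesis unfolding R_def Compl_eq_Diff_UNIV by (subst card_Diff_subset) auto
  qed
  define H where "H = nat \<lceil>\<Sum>i\<in>UNIV. \<Sum>j\<in>UNIV. 2 * \<bar>F $ i $ j\<bar>\<rceil> + 1"
  have H: "(\<Sum>j\<in>UNIV. 2 * \<bar>F $ i $ j\<bar>) \<le> real H" for i
  proof -
    have "(\<Sum>j\<in>UNIV. 2 * \<bar>F $ i $ j\<bar>) \<le> (\<Sum>i\<in>UNIV. \<Sum>j\<in>UNIV. 2 * \<bar>F $ i $ j\<bar>)"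
      by (rule member_le_sum[where f = "\<lambda>i. \<Sum>j\<in>UNIV. 2 * \<bar>F $ i $ j\<bar>"]) (auto intro: sum_nonneg)
    then show ?thesis unfolding H_def by linarith
  qed
  \<comment> \<open>The square root of the fifth power of 1000 H^2 is needed; 3 is an integer
    exponent above 5/2.\<close>
  define C where "C = (1000 * real H ^ 2) ^ 3"
  have H1: "H \<ge> 1" by (simp add: H_def)
  have main: "norm (\<Sum>x\<in>vbox UNIV (\<lambda>_. {1..int N}). of_real (\<Prod>i\<in>UNIV. b i (x $ i)) * e ((of_int a / real q + \<beta>) * qform F (ivec x)))
      \<le> C * D1 ^ (CARD('n) - 10) * D2 ^ 5 * real N ^ 5 * (real q * (1 + real N ^ 2 * \<bar>\<beta>\<bar>)) powr (-(9/4))"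
    if N: "N \<ge> 1" and b0: "\<And>i n. 0 \<le> b i n" and D1: "\<And>i. (\<Sum>n\<in>{1..int N}. b i n) \<le> D1"
      and D2: "\<And>i. (\<Sum>n\<in>{1..int N}. (b i n)\<^sup>2) \<le> D2" and q: "coprime a (int q)" "q \<ge> 1" "q \<le> 2 * H * N"
      and \<beta>: "\<bar>\<beta>\<bar> \<le> 1 / (2 * real (H * N) * real q)"
    for N :: nat and b :: "'n \<Rightarrow> int \<Rightarrow> real" and D1 D2 :: real and a :: int and q :: nat and \<beta> :: real
  proof -
    define \<alpha> where "\<alpha> = of_int a / real q + \<beta>"
    define W where "W = real q * (1 + real N ^ 2 * \<bar>\<beta>\<bar>)"
    have Wpos: "W > 0" using q(2) by (simp add: W_def add_pos_nonneg)
    define U where "U = (vbox I (\<lambda>_. {1..int N}) :: (int^'n) set)"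
    define V where "V = (vbox J (\<lambda>_. {1..int N}) :: (int^'n) set)"
    define Z where "Z = (vbox R (\<lambda>_. {1..int N}) :: (int^'n) set)"
    have fin: "finite U" "finite V" "finite Z" by (auto simp: U_def V_def Z_def)
    define k where "k x y = e (\<alpha> * (2 * (ivec x \<bullet> (F *v ivec y))))" for x y :: "int^'n"
    \<comment> \<open>The floor changes only the type: for i in \<open>I\<close> and j in
      \<open>J\<close> the indices differ, so 2 F_ij = F_ij + F_ji is an integer.\<close>
    define m where "m y i = \<lfloor>2 * (F *v ivec y) $ i\<rfloor>" for y :: "int^'n" and i
    have m: "of_int (m y i) = 2 * (F *v ivec y) $ i" if "i \<in> I" "\<And>j. j \<notin> J \<Longrightarrow> y $ j = 0" for y i
    proof -
      have "2 * F $ i $ j * of_int (y $ j) \<in> \<int>" for j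
      proof (cases "j \<in> J")
        case True
        then have "i \<noteq> j" using that(1) IJ by auto
        then have "F $ i $ j + F $ j $ i \<in> \<int>" using F by (simp add: integer_form_def)
        moreover have "F $ j $ i = F $ i $ j" using sym by (metis transpose_def vec_lambda_beta)
        ultimately show ?thesis by (simp add: Ints_mult)
      qed (use that(2) in auto)
      then have "(\<Sum>j\<in>UNIV. 2 * F $ i $ j * of_int (y $ j)) \<in> \<int>" by (intro Ints_sum) auto
      then have "2 * (F *v ivec y) $ i \<in> \<int>"
        by (simp add: matrix_vector_mult_def sum_distrib_left mult_ac)
      then show ?thesis unfolding m_def by (metis Ints_cases floor_of_int)
    qed
    define G where "G = (1000 * real H ^ 2 * real N ^ 2 * W powr (-(9/10))) ^ 5"
    have Gb: "(\<Sum>y'\<in>V. norm (\<Sum>x\<in>U. k x y * cnj (k x y'))) \<le> G" if y: "y \<in> V" for y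
    proof -
      have Vd: "(y - y') $ j = 0" if "y' \<in> V" "j \<notin> J" for y' j
        using y that by (auto simp: V_def vbox_def)
      have eq: "norm (\<Sum>x\<in>U. k x y * cnj (k x y')) = (\<Prod>i\<in>I. geom_kernel N (\<alpha> * of_int (m (y - y') i)))"
        if y': "y' \<in> V" for y'
      proof -
        have "k x y * cnj (k x y') = (\<Prod>i\<in>I. e (of_int (x $ i) * (\<alpha> * of_int (m (y - y') i))))" if x: "x \<in> U" for x
        proof -
          have "k x y * cnj (k x y') = e (\<alpha> * (2 * (ivec x \<bullet> (F *v ivec y))) - \<alpha> * (2 * (ivec x \<bullet> (F *v ivec y'))))"
            unfolding k_def e_diff e_neg ..
          also have "\<alpha> * (2 * (ivec x \<bullet> (F *v ivec y))) - \<alpha> * (2 * (ivec x \<bullet> (F *v ivec y'))) = \<alpha> * (2 * (ivec x \<bullet> (F *v ivec (y - y'))))"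
            by (simp add: ivec_diff matrix_vector_mult_diff_distrib inner_diff_right algebra_simps)
          also have "ivec x \<bullet> (F *v ivec (y - y')) = (\<Sum>i\<in>I. of_int (x $ i) * (F *v ivec (y - y')) $ i)"
            unfolding inner_vec_def using x by (intro sum.mono_neutral_cong_right) (auto simp: U_def vbox_def)
          also have "\<alpha> * (2 * (\<Sum>i\<in>I. of_int (x $ i) * (F *v ivec (y - y')) $ i))
             = (\<Sum>i\<in>I. of_int (x $ i) * (\<alpha> * of_int (m (y - y') i)))"
            using Vd[OF y'] by (simp add: sum_distrib_left m mult_ac)
          finally show ?thesis by (simp add: e_sum)
        qed
        then have "(\<Sum>x\<in>U. k x y * cnj (k x y')) = (\<Sum>x\<in>U. \<Prod>i\<in>I. e (of_int (x $ i) * (\<alpha> * of_int (m (y - y') i))))"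
          by (rule sum.cong[OF refl])
        also have "\<dots> = (\<Prod>i\<in>I. \<Sum>n\<in>{1..int N}. e (of_int n * (\<alpha> * of_int (m (y - y') i))))"
          unfolding U_def by (rule sum_vbox_prod) auto
        finally show ?thesis by (simp add: prod_norm[symmetric] sum_int_geom_kernel)
      qed
      \<comment> \<open>Restricting to \<open>I\<close> turns the five frequencies into an element
        of a dependent product, over which the sum of products factorises.\<close>
      define \<phi> where "\<phi> y' = restrict (m (y - y')) I" for y'
      have "inj_on \<phi> V"
      proof (rule inj_onI)
        fix u v assume u: "u \<in> V" and v: "v \<in> V" and "\<phi> u = \<phi> v"
        then have mm: "m (y - u) i = m (y - v) i" if "i \<in> I" for i
          using that unfolding \<phi>_def by (metis restrict_apply')
        have "ivec (v - u) = 0"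
        proof (rule inj)
          fix i assume i: "i \<in> I"
          have "2 * (F *v ivec (y - u)) $ i = 2 * (F *v ivec (y - v)) $ i"
            using mm[OF i] m[OF i] Vd[OF u] Vd[OF v] by metis
          then show "(F *v ivec (v - u)) $ i = 0"
            by (simp add: ivec_diff matrix_vector_mult_diff_distrib)
        next
          fix j assume "j \<notin> J"
          then show "ivec (v - u) $ j = 0" using u v by (auto simp: V_def vbox_def)
        qed
        then show "u = v" by (simp add: vec_eq_iff)
      qed
      have \<phi>: "\<phi> y' \<in> Pi\<^sub>E I (\<lambda>_. {-int (H * N)..int (H * N)})" if y': "y' \<in> V" for y'
      proof -
        have "\<bar>m (y - y') i\<bar> \<le> int (H * N)" if i: "i \<in> I" for i
        proof -
          have yj: "\<bar>real_of_int ((y - y') $ j)\<bar> \<le> real N" for j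
            using y y' by (cases "j \<in> J") (auto simp: V_def vbox_def abs_le_iff dest!: bspec[where x=j] simp flip: of_int_diff)
          have "\<bar>real_of_int (m (y - y') i)\<bar> = \<bar>\<Sum>j\<in>UNIV. 2 * F $ i $ j * of_int ((y - y') $ j)\<bar>"
            using m[OF i] Vd[OF y'] by (simp add: matrix_vector_mult_def sum_distrib_left mult_ac)
          also have "\<dots> \<le> (\<Sum>j\<in>UNIV. \<bar>2 * F $ i $ j * of_int ((y - y') $ j)\<bar>)" by (rule sum_abs)
          also have "\<dots> \<le> (\<Sum>j\<in>UNIV. 2 * \<bar>F $ i $ j\<bar> * real N)"
            using yj by (intro sum_mono) (simp add: abs_mult mult_left_mono)
          also have "\<dots> \<le> real H * real N" unfolding sum_distrib_right[symmetric] using H by (intro mult_right_mono) auto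
          finally have "real_of_int \<bar>m (y - y') i\<bar> \<le> real_of_int (int (H * N))" by simp
          then show ?thesis by (simp only: of_int_le_iff)
        qed
        then show ?thesis unfolding \<phi>_def by (force simp: abs_le_iff)
      qed
      have "(\<Sum>y'\<in>V. norm (\<Sum>x\<in>U. k x y * cnj (k x y'))) = (\<Sum>y'\<in>V. \<Prod>i\<in>I. geom_kernel N (\<alpha> * of_int (\<phi> y' i)))"
        by (intro sum.cong refl) (simp add: eq \<phi>_def)
      also have "\<dots> = (\<Sum>g\<in>\<phi> ` V. \<Prod>i\<in>I. geom_kernel N (\<alpha> * of_int (g i)))"
        by (simp add: sum.reindex[OF \<open>inj_on \<phi> V\<close>])
      also have "\<dots> \<le> (\<Sum>g\<in>Pi\<^sub>E I (\<lambda>_. {-int (H * N)..int (H * N)}). \<Prod>i\<in>I. geom_kernel N (\<alpha> * of_int (g i)))"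
        using \<phi> by (intro sum_mono2) (auto intro!: finite_PiE prod_nonneg geom_kernel_nonneg)
      also have "\<dots> = (\<Prod>i\<in>I. \<Sum>n\<in>{-int (H * N)..int (H * N)}. geom_kernel N (\<alpha> * of_int n))"
        by (rule prod_sum_PiE[symmetric]) auto
      also have "\<dots> \<le> (\<Prod>i\<in>I. 1000 * real H ^ 2 * real N ^ 2 * W powr (-(9/10)))"
      proof (intro prod_mono conjI)
        show "0 \<le> (\<Sum>n\<in>{-int (H * N)..int (H * N)}. geom_kernel N (\<alpha> * of_int n))"
          by (intro sum_nonneg geom_kernel_nonneg)
        show "(\<Sum>n\<in>{-int (H * N)..int (H * N)}. geom_kernel N (\<alpha> * of_int n)) \<le> 1000 * real H ^ 2 * real N ^ 2 * W powr (-(9/10))"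
          unfolding \<alpha>_def W_def by (rule geom_kernel_sum[OF q(1,2) H1 N q(3) \<beta>])
      qed
      also have "\<dots> = G" by (simp add: G_def cI)
      finally show ?thesis .
    qed
    have G0: "G \<ge> 0" by (simp add: G_def)
    have D20: "D2 \<ge> 0" using order_trans[OF sum_nonneg D2] by (meson zero_le_power2)
    have Tz: "norm (\<Sum>x\<in>U. \<Sum>y\<in>V. of_real ((\<Prod>i\<in>I. b i (x $ i)) * (\<Prod>i\<in>J. b i (y $ i))) * e (\<alpha> * qform F (ivec (z + x + y))))
        \<le> C * D2 ^ 5 * real N ^ 5 * W powr (-(9/4))" for z
    proof -
      define p where "p x = of_real (\<Prod>i\<in>I. b i (x $ i)) * e (\<alpha> * qform F (ivec (z + x)))" for x
      define r where "r y = of_real (\<Prod>i\<in>J. b i (y $ i)) * e (\<alpha> * (qform F (ivec (z + y)) - qform F (ivec z)))" for y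
      have "of_real ((\<Prod>i\<in>I. b i (x $ i)) * (\<Prod>i\<in>J. b i (y $ i))) * e (\<alpha> * qform F (ivec (z + x + y))) = p x * r y * k x y" for x y
      proof -
        have "\<alpha> * qform F (ivec (z + x + y)) = \<alpha> * qform F (ivec (z + x)) + \<alpha> * (qform F (ivec (z + y)) - qform F (ivec z))
           + \<alpha> * (2 * (ivec x \<bullet> (F *v ivec y)))"
          using qform_add3[OF sym, of "ivec z" "ivec x" "ivec y"] by (simp add: ivec_add ring_distribs)
        then show ?thesis by (simp add: p_def r_def k_def e_add mult_ac)
      qed
      then have eq: "(\<Sum>x\<in>U. \<Sum>y\<in>V. of_real ((\<Prod>i\<in>I. b i (x $ i)) * (\<Prod>i\<in>J. b i (y $ i))) * e (\<alpha> * qform F (ivec (z + x + y))))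
        = (\<Sum>x\<in>U. \<Sum>y\<in>V. p x * r y * k x y)" by simp
      have pp: "(\<Sum>x\<in>U. (norm (p x))\<^sup>2) \<le> D2 ^ 5"
      proof -
        have "(\<Sum>x\<in>U. (norm (p x))\<^sup>2) = (\<Sum>x\<in>U. \<Prod>i\<in>I. (b i (x $ i))\<^sup>2)"
          by (simp add: p_def norm_mult power_mult_distrib prod_power_distrib del: of_real_prod)
        also have "\<dots> = (\<Prod>i\<in>I. \<Sum>n\<in>{1..int N}. (b i n)\<^sup>2)"
          unfolding U_def by (rule sum_vbox_prod) auto
        also have "\<dots> \<le> (\<Prod>i\<in>I. D2)" by (intro prod_mono conjI sum_nonneg D2) auto
        finally show ?thesis by (simp add: cI)
      qed
      have rr: "(\<Sum>y\<in>V. (norm (r y))\<^sup>2) \<le> D2 ^ 5"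
      proof -
        have "(\<Sum>x\<in>V. (norm (r x))\<^sup>2) = (\<Sum>x\<in>V. \<Prod>i\<in>J. (b i (x $ i))\<^sup>2)"
          by (simp add: r_def norm_mult power_mult_distrib prod_power_distrib del: of_real_prod)
        also have "\<dots> = (\<Prod>i\<in>J. \<Sum>n\<in>{1..int N}. (b i n)\<^sup>2)"
          unfolding V_def by (rule sum_vbox_prod) auto
        also have "\<dots> \<le> (\<Prod>i\<in>J. D2)" by (intro prod_mono conjI sum_nonneg D2) auto
        finally show ?thesis by (simp add: cJ)
      qed
      have "(norm (\<Sum>x\<in>U. \<Sum>y\<in>V. p x * r y * k x y))\<^sup>2
        \<le> (\<Sum>x\<in>U. (norm (p x))\<^sup>2) * (\<Sum>y\<in>V. (norm (r y))\<^sup>2) * G"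
        by (rule bilinear_bound[OF fin(1,2) Gb])
      also have "\<dots> \<le> D2 ^ 5 * D2 ^ 5 * G"
        using pp rr G0 D20 by (intro mult_mono mult_nonneg_nonneg sum_nonneg) auto
      also have "\<dots> \<le> (C * D2 ^ 5 * real N ^ 5 * W powr (-(9/4)))\<^sup>2"
      proof -
        \<comment> \<open>-(9/10) * 5 = 2 * (-(9/4)): this is the origin of the exponent
          9/4.\<close>
        have WW: "(W powr (-(9/10))) ^ 5 = (W powr (-(9/4)))\<^sup>2"
          using Wpos by (simp add: powr_powr flip: powr_realpow)
        have "(1000 * real H ^ 2) ^ 5 \<le> C\<^sup>2"
          unfolding C_def power_mult[symmetric] using H1
          by (intro power_increasing) (auto intro: order_trans[of _ 1000] simp: one_le_power)
        then have "(D2 ^ 5 * D2 ^ 5 * (real N ^ 2) ^ 5 * (W powr (-(9/4)))\<^sup>2) * (1000 * real H ^ 2) ^ 5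
          \<le> (D2 ^ 5 * D2 ^ 5 * (real N ^ 2) ^ 5 * (W powr (-(9/4)))\<^sup>2) * C\<^sup>2"
          using D20 by (intro mult_left_mono) auto
        then show ?thesis unfolding G_def power_mult_distrib WW
          by (simp add: power2_eq_square power_mult_distrib mult_ac)
      qed
      finally show ?thesis unfolding eq
        by (rule power2_le_imp_le) (use D20 in \<open>auto simp: C_def\<close>)
    qed
    have UN: "UNIV = R \<union> (I \<union> J)" by (auto simp: R_def)
    have disj: "R \<inter> (I \<union> J) = {}" by (auto simp: R_def)
    define B where "B x = complex_of_real (\<Prod>i\<in>UNIV. b i (x $ i)) * e (\<alpha> * qform F (ivec x))" for x :: "int^'n"
    have "(\<Sum>x\<in>vbox UNIV (\<lambda>_. {1..int N}). B x) = (\<Sum>z\<in>Z. \<Sum>x\<in>U. \<Sum>y\<in>V. B (z + (x + y)))"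
      unfolding UN sum_vbox_union[OF disj] sum_vbox_union[OF IJ] U_def V_def Z_def ..
    also have "\<dots> = (\<Sum>z\<in>Z. of_real (\<Prod>i\<in>R. b i (z $ i)) * (\<Sum>x\<in>U. \<Sum>y\<in>V. of_real ((\<Prod>i\<in>I. b i (x $ i)) * (\<Prod>i\<in>J. b i (y $ i))) * e (\<alpha> * qform F (ivec (z + x + y)))))"
    proof (rule sum.cong[OF refl])
      fix z assume z: "z \<in> Z"
      have "B (z + (x + y)) = of_real (\<Prod>i\<in>R. b i (z $ i)) * (of_real ((\<Prod>i\<in>I. b i (x $ i)) * (\<Prod>i\<in>J. b i (y $ i))) * e (\<alpha> * qform F (ivec (z + x + y))))"
        if x: "x \<in> U" and y: "y \<in> V" for x y
      proof -
        have "(\<Prod>i\<in>UNIV. b i ((z + (x + y)) $ i)) = (\<Prod>i\<in>R. b i ((z + (x + y)) $ i)) * ((\<Prod>i\<in>I. b i ((z + (x + y)) $ i)) * (\<Prod>i\<in>J. b i ((z + (x + y)) $ i)))"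
          unfolding UN using disj IJ by (simp add: prod.union_disjoint)
        moreover have "(\<Prod>i\<in>R. b i ((z + (x + y)) $ i)) = (\<Prod>i\<in>R. b i (z $ i))"
          using x y by (intro prod.cong) (auto simp: R_def U_def V_def vbox_def)
        moreover have "(\<Prod>i\<in>I. b i ((z + (x + y)) $ i)) = (\<Prod>i\<in>I. b i (x $ i))"
          using z y IJ by (intro prod.cong) (auto simp: R_def Z_def V_def vbox_def)
        moreover have "(\<Prod>i\<in>J. b i ((z + (x + y)) $ i)) = (\<Prod>i\<in>J. b i (y $ i))"
          using z x IJ by (intro prod.cong) (auto simp: R_def Z_def U_def vbox_def)
        ultimately show ?thesis by (simp add: B_def add.assoc mult.assoc)
      qed
      then show "(\<Sum>x\<in>U. \<Sum>y\<in>V. B (z + (x + y))) = of_real (\<Prod>i\<in>R. b i (z $ i)) * (\<Sum>x\<in>U. \<Sum>y\<in>V. of_real ((\<Prod>i\<in>I. b i (x $ i)) * (\<Prod>i\<in>J. b i (y $ i))) * e (\<alpha> * qform F (ivec (z + x + y))))"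
        by (simp add: sum_distrib_left cong: sum.cong)
    qed
    finally have "norm (\<Sum>x\<in>vbox UNIV (\<lambda>_. {1..int N}). B x) \<le> (\<Sum>z\<in>Z. (\<Prod>i\<in>R. b i (z $ i)) * (C * D2 ^ 5 * real N ^ 5 * W powr (-(9/4))))"
      using b0 by (simp only:) (intro order_trans[OF norm_sum] sum_mono,
        simp only: norm_mult norm_of_real abs_of_nonneg prod_nonneg, intro mult_left_mono Tz prod_nonneg, auto simp: abs_of_nonneg prod_nonneg)
    also have "\<dots> = (\<Prod>i\<in>R. \<Sum>n\<in>{1..int N}. b i n) * (C * D2 ^ 5 * real N ^ 5 * W powr (-(9/4)))"
      unfolding sum_distrib_right[symmetric] Z_def by (subst sum_vbox_prod) auto
    also have "\<dots> \<le> (\<Prod>i\<in>R. D1) * (C * D2 ^ 5 * real N ^ 5 * W powr (-(9/4)))"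
      using D20 by (intro mult_right_mono prod_mono conjI sum_nonneg D1 b0) (auto simp: C_def)
    finally show ?thesis by (simp add: B_def \<alpha>_def W_def cR mult_ac)
  qed
  have C0: "C \<ge> 0" by (simp add: C_def)
  have "weyl_estimate F C H"
    unfolding weyl_estimate_def by (intro allI impI) (rule main; blast)
  then show ?thesis by (rule that[OF C0 H1])
qed

subsection \<open>The circle method\<close>

lemma has_integral_e_period:
  assumes "k \<noteq> 0"
  shows "((\<lambda>x. e (x * of_int k)) has_integral 0) {c..c + 1}"
proof -
  define w where "w = 2 * complex_of_real pi * \<i> * of_int k"
  have w: "w \<noteq> 0" using assms by (simp add: w_def)
  have e: "e (x * of_int k) = exp (w * of_real x)" for x
    by (simp add: e_def w_def mult_ac)
  have "((\<lambda>x. exp (w * of_real x)) has_integral (exp (w * of_real (c + 1)) / w - exp (w * of_real c) / w)) {c..c + 1}"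
  proof (rule fundamental_theorem_of_calculus)
    fix x
    have "((\<lambda>z. exp (w * z) / w) has_field_derivative exp (w * of_real x)) (at (of_real x))"
      using w by (auto intro!: derivative_eq_intros)
    then show "((\<lambda>x. exp (w * of_real x) / w) has_vector_derivative exp (w * of_real x)) (at x within {c..c + 1})"
      by (rule has_vector_derivative_real_field)
  qed simp
  moreover have "exp (w * of_real (c + 1)) = exp (w * of_real c)"
  proof -
    have "e ((c + 1) * of_int k) = e (c * of_int k)" by (simp add: distrib_right e_add)
    then show ?thesis by (simp only: e)
  qed
  ultimately show ?thesis by (simp add: e)
qed

lemma integral_e_period:
  "integral {c..c + 1} (\<lambda>x. e (x * of_int k)) = (if k = 0 then 1 else 0)"
  using has_integral_e_period[of k c] by (auto intro: integral_unique)

text \<open>The Lorentzian is an upper bound for (1 + Y|x - p|)^(-2) with primitive arctan; the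
  integral over the whole line is pi/Y, which is below 4/Y.\<close>

lemma integral_lorentz_le:
  fixes Y p c d :: real
  assumes "Y > 0" "c \<le> d"
  shows "set_integrable lborel {c..d} (\<lambda>x. 1 / (1 + (Y * (x - p))\<^sup>2))"
    and "(LINT x:{c..d}|lborel. 1 / (1 + (Y * (x - p))\<^sup>2)) \<le> 4 / Y"
proof -
  have nz: "1 + (Y * (x - p))\<^sup>2 \<noteq> 0" for x
    using zero_le_power2[of "Y * (x - p)"] by linarith
  show int: "set_integrable lborel {c..d} (\<lambda>x. 1 / (1 + (Y * (x - p))\<^sup>2))"
    unfolding set_integrable_def
    by (rule borel_integrable_compact) (use nz in \<open>auto intro!: continuous_intros\<close>)
  have "((\<lambda>x. 1 / (1 + (Y * (x - p))\<^sup>2)) has_integral (arctan (Y * (d - p)) / Y - arctan (Y * (c - p)) / Y)) {c..d}"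
  proof (rule fundamental_theorem_of_calculus[OF assms(2)])
    fix x
    have "((\<lambda>x. arctan (Y * (x - p)) / Y) has_real_derivative (inverse (1 + (Y * (x - p))\<^sup>2) * Y) / Y) (at x within {c..d})"
      using assms(1) by (auto intro!: derivative_eq_intros)
    then show "((\<lambda>x. arctan (Y * (x - p)) / Y) has_vector_derivative 1 / (1 + (Y * (x - p))\<^sup>2)) (at x within {c..d})"
      using assms(1) by (simp add: has_real_derivative_iff_has_vector_derivative inverse_eq_divide)
  qed
  then have "(LINT x:{c..d}|lborel. 1 / (1 + (Y * (x - p))\<^sup>2)) = arctan (Y * (d - p)) / Y - arctan (Y * (c - p)) / Y"
    using set_borel_integral_eq_integral(2)[OF int] by (simp add: integral_unique)
  also have "\<dots> = (arctan (Y * (d - p)) - arctan (Y * (c - p))) / Y" by (simp add: diff_divide_distrib)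
  also have "\<dots> \<le> 4 / Y"
    using arctan_bounded[of "Y * (d - p)"] arctan_bounded[of "Y * (c - p)"] pi_less_4 assms
    by (intro divide_right_mono) auto
  finally show "(LINT x:{c..d}|lborel. 1 / (1 + (Y * (x - p))\<^sup>2)) \<le> 4 / Y" .
qed

lemma sum_inverse_le: "D \<ge> 1 \<Longrightarrow> (\<Sum>q=1..D. 1 / real q) \<le> 1 + ln (real D)"
proof (induction D rule: nat_induct_at_least)
  case (Suc n)
  have "ln (real n / real (Suc n)) \<le> real n / real (Suc n) - 1"
    using Suc.hyps by (intro ln_le_minus_one) auto
  then have "1 / real (Suc n) \<le> ln (real (Suc n)) - ln (real n)"
    using Suc.hyps by (simp add: ln_div field_simps)
  then show ?case using Suc.IH by simp
qed auto

text \<open>Stated for an arbitrary finite family of integer frequencies, with \<open>minor\<close>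
  available at every Dirichlet approximation. Let W = q (1 + Y|\<beta>|). Off the major arcs W \<ge>
  P, so W^(-9/4) \<le> P^(-1/4) W^(-2), and integrating W^(-2) around all fractions with denominator
  up to \<open>D\<close> gives order (1 + ln D)/Y. The constant 12 is 4 from the Lorentzian times 3
  from 2q + 1 \<le> 3q.\<close>

lemma circle_method:
  fixes \<Omega> :: "'x set" and c :: "'x \<Rightarrow> complex" and k :: "'x \<Rightarrow> int" and S :: "nat \<Rightarrow> nat \<Rightarrow> complex"
    and V :: "real \<Rightarrow> complex" and P Y M E :: real and D :: nat
  defines "T \<equiv> \<lambda>\<alpha>. \<Sum>x\<in>\<Omega>. c x * e (\<alpha> * of_int (k x))"
  assumes fin: "finite \<Omega>" and P: "P \<ge> 1" and Y: "4 * P ^ 3 \<le> Y" and D: "D \<ge> 1" and M: "M \<ge> 0" and E: "E \<ge> 0"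
    and minor: "\<And>q a \<beta>. 1 \<le> q \<Longrightarrow> q \<le> D \<Longrightarrow> coprime a (int q) \<Longrightarrow> \<bar>\<beta>\<bar> \<le> 1 / (real D * real q) \<Longrightarrow>
        norm (T (of_int a / real q + \<beta>)) \<le> M * (real q * (1 + Y * \<bar>\<beta>\<bar>)) powr (-(9/4))"
    and major: "\<And>q b \<beta>. 1 \<le> q \<Longrightarrow> real q \<le> P \<Longrightarrow> 1 \<le> b \<Longrightarrow> b \<le> q \<Longrightarrow> coprime b q \<Longrightarrow> \<bar>\<beta>\<bar> \<le> P / Y \<Longrightarrow>
        norm (T (real b / real q + \<beta>) - S q b * V \<beta>) \<le> E"
    and V: "continuous_on UNIV V"
  shows "norm ((\<Sum>x | x \<in> \<Omega> \<and> k x = t. c x) -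
      (\<Sum>q=1..nat \<lfloor>P\<rfloor>. \<Sum>b | 1 \<le> b \<and> b \<le> q \<and> coprime b q. S q b * e (- (real b / real q * of_int t)))
        * integral {-(P/Y)..P/Y} (\<lambda>\<beta>. V \<beta> * e (- (\<beta> * of_int t))))
    \<le> 2 * P ^ 3 / Y * E + 12 * M * P powr (-(1/4)) * (1 + ln (real D)) / Y"
proof -
  define \<eta> where "\<eta> = P / Y"
  have Ypos: "Y > 0" using P Y by (smt (verit) one_le_power)
  have \<eta>0: "\<eta> > 0" using P Ypos by (simp add: \<eta>_def)
  have P23: "P \<le> P^2" "P^2 \<le> P^3" using P by (auto simp: power_increasing self_le_power)
  have \<eta>P: "4 * \<eta> * P ^ 2 \<le> 1" using Y Ypos by (simp add: \<eta>_def field_simps power2_eq_square power3_eq_cube)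
  have \<eta>P1: "4 * \<eta> * P \<le> 1" using mult_left_mono[OF P23(1), of "4 * \<eta>"] \<eta>P \<eta>0 by linarith
  have \<eta>1: "4 * \<eta> \<le> 1" using mult_left_mono[OF P, of "4 * \<eta>"] \<eta>P1 \<eta>0 by linarith
  \<comment> \<open>Starting the unit interval at 2\<eta> puts the arc around 1 (b = q) inside it,
    and since 4\<eta> \<le> 1/P all the other arcs lie inside too.\<close>
  define Wd where "Wd = {2 * \<eta>..2 * \<eta> + 1}"
  define I where "I = (SIGMA q:{1..nat \<lfloor>P\<rfloor>}. {b. 1 \<le> b \<and> b \<le> q \<and> coprime b q})"
  have finb: "finite {b. 1 \<le> b \<and> b \<le> q \<and> coprime b q}" for q :: nat
    by (rule finite_subset[of _ "{1..q}"]) auto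
  have finI: "finite I" unfolding I_def by (intro finite_SigmaI finb) auto
  have I: "(q, b) \<in> I \<longleftrightarrow> 1 \<le> q \<and> real q \<le> P \<and> 1 \<le> b \<and> b \<le> q \<and> coprime b q" for q b
    unfolding I_def using P by (auto simp: le_nat_iff le_floor_iff)
  define arc where "arc = (\<lambda>(q::nat, b::nat). {real b / real q - \<eta>..real b / real q + \<eta>})"
  define Maj where "Maj = (\<Union>i\<in>I. arc i)"
  define g where "g \<alpha> = T \<alpha> * e (- (\<alpha> * of_int t))" for \<alpha>
  have contT: "continuous_on UNIV T" unfolding T_def by (intro continuous_intros continuous_e)
  have contg: "continuous_on UNIV g" unfolding g_def by (intro continuous_intros continuous_e contT)
  have intg: "set_integrable lborel {x..y} g" for x y
    unfolding set_integrable_def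
    by (rule borel_integrable_compact) (auto intro: continuous_on_subset[OF contg])
  have total: "(LINT \<alpha>:Wd|lborel. g \<alpha>) = (\<Sum>x | x \<in> \<Omega> \<and> k x = t. c x)"
  proof -
    have geq: "g = (\<lambda>\<alpha>. \<Sum>x\<in>\<Omega>. c x * e (\<alpha> * of_int (k x - t)))"
      by (simp add: fun_eq_iff g_def T_def sum_distrib_right mult.assoc ring_distribs e_diff)
    have "(LINT \<alpha>:Wd|lborel. g \<alpha>) = integral Wd g"
      unfolding Wd_def by (rule set_borel_integral_eq_integral(2)[OF intg])
    also have "\<dots> = (\<Sum>x\<in>\<Omega>. c x * integral Wd (\<lambda>\<alpha>. e (\<alpha> * of_int (k x - t))))"
      unfolding Wd_def geq using fin
      by (subst integral_sum) (auto intro!: integrable_continuous_interval continuous_intros continuous_e)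
    also have "\<dots> = (\<Sum>x\<in>\<Omega>. if k x = t then c x else 0)"
      unfolding Wd_def by (intro sum.cong refl) (subst integral_e_period, auto)
    also have "\<dots> = (\<Sum>x | x \<in> \<Omega> \<and> k x = t. c x)"
      using fin by (simp add: sum.If_cases Int_def)
    finally show ?thesis .
  qed
  have arcWd: "arc i \<subseteq> Wd" if "i \<in> I" for i
  proof -
    obtain q b where i: "i = (q, b)" by (cases i)
    have qb: "1 \<le> q" "real q \<le> P" "1 \<le> b" "b \<le> q" using that by (auto simp: i I)
    have "1 / P \<le> 1 / real q" using qb P by (simp add: frac_le)
    also have "\<dots> \<le> real b / real q" using qb by (simp add: divide_right_mono)
    finally have "1 / P \<le> real b / real q" .
    moreover have "4 * \<eta> \<le> 1 / P" using \<eta>P1 P by (simp add: field_simps)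
    moreover have "real b / real q \<le> 1" using qb by simp
    ultimately show ?thesis using \<eta>0 unfolding i arc_def Wd_def by auto
  qed
  have disj: "disjoint_family_on arc I"
    unfolding disjoint_family_on_def
  proof (intro ballI impI)
    fix i j assume ij: "i \<in> I" "j \<in> I" "i \<noteq> j"
    obtain q b where i: "i = (q, b)" by (cases i)
    obtain q' b' where j: "j = (q', b')" by (cases j)
    have qb: "1 \<le> q" "real q \<le> P" "coprime b q" using ij by (auto simp: i I)
    have qb': "1 \<le> q'" "real q' \<le> P" "coprime b' q'" using ij by (auto simp: j I)
    have ne: "b * q' \<noteq> b' * q"
    proof
      assume eq: "b * q' = b' * q"
      then have "q dvd q'" using qb(3) by (metis coprime_commute coprime_dvd_mult_right_iff dvd_triv_right)
      moreover have "q' dvd q" using eq qb'(3) by (metis coprime_commute coprime_dvd_mult_right_iff dvd_triv_right)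
      ultimately have "q = q'" by (rule dvd_antisym)
      then show False using eq ij(3) qb(1) i j by auto
    qed
    have "1 \<le> \<bar>int (b * q') - int (b' * q)\<bar>" using ne by linarith
    then have "1 \<le> \<bar>real b * real q' - real b' * real q\<bar>"
    proof -
      have "real_of_int 1 \<le> real_of_int \<bar>int (b * q') - int (b' * q)\<bar>"
        using \<open>1 \<le> \<bar>int (b * q') - int (b' * q)\<bar>\<close> by (simp only: of_int_le_iff)
      then show ?thesis by simp
    qed
    moreover have "real b / real q - real b' / real q' = (real b * real q' - real b' * real q) / (real q * real q')"
      using qb qb' by (simp add: field_simps)
    ultimately have "\<bar>real b / real q - real b' / real q'\<bar> \<ge> 1 / (real q * real q')"
      using qb qb' by (simp add: divide_right_mono)
    moreover have "1 / (real q * real q') \<ge> 1 / (P * P)"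
      using qb qb' by (intro divide_left_mono mult_mono) auto
    moreover have "1 / (P * P) \<ge> 4 * \<eta>" using \<eta>P P by (simp add: field_simps power2_eq_square)
    ultimately have "\<bar>real b / real q - real b' / real q'\<bar> > 2 * \<eta>" using \<eta>0 by linarith
    then show "arc i \<inter> arc j = {}" unfolding i j arc_def by auto
  qed
  have Majsets: "Maj \<in> sets lborel" unfolding Maj_def arc_def using finI by (intro sets.finite_UN) auto
  have MajWd: "Maj \<subseteq> Wd" unfolding Maj_def using arcWd by blast
  define Min where "Min = Wd - Maj"
  have Minsets: "Min \<in> sets lborel" unfolding Min_def Wd_def using Majsets by (intro sets.Diff) auto
  have intWd: "set_integrable lborel Wd g" unfolding Wd_def by (rule intg)
  have intMaj: "set_integrable lborel Maj g" by (rule set_integrable_subset[OF intWd Majsets MajWd])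
  have intMin: "set_integrable lborel Min g" by (rule set_integrable_subset[OF intWd Minsets]) (auto simp: Min_def)
  have split: "(LINT \<alpha>:Wd|lborel. g \<alpha>) = (LINT \<alpha>:Maj|lborel. g \<alpha>) + (LINT \<alpha>:Min|lborel. g \<alpha>)"
  proof -
    have "Wd = Maj \<union> Min" using MajWd by (auto simp: Min_def)
    then show ?thesis using set_integral_Un[OF _ intMaj intMin] by (auto simp: Min_def)
  qed
  have MajE: "norm ((LINT \<alpha>:Maj|lborel. g \<alpha>) - (\<Sum>(q, b)\<in>I. S q b * e (- (real b / real q * of_int t)) * integral {-\<eta>..\<eta>} (\<lambda>\<beta>. V \<beta> * e (- (\<beta> * of_int t)))))
      \<le> 2 * P ^ 3 / Y * E"
  proof -
    have "(LINT \<alpha>:Maj|lborel. g \<alpha>) = (\<Sum>i\<in>I. LINT \<alpha>:arc i|lborel. g \<alpha>)"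
      unfolding Maj_def using finI disj
      by (intro set_integral_finite_Union) (auto simp: arc_def intro: intg)
    then have "norm ((LINT \<alpha>:Maj|lborel. g \<alpha>) - (\<Sum>(q, b)\<in>I. S q b * e (- (real b / real q * of_int t)) * integral {-\<eta>..\<eta>} (\<lambda>\<beta>. V \<beta> * e (- (\<beta> * of_int t)))))
      = norm (\<Sum>(q, b)\<in>I. (LINT \<alpha>:arc (q, b)|lborel. g \<alpha>) - S q b * e (- (real b / real q * of_int t)) * integral {-\<eta>..\<eta>} (\<lambda>\<beta>. V \<beta> * e (- (\<beta> * of_int t))))"
      by (simp add: sum_subtractf case_prod_beta)
    also have "\<dots> \<le> (\<Sum>(q, b)\<in>I. 2 * \<eta> * E)"
    proof (intro order_trans[OF norm_sum] sum_mono, clarify)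
      fix q b assume qb: "(q, b) \<in> I"
      define x where "x = real b / real q"
      have "(LINT \<alpha>:arc (q, b)|lborel. g \<alpha>) = integral {-\<eta> + x..\<eta> + x} g"
        unfolding arc_def x_def using set_borel_integral_eq_integral(2)[OF intg] by (simp add: add.commute)
      also have "\<dots> = integral {-\<eta>..\<eta>} (g \<circ> (+) x)" by (rule integral_shift_Icc_real[symmetric])
      finally have "(LINT \<alpha>:arc (q, b)|lborel. g \<alpha>) = integral {-\<eta>..\<eta>} (\<lambda>\<beta>. g (x + \<beta>))" by (simp add: o_def)
      moreover have "S q b * e (- (x * of_int t)) * integral {-\<eta>..\<eta>} (\<lambda>\<beta>. V \<beta> * e (- (\<beta> * of_int t)))
        = integral {-\<eta>..\<eta>} (\<lambda>\<beta>. S q b * e (- (x * of_int t)) * (V \<beta> * e (- (\<beta> * of_int t))))"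
        by (rule integral_mult_right[symmetric])
      ultimately have "(LINT \<alpha>:arc (q, b)|lborel. g \<alpha>) - S q b * e (- (x * of_int t)) * integral {-\<eta>..\<eta>} (\<lambda>\<beta>. V \<beta> * e (- (\<beta> * of_int t)))
        = integral {-\<eta>..\<eta>} (\<lambda>\<beta>. g (x + \<beta>) - S q b * e (- (x * of_int t)) * (V \<beta> * e (- (\<beta> * of_int t))))"
        by (simp only:) (rule integral_diff[symmetric]; intro integrable_continuous_interval continuous_intros continuous_e
            continuous_on_subset[OF V] continuous_on_compose2[OF contg]; simp)
      also have "norm \<dots> \<le> E * (\<eta> - (-\<eta>))"
      proof (rule integral_bound)
        fix \<beta> assume \<beta>: "\<beta> \<in> {-\<eta>..\<eta>}"
        have "g (x + \<beta>) - S q b * e (- (x * of_int t)) * (V \<beta> * e (- (\<beta> * of_int t)))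
          = (T (x + \<beta>) - S q b * V \<beta>) * e (- ((x + \<beta>) * of_int t))"
          using e_add[of "- (x * of_int t)" "- (\<beta> * of_int t)"] by (simp add: g_def algebra_simps)
        then have "norm (g (x + \<beta>) - S q b * e (- (x * of_int t)) * (V \<beta> * e (- (\<beta> * of_int t)))) = norm (T (x + \<beta>) - S q b * V \<beta>)"
          by (simp add: norm_mult)
        also have "\<dots> \<le> E" unfolding x_def using qb \<beta> by (intro major) (auto simp: I \<eta>_def)
        finally show "norm (g (x + \<beta>) - S q b * e (- (x * of_int t)) * (V \<beta> * e (- (\<beta> * of_int t)))) \<le> E" .
      qed (use \<eta>0 in \<open>auto intro!: continuous_intros continuous_e continuous_on_subset[OF V] continuous_on_compose2[OF contg]\<close>)
      finally show "norm ((LINT \<alpha>:arc (q, b)|lborel. g \<alpha>) - S q b * e (- (real b / real q * of_int t)) * integral {-\<eta>..\<eta>} (\<lambda>\<beta>. V \<beta> * e (- (\<beta> * of_int t)))) \<le> 2 * \<eta> * E"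
        by (simp add: x_def mult_ac)
    qed
    also have "\<dots> = real (card I) * (2 * \<eta> * E)" by (simp add: case_prod_beta)
    also have "\<dots> \<le> P ^ 2 * (2 * \<eta> * E)"
    proof (intro mult_right_mono)
      have "card I \<le> card ({1..nat \<lfloor>P\<rfloor>} \<times> {1..nat \<lfloor>P\<rfloor>})" by (intro card_mono) (auto simp: I_def)
      then have "card I \<le> nat \<lfloor>P\<rfloor> * nat \<lfloor>P\<rfloor>" by (simp add: card_cartesian_product)
      then have "real (card I) \<le> real (nat \<lfloor>P\<rfloor>) * real (nat \<lfloor>P\<rfloor>)" by (metis of_nat_le_iff of_nat_mult)
      also have "\<dots> \<le> P * P" using P by (intro mult_mono) auto
      finally show "real (card I) \<le> P ^ 2" by (simp add: power2_eq_square)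
    qed (use E \<eta>0 in auto)
    finally show ?thesis by (simp add: \<eta>_def power2_eq_square power3_eq_cube mult_ac)
  qed
  have MinE: "norm (LINT \<alpha>:Min|lborel. g \<alpha>) \<le> 12 * M * P powr (-(1/4)) * (1 + ln (real D)) / Y"
  proof -
    \<comment> \<open>Every fraction with 0 \<le> a \<le> 2q contributes over the whole interval, so
      overlaps of Farey arcs are harmless.\<close>
    define L where "L q a \<alpha> = 1 / (1 + (Y * (\<alpha> - real a / real q))\<^sup>2)" for q a :: nat and \<alpha>
    define M' where "M' = M * P powr (-(1/4))"
    define h where "h \<alpha> = (\<Sum>q=1..D. \<Sum>a=0..2*q. M' / real q ^ 2 * L q a \<alpha>)" for \<alpha>
    have M'0: "M' \<ge> 0" using M by (simp add: M'_def)
    have L0: "L q a \<alpha> \<ge> 0" for q a \<alpha> by (simp add: L_def)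
    have bnd: "norm (g \<alpha>) \<le> h \<alpha>" if \<alpha>: "\<alpha> \<in> Min" for \<alpha>
    proof -
      obtain a k where ak: "coprime a k" "0 < k" "k \<le> int D" "\<bar>of_int k * \<alpha> - of_int a\<bar> < 1 / real D"
        using Dirichlet_approx_coprime[of D \<alpha>] D by auto
      define q where "q = nat k"
      have q: "1 \<le> q" "q \<le> D" "k = int q" using ak by (auto simp: q_def)
      define \<beta> where "\<beta> = \<alpha> - of_int a / real q"
      have \<alpha>W: "2 * \<eta> \<le> \<alpha>" "\<alpha> \<le> 2 * \<eta> + 1" using \<alpha> by (auto simp: Min_def Wd_def)
      have "real q * \<beta> = of_int k * \<alpha> - of_int a" using q by (simp add: \<beta>_def field_simps)
      then have "real q * \<bar>\<beta>\<bar> \<le> 1 / real D" using ak(4) q by (simp add: abs_mult flip: abs_mult)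
      then have \<beta>: "\<bar>\<beta>\<bar> \<le> 1 / (real D * real q)" using q D by (simp add: field_simps)
      have d1: "1 / real D \<le> 1" using D by simp
      have "of_int a > of_int k * \<alpha> - 1" using ak(4) d1 by linarith
      moreover have "of_int k * \<alpha> \<ge> 0" using ak(2) \<alpha>W \<eta>0 by simp
      ultimately have "real_of_int a > -1" by linarith
      then have a0: "a \<ge> 0" by linarith
      have "of_int a < of_int k * \<alpha> + 1" using ak(4) d1 by linarith
      moreover have "of_int k * \<alpha> \<le> real q * 2" unfolding q(3) using \<alpha>W \<eta>1 by (auto intro!: mult_left_mono)
      ultimately have "real_of_int a < of_int (2 * int q + 1)" by simp
      then have a2: "a \<le> 2 * int q" by (simp only: of_int_less_iff)
      define W where "W = real q * (1 + Y * \<bar>\<beta>\<bar>)"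
      have W1: "W \<ge> 1" unfolding W_def using q Ypos
        by (metis abs_ge_zero add_increasing2 less_imp_le mult_mono' mult_nonneg_nonneg mult_1 of_nat_1 of_nat_le_iff order_refl zero_le_one)
      \<comment> \<open>W < P would force q \<le> P and |\<beta>| \<le> \<eta>. The position of
        \<open>Wd\<close> then forces 1 \<le> a \<le> q, so \<alpha> would lie in a major
        arc.\<close>
      have WP: "W \<ge> P"
      proof (rule ccontr)
        assume "\<not> W \<ge> P"
        then have "W < P" by simp
        moreover have "W \<ge> real q" unfolding W_def using Ypos by (simp add: distrib_left)
        moreover have "W \<ge> Y * \<bar>\<beta>\<bar>"
        proof -
          have "1 * (Y * \<bar>\<beta>\<bar>) \<le> real q * (1 + Y * \<bar>\<beta>\<bar>)" using q Ypos by (intro mult_mono) auto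
          then show ?thesis by (simp add: W_def)
        qed
        ultimately have qP: "real q \<le> P" and "Y * \<bar>\<beta>\<bar> \<le> P" by auto
        then have b\<eta>: "\<bar>\<beta>\<bar> \<le> \<eta>" using Ypos by (simp add: \<eta>_def field_simps)
        have \<alpha>eq: "\<alpha> = of_int a / real q + \<beta>" by (simp add: \<beta>_def)
        have iq: "4 * \<eta> \<le> 1 / real q"
        proof -
          have "4 * \<eta> * real q \<le> 4 * \<eta> * P" using qP \<eta>0 by (intro mult_left_mono) auto
          then have "4 * \<eta> * real q \<le> 1" using \<eta>P1 by linarith
          then show ?thesis using q by (simp add: field_simps)
        qed
        have "a \<noteq> 0"
        proof
          assume "a = 0"
          then show False using \<alpha>eq b\<eta> \<alpha>W \<eta>0 by auto
        qed
        then have a1: "a \<ge> 1" using a0 by simp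
        have "a \<le> int q"
        proof (rule ccontr)
          assume "\<not> a \<le> int q"
          then have "real_of_int a \<ge> real q + 1" by linarith
          then have "of_int a / real q \<ge> (real q + 1) / real q" by (intro divide_right_mono) auto
          then have "of_int a / real q \<ge> 1 + 1 / real q" using q by (simp add: add_divide_distrib)
          then show False using \<alpha>eq b\<eta> \<alpha>W iq \<eta>0 by auto
        qed
        then have "(q, nat a) \<in> I" using q qP a1 ak(1) by (auto simp: I q(3) le_nat_iff simp flip: coprime_int_iff)
        moreover have "\<alpha> \<in> arc (q, nat a)" unfolding arc_def using b\<eta> a1 \<alpha>eq by auto
        ultimately show False using \<alpha> by (auto simp: Min_def Maj_def)
      qed
      \<comment> \<open>The part -1/4 of the exponent is spent on \<open>P\<close>; the part -2 is
        what the Lorentzian dominates.\<close>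
      have "W powr (-(9/4)) = W powr (-(1/4)) * W powr (-2)" by (simp flip: powr_add)
      also have "\<dots> \<le> P powr (-(1/4)) * (1 / real q ^ 2 * L q (nat a) \<alpha>)"
      proof (intro mult_mono)
        show "W powr (-(1/4)) \<le> P powr (-(1/4))" using WP P by (intro powr_mono2') auto
        have "W powr (-2) = 1 / W ^ 2" using W1 by (simp add: powr_minus_divide)
        also have "\<dots> = 1 / real q ^ 2 * (1 / (1 + Y * \<bar>\<beta>\<bar>)^2)" by (simp add: W_def power_mult_distrib)
        also have "\<dots> \<le> 1 / real q ^ 2 * L q (nat a) \<alpha>"
        proof -
          have "(1 + Y * \<bar>\<beta>\<bar>)^2 \<ge> 1 + (Y * \<bar>\<beta>\<bar>)^2" using Ypos by (simp add: power2_sum)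
          moreover have "(Y * \<bar>\<beta>\<bar>)^2 = (Y * (\<alpha> - real (nat a) / real q))^2" using a0 by (simp add: \<beta>_def power_mult_distrib)
          moreover have "1 + (Y * \<bar>\<beta>\<bar>)^2 > 0" by (simp add: add_pos_nonneg)
          ultimately have "1 / (1 + Y * \<bar>\<beta>\<bar>)^2 \<le> L q (nat a) \<alpha>" unfolding L_def by (simp add: frac_le)
          then show ?thesis by (intro mult_left_mono) auto
        qed
        finally show "W powr (-2) \<le> 1 / real q ^ 2 * L q (nat a) \<alpha>" .
      qed auto
      finally have Wle: "W powr (-(9/4)) \<le> P powr (-(1/4)) * (1 / real q ^ 2 * L q (nat a) \<alpha>)" .
      have "norm (g \<alpha>) = norm (T (of_int a / real q + \<beta>))" by (simp add: g_def norm_mult \<beta>_def)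
      also have "\<dots> \<le> M * W powr (-(9/4))" unfolding W_def using q ak(1) \<beta> by (intro minor) auto
      also have "\<dots> \<le> M * (P powr (-(1/4)) * (1 / real q ^ 2 * L q (nat a) \<alpha>))"
        using Wle M by (rule mult_left_mono)
      also have "\<dots> = M' / real q ^ 2 * L q (nat a) \<alpha>" by (simp add: M'_def)
      also have "\<dots> \<le> (\<Sum>a=0..2*q. M' / real q ^ 2 * L q a \<alpha>)"
        using a0 a2 M'0 L0 by (intro member_le_sum[of "nat a"]) auto
      also have "\<dots> \<le> h \<alpha>" unfolding h_def
        using q M'0 L0 by (intro member_le_sum[of q "{1..D}" "\<lambda>q. \<Sum>a=0..2*q. M' / real q ^ 2 * L q a \<alpha>"] ) (auto intro!: sum_nonneg)
      finally show ?thesis .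
    qed
    have h0: "h \<alpha> \<ge> 0" for \<alpha> unfolding h_def using M'0 L0 by (intro sum_nonneg mult_nonneg_nonneg) auto
    have intL: "set_integrable lborel Wd (L q a)" for q a
      unfolding Wd_def L_def by (rule integral_lorentz_le(1)) (use Ypos in auto)
    have LL: "(LINT \<alpha>:Wd|lborel. L q a \<alpha>) \<le> 4 / Y" for q a
      unfolding Wd_def L_def by (rule integral_lorentz_le(2)) (use Ypos in auto)
    have intcL: "set_integrable lborel Wd (\<lambda>\<alpha>. c * L q a \<alpha>)" for c q a
      using intL by (intro set_integrable_mult_right) auto
    have inth: "set_integrable lborel Wd h"
      unfolding h_def set_integrable_def scaleR_sum_right
      by (intro Bochner_Integration.integrable_sum intcL[unfolded set_integrable_def])
    have "norm (LINT \<alpha>:Min|lborel. g \<alpha>) \<le> (LINT \<alpha>:Wd|lborel. h \<alpha>)"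
      unfolding set_lebesgue_integral_def
    proof (rule integral_norm_bound[THEN order_trans], rule integral_mono)
      show "integrable lborel (\<lambda>x. norm (indicat_real Min x *\<^sub>R g x))"
        by (rule integrable_norm) (use intMin in \<open>simp add: set_integrable_def\<close>)
      show "integrable lborel (\<lambda>x. indicat_real Wd x *\<^sub>R h x)" using inth by (simp add: set_integrable_def)
      show "norm (indicat_real Min x *\<^sub>R g x) \<le> indicat_real Wd x *\<^sub>R h x" for x
        using bnd[of x] h0[of x] by (auto simp: indicator_def Min_def)
    qed
    also have "\<dots> = (\<Sum>q=1..D. (LINT \<alpha>:Wd|lborel. \<Sum>a=0..2*q. M' / real q ^ 2 * L q a \<alpha>))"
      unfolding h_def set_lebesgue_integral_def scaleR_sum_right
      by (intro Bochner_Integration.integral_sum Bochner_Integration.integrable_sum intcL[unfolded set_integrable_def])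
    also have "\<dots> = (\<Sum>q=1..D. \<Sum>a=0..2*q. (LINT \<alpha>:Wd|lborel. M' / real q ^ 2 * L q a \<alpha>))"
      unfolding set_lebesgue_integral_def scaleR_sum_right
      by (intro sum.cong refl Bochner_Integration.integral_sum intcL[unfolded set_integrable_def])
    also have "\<dots> = (\<Sum>q=1..D. \<Sum>a=0..2*q. M' / real q ^ 2 * (LINT \<alpha>:Wd|lborel. L q a \<alpha>))"
      by (simp only: set_integral_mult_right)
    also have "\<dots> \<le> (\<Sum>q=1..D. \<Sum>a=0..2*q. M' / real q ^ 2 * (4 / Y))"
      using M'0 LL by (intro sum_mono mult_left_mono) auto
    also have "\<dots> = (\<Sum>q=1..D. (M' * (4 / Y)) * (real (2 * q + 1) / real q ^ 2))"
      by (simp add: mult_ac)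
    also have "\<dots> \<le> (\<Sum>q=1..D. (M' * (4 / Y)) * (3 * (1 / real q)))"
    proof (intro sum_mono mult_left_mono)
      fix q assume "q \<in> {1..D}"
      then show "real (2 * q + 1) / real q ^ 2 \<le> 3 * (1 / real q)"
        by (simp add: field_simps power2_eq_square)
    qed (use M'0 Ypos in auto)
    also have "\<dots> = M' * (4 / Y) * 3 * (\<Sum>q=1..D. 1 / real q)" by (simp add: sum_distrib_left mult_ac)
    also have "\<dots> \<le> M' * (4 / Y) * 3 * (1 + ln (real D))"
      using M'0 Ypos D by (intro mult_left_mono sum_inverse_le) auto
    finally show ?thesis by (simp add: M'_def mult_ac)
  qed
  have eqI: "(\<Sum>(q, b)\<in>I. S q b * e (- (real b / real q * of_int t)) * J) =
     (\<Sum>q=1..nat \<lfloor>P\<rfloor>. \<Sum>b | 1 \<le> b \<and> b \<le> q \<and> coprime b q. S q b * e (- (real b / real q * of_int t))) * J" for J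
    unfolding I_def sum_distrib_right using finb by (subst sum.Sigma) auto
  have tri: "norm (m + r - j) \<le> x + y" if "norm (m - j) \<le> x" "norm r \<le> y" for m r j :: complex and x y
    using norm_triangle_ineq[of "m - j" r] that by (simp add: algebra_simps)
  show ?thesis
    unfolding total[symmetric] split eqI[symmetric] \<eta>_def[symmetric] by (rule tri[OF MajE MinE])
qed

subsection \<open>Major arcs\<close>

text \<open>Off-diagonal entries may be half-integers and only F_ij + F_ji is integral, so the
  variables are added one at a time and the two mixed terms are paired.\<close>

lemma qform_ivec_Ints:
  fixes F :: "real^'n^'n"
  assumes "integer_form F"
  shows "qform F (ivec z) \<in> \<int>"
proof -
  have "(\<Sum>i\<in>S. \<Sum>j\<in>S. F $ i $ j * ivec z $ i * ivec z $ j) \<in> \<int>" if "finite S" for S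
    using that
  proof (induction S)
    case (insert k S)
    have "(\<Sum>i\<in>insert k S. \<Sum>j\<in>insert k S. F $ i $ j * ivec z $ i * ivec z $ j)
      = F $ k $ k * ivec z $ k * ivec z $ k + (\<Sum>j\<in>S. (F $ j $ k + F $ k $ j) * ivec z $ j * ivec z $ k)
        + (\<Sum>i\<in>S. \<Sum>j\<in>S. F $ i $ j * ivec z $ i * ivec z $ j)"
      using insert.hyps by (simp add: sum.distrib algebra_simps)
    moreover have "(\<Sum>j\<in>S. (F $ j $ k + F $ k $ j) * ivec z $ j * ivec z $ k) \<in> \<int>"
    proof (intro Ints_sum)
      fix j assume "j \<in> S"
      then have "j \<noteq> k" using insert.hyps(2) by blast
      then have "F $ j $ k + F $ k $ j \<in> \<int>" using assms unfolding integer_form_def by blast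
      then show "(F $ j $ k + F $ k $ j) * ivec z $ j * ivec z $ k \<in> \<int>"
        by (intro Ints_mult[OF Ints_mult]) simp_all
    qed
    moreover have "F $ k $ k * ivec z $ k * ivec z $ k \<in> \<int>"
      using assms by (intro Ints_mult) (simp_all add: integer_form_def)
    ultimately show ?case using insert.IH by (simp only: Ints_add)
  qed auto
  then show ?thesis by (simp add: qform_def)
qed

lemma qform_add:
  fixes F :: "real^'n^'n"
  assumes "transpose F = F"
  shows "qform F (x + y) = qform F x + qform F y + 2 * (x \<bullet> (F *v y))"
  using qform_add3[OF assms, of 0 x y] by (simp add: qform_inner)

lemma qform_scaleR: "qform F (c *\<^sub>R x) = c\<^sup>2 * qform F x"
  by (simp add: qform_def sum_distrib_left power2_eq_square mult_ac)

text \<open>f(h + q z) = f(h) + 2 q h.Fz + q^2 f(z), and 2 h.Fz = f(h + z) - f(h) - f(z) is an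
  integer.\<close>

lemma e_qform_cong:
  fixes F :: "real^'n^'n" and x h :: "int^'n"
  assumes F: "integer_form F" and q: "q \<ge> 1" and xh: "\<And>i. x $ i mod int q = h $ i mod int q"
  shows "e (real b / real q * qform F (ivec x)) = e (real b / real q * qform F (ivec h))"
proof -
  have sym: "transpose F = F" using F by (simp add: integer_form_def)
  define z :: "int^'n" where "z = (\<chi> i. (x $ i - h $ i) div int q)"
  have x: "x $ i = h $ i + int q * z $ i" for i
  proof -
    have "int q dvd x $ i - h $ i" using xh[of i] by (simp add: mod_eq_dvd_iff)
    then show ?thesis by (simp add: z_def)
  qed
  have ix: "ivec x = ivec h + real q *\<^sub>R ivec z" by (simp add: vec_eq_iff x)
  have "2 * (ivec h \<bullet> (F *v ivec z)) = qform F (ivec (h + z)) - qform F (ivec h) - qform F (ivec z)"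
    using qform_add[OF sym, of "ivec h" "ivec z"] by (simp add: ivec_add)
  then have "2 * (ivec h \<bullet> (F *v ivec z)) \<in> \<int>"
    by (simp only:) (intro Ints_diff qform_ivec_Ints F)
  moreover have "qform F (ivec z) \<in> \<int>" by (rule qform_ivec_Ints[OF F])
  ultimately have "real b * (real q * qform F (ivec z) + 2 * (ivec h \<bullet> (F *v ivec z))) \<in> \<int>"
    using Ints_mult[OF Ints_of_nat Ints_add[OF Ints_mult[OF Ints_of_nat]]] by blast
  then obtain m where m: "real b * (real q * qform F (ivec z) + 2 * (ivec h \<bullet> (F *v ivec z))) = of_int m"
    by (auto elim: Ints_cases)
  have "real b / real q * qform F (ivec x) = real b / real q * qform F (ivec h) +
      real b * (real q * qform F (ivec z) + 2 * (ivec h \<bullet> (F *v ivec z)))"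
    unfolding ix qform_add[OF sym] using q
    by (simp add: qform_scaleR matrix_vector_mult_scaleR field_simps power2_eq_square)
  then show ?thesis unfolding m by (simp add: e_add)
qed

lemma qform_lipschitz:
  fixes F :: "real^'n^'n"
  assumes "\<And>i. \<bar>u $ i\<bar> \<le> R" "\<And>i. \<bar>v $ i\<bar> \<le> R" "\<And>i. \<bar>u $ i - v $ i\<bar> \<le> d"
  shows "\<bar>qform F u - qform F v\<bar> \<le> 2 * R * d * (\<Sum>i\<in>UNIV. \<Sum>j\<in>UNIV. \<bar>F $ i $ j\<bar>)"
proof -
  have d: "d \<ge> 0" using assms(3) abs_ge_zero order_trans by blast
  have R: "R \<ge> 0" using assms(1) abs_ge_zero order_trans by blast
  have "\<bar>qform F u - qform F v\<bar> = \<bar>\<Sum>i\<in>UNIV. \<Sum>j\<in>UNIV. F $ i $ j * (u $ i * (u $ j - v $ j) + (u $ i - v $ i) * v $ j)\<bar>"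
    by (simp add: qform_def sum_subtractf[symmetric] algebra_simps)
  also have "\<dots> \<le> (\<Sum>i\<in>UNIV. \<Sum>j\<in>UNIV. \<bar>F $ i $ j\<bar> * (2 * R * d))"
  proof (intro order_trans[OF sum_abs] sum_mono order_trans[OF sum_abs])
    fix i j
    have "\<bar>u $ i * (u $ j - v $ j) + (u $ i - v $ i) * v $ j\<bar> \<le> \<bar>u $ i\<bar> * \<bar>u $ j - v $ j\<bar> + \<bar>u $ i - v $ i\<bar> * \<bar>v $ j\<bar>"
      using abs_triangle_ineq[of "u $ i * (u $ j - v $ j)" "(u $ i - v $ i) * v $ j"] by (simp add: abs_mult)
    also have "\<dots> \<le> R * d + d * R" using assms d R by (intro add_mono mult_mono) auto
    finally show "\<bar>F $ i $ j * (u $ i * (u $ j - v $ j) + (u $ i - v $ i) * v $ j)\<bar> \<le> \<bar>F $ i $ j\<bar> * (2 * R * d)"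
      unfolding abs_mult by (intro mult_left_mono) auto
  qed
  also have "\<dots> = 2 * R * d * (\<Sum>i\<in>UNIV. \<Sum>j\<in>UNIV. \<bar>F $ i $ j\<bar>)"
    by (simp add: sum_distrib_left mult_ac)
  finally show ?thesis .
qed

section \<open>Cells of an interval and the discrete side of the major arcs\<close>

definition cell :: "real \<Rightarrow> real \<Rightarrow> nat \<Rightarrow> real set" where
  "cell p \<delta> k = (if k = 0 then {p..p + \<delta>} else {p + real k * \<delta><..p + (real k + 1) * \<delta>})"

text \<open>Cells are open on the left, to match differences of \<open>A\<close>, except cell 0,
  which is closed so that the cells partition a closed interval. Truncated subtraction does the same
  here: ceilings 0 and 1 both give cell 0.\<close>

definition cell_index :: "real \<Rightarrow> real \<Rightarrow> real \<Rightarrow> nat" where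
  "cell_index p \<delta> x = nat \<lceil>(x - p) / \<delta>\<rceil> - 1"

lemma cell_iff:
  assumes "\<delta> > 0" "p \<le> x"
  shows "x \<in> cell p \<delta> k \<longleftrightarrow> cell_index p \<delta> x = k"
proof -
  define z where "z = (x - p) / \<delta>"
  have z: "z \<ge> 0" and x: "x = p + z * \<delta>" using assms by (auto simp: z_def)
  have "x \<in> cell p \<delta> k \<longleftrightarrow> (if k = 0 then z \<le> 1 else real k < z \<and> z \<le> real k + 1)"
    using z assms(1) by (simp add: cell_def x mult_le_cancel_right mult_less_cancel_right)
  also have "\<dots> \<longleftrightarrow> nat \<lceil>z\<rceil> - 1 = k"
    using z by (cases "k = 0") (auto simp: ceiling_le_iff less_ceiling_iff; linarith)+
  finally show ?thesis by (simp add: cell_index_def z_def)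
qed

lemma cell_index_less:
  assumes "\<delta> > 0" "p \<le> x" "x \<le> p + real M * \<delta>" "M \<ge> 1"
  shows "cell_index p \<delta> x < M"
proof -
  have "(x - p) / \<delta> \<le> real M" using assms by (simp add: field_simps)
  then have "\<lceil>(x - p) / \<delta>\<rceil> \<le> int M" by (simp add: ceiling_le_iff)
  then show ?thesis using assms(4) unfolding cell_index_def by linarith
qed

lemma cell_subset: "\<delta> > 0 \<Longrightarrow> cell p \<delta> k \<subseteq> {p + real k * \<delta>..p + (real k + 1) * \<delta>}"
  by (auto simp: cell_def)

lemma cell_subset_box:
  assumes "\<delta> > 0" "k < M"
  shows "cell p \<delta> k \<subseteq> {p..p + real M * \<delta>}"
proof -
  have "(real k + 1) * \<delta> \<le> real M * \<delta>" using assms by (intro mult_right_mono) auto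
  moreover have "0 \<le> real k * \<delta>" using assms by simp
  ultimately show ?thesis using cell_subset[OF assms(1), of p k] by force
qed

text \<open>Scaling all factors by \<open>D\<close> reduces this to the telescoping bound for
  factors of absolute value at most 1.\<close>

lemma prod_diff_bound:
  fixes f g :: "'a \<Rightarrow> real"
  assumes fin: "finite S" and D: "D > 0" and f: "\<And>i. i \<in> S \<Longrightarrow> \<bar>f i\<bar> \<le> D" and g: "\<And>i. i \<in> S \<Longrightarrow> \<bar>g i\<bar> \<le> D"
    and E: "\<And>i. i \<in> S \<Longrightarrow> \<bar>f i - g i\<bar> \<le> E"
  shows "\<bar>(\<Prod>i\<in>S. f i) - (\<Prod>i\<in>S. g i)\<bar> \<le> real (card S) * E * D ^ (card S - 1)"
proof (cases "S = {}")
  case False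
  then have c: "card S > 0" using fin by (simp add: card_gt_0_iff)
  have "norm ((\<Prod>i\<in>S. f i / D) - (\<Prod>i\<in>S. g i / D)) \<le> (\<Sum>i\<in>S. norm (f i / D - g i / D))"
    using D f g by (intro norm_prod_diff) auto
  also have "\<dots> \<le> (\<Sum>i\<in>S. E / D)"
    using E D by (intro sum_mono) (auto simp: diff_divide_distrib[symmetric] intro!: divide_right_mono)
  finally have "\<bar>(\<Prod>i\<in>S. f i / D) - (\<Prod>i\<in>S. g i / D)\<bar> \<le> real (card S) * E / D" by simp
  then have "\<bar>(\<Prod>i\<in>S. f i / D) - (\<Prod>i\<in>S. g i / D)\<bar> * D ^ card S \<le> real (card S) * E / D * D ^ card S"
    using D by (intro mult_right_mono) auto
  moreover have "D ^ card S = D * D ^ (card S - 1)" using c by (metis power_eq_if not_gr_zero)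
  moreover have "\<bar>(\<Prod>i\<in>S. f i / D) - (\<Prod>i\<in>S. g i / D)\<bar> * D ^ card S = \<bar>(\<Prod>i\<in>S. f i) - (\<Prod>i\<in>S. g i)\<bar>"
    using D by (simp add: prod_dividef flip: diff_divide_distrib)
  ultimately have "\<bar>(\<Prod>i\<in>S. f i) - (\<Prod>i\<in>S. g i)\<bar> \<le> real (card S) * E / D * (D * D ^ (card S - 1))"
    by (simp only:)
  then show ?thesis using D by simp
qed simp

text \<open>The box is cut into M^s cells and each cell into q^s residue classes. On such a piece
  the rational part of the phase is constant and the factor with \<beta> is replaced by its value at
  the corner of the cell, which gives the first error term. The mass of a piece is a product over
  the coordinates in which every factor is known up to \<open>E\<close>, which gives the
  second.\<close>

lemma major_arc_discrete:
  fixes F :: "real^'n^'n" and p :: "real^'n" and \<delta> R D E \<beta> :: real and M q b :: nat and a :: "nat \<Rightarrow> real"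
    and \<kappa> :: "nat \<Rightarrow> int \<Rightarrow> real" and \<nu> :: "'n \<Rightarrow> nat \<Rightarrow> real"
  assumes F: "integer_form F" and \<delta>: "\<delta> > 0" and M: "M \<ge> 1" and q: "q \<ge> 1" and D: "D > 0"
    and p: "\<And>i. 0 < p $ i" "\<And>i. p $ i + real M * \<delta> \<le> R"
    and a0: "\<And>n. n \<ge> 1 \<Longrightarrow> 0 \<le> a n"
    and aD: "\<And>i. (\<Sum>n | p $ i \<le> of_int n \<and> of_int n \<le> p $ i + real M * \<delta>. a (nat n)) \<le> D"
    and \<kappa>: "\<And>h. 0 \<le> \<kappa> q h \<and> \<kappa> q h \<le> 1" and \<nu>: "\<And>i k. k < M \<Longrightarrow> 0 \<le> \<nu> i k \<and> \<nu> i k \<le> D"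
    and E: "\<And>i k h. k < M \<Longrightarrow> 0 \<le> h \<Longrightarrow> h < int q \<Longrightarrow>
        \<bar>(\<Sum>n | of_int n \<in> cell (p $ i) \<delta> k \<and> n mod int q = h. a (nat n)) - \<kappa> q h * \<nu> i k\<bar> \<le> E"
  shows "norm ((\<Sum>x\<in>vbox UNIV (\<lambda>i. {n. p $ i \<le> of_int n \<and> of_int n \<le> p $ i + real M * \<delta>}).
         of_real (\<Prod>i\<in>UNIV. a (nat (x $ i))) * e ((real b / real q + \<beta>) * qform F (ivec x)))
      - S_sum F \<kappa> q b * (\<Sum>k\<in>vbox UNIV (\<lambda>_. {..<M}). of_real (\<Prod>i\<in>UNIV. \<nu> i (k $ i)) *
          e (\<beta> * qform F (\<chi> i. p $ i + real (k $ i) * \<delta>))))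
    \<le> 2 * pi * \<bar>\<beta>\<bar> * (2 * R * \<delta> * (\<Sum>i\<in>UNIV. \<Sum>j\<in>UNIV. \<bar>F $ i $ j\<bar>)) * D ^ CARD('n)
      + (real M * real q) ^ CARD('n) * (real CARD('n) * E * D ^ (CARD('n) - 1))"
proof -
  define X where "X = (vbox UNIV (\<lambda>i. {n. p $ i \<le> of_int n \<and> of_int n \<le> p $ i + real M * \<delta>}) :: (int^'n) set)"
  define Kk where "Kk = (vbox UNIV (\<lambda>_. {..<M}) :: (nat^'n) set)"
  define Hh where "Hh = (vbox UNIV (\<lambda>_. {0..<int q}) :: (int^'n) set)"
  define fib where "fib k h = (vbox UNIV (\<lambda>i. {n. of_int n \<in> cell (p $ i) \<delta> (k $ i) \<and> n mod int q = h $ i}) :: (int^'n) set)"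
    for k :: "nat^'n" and h :: "int^'n"
  define w where "w x = complex_of_real (\<Prod>i\<in>UNIV. a (nat (x $ i)))" for x :: "int^'n"
  define G where "G k = e (\<beta> * qform F (\<chi> i. p $ i + real (k $ i) * \<delta>))" for k :: "nat^'n"
  define g where "g h = e (real b / real q * qform F (ivec h))" for h :: "int^'n"
  define m where "m i k h = (\<Sum>n | of_int n \<in> cell (p $ i) \<delta> k \<and> n mod int q = h. a (nat n))" for i k h
  define \<epsilon> where "\<epsilon> = 2 * pi * \<bar>\<beta>\<bar> * (2 * R * \<delta> * (\<Sum>i\<in>UNIV. \<Sum>j\<in>UNIV. \<bar>F $ i $ j\<bar>))"
  have finI: "finite {n::int. x \<le> of_int n \<and> of_int n \<le> y}" for x y :: real
    by (rule finite_subset[of _ "{\<lceil>x\<rceil>..\<lfloor>y\<rfloor>}"]) (auto simp: ceiling_le_iff le_floor_iff)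
  have finX: "finite X" unfolding X_def by (intro finite_vbox finI)
  have finK: "finite Kk" and finH: "finite Hh" unfolding Kk_def Hh_def by auto
  have cellX: "{n. of_int n \<in> cell (p $ i) \<delta> k \<and> n mod int q = h} \<subseteq> {n. p $ i \<le> of_int n \<and> of_int n \<le> p $ i + real M * \<delta>}" if "k < M" for i k h
    using cell_subset_box[OF \<delta> that, of "p $ i"] by auto
  have fincell: "finite {n. of_int n \<in> cell (p $ i) \<delta> k \<and> n mod int q = h}" if "k < M" for i k h
    by (rule finite_subset[OF cellX[OF that] finI])
  have apos: "0 \<le> a (nat n)" if "p $ i \<le> of_int n" for i n
  proof -
    have "real_of_int n > 0" using that p(1)[of i] by linarith
    then show ?thesis by (intro a0) linarith
  qed
  have w0: "0 \<le> (\<Prod>i\<in>UNIV. a (nat (x $ i)))" if "x \<in> X" for x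
    using that apos by (intro prod_nonneg) (auto simp: X_def vbox_def)
  have m0: "0 \<le> m i k h" and mD: "m i k h \<le> D" if "k < M" for i k h
  proof -
    show "0 \<le> m i k h" unfolding m_def using cellX[OF that, of i h] apos by (intro sum_nonneg) blast
    have "m i k h \<le> (\<Sum>n | p $ i \<le> of_int n \<and> of_int n \<le> p $ i + real M * \<delta>. a (nat n))"
      unfolding m_def using apos by (intro sum_mono2 finI cellX[OF that]) auto
    then show "m i k h \<le> D" using aD[of i] by linarith
  qed
  have kM: "k $ i < M" if "k \<in> Kk" for k i using that by (auto simp: Kk_def vbox_def)
  define idx where "idx x = ((\<chi> i. cell_index (p $ i) \<delta> (of_int (x $ i))) :: nat^'n, (\<chi> i. x $ i mod int q) :: int^'n)" for x :: "int^'n"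
  have idx: "idx x \<in> Kk \<times> Hh" if "x \<in> X" for x
    using that q M \<delta> by (auto simp: idx_def X_def Kk_def Hh_def vbox_def intro: cell_index_less)
  have fibeq: "{x \<in> X. idx x = kh} = fib (fst kh) (snd kh)" if kh: "kh \<in> Kk \<times> Hh" for kh
  proof -
    obtain k h where kh': "kh = (k, h)" "k \<in> Kk" "h \<in> Hh" using kh by auto
    have "x \<in> X \<and> idx x = (k, h) \<longleftrightarrow> x \<in> fib k h" for x
    proof
      assume x: "x \<in> X \<and> idx x = (k, h)"
      then have "cell_index (p $ i) \<delta> (of_int (x $ i)) = k $ i" "x $ i mod int q = h $ i" for i
        by (auto simp: idx_def vec_eq_iff)
      then show "x \<in> fib k h" using x cell_iff[OF \<delta>] by (auto simp: fib_def X_def vbox_def)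
    next
      assume x: "x \<in> fib k h"
      then have *: "of_int (x $ i) \<in> cell (p $ i) \<delta> (k $ i)" "x $ i mod int q = h $ i" for i by (auto simp: fib_def vbox_def)
      have **: "p $ i \<le> of_int (x $ i)" "of_int (x $ i) \<le> p $ i + real M * \<delta>" for i
        using subsetD[OF cell_subset_box[OF \<delta> kM[OF kh'(2), of i]] *(1)[of i]] by auto
      show "x \<in> X \<and> idx x = (k, h)"
        using * ** cell_iff[OF \<delta> **(1)] by (auto simp: X_def vbox_def idx_def vec_eq_iff)
    qed
    then show ?thesis by (auto simp: kh'(1))
  qed
  have group: "(\<Sum>x\<in>X. \<phi> x) = (\<Sum>kh\<in>Kk \<times> Hh. \<Sum>x\<in>fib (fst kh) (snd kh). \<phi> x)" for \<phi> :: "int^'n \<Rightarrow> complex"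
  proof -
    have "(\<Sum>x\<in>X. \<phi> x) = (\<Sum>kh\<in>Kk \<times> Hh. \<Sum>x\<in>{x \<in> X. idx x = kh}. \<phi> x)"
      by (rule sum.group[OF finX finite_cartesian_product[OF finK finH], symmetric]) (use idx in blast)
    also have "\<dots> = (\<Sum>kh\<in>Kk \<times> Hh. \<Sum>x\<in>fib (fst kh) (snd kh). \<phi> x)"
      by (rule sum.cong[OF refl]) (simp add: fibeq)
    finally show ?thesis .
  qed
  have fibsum: "(\<Sum>x\<in>fib k h. w x) = of_real (\<Prod>i\<in>UNIV. m i (k $ i) (h $ i))" if "k \<in> Kk" for k h
  proof -
    have "(\<Sum>x\<in>fib k h. \<Prod>i\<in>UNIV. a (nat (x $ i))) = (\<Prod>i\<in>UNIV. m i (k $ i) (h $ i))"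
      unfolding fib_def m_def by (rule sum_vbox_prod) (use fincell kM that in auto)
    then show ?thesis by (simp only: w_def of_real_sum[symmetric])
  qed
  have near: "norm (e ((real b / real q + \<beta>) * qform F (ivec x)) - g h * G k) \<le> \<epsilon>"
    if k: "k \<in> Kk" and x: "x \<in> fib k h" for k h x
  proof -
    have *: "of_int (x $ i) \<in> cell (p $ i) \<delta> (k $ i)" "x $ i mod int q = h $ i" for i using x by (auto simp: fib_def vbox_def)
    have **: "p $ i \<le> of_int (x $ i)" "of_int (x $ i) \<le> p $ i + real M * \<delta>" for i
      using subsetD[OF cell_subset_box[OF \<delta> kM[OF k, of i]] *(1)[of i]] by auto
    have k1: "real (k $ i) * \<delta> \<le> real M * \<delta>" for i using kM[OF k, of i] \<delta> by (intro mult_right_mono) auto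
    have k0: "0 \<le> real (k $ i) * \<delta>" for i using \<delta> by simp
    have "\<bar>qform F (ivec x) - qform F (\<chi> i. p $ i + real (k $ i) * \<delta>)\<bar> \<le> 2 * R * \<delta> * (\<Sum>i\<in>UNIV. \<Sum>j\<in>UNIV. \<bar>F $ i $ j\<bar>)"
    proof (rule qform_lipschitz)
      fix i
      show "\<bar>ivec x $ i\<bar> \<le> R" using **[of i] p[of i] by auto
      show "\<bar>(\<chi> i. p $ i + real (k $ i) * \<delta>) $ i\<bar> \<le> R" using k1[of i] k0[of i] p[of i] by auto
      show "\<bar>ivec x $ i - (\<chi> i. p $ i + real (k $ i) * \<delta>) $ i\<bar> \<le> \<delta>"
        using *(1)[of i] cell_subset[OF \<delta>, of "p $ i" "k $ i"] by (auto simp: algebra_simps)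
    qed
    then have "\<bar>\<beta> * qform F (ivec x) - \<beta> * qform F (\<chi> i. p $ i + real (k $ i) * \<delta>)\<bar> \<le> \<bar>\<beta>\<bar> * (2 * R * \<delta> * (\<Sum>i\<in>UNIV. \<Sum>j\<in>UNIV. \<bar>F $ i $ j\<bar>))"
      unfolding right_diff_distrib[symmetric] abs_mult by (intro mult_left_mono) auto
    then have "norm (e (\<beta> * qform F (ivec x)) - G k) \<le> 2 * pi * (\<bar>\<beta>\<bar> * (2 * R * \<delta> * (\<Sum>i\<in>UNIV. \<Sum>j\<in>UNIV. \<bar>F $ i $ j\<bar>)))"
      unfolding G_def by (intro order_trans[OF e_lipschitz] mult_left_mono) auto
    moreover have "e (real b / real q * qform F (ivec x)) = g h"
      unfolding g_def by (rule e_qform_cong[OF F q]) (metis *(2) mod_mod_trivial)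
    then have "e ((real b / real q + \<beta>) * qform F (ivec x)) - g h * G k = g h * (e (\<beta> * qform F (ivec x)) - G k)"
      by (simp add: distrib_right e_add right_diff_distrib)
    ultimately show ?thesis by (simp add: norm_mult g_def \<epsilon>_def mult.assoc)
  qed
  have \<epsilon>0: "\<epsilon> \<ge> 0"
  proof -
    \<comment> \<open>Types are non-empty, so some coordinate exists; this is all that the
      positivity of \<open>R\<close> requires.\<close>
    obtain i :: 'n where True by simp
    have "R > 0" using p[of i] \<delta> by (smt (verit) mult_nonneg_nonneg of_nat_0_le_iff)
    then show ?thesis using \<delta> by (auto simp: \<epsilon>_def intro!: mult_nonneg_nonneg sum_nonneg)
  qed
  have wnorm: "(\<Sum>x\<in>X. norm (w x)) \<le> D ^ CARD('n)"
  proof -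
    have "(\<Sum>x\<in>X. norm (w x)) = (\<Sum>x\<in>X. \<Prod>i\<in>UNIV. a (nat (x $ i)))"
      using w0 by (intro sum.cong refl) (simp add: w_def del: of_real_prod)
    also have "\<dots> = (\<Prod>i\<in>UNIV. \<Sum>n | p $ i \<le> of_int n \<and> of_int n \<le> p $ i + real M * \<delta>. a (nat n))"
      unfolding X_def by (rule sum_vbox_prod) (rule finI)
    also have "\<dots> \<le> (\<Prod>i\<in>(UNIV::'n set). D)" using aD apos by (intro prod_mono conjI sum_nonneg) auto
    finally show ?thesis by simp
  qed
  define T where "T = (\<Sum>x\<in>X. w x * e ((real b / real q + \<beta>) * qform F (ivec x)))"
  define T1 where "T1 = (\<Sum>kh\<in>Kk \<times> Hh. of_real (\<Prod>i\<in>UNIV. m i (fst kh $ i) (snd kh $ i)) * (g (snd kh) * G (fst kh)))"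
  define T2 where "T2 = (\<Sum>kh\<in>Kk \<times> Hh. of_real (\<Prod>i\<in>UNIV. \<kappa> q (snd kh $ i) * \<nu> i (fst kh $ i)) * (g (snd kh) * G (fst kh)))"
  have 1: "norm (T - T1) \<le> \<epsilon> * D ^ CARD('n)"
  proof -
    have T1: "T1 = (\<Sum>kh\<in>Kk \<times> Hh. \<Sum>x\<in>fib (fst kh) (snd kh). w x * (g (snd kh) * G (fst kh)))"
      unfolding T1_def sum_distrib_right[symmetric] by (intro sum.cong refl) (auto simp: fibsum)
    have "norm (T - T1) = norm (\<Sum>kh\<in>Kk \<times> Hh. \<Sum>x\<in>fib (fst kh) (snd kh). w x * (e ((real b / real q + \<beta>) * qform F (ivec x)) - g (snd kh) * G (fst kh)))"
      unfolding T_def group T1 by (simp add: sum_subtractf right_diff_distrib)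
    also have "\<dots> \<le> (\<Sum>kh\<in>Kk \<times> Hh. \<Sum>x\<in>fib (fst kh) (snd kh). norm (w x) * \<epsilon>)"
      by (intro order_trans[OF norm_sum] sum_mono order_trans[OF norm_sum])
        (auto simp: norm_mult intro!: mult_left_mono near)
    also have "\<dots> = (\<Sum>x\<in>X. norm (w x)) * \<epsilon>"
    proof -
      \<comment> \<open>\<open>group\<close> is stated for complex summands, hence the detour
        through the embedding of the reals.\<close>
      have "complex_of_real (\<Sum>kh\<in>Kk \<times> Hh. \<Sum>x\<in>fib (fst kh) (snd kh). norm (w x) * \<epsilon>) = of_real ((\<Sum>x\<in>X. norm (w x)) * \<epsilon>)"
        using group[of "\<lambda>x. of_real (norm (w x) * \<epsilon>)"] by (simp add: sum_distrib_right)
      then show ?thesis by (simp only: of_real_eq_iff)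
    qed
    also have "\<dots> \<le> D ^ CARD('n) * \<epsilon>" by (intro mult_right_mono wnorm \<epsilon>0)
    finally show ?thesis by (simp add: mult.commute)
  qed
  have 2: "norm (T1 - T2) \<le> (real M * real q) ^ CARD('n) * (real CARD('n) * E * D ^ (CARD('n) - 1))"
  proof -
    have "norm (T1 - T2) = norm (\<Sum>kh\<in>Kk \<times> Hh. of_real ((\<Prod>i\<in>UNIV. m i (fst kh $ i) (snd kh $ i)) - (\<Prod>i\<in>UNIV. \<kappa> q (snd kh $ i) * \<nu> i (fst kh $ i))) * (g (snd kh) * G (fst kh)))"
      unfolding T1_def T2_def by (simp add: sum_subtractf left_diff_distrib)
    also have "\<dots> \<le> (\<Sum>kh\<in>Kk \<times> Hh. real CARD('n) * E * D ^ (CARD('n) - 1))"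
    proof (intro order_trans[OF norm_sum] sum_mono)
      fix kh assume kh: "kh \<in> Kk \<times> Hh"
      have h: "0 \<le> snd kh $ i" "snd kh $ i < int q" for i using kh by (auto simp: Hh_def vbox_def)
      have k: "fst kh $ i < M" for i using kh kM by auto
      have "\<bar>(\<Prod>i\<in>UNIV. m i (fst kh $ i) (snd kh $ i)) - (\<Prod>i\<in>UNIV. \<kappa> q (snd kh $ i) * \<nu> i (fst kh $ i))\<bar> \<le> real CARD('n) * E * D ^ (CARD('n) - 1)"
      proof (rule prod_diff_bound)
        fix i
        show "\<bar>m i (fst kh $ i) (snd kh $ i)\<bar> \<le> D" using m0[OF k] mD[OF k] by (simp add: abs_of_nonneg)
        have "\<kappa> q (snd kh $ i) * \<nu> i (fst kh $ i) \<le> 1 * D" using \<kappa> \<nu>[OF k] by (intro mult_mono) auto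
        then show "\<bar>\<kappa> q (snd kh $ i) * \<nu> i (fst kh $ i)\<bar> \<le> D" using \<kappa> \<nu>[OF k] by (simp add: abs_mult)
        show "\<bar>m i (fst kh $ i) (snd kh $ i) - \<kappa> q (snd kh $ i) * \<nu> i (fst kh $ i)\<bar> \<le> E"
          unfolding m_def by (rule E[OF k h])
      qed (use D in auto)
      then show "norm (of_real ((\<Prod>i\<in>UNIV. m i (fst kh $ i) (snd kh $ i)) - (\<Prod>i\<in>UNIV. \<kappa> q (snd kh $ i) * \<nu> i (fst kh $ i))) * (g (snd kh) * G (fst kh))) \<le> real CARD('n) * E * D ^ (CARD('n) - 1)"
        by (simp only: norm_mult norm_of_real g_def G_def norm_e mult_1_right)
    qed
    also have "\<dots> = real (card Kk * card Hh) * (real CARD('n) * E * D ^ (CARD('n) - 1))"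
      by (simp add: card_cartesian_product)
    also have "card Kk = M ^ CARD('n)"
    proof -
      have "card Kk = (\<Sum>k\<in>Kk. \<Prod>i\<in>(UNIV::'n set). 1)" by simp
      also have "\<dots> = (\<Prod>i\<in>(UNIV::'n set). \<Sum>k<M. 1)" unfolding Kk_def by (rule sum_vbox_prod) auto
      finally show ?thesis by simp
    qed
    also have "card Hh = q ^ CARD('n)"
    proof -
      have "card Hh = (\<Sum>k\<in>Hh. \<Prod>i\<in>(UNIV::'n set). 1)" by simp
      also have "\<dots> = (\<Prod>i\<in>(UNIV::'n set). \<Sum>k\<in>{0..<int q}. 1)" unfolding Hh_def by (rule sum_vbox_prod) auto
      finally show ?thesis by simp
    qed
    finally show ?thesis by (simp add: power_mult_distrib)
  qed
  have T2: "T2 = S_sum F \<kappa> q b * (\<Sum>k\<in>Kk. of_real (\<Prod>i\<in>UNIV. \<nu> i (k $ i)) * G k)"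
  proof -
    have Hh: "Hh = {h. \<forall>i. 0 \<le> h $ i \<and> h $ i < int q}" by (auto simp: Hh_def vbox_def)
    have "S_sum F \<kappa> q b = (\<Sum>h\<in>Hh. of_real (\<Prod>i\<in>UNIV. \<kappa> q (h $ i)) * g h)"
      by (simp add: S_sum_def Hh g_def)
    then have "S_sum F \<kappa> q b * (\<Sum>k\<in>Kk. of_real (\<Prod>i\<in>UNIV. \<nu> i (k $ i)) * G k)
      = (\<Sum>h\<in>Hh. \<Sum>k\<in>Kk. of_real (\<Prod>i\<in>UNIV. \<kappa> q (h $ i)) * g h * (of_real (\<Prod>i\<in>UNIV. \<nu> i (k $ i)) * G k))"
      by (simp only: sum_product)
    also have "\<dots> = (\<Sum>k\<in>Kk. \<Sum>h\<in>Hh. of_real (\<Prod>i\<in>UNIV. \<kappa> q (h $ i)) * g h * (of_real (\<Prod>i\<in>UNIV. \<nu> i (k $ i)) * G k))"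
      by (rule sum.swap)
    also have "\<dots> = T2"
      by (simp add: T2_def sum.cartesian_product case_prod_beta prod.distrib mult_ac)
    finally show ?thesis by simp
  qed
  have "norm (T - T2) \<le> norm (T - T1) + norm (T1 - T2)"
    using norm_triangle_ineq[of "T - T1" "T1 - T2"] by simp
  then have "norm (T - T2) \<le> \<epsilon> * D ^ CARD('n) + (real M * real q) ^ CARD('n) * (real CARD('n) * E * D ^ (CARD('n) - 1))"
    using 1 2 by linarith
  then show ?thesis unfolding T2 unfolding T_def w_def X_def Kk_def G_def \<epsilon>_def .
qed

section \<open>Integrals of products over the coordinates and the continuous side of the major
  arcs\<close>

lemma nn_integral_vec_prod:
  fixes g :: "'n::finite \<Rightarrow> real \<Rightarrow> ennreal"
  assumes [measurable]: "\<And>i. g i \<in> borel_measurable borel"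
  shows "(\<integral>\<^sup>+x. (\<Prod>i\<in>UNIV. g i (x $ i)) \<partial>(lborel :: (real^'n) measure)) = (\<Prod>i\<in>UNIV. \<integral>\<^sup>+y. g i y \<partial>lborel)"
proof -
  have bij: "bij_betw (\<lambda>i. axis i 1) UNIV (Basis :: (real^'n) set)"
    by (auto simp: bij_betw_def inj_on_def axis_eq_axis Basis_vec_def)
  have idx: "axis_index (axis i 1 :: real^'n) = i" for i by (rule axis_index_axis)
  have prod: "(\<Prod>b\<in>(Basis :: (real^'n) set). G b) = (\<Prod>i\<in>UNIV. G (axis i 1))" for G :: "real^'n \<Rightarrow> ennreal"
    by (rule prod.reindex_bij_betw[OF bij, symmetric])
  show ?thesis
    using nn_integral_lborel_prod[of "\<lambda>b::real^'n. g (axis_index b)"] unfolding prod by (simp add: idx inner_axis)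
qed

lemma has_integral_vec_prod:
  fixes h :: "'n::finite \<Rightarrow> real \<Rightarrow> real"
  assumes int: "\<And>i. integrable lborel (h i)" and h0: "\<And>i y. 0 \<le> h i y"
  shows "has_bochner_integral lborel (\<lambda>x::real^'n. \<Prod>i\<in>UNIV. h i (x $ i)) (\<Prod>i\<in>UNIV. integral\<^sup>L lborel (h i))"
proof (rule has_bochner_integral_nn_integral)
  have [measurable]: "h i \<in> borel_measurable borel" for i using int[of i] by auto
  show "(\<lambda>x::real^'n. \<Prod>i\<in>UNIV. h i (x $ i)) \<in> borel_measurable lborel" by measurable
  have "(\<integral>\<^sup>+x. ennreal (\<Prod>i\<in>UNIV. h i (x $ i)) \<partial>(lborel :: (real^'n) measure)) = (\<integral>\<^sup>+x. (\<Prod>i\<in>UNIV. ennreal (h i (x $ i))) \<partial>(lborel :: (real^'n) measure))"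
    by (simp add: prod_ennreal h0)
  also have "\<dots> = (\<Prod>i\<in>UNIV. \<integral>\<^sup>+y. ennreal (h i y) \<partial>lborel)"
    by (rule nn_integral_vec_prod) measurable
  also have "\<dots> = (\<Prod>i\<in>UNIV. ennreal (integral\<^sup>L lborel (h i)))"
    by (intro prod.cong refl nn_integral_eq_integral int) (simp add: h0)
  also have "\<dots> = ennreal (\<Prod>i\<in>UNIV. integral\<^sup>L lborel (h i))"
    by (rule prod_ennreal) (simp add: h0)
  finally show "(\<integral>\<^sup>+x. ennreal (\<Prod>i\<in>UNIV. h i (x $ i)) \<partial>(lborel :: (real^'n) measure)) = ennreal (\<Prod>i\<in>UNIV. integral\<^sup>L lborel (h i))" .
qed (auto intro!: prod_nonneg h0 Bochner_Integration.integral_nonneg)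

lemma set_integral_vec_prod:
  fixes \<phi> :: "'n::finite \<Rightarrow> real \<Rightarrow> real" and S :: "'n \<Rightarrow> real set"
  assumes int: "\<And>i. set_integrable lborel (S i) (\<phi> i)" and p: "\<And>i y. y \<in> S i \<Longrightarrow> 0 \<le> \<phi> i y"
  shows "set_integrable lborel {x::real^'n. \<forall>i. x $ i \<in> S i} (\<lambda>x. \<Prod>i\<in>UNIV. \<phi> i (x $ i))"
    and "(LINT x:{x::real^'n. \<forall>i. x $ i \<in> S i}|lborel. \<Prod>i\<in>UNIV. \<phi> i (x $ i)) = (\<Prod>i\<in>UNIV. LINT y:S i|lborel. \<phi> i y)"
proof -
  define h where "h i y = indicat_real (S i) y *\<^sub>R \<phi> i y" for i y
  have "has_bochner_integral lborel (\<lambda>x::real^'n. \<Prod>i\<in>UNIV. h i (x $ i)) (\<Prod>i\<in>UNIV. integral\<^sup>L lborel (h i))"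
    using int p by (intro has_integral_vec_prod) (auto simp: h_def set_integrable_def indicator_def)
  moreover have "(\<Prod>i\<in>UNIV. h i (x $ i)) = indicat_real {x. \<forall>i. x $ i \<in> S i} x *\<^sub>R (\<Prod>i\<in>UNIV. \<phi> i (x $ i))" for x :: "real^'n"
  proof (cases "\<forall>i. x $ i \<in> S i")
    case False
    then obtain i where "x $ i \<notin> S i" by blast
    then have "(\<Prod>i\<in>UNIV. h i (x $ i)) = 0" by (intro prod_zero bexI[of _ i]) (auto simp: h_def)
    then show ?thesis using False by simp
  qed (simp add: h_def)
  ultimately have *: "has_bochner_integral lborel (\<lambda>x::real^'n. indicat_real {x. \<forall>i. x $ i \<in> S i} x *\<^sub>R (\<Prod>i\<in>UNIV. \<phi> i (x $ i))) (\<Prod>i\<in>UNIV. integral\<^sup>L lborel (h i))"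
    by simp
  show "set_integrable lborel {x::real^'n. \<forall>i. x $ i \<in> S i} (\<lambda>x. \<Prod>i\<in>UNIV. \<phi> i (x $ i))"
    unfolding set_integrable_def using * by (rule integrable.intros)
  show "(LINT x:{x::real^'n. \<forall>i. x $ i \<in> S i}|lborel. \<Prod>i\<in>UNIV. \<phi> i (x $ i)) = (\<Prod>i\<in>UNIV. LINT y:S i|lborel. \<phi> i y)"
    unfolding set_lebesgue_integral_def using has_bochner_integral_integral_eq[OF *] by (simp add: h_def[abs_def])
qed

lemma cbox_eq_Collect: "cbox p r = {x::real^'n. \<forall>i. x $ i \<in> {p $ i..r $ i}}"
  by (auto simp: mem_box_cart)

lemma qform_continuous [continuous_intros]: "continuous_on S g \<Longrightarrow> continuous_on S (\<lambda>x. qform F (g x))"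
  unfolding qform_def by (intro continuous_intros)

text \<open>Uses the same cells and the same corners as \<open>major_arc_discrete\<close>, so that
  the two comparisons meet in one sum over \<open>k\<close>.\<close>

lemma major_arc_integral:
  fixes F :: "real^'n^'n" and p :: "real^'n" and \<delta> R D \<beta> :: real and M :: nat and \<psi> :: "real \<Rightarrow> real"
  assumes \<delta>: "\<delta> > 0" and M: "M \<ge> 1"
    and p: "\<And>i. 0 < p $ i" "\<And>i. p $ i + real M * \<delta> \<le> R"
    and \<psi>: "\<And>i y. p $ i \<le> y \<Longrightarrow> y \<le> p $ i + real M * \<delta> \<Longrightarrow> 0 \<le> \<psi> y"
    and cont: "continuous_on {0<..} \<psi>"
    and D: "\<And>i. (LINT y:{p $ i..p $ i + real M * \<delta>}|lborel. \<psi> y) \<le> D"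
  defines "r \<equiv> (\<chi> i. p $ i + real M * \<delta>)"
  shows "norm ((\<Sum>k\<in>vbox UNIV (\<lambda>_. {..<M}). of_real (\<Prod>i\<in>UNIV. LINT y:cell (p $ i) \<delta> (k $ i)|lborel. \<psi> y) *
          e (\<beta> * qform F (\<chi> i. p $ i + real (k $ i) * \<delta>))) -
       (LINT x:cbox p r|lborel. of_real (\<Prod>i\<in>UNIV. \<psi> (x $ i)) * e (\<beta> * qform F x)))
    \<le> 2 * pi * \<bar>\<beta>\<bar> * (2 * R * \<delta> * (\<Sum>i\<in>UNIV. \<Sum>j\<in>UNIV. \<bar>F $ i $ j\<bar>)) * D ^ CARD('n)"
proof -
  define Kk where "Kk = (vbox UNIV (\<lambda>_. {..<M}) :: (nat^'n) set)"
  define G where "G k = e (\<beta> * qform F (\<chi> i. p $ i + real (k $ i) * \<delta>))" for k :: "nat^'n"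
  define \<epsilon> where "\<epsilon> = 2 * pi * \<bar>\<beta>\<bar> * (2 * R * \<delta> * (\<Sum>i\<in>UNIV. \<Sum>j\<in>UNIV. \<bar>F $ i $ j\<bar>))"
  define C where "C k = {x::real^'n. \<forall>i. x $ i \<in> cell (p $ i) \<delta> (k $ i)}" for k :: "nat^'n"
  define W where "W x = (\<Prod>i\<in>UNIV. \<psi> (x $ i))" for x :: "real^'n"
  define \<nu> where "\<nu> i k = (LINT y:cell (p $ i) \<delta> k|lborel. \<psi> y)" for i k
  have finK: "finite Kk" unfolding Kk_def by auto
  have kM: "k $ i < M" if "k \<in> Kk" for k i using that by (auto simp: Kk_def vbox_def)
  have intp: "set_integrable lborel {p $ i..p $ i + real M * \<delta>} \<psi>" for i
    unfolding set_integrable_def using p(1)[of i]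
    by (intro borel_integrable_compact continuous_on_subset[OF cont]) auto
  have cellm: "cell y \<delta> k \<in> sets lborel" for y k by (simp add: cell_def)
  have intcell: "set_integrable lborel (cell (p $ i) \<delta> k) \<psi>" if "k < M" for i k
    by (rule set_integrable_subset[OF intp cellm cell_subset_box[OF \<delta> that]])
  have pos: "0 < x $ i" if "x \<in> cbox p r" for x i
    using that less_le_trans[OF p(1)[of i], of "x $ i"] by (auto simp: mem_box_cart)
  have contW: "continuous_on (cbox p r) W"
  proof -
    have "continuous_on (cbox p r) (\<lambda>x. \<psi> (x $ i))" for i
      by (rule continuous_on_compose2[OF cont]) (auto intro!: continuous_intros intro: pos)
    then show ?thesis unfolding W_def by (intro continuous_intros) auto
  qed
  have intWe: "set_integrable lborel (cbox p r) (\<lambda>x. of_real (W x) * e (\<beta> * qform F x))"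
    unfolding set_integrable_def
    by (intro borel_integrable_compact continuous_intros contW continuous_e) auto
  have intW: "set_integrable lborel (cbox p r) W"
    unfolding set_integrable_def by (intro borel_integrable_compact contW) auto
  have Cm: "C k \<in> sets lborel" for k
  proof -
    have m: "(\<lambda>x::real^'n. x $ i) \<in> borel_measurable lborel" for i by measurable
    have "C k = (\<Inter>i\<in>UNIV. (\<lambda>x. x $ i) -` cell (p $ i) \<delta> (k $ i) \<inter> space lborel)" by (auto simp: C_def)
    also have "\<dots> \<in> sets lborel"
      by (intro sets.finite_INT measurable_sets[OF m]) (auto simp: cell_def)
    finally show ?thesis .
  qed
  have Csub: "C k \<subseteq> cbox p r" if k: "k \<in> Kk" for k
  proof
    fix x assume x: "x \<in> C k"
    have "x $ i \<in> {p $ i..p $ i + real M * \<delta>}" for i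
      using x cell_subset_box[OF \<delta> kM[OF k, of i], of "p $ i"] by (auto simp: C_def)
    then show "x \<in> cbox p r" by (auto simp: mem_box_cart r_def)
  qed
  have U: "cbox p r = (\<Union>k\<in>Kk. C k)"
  proof (intro equalityI subsetI)
    fix x assume x: "x \<in> cbox p r"
    define k :: "nat^'n" where "k = (\<chi> i. cell_index (p $ i) \<delta> (x $ i))"
    have px: "p $ i \<le> x $ i" "x $ i \<le> p $ i + real M * \<delta>" for i using x by (auto simp: mem_box_cart r_def)
    have "k \<in> Kk" using cell_index_less[OF \<delta> px M] by (auto simp: Kk_def vbox_def k_def)
    moreover have "x \<in> C k" using cell_iff[OF \<delta> px(1)] by (auto simp: C_def k_def)
    ultimately show "x \<in> (\<Union>k\<in>Kk. C k)" by blast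
  qed (use Csub in blast)
  have disj: "disjoint_family_on C Kk"
    unfolding disjoint_family_on_def
  proof (intro ballI impI)
    fix k l assume kl: "k \<in> Kk" "l \<in> Kk" "k \<noteq> l"
    show "C k \<inter> C l = {}"
    proof (rule ccontr)
      assume "C k \<inter> C l \<noteq> {}"
      then obtain x where x: "x \<in> C k" "x \<in> C l" by blast
      have "p $ i \<le> x $ i" for i using Csub[OF kl(1)] x(1) by (auto simp: mem_box_cart)
      then have "x $ i \<in> cell (p $ i) \<delta> m \<longleftrightarrow> cell_index (p $ i) \<delta> (x $ i) = m" for i m
        by (rule cell_iff[OF \<delta>])
      then have "k $ i = l $ i" for i
        using x by (simp add: C_def)
      then show False using kl(3) by (simp add: vec_eq_iff)
    qed
  qed
  have Wk: "(LINT x:C k|lborel. W x) = (\<Prod>i\<in>UNIV. \<nu> i (k $ i))" if k: "k \<in> Kk" for k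
    unfolding C_def W_def \<nu>_def
  proof (rule set_integral_vec_prod(2)[where \<phi> = "\<lambda>_. \<psi>" and S = "\<lambda>i. cell (p $ i) \<delta> (k $ i)"])
    fix i
    show "set_integrable lborel (cell (p $ i) \<delta> (k $ i)) \<psi>" by (rule intcell[OF kM[OF k]])
    fix y assume "y \<in> cell (p $ i) \<delta> (k $ i)"
    then have "y \<in> {p $ i..p $ i + real M * \<delta>}" by (rule subsetD[OF cell_subset_box[OF \<delta> kM[OF k]]])
    then show "0 \<le> \<psi> y" using \<psi>[of i y] by simp
  qed
  have W0: "W x \<ge> 0" if "x \<in> cbox p r" for x
    using that \<psi> unfolding W_def by (intro prod_nonneg) (auto simp: mem_box_cart r_def)
  have near: "norm (G k - e (\<beta> * qform F x)) \<le> \<epsilon>" if k: "k \<in> Kk" and x: "x \<in> C k" for k x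
  proof -
    have *: "x $ i \<in> cell (p $ i) \<delta> (k $ i)" for i using x by (auto simp: C_def)
    have **: "p $ i \<le> x $ i" "x $ i \<le> p $ i + real M * \<delta>" for i
      using subsetD[OF cell_subset_box[OF \<delta> kM[OF k, of i]] *[of i]] by auto
    have k1: "real (k $ i) * \<delta> \<le> real M * \<delta>" for i using kM[OF k, of i] \<delta> by (intro mult_right_mono) auto
    have k0: "0 \<le> real (k $ i) * \<delta>" for i using \<delta> by simp
    have "\<bar>qform F (\<chi> i. p $ i + real (k $ i) * \<delta>) - qform F x\<bar> \<le> 2 * R * \<delta> * (\<Sum>i\<in>UNIV. \<Sum>j\<in>UNIV. \<bar>F $ i $ j\<bar>)"
    proof (rule qform_lipschitz)
      fix i
      show "\<bar>x $ i\<bar> \<le> R" using **[of i] p[of i] by auto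
      show "\<bar>(\<chi> i. p $ i + real (k $ i) * \<delta>) $ i\<bar> \<le> R" using k1[of i] k0[of i] p[of i] by auto
      show "\<bar>(\<chi> i. p $ i + real (k $ i) * \<delta>) $ i - x $ i\<bar> \<le> \<delta>"
        using *[of i] cell_subset[OF \<delta>, of "p $ i" "k $ i"] by (auto simp: algebra_simps)
    qed
    then have "\<bar>\<beta> * qform F (\<chi> i. p $ i + real (k $ i) * \<delta>) - \<beta> * qform F x\<bar> \<le> \<bar>\<beta>\<bar> * (2 * R * \<delta> * (\<Sum>i\<in>UNIV. \<Sum>j\<in>UNIV. \<bar>F $ i $ j\<bar>))"
      unfolding right_diff_distrib[symmetric] abs_mult by (intro mult_left_mono) auto
    then have "norm (G k - e (\<beta> * qform F x)) \<le> 2 * pi * (\<bar>\<beta>\<bar> * (2 * R * \<delta> * (\<Sum>i\<in>UNIV. \<Sum>j\<in>UNIV. \<bar>F $ i $ j\<bar>)))"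
      unfolding G_def by (intro order_trans[OF e_lipschitz] mult_left_mono) auto
    then show ?thesis by (simp add: \<epsilon>_def mult.assoc)
  qed
  have \<epsilon>0: "\<epsilon> \<ge> 0"
  proof -
    obtain i :: 'n where True by simp
    have "real M * \<delta> \<ge> 0" using \<delta> by simp
    then have "R > 0" using p[of i] by linarith
    then show ?thesis using \<delta> by (auto simp: \<epsilon>_def intro!: mult_nonneg_nonneg sum_nonneg)
  qed
  have "(LINT x:cbox p r|lborel. of_real (W x) * e (\<beta> * qform F x)) = (\<Sum>k\<in>Kk. LINT x:C k|lborel. of_real (W x) * e (\<beta> * qform F x))"
    unfolding U using finK disj Cm set_integrable_subset[OF intWe Cm Csub]
    by (intro set_integral_finite_Union) auto
  then have "norm ((\<Sum>k\<in>Kk. of_real (\<Prod>i\<in>UNIV. \<nu> i (k $ i)) * G k) - (LINT x:cbox p r|lborel. of_real (W x) * e (\<beta> * qform F x)))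
    = norm (\<Sum>k\<in>Kk. of_real (\<Prod>i\<in>UNIV. \<nu> i (k $ i)) * G k - (LINT x:C k|lborel. of_real (W x) * e (\<beta> * qform F x)))"
    by (simp add: sum_subtractf)
  also have "\<dots> \<le> (\<Sum>k\<in>Kk. \<epsilon> * (LINT x:C k|lborel. W x))"
  proof (intro order_trans[OF norm_sum] sum_mono)
    fix k assume k: "k \<in> Kk"
    have iW: "set_integrable lborel (C k) W" by (rule set_integrable_subset[OF intW Cm Csub[OF k]])
    have iWe: "set_integrable lborel (C k) (\<lambda>x. of_real (W x) * e (\<beta> * qform F x))" by (rule set_integrable_subset[OF intWe Cm Csub[OF k]])
    have iWc: "set_integrable lborel (C k) (\<lambda>x. complex_of_real (W x))"
      using iW unfolding set_integrable_def by (auto simp: scaleR_conv_of_real simp flip: of_real_mult)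
    have iWG: "set_integrable lborel (C k) (\<lambda>x. of_real (W x) * G k)" using iWc by (intro set_integrable_mult_left) auto
    have "of_real (\<Prod>i\<in>UNIV. \<nu> i (k $ i)) = (LINT x:C k|lborel. complex_of_real (W x))"
      unfolding Wk[OF k, symmetric] by (simp add: set_integral_complex_of_real)
    then have "of_real (\<Prod>i\<in>UNIV. \<nu> i (k $ i)) * G k - (LINT x:C k|lborel. of_real (W x) * e (\<beta> * qform F x))
      = (LINT x:C k|lborel. of_real (W x) * G k - of_real (W x) * e (\<beta> * qform F x))"
      using iWG iWe by (simp add: set_integral_diff)
    also have "norm \<dots> \<le> (LINT x:C k|lborel. \<epsilon> * W x)"
      unfolding set_lebesgue_integral_def
    proof (rule integral_norm_bound[THEN order_trans], rule integral_mono)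
      show "integrable lborel (\<lambda>x. norm (indicat_real (C k) x *\<^sub>R (of_real (W x) * G k - of_real (W x) * e (\<beta> * qform F x))))"
        using set_integral_diff(1)[OF iWG iWe] unfolding set_integrable_def by (rule integrable_norm)
      show "integrable lborel (\<lambda>x. indicat_real (C k) x *\<^sub>R (\<epsilon> * W x))"
        using set_integrable_mult_right[OF iW, of \<epsilon>] iW unfolding set_integrable_def by auto
      fix x
      have "norm (of_real (W x) * G k - of_real (W x) * e (\<beta> * qform F x)) \<le> \<epsilon> * W x" if "x \<in> C k"
      proof -
        have Wx: "W x \<ge> 0" using W0 Csub[OF k] that by blast
        have "norm (of_real (W x) * G k - of_real (W x) * e (\<beta> * qform F x)) = W x * norm (G k - e (\<beta> * qform F x))"
          unfolding right_diff_distrib[symmetric] norm_mult norm_of_real using Wx by simp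
        also have "\<dots> \<le> W x * \<epsilon>" by (intro mult_left_mono near[OF k that] Wx)
        finally show ?thesis by (simp add: mult.commute)
      qed
      then show "norm (indicat_real (C k) x *\<^sub>R (of_real (W x) * G k - of_real (W x) * e (\<beta> * qform F x))) \<le> indicat_real (C k) x *\<^sub>R (\<epsilon> * W x)"
        by (simp add: indicator_def)
    qed
    finally show "norm (of_real (\<Prod>i\<in>UNIV. \<nu> i (k $ i)) * G k - (LINT x:C k|lborel. of_real (W x) * e (\<beta> * qform F x))) \<le> \<epsilon> * (LINT x:C k|lborel. W x)"
      by simp
  qed
  also have "\<dots> = \<epsilon> * (LINT x:cbox p r|lborel. W x)"
    unfolding U sum_distrib_left[symmetric] using finK disj Cm set_integrable_subset[OF intW Cm Csub]
    by (subst set_integral_finite_Union) auto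
  also have "\<dots> \<le> \<epsilon> * D ^ CARD('n)"
  proof (intro mult_left_mono \<epsilon>0)
    have "(LINT x:cbox p r|lborel. W x) = (\<Prod>i\<in>UNIV. LINT y:{p $ i..p $ i + real M * \<delta>}|lborel. \<psi> y)"
      unfolding cbox_eq_Collect W_def r_def vec_lambda_beta
      by (rule set_integral_vec_prod(2)[where \<phi> = "\<lambda>_. \<psi>" and S = "\<lambda>i. {p $ i..p $ i + real M * \<delta>}"])
        (use intp \<psi> in auto)
    also have "\<dots> \<le> (\<Prod>i\<in>(UNIV::'n set). D)"
      using D \<psi> by (intro prod_mono conjI) (auto simp: set_lebesgue_integral_def indicator_def intro!: Bochner_Integration.integral_nonneg)
    finally show "(LINT x:cbox p r|lborel. W x) \<le> D ^ CARD('n)" by simp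
  qed
  finally show ?thesis unfolding \<nu>_def G_def Kk_def \<epsilon>_def W_def .
qed

subsection \<open>Level sets of quadratic forms\<close>

lemma qform_diff:
  fixes F :: "real^'n^'n"
  assumes "transpose F = F"
  shows "qform F v - qform F u = (v - u) \<bullet> (F *v u + F *v v)"
  using inner_symmetric_matrix[OF assms, of u v]
  by (simp add: qform_inner inner_diff_left inner_add_right)

text \<open>
  Near \<open>x0\<close> one coordinate of the gradient is bounded away from zero, so along that axis the form grows at
  a rate of exact order one.  Both bounds compare translates of the level sets along this axis: for the
  upper bound the translates are disjoint, for the lower bound they cover a fixed box.
\<close>

lemma qform_level_measure:
  fixes F :: "real^'n^'n" and x0 :: "real^'n"
  assumes sym: "transpose F = F" and det: "det F \<noteq> 0" and x0: "x0 \<in> pos_orthant" "qform F x0 = 0"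
  obtains \<rho> k1 K1 \<eta> \<epsilon>0 :: real where "\<rho> > 0" "k1 > 0" "K1 > 0" "\<eta> > 0" "\<epsilon>0 > 0" "\<And>i. \<rho> < x0 $ i"
    "\<And>t \<epsilon>. \<epsilon> > 0 \<Longrightarrow> measure lebesgue {u \<in> cbox (\<chi> i. x0 $ i - \<rho>) (\<chi> i. x0 $ i + \<rho>). \<bar>qform F u - t\<bar> \<le> \<epsilon>} \<le> K1 * \<epsilon>"
    "\<And>t \<epsilon>. \<bar>t\<bar> \<le> \<eta> \<Longrightarrow> 0 < \<epsilon> \<Longrightarrow> \<epsilon> \<le> \<epsilon>0 \<Longrightarrow>
       k1 * \<epsilon> \<le> measure lebesgue {u \<in> cbox (\<chi> i. x0 $ i - \<rho>) (\<chi> i. x0 $ i + \<rho>). \<bar>qform F u - t\<bar> \<le> \<epsilon>}"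
proof -
  have xpos: "x0 $ i > 0" for i using x0(1) by (simp add: pos_orthant_def)
  have "x0 \<noteq> 0" using xpos by (metis less_irrefl zero_index)
  then have "F *v x0 \<noteq> 0" using det by (metis invertible_det_nz invertible_left_inverse matrix_left_invertible_ker)
  then obtain j where j: "(F *v x0) $ j \<noteq> 0" by (auto simp: vec_eq_iff)
  define \<sigma> where "\<sigma> = sgn ((F *v x0) $ j)"
  define c where "c = \<bar>(F *v x0) $ j\<bar>"
  have c: "c > 0" using j by (simp add: c_def)
  have \<sigma>c: "\<sigma> * (F *v x0) $ j = c" by (simp add: \<sigma>_def c_def sgn_mult_self_eq[symmetric] abs_sgn mult.commute)
  have \<sigma>1: "\<sigma> * \<sigma> = 1" "\<bar>\<sigma>\<bar> = 1" using j by (auto simp: \<sigma>_def sgn_real_def)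
  define S where "S = (\<Sum>i\<in>UNIV. \<Sum>k\<in>UNIV. \<bar>F $ i $ k\<bar>)"
  have S0: "S \<ge> 0" by (simp add: S_def sum_nonneg)
  define Sp where "Sp = S + 1"
  have Sp: "Sp > 0" "S \<le> Sp" using S0 by (simp_all add: Sp_def)
  define \<mu> where "\<mu> = Min (range (\<lambda>i. x0 $ i))"
  have \<mu>: "\<mu> > 0" "\<And>i. \<mu> \<le> x0 $ i" unfolding \<mu>_def using xpos by (auto simp: Min_gr_iff)
  \<comment> \<open>The first bound keeps the cube inside the open orthant; the second keeps the
    j-th component of F u within c/2 of its value at \<open>x0\<close>. \<open>Sp\<close> replaces
    \<open>S\<close> so that the divisor is positive by construction.\<close>
  define \<rho> where "\<rho> = min (\<mu> / 2) (c / (2 * Sp))"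
  have \<rho>: "\<rho> > 0" using \<mu> c Sp by (simp add: \<rho>_def)
  have \<rho>x: "\<rho> < x0 $ i" for i
  proof -
    have "\<rho> \<le> \<mu> / 2" unfolding \<rho>_def by (rule min.cobounded1)
    then show ?thesis using \<mu>(1) \<mu>(2)[of i] by linarith
  qed
  have S\<rho>: "S * \<rho> \<le> c / 2"
  proof -
    have "S * \<rho> \<le> Sp * (c / (2 * Sp))" using Sp \<rho> by (intro mult_mono) (auto simp: \<rho>_def)
    then show ?thesis using Sp by (simp add: field_simps)
  qed
  define l where "l = (\<chi> i. x0 $ i - \<rho>)"
  define r where "r = (\<chi> i. x0 $ i + \<rho>)"
  have inB: "u \<in> cbox l r \<longleftrightarrow> (\<forall>i. \<bar>u $ i - x0 $ i\<bar> \<le> \<rho>)" for u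
    by (auto simp: mem_box_cart l_def r_def abs_le_iff algebra_simps)
  have grad: "c / 2 \<le> \<sigma> * (F *v u) $ j" "\<sigma> * (F *v u) $ j \<le> 3 * c / 2" if u: "u \<in> cbox l r" for u
  proof -
    have "\<bar>\<sigma> * (F *v u) $ j - c\<bar> = \<bar>(F *v (u - x0)) $ j\<bar>"
      using \<sigma>1 by (simp add: \<sigma>c[symmetric] right_diff_distrib[symmetric] abs_mult matrix_vector_mult_diff_distrib)
    also have "\<dots> \<le> (\<Sum>k\<in>UNIV. \<bar>F $ j $ k * (u - x0) $ k\<bar>)"
      unfolding matrix_vector_mult_def by simp
    also have "\<dots> \<le> (\<Sum>k\<in>UNIV. \<bar>F $ j $ k\<bar> * \<rho>)"
      using u by (intro sum_mono) (auto simp: abs_mult inB intro!: mult_left_mono)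
    also have "\<dots> = (\<Sum>k\<in>UNIV. \<bar>F $ j $ k\<bar>) * \<rho>" by (simp add: sum_distrib_right)
    also have "\<dots> \<le> S * \<rho>" unfolding S_def
      using \<rho> by (intro mult_right_mono member_le_sum[where f = "\<lambda>i. \<Sum>k\<in>UNIV. \<bar>F $ i $ k\<bar>"]) (auto intro: sum_nonneg)
    finally have "\<bar>\<sigma> * (F *v u) $ j - c\<bar> \<le> c / 2" using S\<rho> by linarith
    then show "c / 2 \<le> \<sigma> * (F *v u) $ j" "\<sigma> * (F *v u) $ j \<le> 3 * c / 2" unfolding abs_le_iff by linarith+
  qed
  define d :: "real^'n" where "d = axis j \<sigma>"
  have incr: "c * \<tau> \<le> qform F (u + \<tau> *\<^sub>R d) - qform F u" "qform F (u + \<tau> *\<^sub>R d) - qform F u \<le> 3 * c * \<tau>"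
    if u: "u \<in> cbox l r" "u + \<tau> *\<^sub>R d \<in> cbox l r" and \<tau>: "\<tau> \<ge> 0" for u \<tau>
  proof -
    have "qform F (u + \<tau> *\<^sub>R d) - qform F u = \<tau> * (\<sigma> * (F *v u) $ j + \<sigma> * (F *v (u + \<tau> *\<^sub>R d)) $ j)"
      using qform_diff[OF sym, of "u + \<tau> *\<^sub>R d" u] by (simp add: d_def inner_axis' inner_add_right algebra_simps)
    moreover have "\<tau> * c \<le> \<tau> * (\<sigma> * (F *v u) $ j + \<sigma> * (F *v (u + \<tau> *\<^sub>R d)) $ j)"
      using grad[OF u(1)] grad[OF u(2)] \<tau> by (intro mult_left_mono) linarith+
    moreover have "\<tau> * (\<sigma> * (F *v u) $ j + \<sigma> * (F *v (u + \<tau> *\<^sub>R d)) $ j) \<le> \<tau> * (3 * c)"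
      using grad[OF u(1)] grad[OF u(2)] \<tau> by (intro mult_left_mono) linarith+
    ultimately show "c * \<tau> \<le> qform F (u + \<tau> *\<^sub>R d) - qform F u" "qform F (u + \<tau> *\<^sub>R d) - qform F u \<le> 3 * c * \<tau>"
      by (simp_all add: mult_ac)
  qed
  define E where "E t \<epsilon> = {u \<in> cbox l r. \<bar>qform F u - t\<bar> \<le> \<epsilon>}" for t \<epsilon>
  have Ecomp: "compact (E t \<epsilon>)" for t \<epsilon>
  proof -
    have "closed {u. \<bar>qform F u - t\<bar> \<le> \<epsilon>}" by (intro closed_Collect_le continuous_intros)
    then have "compact (cbox l r \<inter> {u. \<bar>qform F u - t\<bar> \<le> \<epsilon>})" by (intro compact_Int_closed) auto
    then show ?thesis by (simp add: E_def Int_def)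
  qed
  have Etr: "(+) v ` E t \<epsilon> \<in> lmeasurable" for v t \<epsilon>
    using Ecomp compact_translation by (intro lmeasurable_compact) blast
  have dk: "\<bar>d $ k\<bar> \<le> 1" for k using \<sigma>1 by (simp add: d_def axis_def)
  define l2 where "l2 = (\<chi> i. x0 $ i - \<rho> - 1)"
  define r2 where "r2 = (\<chi> i. x0 $ i + \<rho> + 1)"
  define K1 where "K1 = 3 * measure lebesgue (cbox l2 r2) / c + 1"
  have K1: "K1 > 0" unfolding K1_def using c by (intro add_nonneg_pos divide_nonneg_pos) auto
  have upper: "measure lebesgue (E t \<epsilon>) \<le> K1 * \<epsilon>" if \<epsilon>: "\<epsilon> > 0" for t \<epsilon>
  proof -
    \<comment> \<open>A translation by h raises the form by at least c h = 3\<epsilon>, more than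
      the width 2\<epsilon> of the level set; hence the translates are disjoint.\<close>
    define h where "h = 3 * \<epsilon> / c"
    have h: "h > 0" using \<epsilon> c by (simp add: h_def)
    define n where "n = nat \<lfloor>1 / h\<rfloor>"
    have n: "real n * h \<le> 1" "1 / h \<le> real n + 1"
    proof -
      have "real n \<le> 1 / h" unfolding n_def using h by simp
      then show "real n * h \<le> 1" using h by (simp add: field_simps)
      show "1 / h \<le> real n + 1" unfolding n_def using h by (simp add: of_nat_nat)
    qed
    define T where "T k = (+) ((real k * h) *\<^sub>R d) ` E t \<epsilon>" for k
    have disj: "disjoint_family_on T {..n}"
    proof -
      have "T k \<inter> T m = {}" if km: "k < m" for k m
      proof (rule ccontr)
        assume "T k \<inter> T m \<noteq> {}"
        then obtain u v where u: "u \<in> E t \<epsilon>" and v: "v \<in> E t \<epsilon>" and eq: "(real k * h) *\<^sub>R d + u = (real m * h) *\<^sub>R d + v"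
          unfolding T_def by auto
        have ueq: "u = v + ((real m - real k) * h) *\<^sub>R d" using eq by (simp add: algebra_simps)
        have "c * ((real m - real k) * h) \<le> qform F u - qform F v"
          unfolding ueq using u v km h by (intro incr) (auto simp: E_def ueq)
        moreover have "c * (1 * h) \<le> c * ((real m - real k) * h)"
          using km c h by (intro mult_left_mono mult_right_mono) auto
        moreover have "c * (1 * h) = 3 * \<epsilon>" using c by (simp add: h_def)
        moreover have "qform F u - qform F v \<le> 2 * \<epsilon>" using u v by (auto simp: E_def)
        ultimately show False using \<epsilon> by linarith
      qed
      then show ?thesis unfolding disjoint_family_on_def by (metis Int_commute linorder_neqE_nat)
    qed
    have "(\<Union>k\<in>{..n}. T k) \<subseteq> cbox l2 r2"
    proof clarify
      fix k x assume k: "k \<le> n" and "x \<in> T k"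
      then obtain u where u: "u \<in> cbox l r" and x: "x = (real k * h) *\<^sub>R d + u" by (auto simp: T_def E_def)
      have "real k * h \<le> real n * h" using k h by (intro mult_right_mono) auto
      then have kh: "real k * h \<le> 1" "0 \<le> real k * h" using n(1) h by (linarith, simp)
      show "x \<in> cbox l2 r2"
      proof -
        have "\<bar>x $ i - x0 $ i\<bar> \<le> \<rho> + 1" for i
        proof -
          have "\<bar>(real k * h) * d $ i\<bar> \<le> 1 * 1" unfolding abs_mult using kh dk by (intro mult_mono) auto
          moreover have "\<bar>u $ i - x0 $ i\<bar> \<le> \<rho>" using u inB by blast
          ultimately show ?thesis unfolding x by simp
        qed
        then have "x0 $ i - \<rho> - 1 \<le> x $ i \<and> x $ i \<le> x0 $ i + \<rho> + 1" for i by (smt (verit))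
        then show ?thesis by (simp add: mem_box_cart l2_def r2_def)
      qed
    qed
    then have "measure lebesgue (\<Union>k\<in>{..n}. T k) \<le> measure lebesgue (cbox l2 r2)"
      using Etr by (intro measure_mono_fmeasurable) (auto simp: T_def intro!: sets.finite_UN fmeasurableD)
    moreover have "measure lebesgue (\<Union>k\<in>{..n}. T k) = (\<Sum>k\<le>n. measure lebesgue (T k))"
    proof (rule measure_finite_Union)
      have TM: "T k \<in> lmeasurable" for k unfolding T_def by (rule Etr)
      show "T ` {..n} \<subseteq> sets lebesgue" using TM fmeasurableD by blast
      show "emeasure lebesgue (T k) \<noteq> \<infinity>" for k
        using fmeasurableD2[OF TM] by (simp only: infinity_ennreal_def not_False_eq_True)
    qed (use disj in auto)
    moreover have "measure lebesgue (T k) = measure lebesgue (E t \<epsilon>)" for k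
      unfolding T_def by (rule measure_translation)
    ultimately have "(real n + 1) * measure lebesgue (E t \<epsilon>) \<le> measure lebesgue (cbox l2 r2)" by (simp add: algebra_simps)
    moreover have "1 / h * measure lebesgue (E t \<epsilon>) \<le> (real n + 1) * measure lebesgue (E t \<epsilon>)"
      using n by (intro mult_right_mono) auto
    ultimately have "1 / h * measure lebesgue (E t \<epsilon>) \<le> measure lebesgue (cbox l2 r2)" by linarith
    then have "measure lebesgue (E t \<epsilon>) \<le> measure lebesgue (cbox l2 r2) * h" using h by (simp add: field_simps)
    also have "\<dots> \<le> K1 * \<epsilon>" using \<epsilon> by (simp add: K1_def h_def algebra_simps)
    finally show ?thesis .
  qed
  define R where "R = norm x0 + \<rho>"
  have R0: "R > 0" using \<rho> by (simp add: R_def add_nonneg_pos)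
  \<comment> \<open>\<rho>/4 leaves room for translations of length 3\<rho>/4 inside the cube; the
    second bound makes |f| \<le> c\<rho>/8 = \<eta> on the smaller cube.\<close>
  define \<rho>' where "\<rho>' = min (\<rho> / 4) (c * \<rho> / (16 * R * Sp))"
  have \<rho>': "\<rho>' > 0" "\<rho>' \<le> \<rho> / 4" using \<rho> c R0 Sp by (auto simp: \<rho>'_def)
  have S\<rho>': "2 * R * \<rho>' * S \<le> c * \<rho> / 8"
  proof -
    have "2 * R * \<rho>' * S \<le> 2 * R * (c * \<rho> / (16 * R * Sp)) * Sp"
      using R0 S0 Sp \<rho>' \<rho> c by (intro mult_mono) (auto simp: \<rho>'_def)
    then show ?thesis using R0 Sp by (simp add: field_simps)
  qed
  define l0 where "l0 = (\<chi> i. x0 $ i - \<rho>')"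
  define r0 where "r0 = (\<chi> i. x0 $ i + \<rho>')"
  define \<eta> where "\<eta> = c * \<rho> / 8"
  \<comment> \<open>Makes the translation step \<epsilon>/(3c) used below at most \<rho>/4.\<close>
  define \<epsilon>0 where "\<epsilon>0 = 3 * c * \<rho> / 4"
  define k1 where "k1 = measure lebesgue (cbox l0 r0) / (9 * \<rho> * c)"
  have m0: "measure lebesgue (cbox l0 r0) > 0"
  proof -
    have "measure lborel (cbox l0 r0) > 0"
      using \<rho>' by (intro content_pos_lt) (auto simp: Basis_vec_def inner_axis l0_def r0_def)
    then show ?thesis by simp
  qed
  have lower: "k1 * \<epsilon> \<le> measure lebesgue (E t \<epsilon>)" if t: "\<bar>t\<bar> \<le> \<eta>" and \<epsilon>: "0 < \<epsilon>" "\<epsilon> \<le> \<epsilon>0" for t \<epsilon>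
  proof -
    \<comment> \<open>The form grows at rate at most 3c, so between an exact solution on the line
      and the previous multiple of h it changes by at most 3 c h = \<epsilon>.\<close>
    define h where "h = \<epsilon> / (3 * c)"
    have h: "h > 0" "h \<le> \<rho> / 4" using \<epsilon> c by (auto simp: h_def \<epsilon>0_def field_simps)
    define n where "n = nat \<lceil>\<rho> / h\<rceil>"
    define T where "T k = (+) ((- (of_int k * h)) *\<^sub>R d) ` E t \<epsilon>" for k :: int
    have cover: "cbox l0 r0 \<subseteq> (\<Union>k\<in>{-int n..int n}. T k)"
    proof
      fix v assume "v \<in> cbox l0 r0"
      then have v: "\<bar>v $ i - x0 $ i\<bar> \<le> \<rho>'" for i by (auto simp: mem_box_cart l0_def r0_def abs_le_iff algebra_simps)
      have vB: "v + \<tau> *\<^sub>R d \<in> cbox l r" if "\<bar>\<tau>\<bar> \<le> 3 * \<rho> / 4" for \<tau>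
        unfolding inB
      proof
        fix i
        have "\<bar>\<tau> * d $ i\<bar> \<le> 3 * \<rho> / 4 * 1" unfolding abs_mult using that dk \<rho> by (intro mult_mono) auto
        then show "\<bar>(v + \<tau> *\<^sub>R d) $ i - x0 $ i\<bar> \<le> \<rho>" using v[of i] \<rho>' by simp
      qed
      have fv: "\<bar>qform F v\<bar> \<le> \<eta>"
      proof -
        have "\<bar>qform F v - qform F x0\<bar> \<le> 2 * R * \<rho>' * S"
          unfolding S_def
        proof (rule qform_lipschitz)
          fix i
          show "\<bar>v $ i\<bar> \<le> R" "\<bar>x0 $ i\<bar> \<le> R" using v[of i] component_le_norm_cart[of x0 i] \<rho>' \<rho> by (auto simp: R_def)
          show "\<bar>v $ i - x0 $ i\<bar> \<le> \<rho>'" by (rule v)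
        qed
        then show ?thesis using S\<rho>' x0(2) by (simp add: \<eta>_def)
      qed
      define g where "g \<tau> = qform F (v + \<tau> *\<^sub>R d)" for \<tau>
      have gm: "c * (b - a) \<le> g b - g a" "g b - g a \<le> 3 * c * (b - a)"
        if "\<bar>a\<bar> \<le> 3 * \<rho> / 4" "\<bar>b\<bar> \<le> 3 * \<rho> / 4" "a \<le> b" for a b
        using incr[of "v + a *\<^sub>R d" "b - a"] vB[OF that(1)] vB[OF that(2)] that(3) by (auto simp: g_def scaleR_diff_left)
      \<comment> \<open>Moving by \<rho>/2 changes the form by more than 2\<eta>, while its value at
        \<open>v\<close> and the level \<open>t\<close> are at most \<eta> in absolute value; so the
        level \<open>t\<close> is crossed within distance \<rho>/2.\<close>
      have cr: "c * (\<rho> / 2) > 2 * \<eta>" using c \<rho> by (simp add: \<eta>_def)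
      have "g (-(\<rho>/2)) \<le> t" using gm(1)[of "-(\<rho>/2)" 0] fv t cr \<rho> by (auto simp: g_def abs_le_iff)
      moreover have "t \<le> g (\<rho>/2)" using gm(1)[of 0 "\<rho>/2"] fv t cr \<rho> by (auto simp: g_def abs_le_iff)
      moreover have "continuous_on {-(\<rho>/2)..\<rho>/2} g" unfolding g_def by (intro continuous_intros)
      ultimately obtain \<tau> where \<tau>: "-(\<rho>/2) \<le> \<tau>" "\<tau> \<le> \<rho>/2" "g \<tau> = t"
        using IVT'[of g "-(\<rho>/2)" t "\<rho>/2"] \<rho> by auto
      define k where "k = \<lfloor>\<tau> / h\<rfloor>"
      have kh: "of_int k * h \<le> \<tau>" "\<tau> < (of_int k + 1) * h"
      proof -
        have "of_int k \<le> \<tau> / h" "\<tau> / h < of_int k + 1" unfolding k_def by linarith+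
        then show "of_int k * h \<le> \<tau>" "\<tau> < (of_int k + 1) * h" using h by (auto simp: field_simps)
      qed
      have kh2: "\<bar>of_int k * h\<bar> \<le> 3 * \<rho> / 4" using kh \<tau> h by (auto simp: abs_le_iff algebra_simps)
      have "g \<tau> - g (of_int k * h) \<le> 3 * c * (\<tau> - of_int k * h)" "c * (\<tau> - of_int k * h) \<le> g \<tau> - g (of_int k * h)"
        using gm[of "of_int k * h" \<tau>] kh2 \<tau> kh \<rho> by auto
      moreover have "3 * c * (\<tau> - of_int k * h) \<le> 3 * c * h" using kh c by (intro mult_left_mono) (auto simp: algebra_simps)
      moreover have "3 * c * h = \<epsilon>" using c by (simp add: h_def)
      moreover have "0 \<le> c * (\<tau> - of_int k * h)" using c kh by simp
      ultimately have "\<bar>g (of_int k * h) - t\<bar> \<le> \<epsilon>" using \<tau>(3) \<epsilon> by (auto simp: abs_le_iff)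
      then have "v + (of_int k * h) *\<^sub>R d \<in> E t \<epsilon>" using vB[OF kh2] by (auto simp: E_def g_def)
      then have "v \<in> T k" unfolding T_def by (rule rev_image_eqI) simp
      moreover have "k \<in> {-int n..int n}"
      proof -
        have "\<bar>of_int k\<bar> * h \<le> \<rho>" using kh2 h \<rho> by (simp add: abs_mult)
        then have "\<bar>real_of_int k\<bar> \<le> \<rho> / h" using h by (simp add: field_simps)
        then have "real_of_int \<bar>k\<bar> \<le> real n" unfolding n_def by linarith
        then show ?thesis by auto
      qed
      ultimately show "v \<in> (\<Union>k\<in>{-int n..int n}. T k)" by blast
    qed
    have TM: "T k \<in> lmeasurable" for k unfolding T_def by (rule Etr)
    have "measure lebesgue (cbox l0 r0) \<le> measure lebesgue (\<Union>k\<in>{-int n..int n}. T k)"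
      using cover TM by (intro measure_mono_fmeasurable fmeasurable.finite_UN) auto
    also have "\<dots> \<le> (\<Sum>k\<in>{-int n..int n}. measure lebesgue (T k))"
      using TM by (intro measure_UNION_le) (auto simp: fmeasurableD)
    also have "\<dots> = (2 * real n + 1) * measure lebesgue (E t \<epsilon>)"
      unfolding T_def measure_translation by simp
    also have "\<dots> \<le> 3 * (\<rho> / h) * measure lebesgue (E t \<epsilon>)"
    proof (intro mult_right_mono)
      have "real n \<le> \<rho> / h + 1" unfolding n_def using \<rho> h by (simp add: of_nat_nat)
      moreover have "4 \<le> \<rho> / h" using h by (simp add: field_simps)
      ultimately show "2 * real n + 1 \<le> 3 * (\<rho> / h)" by linarith
    qed auto
    also have "\<rho> / h = 3 * \<rho> * c / \<epsilon>" using c by (simp add: h_def)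
    finally have "measure lebesgue (cbox l0 r0) * \<epsilon> \<le> 9 * \<rho> * c * measure lebesgue (E t \<epsilon>)"
      using \<epsilon> by (simp add: field_simps)
    then show ?thesis using \<rho> c by (simp add: k1_def field_simps)
  qed
  show ?thesis
    by (rule that[of \<rho> k1 K1 \<eta> \<epsilon>0])
      (use \<rho> c m0 K1 \<rho>x upper lower in \<open>auto simp: k1_def \<eta>_def \<epsilon>0_def E_def l_def r_def\<close>)
qed

subsection \<open>Decay of oscillatory integrals\<close>

lemma null_sets_cbox_minus_box: "cbox l u - box l u \<in> null_sets (lborel :: 'a::euclidean_space measure)"
proof -
  have "cbox l u - box l u \<in> null_sets lebesgue"
    using negligible_frontier_interval[of l u] by (simp add: negligible_iff_null_sets)
  then show ?thesis by (simp add: null_sets_completion_iff)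
qed

lemma measure_lattice_cell:
  fixes x :: "int^'n"
  assumes "N \<ge> 1"
  defines "Q \<equiv> {y::real^'n. \<forall>i. y $ i \<in> {of_int (x $ i) / real N..<of_int (x $ i + 1) / real N}}"
  shows "integrable lborel (indicat_real Q)" "integral\<^sup>L lborel (indicat_real Q) = 1 / real N ^ CARD('n)" "Q \<in> sets lborel"
proof -
  define S where "S i = {of_int (x $ i) / real N..<of_int (x $ i + 1) / real N}" for i
  have Q: "Q = {y. \<forall>i. y $ i \<in> S i}" by (simp add: Q_def S_def)
  have le: "of_int (x $ i) / real N \<le> of_int (x $ i + 1) / real N" for i by (intro divide_right_mono) auto
  have em: "emeasure lborel (S i) = ennreal (1 / real N)" for i
    unfolding S_def using le[of i] assms(1) by (simp add: diff_divide_distrib[symmetric])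
  have int: "set_integrable lborel (S i) (\<lambda>_. 1::real)" for i
    using em[of i] by (simp add: set_integrable_def S_def[of i])
  have I1: "set_integrable lborel {y::real^'n. \<forall>i. y $ i \<in> S i} (\<lambda>_. \<Prod>i\<in>(UNIV::'n set). 1::real)"
    by (rule set_integral_vec_prod(1)[where \<phi> = "\<lambda>_ _. 1"]) (use int in auto)
  then show "integrable lborel (indicat_real Q)" unfolding Q set_integrable_def by simp
  have m: "(\<lambda>y::real^'n. y $ i) \<in> borel_measurable lborel" for i by measurable
  have "Q = (\<Inter>i\<in>UNIV. (\<lambda>y. y $ i) -` S i \<inter> space lborel)" by (auto simp: Q)
  also have "\<dots> \<in> sets lborel"
    by (intro sets.finite_INT measurable_sets[OF m]) (auto simp: S_def)
  finally show "Q \<in> sets lborel" .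
  have "(LINT y:{y::real^'n. \<forall>i. y $ i \<in> S i}|lborel. \<Prod>i\<in>(UNIV::'n set). 1::real) = (\<Prod>i\<in>(UNIV::'n set). LINT y:S i|lborel. 1)"
    by (rule set_integral_vec_prod(2)[where \<phi> = "\<lambda>_ _. 1"]) (use int in auto)
  also have "\<dots> = (\<Prod>i\<in>(UNIV::'n set). 1 / real N)"
    by (intro prod.cong refl) (simp add: set_lebesgue_integral_def measure_def em)
  finally show "integral\<^sup>L lborel (indicat_real Q) = 1 / real N ^ CARD('n)"
    unfolding Q set_lebesgue_integral_def by (simp add: power_one_over)
qed

lemma finite_int_between [simp, intro]: "finite {n::int. (x::real) \<le> of_int n \<and> of_int n \<le> (y::real)}"
  by (rule finite_subset[of _ "{\<lceil>x\<rceil>..\<lfloor>y\<rfloor>}"]) (auto simp: ceiling_le_iff le_floor_iff)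

text \<open>The Riemann sum is the integral of the step function obtained by rounding the argument
  down to the lattice. It converges pointwise off the boundary of the box, a null set, so dominated
  convergence applies.\<close>

lemma riemann_sum_limit:
  fixes g :: "real^'n \<Rightarrow> complex" and l u :: "real^'n"
  assumes cont: "continuous_on (cbox l u) g"
  shows "(\<lambda>N. (\<Sum>x\<in>vbox UNIV (\<lambda>i. {n. real (Suc N) * l $ i \<le> of_int n \<and> of_int n \<le> real (Suc N) * u $ i}).
      g ((1 / real (Suc N)) *\<^sub>R ivec x)) / real (Suc N) ^ CARD('n)) \<longlonglongrightarrow> (LINT x:cbox l u|lborel. g x)"
proof -
  define G where "G y = indicat_real (cbox l u) y *\<^sub>R g y" for y
  define fl where "fl N y = (\<chi> i. of_int \<lfloor>real (Suc N) * y $ i\<rfloor> / real (Suc N))" for N and y :: "real^'n"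
  define X where "X N = (vbox UNIV (\<lambda>i. {n. real (Suc N) * l $ i \<le> of_int n \<and> of_int n \<le> real (Suc N) * u $ i}) :: (int^'n) set)" for N
  define Q where "Q N x = {y::real^'n. \<forall>i. y $ i \<in> {of_int (x $ i) / real (Suc N)..<of_int (x $ i + 1) / real (Suc N)}}" for N and x :: "int^'n"
  have finX: "finite (X N)" for N unfolding X_def by (intro finite_vbox) auto
  have inX: "x \<in> X N \<longleftrightarrow> (1 / real (Suc N)) *\<^sub>R ivec x \<in> cbox l u" for N x
    by (auto simp: X_def vbox_def mem_box_cart field_simps simp del: of_nat_Suc)
  have inQ: "y \<in> Q N x \<longleftrightarrow> (\<forall>i. \<lfloor>real (Suc N) * y $ i\<rfloor> = x $ i)" for N x y
    by (auto simp: Q_def floor_eq_iff field_simps simp del: of_nat_Suc)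
  have step: "G (fl N y) = (\<Sum>x\<in>X N. indicat_real (Q N x) y *\<^sub>R g ((1 / real (Suc N)) *\<^sub>R ivec x))" for N y
  proof -
    define z where "z = (\<chi> i. \<lfloor>real (Suc N) * y $ i\<rfloor>)"
    have fz: "fl N y = (1 / real (Suc N)) *\<^sub>R ivec z" by (simp add: fl_def z_def vec_eq_iff)
    have "y \<in> Q N x \<longleftrightarrow> x = z" for x by (auto simp: inQ z_def vec_eq_iff)
    then have "(\<Sum>x\<in>X N. indicat_real (Q N x) y *\<^sub>R g ((1 / real (Suc N)) *\<^sub>R ivec x))
       = (\<Sum>x\<in>X N. if x = z then g ((1 / real (Suc N)) *\<^sub>R ivec x) else 0)"
      by (intro sum.cong refl) (auto simp: indicator_def)
    also have "\<dots> = (if z \<in> X N then g ((1 / real (Suc N)) *\<^sub>R ivec z) else 0)" using finX by simp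
    also have "\<dots> = G (fl N y)" by (simp only: G_def fz inX indicator_def) auto
    finally show ?thesis by simp
  qed
  have mc: "integrable lborel (indicat_real (Q N x))" "integral\<^sup>L lborel (indicat_real (Q N x)) = 1 / real (Suc N) ^ CARD('n)" for N x
    using measure_lattice_cell[of "Suc N" x] unfolding Q_def by auto
  have intstep: "integrable lborel (\<lambda>y. G (fl N y))" for N
    unfolding step using mc(1) by (intro Bochner_Integration.integrable_sum) auto
  have eqstep: "(LINT y|lborel. G (fl N y)) = (\<Sum>x\<in>X N. g ((1 / real (Suc N)) *\<^sub>R ivec x)) / real (Suc N) ^ CARD('n)" for N
  proof -
    have "(LINT y|lborel. G (fl N y)) = (\<Sum>x\<in>X N. LINT y|lborel. indicat_real (Q N x) y *\<^sub>R g ((1 / real (Suc N)) *\<^sub>R ivec x))"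
      unfolding step using mc(1) by (intro Bochner_Integration.integral_sum) auto
    also have "\<dots> = (\<Sum>x\<in>X N. (1 / real (Suc N) ^ CARD('n)) *\<^sub>R g ((1 / real (Suc N)) *\<^sub>R ivec x))"
      using mc by (intro sum.cong refl) (subst integral_scaleR_left, auto simp del: of_nat_Suc)
    finally show ?thesis by (simp add: sum_divide_distrib scaleR_conv_of_real del: of_nat_Suc)
  qed
  obtain K where K: "\<And>x. x \<in> cbox l u \<Longrightarrow> norm (g x) \<le> K"
    using compact_imp_bounded[OF compact_continuous_image[OF cont compact_cbox]] by (auto simp: bounded_iff)
  \<comment> \<open>Rounding down moves a coordinate by at most 1, so points whose rounded image
    lies in the box stay below \<open>u'\<close>; this box carries the dominating function.\<close>
  define u' where "u' = (\<chi> i. u $ i + 1)"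
  have lim: "(\<lambda>N. LINT y|lborel. G (fl N y)) \<longlonglongrightarrow> (LINT y|lborel. G y)"
  proof (rule integral_dominated_convergence[where w = "\<lambda>y. \<bar>K\<bar> * indicat_real (cbox l u') y"])
    show "G \<in> borel_measurable lborel"
      using borel_integrable_compact[OF compact_cbox cont] unfolding G_def by auto
    show "(\<lambda>y. G (fl N y)) \<in> borel_measurable lborel" for N using intstep[of N] by auto
    show "integrable lborel (\<lambda>y. \<bar>K\<bar> * indicat_real (cbox l u') y)"
      by (intro integrable_mult_right integrable_real_indicator) (use emeasure_lborel_cbox_finite[of l u'] in auto)
    show "AE y in lborel. norm (G (fl N y)) \<le> \<bar>K\<bar> * indicat_real (cbox l u') y" for N
    proof (rule AE_I2)
      fix y :: "real^'n"
      show "norm (G (fl N y)) \<le> \<bar>K\<bar> * indicat_real (cbox l u') y"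
      proof (cases "fl N y \<in> cbox l u")
        case True
        have "y \<in> cbox l u'"
        proof -
          have "l $ i \<le> y $ i \<and> y $ i \<le> u $ i + 1" for i
          proof -
            have "of_int \<lfloor>real (Suc N) * y $ i\<rfloor> / real (Suc N) \<le> (real (Suc N) * y $ i) / real (Suc N)"
              by (intro divide_right_mono) auto
            moreover have "(real (Suc N) * y $ i) / real (Suc N) \<le> (of_int \<lfloor>real (Suc N) * y $ i\<rfloor> + 1) / real (Suc N)"
              by (intro divide_right_mono) (linarith, simp)
            moreover have "1 / real (Suc N) \<le> 1" by simp
            moreover have "l $ i \<le> of_int \<lfloor>real (Suc N) * y $ i\<rfloor> / real (Suc N)" "of_int \<lfloor>real (Suc N) * y $ i\<rfloor> / real (Suc N) \<le> u $ i"
              using True by (auto simp: mem_box_cart fl_def)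
            moreover have "(real (Suc N) * y $ i) / real (Suc N) = y $ i" by simp
            ultimately show ?thesis unfolding add_divide_distrib by linarith
          qed
          then show ?thesis by (simp add: mem_box_cart u'_def)
        qed
        then show ?thesis using K[OF True] True by (simp add: G_def)
      qed (simp add: G_def)
    qed
    show "AE y in lborel. (\<lambda>N. G (fl N y)) \<longlonglongrightarrow> G y"
    proof -
      have "(\<lambda>N. G (fl N y)) \<longlonglongrightarrow> G y" if y: "y \<notin> cbox l u - box l u" for y
      proof -
        have flim: "(\<lambda>N. fl N y) \<longlonglongrightarrow> y"
        proof (rule vec_tendstoI)
          fix i
          have "(\<lambda>N. of_int \<lfloor>real (Suc N) * y $ i\<rfloor> / real (Suc N)) \<longlonglongrightarrow> y $ i"
          proof (rule tendsto_sandwich[of "\<lambda>N. y $ i - 1 / real (Suc N)" _ _ "\<lambda>N. y $ i"])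
            show "\<forall>\<^sub>F N in sequentially. y $ i - 1 / real (Suc N) \<le> of_int \<lfloor>real (Suc N) * y $ i\<rfloor> / real (Suc N)"
            proof (intro always_eventually allI)
              fix N
              have "(real (Suc N) * y $ i - 1) / real (Suc N) \<le> of_int \<lfloor>real (Suc N) * y $ i\<rfloor> / real (Suc N)"
                by (intro divide_right_mono) (linarith, simp)
              then show "y $ i - 1 / real (Suc N) \<le> of_int \<lfloor>real (Suc N) * y $ i\<rfloor> / real (Suc N)"
                by (simp add: diff_divide_distrib)
            qed
            show "\<forall>\<^sub>F N in sequentially. of_int \<lfloor>real (Suc N) * y $ i\<rfloor> / real (Suc N) \<le> y $ i"
            proof (intro always_eventually allI)
              fix N
              have "of_int \<lfloor>real (Suc N) * y $ i\<rfloor> / real (Suc N) \<le> (real (Suc N) * y $ i) / real (Suc N)"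
                by (intro divide_right_mono) auto
              then show "of_int \<lfloor>real (Suc N) * y $ i\<rfloor> / real (Suc N) \<le> y $ i" by simp
            qed
            have "(\<lambda>N. y $ i - 1 / real (Suc N)) \<longlonglongrightarrow> y $ i - 0"
              by (intro tendsto_diff tendsto_const LIMSEQ_Suc[OF lim_1_over_n])
            then show "(\<lambda>N. y $ i - 1 / real (Suc N)) \<longlonglongrightarrow> y $ i" by simp
          qed simp
          then show "(\<lambda>N. fl N y $ i) \<longlonglongrightarrow> y $ i" by (simp add: fl_def)
        qed
        show ?thesis
        proof (cases "y \<in> cbox l u")
          case True
          then have yb: "y \<in> box l u" using y by blast
          have "isCont g y" using cont yb
            by (metis continuous_on_interior interior_cbox)
          then have "(\<lambda>N. g (fl N y)) \<longlonglongrightarrow> g y" using flim by (rule isCont_tendsto_compose)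
          moreover have "\<forall>\<^sub>F N in sequentially. g (fl N y) = G (fl N y)"
            using topological_tendstoD[OF flim open_box yb]
            by eventually_elim (use box_subset_cbox[of l u] in \<open>auto simp: G_def\<close>)
          moreover have "G y = g y" using True by (simp add: G_def)
          ultimately show ?thesis using Lim_transform_eventually by metis
        next
          case False
          have "open (- cbox l u)" by (intro open_Compl closed_cbox)
          then have "\<forall>\<^sub>F N in sequentially. fl N y \<in> - cbox l u"
            using topological_tendstoD[OF flim] False by blast
          then have "\<forall>\<^sub>F N in sequentially. G (fl N y) = 0" by eventually_elim (simp add: G_def)
          then show ?thesis using False by (simp add: G_def tendsto_eventually)
        qed
      qed
      then show ?thesis using AE_not_in[OF null_sets_cbox_minus_box[of l u]] by (auto elim: eventually_mono)
    qed
  qed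
  show ?thesis using lim[unfolded eqstep] unfolding X_def set_lebesgue_integral_def G_def .
qed

lemma cond_L1_card:
  fixes F :: "real^'n^'n"
  assumes "cond_L1 F"
  shows "CARD('n) \<ge> 10"
proof (rule cond_L1_blocks[OF assms])
  fix I J :: "'n set" assume "card I = 5" "card J = 5" "I \<inter> J = {}"
  then have "card (I \<union> J) = 10" by (simp add: card_Un_disjoint)
  then show ?thesis using card_mono[of UNIV "I \<union> J"] by simp
qed

text \<open>Extension by zero weights brings a sum over a box into the shape to which
  \<open>weyl_estimate\<close> applies.\<close>

lemma sum_vbox_restrict:
  fixes c :: "'n::finite \<Rightarrow> int \<Rightarrow> real" and g :: "int^'n \<Rightarrow> complex"
  assumes S: "\<And>i. S i \<subseteq> {1..int N}"
  shows "(\<Sum>x\<in>vbox UNIV (\<lambda>_. {1..int N}). of_real (\<Prod>i\<in>UNIV. if x $ i \<in> S i then c i (x $ i) else 0) * g x)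
     = (\<Sum>x\<in>vbox UNIV S. of_real (\<Prod>i\<in>UNIV. c i (x $ i)) * g x)"
proof (rule sum.mono_neutral_cong_right)
  show "finite (vbox UNIV (\<lambda>_. {1..int N}) :: (int^'n) set)" by auto
  show "vbox UNIV S \<subseteq> (vbox UNIV (\<lambda>_. {1..int N}) :: (int^'n) set)" using S by (fastforce simp: vbox_def)
  show "\<forall>x\<in>vbox UNIV (\<lambda>_. {1..int N}) - vbox UNIV S. of_real (\<Prod>i\<in>UNIV. if x $ i \<in> S i then c i (x $ i) else 0) * g x = 0"
  proof
    fix x :: "int^'n" assume "x \<in> vbox UNIV (\<lambda>_. {1..int N}) - vbox UNIV S"
    then obtain i where "x $ i \<notin> S i" by (auto simp: vbox_def)
    then have "(\<Prod>i\<in>UNIV. if x $ i \<in> S i then c i (x $ i) else 0) = 0" by (intro prod_zero bexI[of _ i]) auto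
    then show "of_real (\<Prod>i\<in>UNIV. if x $ i \<in> S i then c i (x $ i) else 0) * g x = 0" by (simp only: of_real_0 mult_zero_left)
  qed
qed (auto simp: vbox_def)

text \<open>
  The integral is the limit of Weyl sums at \<open>\<alpha> = \<gamma>/N\<^sup>2\<close>, so that the Weyl bound with \<open>q = 1\<close> gives its decay.
\<close>

lemma fourier_decay:
  fixes F :: "real^'n^'n" and l u :: "real^'n" and \<Lambda> :: nat
  assumes F: "integer_form F" and L1: "cond_L1 F"
    and l: "\<And>i. 0 < l $ i" and u: "\<And>i. u $ i \<le> real \<Lambda>" and \<Lambda>: "\<Lambda> \<ge> 1"
  obtains C :: real where "C \<ge> 0"
    "\<And>\<phi> K \<gamma>. continuous_on {0<..} \<phi> \<Longrightarrow> (\<And>i y. l $ i \<le> y \<Longrightarrow> y \<le> u $ i \<Longrightarrow> 0 \<le> \<phi> y \<and> \<phi> y \<le> K) \<Longrightarrow> K \<ge> 0 \<Longrightarrow>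
      norm (LINT x:cbox l u|lborel. of_real (\<Prod>i\<in>UNIV. \<phi> (x $ i)) * e (\<gamma> * qform F x)) \<le> C * K ^ CARD('n) * (1 + \<bar>\<gamma>\<bar>) powr (-(9/4))"
proof -
  obtain C0 :: real and H :: nat where C0: "C0 \<ge> 0" and H: "H \<ge> 1" and weyl: "weyl_estimate F C0 H"
    using weyl_bound[OF F L1] by blast
  have card: "CARD('n) \<ge> 10" by (rule cond_L1_card[OF L1])
  have main: "norm (LINT x:cbox l u|lborel. of_real (\<Prod>i\<in>UNIV. \<phi> (x $ i)) * e (\<gamma> * qform F x)) \<le> C0 * real \<Lambda> ^ CARD('n) * K ^ CARD('n) * (1 + \<bar>\<gamma>\<bar>) powr (-(9/4))"
    if \<phi>: "continuous_on {0<..} \<phi>" and \<phi>K: "\<And>i y. l $ i \<le> y \<Longrightarrow> y \<le> u $ i \<Longrightarrow> 0 \<le> \<phi> y \<and> \<phi> y \<le> K" and K: "K \<ge> 0"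
    for \<phi> K \<gamma>
  proof -
    define g where "g x = of_real (\<Prod>i\<in>UNIV. \<phi> (x $ i)) * e (\<gamma> * qform F x)" for x :: "real^'n"
    have pos: "0 < x $ i" if "x \<in> cbox l u" for x i
      using that less_le_trans[OF l[of i], of "x $ i"] by (auto simp: mem_box_cart)
    have "continuous_on (cbox l u) (\<lambda>x. \<phi> (x $ i))" for i
      by (rule continuous_on_compose2[OF \<phi>]) (auto intro!: continuous_intros intro: pos)
    then have contg: "continuous_on (cbox l u) g" unfolding g_def by (intro continuous_intros continuous_e)
    have lim: "(\<lambda>N. norm ((\<Sum>x\<in>vbox UNIV (\<lambda>i. {n. real (Suc N) * l $ i \<le> of_int n \<and> of_int n \<le> real (Suc N) * u $ i}).
      g ((1 / real (Suc N)) *\<^sub>R ivec x)) / real (Suc N) ^ CARD('n))) \<longlonglongrightarrow> norm (LINT x:cbox l u|lborel. g x)"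
      by (intro tendsto_norm riemann_sum_limit contg)
    have ev: "\<forall>\<^sub>F N in sequentially. norm ((\<Sum>x\<in>vbox UNIV (\<lambda>i. {n. real (Suc N) * l $ i \<le> of_int n \<and> of_int n \<le> real (Suc N) * u $ i}).
      g ((1 / real (Suc N)) *\<^sub>R ivec x)) / real (Suc N) ^ CARD('n)) \<le> C0 * real \<Lambda> ^ CARD('n) * K ^ CARD('n) * (1 + \<bar>\<gamma>\<bar>) powr (-(9/4))"
      using eventually_ge_at_top[of "nat \<lceil>2 * real H * real \<Lambda> * \<bar>\<gamma>\<bar>\<rceil>"]
    proof eventually_elim
      case (elim N0)
      define N where "N = Suc N0"
      have N: "N \<ge> 1" "real N > 0" by (simp_all add: N_def)
      have N\<gamma>: "2 * real H * real \<Lambda> * \<bar>\<gamma>\<bar> \<le> real N" using elim unfolding N_def by linarith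
      define S where "S i = {n::int. real N * l $ i \<le> of_int n \<and> of_int n \<le> real N * u $ i}" for i
      define b where "b i n = (if n \<in> S i then \<phi> (of_int n / real N) else 0)" for i n
      define M where "M = \<Lambda> * N"
      define \<beta> where "\<beta> = \<gamma> / real N ^ 2"
      have S: "S i \<subseteq> {1..int M}" for i
      proof
        fix n assume "n \<in> S i"
        then have n: "real N * l $ i \<le> of_int n" "of_int n \<le> real N * u $ i" by (auto simp: S_def)
        have "0 < real N * l $ i" using N l by simp
        then have "(0::real) < of_int n" using n by linarith
        moreover have "real N * u $ i \<le> real N * real \<Lambda>" using u N by (intro mult_left_mono) auto
        then have "real_of_int n \<le> of_int (int M)" using n by (simp add: M_def mult.commute)
        ultimately show "n \<in> {1..int M}" by (simp only: of_int_le_iff of_int_0_less_iff) auto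
      qed
      have b: "0 \<le> b i n" "b i n \<le> K" for i n
        using \<phi>K[of i "of_int n / real N"] K N by (auto simp: b_def S_def field_simps)
      have "norm (\<Sum>x\<in>vbox UNIV (\<lambda>_. {1..int M}). of_real (\<Prod>i\<in>UNIV. b i (x $ i)) * e ((of_int 0 / real 1 + \<beta>) * qform F (ivec x)))
        \<le> C0 * (K * real M) ^ (CARD('n) - 10) * (K\<^sup>2 * real M) ^ 5 * real M ^ 5 * (real 1 * (1 + real M ^ 2 * \<bar>\<beta>\<bar>)) powr (-(9/4))"
      proof (rule weyl_estimateD[OF weyl])
        show "1 \<le> M" using N \<Lambda> by (simp add: M_def)
        show "(\<Sum>n\<in>{1..int M}. b i n) \<le> K * real M" for i
          using sum_bounded_above[of "{1..int M}" "b i" K] b by (simp add: mult.commute)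
        have "(b i n)\<^sup>2 \<le> K\<^sup>2" for i n using b by (intro power_mono) auto
        then show "(\<Sum>n\<in>{1..int M}. (b i n)\<^sup>2) \<le> K\<^sup>2 * real M" for i
          using sum_bounded_above[of "{1..int M}" "\<lambda>n. (b i n)\<^sup>2" "K\<^sup>2"] by (simp add: mult.commute)
        have "H * M \<ge> 1" using H N \<Lambda> by (simp add: M_def)
        then show "1 \<le> 2 * H * M" by linarith
        have "\<bar>\<gamma>\<bar> * (2 * real H * real \<Lambda> * real N) \<le> real N * real N"
          using mult_right_mono[OF N\<gamma>, of "real N"] by (simp add: mult_ac)
        then show "\<bar>\<beta>\<bar> \<le> 1 / (2 * real (H * M) * real 1)"
          using N H \<Lambda> by (simp add: \<beta>_def M_def field_simps power2_eq_square)
      qed (use b in auto)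
      also have "(\<Sum>x\<in>vbox UNIV (\<lambda>_. {1..int M}). of_real (\<Prod>i\<in>UNIV. b i (x $ i)) * e ((of_int 0 / real 1 + \<beta>) * qform F (ivec x)))
        = (\<Sum>x\<in>vbox UNIV S. of_real (\<Prod>i\<in>UNIV. \<phi> (of_int (x $ i) / real N)) * e (\<beta> * qform F (ivec x)))"
        unfolding b_def using sum_vbox_restrict[OF S, where c = "\<lambda>i n. \<phi> (of_int n / real N)"] by simp
      also have "\<dots> = (\<Sum>x\<in>vbox UNIV S. g ((1 / real N) *\<^sub>R ivec x))"
        by (simp add: g_def qform_scaleR \<beta>_def power_divide)
      also have "C0 * (K * real M) ^ (CARD('n) - 10) * (K\<^sup>2 * real M) ^ 5 * real M ^ 5 = C0 * (K * real M) ^ CARD('n)"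
      proof -
        have "(K * real M) ^ CARD('n) = (K * real M) ^ (CARD('n) - 10) * (K * real M) ^ 10"
          using card by (simp flip: power_add)
        then show ?thesis by (simp add: power_mult_distrib power_mult[symmetric] power_add[symmetric] mult_ac)
      qed
      also have "real 1 * (1 + real M ^ 2 * \<bar>\<beta>\<bar>) = 1 + real \<Lambda> ^ 2 * \<bar>\<gamma>\<bar>"
        using N by (simp add: M_def \<beta>_def power_mult_distrib)
      finally have le: "norm (\<Sum>x\<in>vbox UNIV S. g ((1 / real N) *\<^sub>R ivec x)) \<le> C0 * (K * real M) ^ CARD('n) * (1 + real \<Lambda> ^ 2 * \<bar>\<gamma>\<bar>) powr (-(9/4))" .
      have "(1 + real \<Lambda> ^ 2 * \<bar>\<gamma>\<bar>) powr (-(9/4)) \<le> (1 + \<bar>\<gamma>\<bar>) powr (-(9/4))"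
      proof (rule powr_mono2')
        have "1 * \<bar>\<gamma>\<bar> \<le> real \<Lambda> ^ 2 * \<bar>\<gamma>\<bar>" using \<Lambda> by (intro mult_right_mono) (auto simp: one_le_power)
        then show "1 + \<bar>\<gamma>\<bar> \<le> 1 + real \<Lambda> ^ 2 * \<bar>\<gamma>\<bar>" by simp
      qed auto
      then have "C0 * (K * real M) ^ CARD('n) * (1 + real \<Lambda> ^ 2 * \<bar>\<gamma>\<bar>) powr (-(9/4)) \<le> C0 * (K * real M) ^ CARD('n) * (1 + \<bar>\<gamma>\<bar>) powr (-(9/4))"
        using C0 K by (intro mult_left_mono) auto
      also have "\<dots> = C0 * real \<Lambda> ^ CARD('n) * K ^ CARD('n) * (1 + \<bar>\<gamma>\<bar>) powr (-(9/4)) * real N ^ CARD('n)"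
        by (simp add: M_def power_mult_distrib)
      finally have "norm (\<Sum>x\<in>vbox UNIV S. g ((1 / real N) *\<^sub>R ivec x)) / real N ^ CARD('n) \<le> C0 * real \<Lambda> ^ CARD('n) * K ^ CARD('n) * (1 + \<bar>\<gamma>\<bar>) powr (-(9/4))"
        using le N by (simp add: divide_le_eq)
      then show ?case unfolding S_def N_def[symmetric] by (simp add: norm_divide norm_power)
    qed
    show ?thesis using tendsto_upperbound[OF lim ev] by (simp add: g_def)
  qed
  have C: "C0 * real \<Lambda> ^ CARD('n) \<ge> 0" using C0 by simp
  show ?thesis
  proof (rule that[OF C])
    fix \<phi> :: "real \<Rightarrow> real" and K \<gamma> :: real
    assume a: "continuous_on {0<..} \<phi>" "\<And>i y. l $ i \<le> y \<Longrightarrow> y \<le> u $ i \<Longrightarrow> 0 \<le> \<phi> y \<and> \<phi> y \<le> K" "K \<ge> 0"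
    show "norm (LINT x:cbox l u|lborel. of_real (\<Prod>i\<in>UNIV. \<phi> (x $ i)) * e (\<gamma> * qform F x)) \<le> C0 * real \<Lambda> ^ CARD('n) * K ^ CARD('n) * (1 + \<bar>\<gamma>\<bar>) powr (-(9/4))"
      by (rule main[OF a])
  qed
qed

subsection \<open>The real density by Fourier inversion\<close>

lemma integrable_lorentz: "integrable lborel (\<lambda>x::real. 1 / (1 + x\<^sup>2))"
  and integral_lorentz: "(LINT x|lborel. 1 / (1 + x\<^sup>2)) = pi"
proof -
  have "einterval (-\<infinity>) \<infinity> = (UNIV :: real set)" by (auto simp: einterval_def)
  then show "integrable lborel (\<lambda>x::real. 1 / (1 + x\<^sup>2))" "(LINT x|lborel. 1 / (1 + x\<^sup>2)) = pi"
    using integrable_inverse_1_plus_square LBINT_inverse_1_plus_square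
    by (simp_all add: set_integrable_def set_lebesgue_integral_def interval_lebesgue_integral_def inverse_eq_divide)
qed

lemma powr_decay_le:
  fixes \<gamma> P :: real
  shows "(1 + \<bar>\<gamma>\<bar>) powr (-(9/4)) \<le> 1 / (1 + \<gamma>\<^sup>2)"
    and "P > 0 \<Longrightarrow> P \<le> \<bar>\<gamma>\<bar> \<Longrightarrow> (1 + \<bar>\<gamma>\<bar>) powr (-(9/4)) \<le> P powr (-(1/4)) * (1 / (1 + \<gamma>\<^sup>2))"
proof -
  have pos: "1 + \<bar>\<gamma>\<bar> > 0" "1 + \<gamma>\<^sup>2 > 0" by (auto simp: add_pos_nonneg)
  have sq: "(1 + \<bar>\<gamma>\<bar>) powr (-2) \<le> 1 / (1 + \<gamma>\<^sup>2)"
  proof -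
    have "(1 + \<bar>\<gamma>\<bar>) powr (-2) = 1 / (1 + \<bar>\<gamma>\<bar>)\<^sup>2" using pos by (simp add: powr_minus_divide)
    also have "\<dots> \<le> 1 / (1 + \<gamma>\<^sup>2)" using pos by (intro divide_left_mono) (auto simp: power2_sum)
    finally show ?thesis .
  qed
  have split: "(1 + \<bar>\<gamma>\<bar>) powr (-(9/4)) = (1 + \<bar>\<gamma>\<bar>) powr (-(1/4)) * (1 + \<bar>\<gamma>\<bar>) powr (-2)"
    unfolding powr_add[symmetric] by simp
  have "(1 + \<bar>\<gamma>\<bar>) powr (-(1/4)) \<le> (1 + \<bar>\<gamma>\<bar>) powr 0" by (intro powr_mono) auto
  then have "(1 + \<bar>\<gamma>\<bar>) powr (-(1/4)) \<le> 1" using pos by simp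
  then show "(1 + \<bar>\<gamma>\<bar>) powr (-(9/4)) \<le> 1 / (1 + \<gamma>\<^sup>2)"
    unfolding split using mult_mono[OF _ sq, of "(1 + \<bar>\<gamma>\<bar>) powr (-(1/4))" 1] by simp
  show "(1 + \<bar>\<gamma>\<bar>) powr (-(9/4)) \<le> P powr (-(1/4)) * (1 / (1 + \<gamma>\<^sup>2))" if "P > 0" "P \<le> \<bar>\<gamma>\<bar>"
    unfolding split using that by (intro mult_mono sq powr_mono2') auto
qed

text \<open>\<open>f\<close> maps the normalised measure with density \<open>w\<close> on
  \<open>B\<close> to a law on the line whose characteristic function at 2 pi \<gamma> is the given
  transform divided by the total mass. The decay makes it integrable, so the symmetric difference
  quotients of the law converge to the inversion integral. Absence of atoms is required by Levy's
  formula at the end points and also removes the difference between closed and half-open intervals.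
  The tail beyond \<open>P\<close> is at most C P^(-1/4) times the integral pi of the Lorentzian,
  and pi < 4.\<close>

lemma real_density_of_decay:
  fixes f w :: "'a::euclidean_space \<Rightarrow> real" and C t0 :: real
  assumes B: "compact B" and f: "continuous_on UNIV f" and w: "continuous_on B w" and w0: "\<And>x. x \<in> B \<Longrightarrow> 0 \<le> w x"
    and Wpos: "(LINT x:B|lborel. w x) > 0"
    and null: "\<And>a. {x \<in> B. f x = a} \<in> null_sets lborel"
    and decay: "\<And>\<gamma>. norm (LINT x:B|lborel. of_real (w x) * e (\<gamma> * f x)) \<le> C * (1 + \<bar>\<gamma>\<bar>) powr (-(9/4))"
  shows "\<exists>d. ((\<lambda>\<epsilon>. integral {x \<in> B. \<bar>f x - t0\<bar> \<le> \<epsilon>} w / (2 * \<epsilon>)) \<longlongrightarrow> d) (at_right 0) \<and>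
    (\<forall>P>0. norm ((LINT \<gamma>:{-P..P}|lborel. (LINT x:B|lborel. of_real (w x) * e (\<gamma> * f x)) * e (- (\<gamma> * t0))) - of_real d) \<le> 4 * C * P powr (-(1/4)))"
proof -
  define W where "W = (LINT x:B|lborel. w x)"
  define I where "I \<gamma> = (LINT x:B|lborel. of_real (w x) * e (\<gamma> * f x))" for \<gamma>
  have Bm [measurable]: "B \<in> sets borel" using B by (rule borel_compact)
  have fm [measurable]: "f \<in> borel_measurable borel" using f by (rule borel_measurable_continuous_onI)
  define v where "v x = indicat_real B x * w x" for x
  have intv: "integrable lborel v" using borel_integrable_compact[OF B w] by (simp add: v_def[abs_def])
  have vm [measurable]: "v \<in> borel_measurable borel" using intv by auto
  have v0: "v x \<ge> 0" for x using w0 by (simp add: v_def indicator_def)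
  have Wv: "W = (LINT x|lborel. v x)" by (simp add: W_def set_lebesgue_integral_def v_def)
  have W: "W > 0" using Wpos by (simp add: W_def)
  define N where "N = density lborel (\<lambda>x. ennreal (v x / W))"
  define M where "M = distr N borel f"
  have emN: "emeasure N S = ennreal ((LINT x:S|lborel. v x) / W)" if [measurable]: "S \<in> sets borel" for S
  proof -
    have "emeasure N S = (\<integral>\<^sup>+x. ennreal (v x / W) * indicator S x \<partial>lborel)"
      unfolding N_def by (rule emeasure_density) auto
    also have "\<dots> = (\<integral>\<^sup>+x. ennreal (indicat_real S x * v x / W) \<partial>lborel)"
      by (intro nn_integral_cong) (auto simp: indicator_def)
    also have "\<dots> = ennreal (LINT x|lborel. indicat_real S x * v x / W)"
    proof (rule nn_integral_eq_integral)
      have "integrable lborel (\<lambda>x. indicat_real S x * v x)"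
        using integrable_mult_indicator[OF _ intv, of S] by simp
      then show "integrable lborel (\<lambda>x. indicat_real S x * v x / W)" by (rule integrable_divide)
    qed (use v0 W in auto)
    finally show ?thesis by (simp add: set_lebesgue_integral_def)
  qed
  have probN: "prob_space N"
  proof
    show "emeasure N (space N) = 1"
      using emN[of UNIV] W by (simp add: N_def Wv[symmetric] set_lebesgue_integral_def)
  qed
  interpret N: prob_space N by (rule probN)
  have fN: "f \<in> measurable N borel" by (simp add: N_def)
  have "prob_space M" unfolding M_def by (rule N.prob_space_distr[OF fN])
  then interpret M: real_distribution M
    by (simp add: real_distribution_def real_distribution_axioms_def M_def)
  have mM: "measure M S = (LINT x:f -` S|lborel. v x) / W" if [measurable]: "S \<in> sets borel" for S
  proof -
    have S': "f -` S \<in> sets borel" using measurable_sets_borel[OF fm that] by simp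
    have "emeasure M S = emeasure N (f -` S \<inter> space N)" unfolding M_def using that fN by (intro emeasure_distr) auto
    also have "\<dots> = ennreal ((LINT x:f -` S|lborel. v x) / W)" using emN[OF S'] by (simp add: N_def)
    finally have "emeasure M S = ennreal ((LINT x:f -` S|lborel. v x) / W)" .
    moreover have "0 \<le> (LINT x:f -` S|lborel. v x) / W"
      using v0 W by (auto simp: set_lebesgue_integral_def intro!: divide_nonneg_pos Bochner_Integration.integral_nonneg)
    ultimately show ?thesis by (simp add: measure_def)
  qed
  have m0: "measure M {a} = 0" for a
  proof -
    have "AE x in lborel. x \<notin> {x \<in> B. f x = a}" by (rule AE_not_in[OF null])
    then have "AE x in lborel. indicat_real (f -` {a}) x *\<^sub>R v x = 0"
      by eventually_elim (auto simp: v_def indicator_def)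
    then have "(LINT x:f -` {a}|lborel. v x) = 0"
      unfolding set_lebesgue_integral_def by (simp add: integral_eq_zero_AE)
    then show ?thesis using mM[of "{a}"] by simp
  qed
  have char: "char M t = I (t / (2 * pi)) / W" for t
  proof -
    have em: "exp (\<i> * (complex_of_real t * complex_of_real (f x))) = e (t * f x / (2 * pi))" for x
      by (simp add: e_def mult_ac)
    have "char M t = (CLINT x|N. iexp (t * f x))"
      unfolding char_def M_def by (rule integral_distr) (use fN in measurable)
    also have "\<dots> = (CLINT x|lborel. (v x / W) *\<^sub>R iexp (t * f x))"
      unfolding N_def using v0 W by (intro integral_density) auto
    also have "\<dots> = (CLINT x|lborel. (indicat_real B x *\<^sub>R (of_real (w x) * e (t / (2 * pi) * f x))) / of_real W)"
      by (intro Bochner_Integration.integral_cong refl) (simp add: v_def em scaleR_conv_of_real)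
    also have "\<dots> = I (t / (2 * pi)) / W" unfolding I_def set_lebesgue_integral_def by simp
    finally show ?thesis .
  qed
  have C0: "C \<ge> 0" using decay[of 0] order_trans[OF norm_ge_zero] by fastforce
  have Idecay: "norm (I \<gamma>) \<le> C * (1 / (1 + \<gamma>\<^sup>2))" for \<gamma>
    unfolding I_def using decay[of \<gamma>] mult_left_mono[OF powr_decay_le(1)[of \<gamma>] C0] by linarith
  have charm [measurable]: "char M \<in> borel_measurable borel"
    by (intro borel_measurable_continuous_onI continuous_at_imp_continuous_on ballI M.isCont_char)
  have Ieq: "I \<gamma> = of_real W * char M (2 * pi * \<gamma>)" for \<gamma> using char[of "2 * pi * \<gamma>"] W by simp
  have Im [measurable]: "I \<in> borel_measurable borel" unfolding Ieq[abs_def] by measurable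
  have intI: "integrable lborel I"
  proof (rule Bochner_Integration.integrable_bound)
    show "integrable lborel (\<lambda>\<gamma>. C * (1 / (1 + \<gamma>\<^sup>2)))" using integrable_lorentz by (intro integrable_mult_right) auto
    show "AE \<gamma> in lborel. norm (I \<gamma>) \<le> norm (C * (1 / (1 + \<gamma>\<^sup>2)))"
    proof (rule AE_I2)
      fix \<gamma> show "norm (I \<gamma>) \<le> norm (C * (1 / (1 + \<gamma>\<^sup>2)))" using Idecay[of \<gamma>] C0 by simp
    qed
  qed auto
  have intchar: "integrable lborel (char M)"
  proof -
    have "integrable lborel (\<lambda>t. I (0 + (1 / (2 * pi)) * t))"
      by (intro lborel_integrable_real_affine intI) auto
    then have "integrable lborel (\<lambda>t. I (t / (2 * pi)) / W)" by (intro integrable_divide) simp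
    then show ?thesis by (simp add: char[abs_def])
  qed
  define Kr where "Kr a b t = (iexp (-(t * a)) - iexp (-(t * b))) / (\<i> * t)" for a b t :: real
  have Krm [measurable]: "Kr a b \<in> borel_measurable borel" for a b unfolding Kr_def by measurable
  have Krb: "norm (Kr a b t) \<le> b - a" if "a \<le> b" for a b t
    using Levy_Inversion_aux2[of "- b" "- a" t] that by (cases "t = 0") (auto simp: Kr_def)
  have intKc: "integrable lborel (\<lambda>t. Kr a b t * char M t)" if "a \<le> b" for a b
  proof (rule Bochner_Integration.integrable_bound)
    show "integrable lborel (\<lambda>t. (b - a) * norm (char M t))" using intchar by auto
    show "AE t in lborel. norm (Kr a b t * char M t) \<le> norm ((b - a) * norm (char M t))"
      using Krb[OF that] that by (intro AE_I2) (simp add: norm_mult mult_right_mono)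
  qed measurable
  have inv: "of_real (measure M {a<..b}) = 1 / (2 * pi) * (LINT t|lborel. Kr a b t * char M t)" if ab: "a \<le> b" for a b
  proof (rule LIMSEQ_unique)
    show "(\<lambda>T::nat. 1 / (2 * pi) * (CLBINT t=-real T..real T. Kr a b t * char M t)) \<longlonglongrightarrow> of_real (measure M {a<..b})"
      unfolding Kr_def using M.Levy_Inversion[OF ab m0 m0] by (simp only: of_int_minus of_int_of_nat_eq)
    have "(\<lambda>T::nat. LINT t|lborel. indicat_real {-real T..real T} t *\<^sub>R (Kr a b t * char M t)) \<longlonglongrightarrow> (LINT t|lborel. Kr a b t * char M t)"
    proof (rule integral_dominated_convergence[where w = "\<lambda>t. norm (Kr a b t * char M t)"])
      show "AE t in lborel. (\<lambda>T::nat. indicat_real {-real T..real T} t *\<^sub>R (Kr a b t * char M t)) \<longlonglongrightarrow> Kr a b t * char M t"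
      proof (rule AE_I2, rule tendsto_eventually)
        fix t :: real
        show "\<forall>\<^sub>F T::nat in sequentially. indicat_real {-real T..real T} t *\<^sub>R (Kr a b t * char M t) = Kr a b t * char M t"
          using eventually_ge_at_top[of "nat \<lceil>\<bar>t\<bar>\<rceil>"]
        proof eventually_elim
          case (elim T)
          then have "\<bar>t\<bar> \<le> real T" by linarith
          then show ?case by (auto simp: indicator_def)
        qed
      qed
      show "integrable lborel (\<lambda>t. norm (Kr a b t * char M t))" using intKc[OF ab] by auto
      show "AE t in lborel. norm (indicat_real {-real T..real T} t *\<^sub>R (Kr a b t * char M t)) \<le> norm (Kr a b t * char M t)" for T :: nat
        by (intro AE_I2) (auto simp: indicator_def)
    qed measurable
    moreover have "(CLBINT t=-real T..real T. Kr a b t * char M t) = (LINT t|lborel. indicat_real {-real T..real T} t *\<^sub>R (Kr a b t * char M t))" for T :: nat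
      using interval_integral_Icc[of "-real T" "real T" "\<lambda>t. Kr a b t * char M t"] by (simp add: set_lebesgue_integral_def)
    ultimately show "(\<lambda>T::nat. 1 / (2 * pi) * (CLBINT t=-real T..real T. Kr a b t * char M t)) \<longlonglongrightarrow> 1 / (2 * pi) * (LINT t|lborel. Kr a b t * char M t)"
      by (intro tendsto_mult tendsto_const) simp
  qed
  define J where "J = (LINT \<gamma>|lborel. I \<gamma> * e (- (\<gamma> * t0)))"
  have em: "(\<lambda>\<gamma>. e (- (\<gamma> * t0))) \<in> borel_measurable borel" unfolding e_def by measurable
  have intIe: "integrable lborel (\<lambda>\<gamma>. I \<gamma> * e (- (\<gamma> * t0)))"
    by (rule Bochner_Integration.integrable_bound[OF intI]) (use em in \<open>auto simp: norm_mult\<close>)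
  have Jchar: "J = of_real W * (1 / (2 * pi) * (LINT t|lborel. iexp (-(t * t0)) * char M t))"
  proof -
    have "(LINT t|lborel. iexp (-(t * t0)) * char M t) = \<bar>2 * pi\<bar> *\<^sub>R (LINT \<gamma>|lborel. iexp (-((0 + 2 * pi * \<gamma>) * t0)) * char M (0 + 2 * pi * \<gamma>))"
      by (rule lborel_integral_real_affine) auto
    also have "(LINT \<gamma>|lborel. iexp (-((0 + 2 * pi * \<gamma>) * t0)) * char M (0 + 2 * pi * \<gamma>)) = (LINT \<gamma>|lborel. (I \<gamma> * e (- (\<gamma> * t0))) / of_real W)"
      using W by (intro Bochner_Integration.integral_cong refl) (simp add: Ieq e_def mult_ac)
    also have "\<dots> = J / of_real W" by (simp add: J_def)
    finally show ?thesis using W by (simp add: scaleR_conv_of_real)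
  qed
  define G where "G \<epsilon> = integral {x \<in> B. \<bar>f x - t0\<bar> \<le> \<epsilon>} w / (2 * \<epsilon>)" for \<epsilon>
  have Gm: "G \<epsilon> = W * measure M {t0 - \<epsilon><..t0 + \<epsilon>} / (2 * \<epsilon>)" if \<epsilon>: "\<epsilon> > 0" for \<epsilon>
  proof -
    define E where "E = {x \<in> B. \<bar>f x - t0\<bar> \<le> \<epsilon>}"
    have E: "E = B \<inter> f -` {t0 - \<epsilon>..t0 + \<epsilon>}" by (auto simp: E_def abs_le_iff)
    have Em: "E \<in> sets borel" unfolding E using measurable_sets_borel[OF fm, of "{t0 - \<epsilon>..t0 + \<epsilon>}"] by auto
    have intE: "set_integrable lborel E w"
      by (rule set_integrable_subset[of _ B]) (use borel_integrable_compact[OF B w] Em in \<open>auto simp: set_integrable_def E\<close>)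
    have "integral E w = (LINT x:E|lborel. w x)" using set_borel_integral_eq_integral(2)[OF intE] by simp
    also have "\<dots> = (LINT x:f -` {t0 - \<epsilon>..t0 + \<epsilon>}|lborel. v x)"
      unfolding set_lebesgue_integral_def by (intro Bochner_Integration.integral_cong refl) (auto simp: E v_def indicator_def)
    also have "\<dots> = W * measure M {t0 - \<epsilon>..t0 + \<epsilon>}" using mM[of "{t0 - \<epsilon>..t0 + \<epsilon>}"] W by simp
    also have "measure M {t0 - \<epsilon>..t0 + \<epsilon>} = measure M {t0 - \<epsilon>} + measure M {t0 - \<epsilon><..t0 + \<epsilon>}"
    proof -
      have "{t0 - \<epsilon>..t0 + \<epsilon>} = {t0 - \<epsilon>} \<union> {t0 - \<epsilon><..t0 + \<epsilon>}" using \<epsilon> by auto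
      then show ?thesis by (simp only:) (intro M.finite_measure_Union, auto)
    qed
    finally show ?thesis by (simp add: G_def E_def m0)
  qed
  have lim: "((\<lambda>\<epsilon>. of_real (G \<epsilon>)) \<longlongrightarrow> J) (at_right 0)"
    \<comment> \<open>Dominated convergence is applied along sequences, so the one-sided limit is
      tested on arbitrary positive null sequences.\<close>
    unfolding tendsto_at_iff_sequentially
  proof (intro allI impI)
    fix X :: "nat \<Rightarrow> real"
    assume X: "\<forall>i. X i \<in> {0<..} - {0}" and Xlim: "X \<longlonglongrightarrow> 0"
    have Xpos: "X i > 0" for i using X by auto
    have eq: "complex_of_real (G (X i)) = of_real W * (1 / (2 * pi) * (LINT t|lborel. (Kr (t0 - X i) (t0 + X i) t / of_real (2 * X i)) * char M t))" for i
    proof -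
      have "complex_of_real (measure M {t0 - X i<..t0 + X i}) / of_real (2 * X i) = 1 / (2 * pi) * ((LINT t|lborel. Kr (t0 - X i) (t0 + X i) t * char M t) / of_real (2 * X i))"
        using inv[of "t0 - X i" "t0 + X i"] Xpos[of i] by simp
      also have "(LINT t|lborel. Kr (t0 - X i) (t0 + X i) t * char M t) / of_real (2 * X i) = (LINT t|lborel. (Kr (t0 - X i) (t0 + X i) t * char M t) / of_real (2 * X i))"
        by simp
      finally have *: "complex_of_real (measure M {t0 - X i<..t0 + X i}) / of_real (2 * X i)
        = 1 / (2 * pi) * (LINT t|lborel. (Kr (t0 - X i) (t0 + X i) t * char M t) / of_real (2 * X i))" .
      have "complex_of_real (G (X i)) = of_real W * (complex_of_real (measure M {t0 - X i<..t0 + X i}) / of_real (2 * X i))"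
        using Gm[OF Xpos[of i]] by simp
      also have "\<dots> = of_real W * (1 / (2 * pi) * (LINT t|lborel. (Kr (t0 - X i) (t0 + X i) t * char M t) / of_real (2 * X i)))"
        by (simp only: *)
      finally show ?thesis by (simp only: times_divide_eq_left)
    qed
    have "(\<lambda>i. LINT t|lborel. (Kr (t0 - X i) (t0 + X i) t / of_real (2 * X i)) * char M t) \<longlonglongrightarrow> (LINT t|lborel. iexp (-(t * t0)) * char M t)"
    proof (rule integral_dominated_convergence[where w = "\<lambda>t. norm (char M t)"])
      show "integrable lborel (\<lambda>t. norm (char M t))" using intchar by auto
      show "AE t in lborel. norm ((Kr (t0 - X i) (t0 + X i) t / of_real (2 * X i)) * char M t) \<le> norm (char M t)" for i
      proof (rule AE_I2)
        fix t
        have "norm (Kr (t0 - X i) (t0 + X i) t) \<le> 2 * X i" using Krb[of "t0 - X i" "t0 + X i" t] Xpos[of i] by simp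
        then have "norm (Kr (t0 - X i) (t0 + X i) t / of_real (2 * X i)) \<le> 1" using Xpos[of i] by (simp add: norm_divide)
        then show "norm ((Kr (t0 - X i) (t0 + X i) t / of_real (2 * X i)) * char M t) \<le> norm (char M t)"
          unfolding norm_mult by (rule mult_left_le_one_le[rotated 2]) auto
      qed
      show "AE t in lborel. (\<lambda>i. (Kr (t0 - X i) (t0 + X i) t / of_real (2 * X i)) * char M t) \<longlonglongrightarrow> iexp (-(t * t0)) * char M t"
        using AE_lborel_singleton[of 0]
      proof eventually_elim
        case (elim t)
        \<comment> \<open>Up to the factor \<open>iexp (-(t * t0))\<close> and division by i t, the
          kernel is the average of the forward and backward difference quotients of \<open>h\<close>
          at 0. The point t = 0, where this formula breaks down, is a null set.\<close>
        define h where "h z = exp (\<i> * (of_real t * z))" for z :: complex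
        have "(h has_field_derivative (\<i> * t)) (at 0)"
          unfolding h_def by (auto intro!: derivative_eq_intros)
        then have d1: "((\<lambda>z. (h z - 1) / z) \<longlongrightarrow> \<i> * t) (at 0)"
          by (simp add: DERIV_def h_def)
        have Xat: "filterlim (\<lambda>i. complex_of_real (X i)) (at 0) sequentially"
          using tendsto_of_real[OF Xlim, where 'a = complex] Xpos by (auto simp: filterlim_at less_imp_neq[symmetric])
        have Xat': "filterlim (\<lambda>i. - complex_of_real (X i)) (at 0) sequentially"
          using tendsto_minus[OF tendsto_of_real[OF Xlim, where 'a = complex]] Xpos by (auto simp: filterlim_at less_imp_neq[symmetric])
        have lim0: "(\<lambda>i. (h (X i) - 1) / X i + (h (- X i) - 1) / (- X i)) \<longlonglongrightarrow> \<i> * t + \<i> * t"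
          using tendsto_add[OF filterlim_compose[OF d1 Xat] filterlim_compose[OF d1 Xat']] by simp
        have "(\<lambda>i. iexp (-(t * t0)) * ((h (X i) - 1) / X i + (h (- X i) - 1) / (- X i)) / (2 * \<i> * t) * char M t)
          \<longlonglongrightarrow> iexp (-(t * t0)) * (\<i> * t + \<i> * t) / (2 * \<i> * t) * char M t"
          using elim by (intro tendsto_mult[OF tendsto_divide[OF tendsto_mult[OF tendsto_const lim0] tendsto_const] tendsto_const]) auto
        moreover have "iexp (-(t * t0)) * ((h (X i) - 1) / X i + (h (- X i) - 1) / (- X i)) / (2 * \<i> * t) = Kr (t0 - X i) (t0 + X i) t / of_real (2 * X i)" for i
        proof -
          have "iexp (-(t * (t0 - X i))) = iexp (-(t * t0)) * h (X i)" "iexp (-(t * (t0 + X i))) = iexp (-(t * t0)) * h (- X i)"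
            by (simp_all add: h_def exp_add[symmetric] algebra_simps)
          then show ?thesis using elim Xpos[of i] by (simp add: Kr_def field_simps)
        qed
        moreover have "iexp (-(t * t0)) * (\<i> * t + \<i> * t) / (2 * \<i> * t) = iexp (-(t * t0))" using elim by (simp add: field_simps)
        ultimately show ?case by (simp only:)
      qed
    qed measurable
    then have "(\<lambda>i. complex_of_real (G (X i))) \<longlonglongrightarrow> J"
      unfolding eq Jchar by (intro tendsto_mult tendsto_const)
    then show "((\<lambda>\<epsilon>. complex_of_real (G \<epsilon>)) \<circ> X) \<longlonglongrightarrow> J" by (simp add: o_def)
  qed
  \<comment> \<open>As a limit of real quotients, \<open>J\<close> equals its real part.\<close>
  define d where "d = Re J"
  have Glim: "(G \<longlongrightarrow> d) (at_right 0)" using tendsto_Re[OF lim] by (simp add: d_def)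
  have "((\<lambda>\<epsilon>. complex_of_real (G \<epsilon>)) \<longlongrightarrow> of_real d) (at_right 0)" by (intro tendsto_of_real Glim)
  then have Jd: "J = of_real d" using lim by (intro tendsto_unique[of "at_right (0::real)"]) auto
  have "norm ((LINT \<gamma>:{-P..P}|lborel. I \<gamma> * e (- (\<gamma> * t0))) - of_real d) \<le> 4 * C * P powr (-(1/4))" if P: "P > 0" for P
  proof -
    have intP: "set_integrable lborel {-P..P} (\<lambda>\<gamma>. I \<gamma> * e (- (\<gamma> * t0)))"
      unfolding set_integrable_def using intIe by (intro integrable_mult_indicator) auto
    have "J - (LINT \<gamma>:{-P..P}|lborel. I \<gamma> * e (- (\<gamma> * t0))) = (LINT \<gamma>|lborel. I \<gamma> * e (- (\<gamma> * t0)) - indicat_real {-P..P} \<gamma> *\<^sub>R (I \<gamma> * e (- (\<gamma> * t0))))"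
      unfolding J_def set_lebesgue_integral_def using intIe intP by (simp add: set_integrable_def)
    also have "norm \<dots> \<le> (LINT \<gamma>|lborel. C * P powr (-(1/4)) * (1 / (1 + \<gamma>\<^sup>2)))"
    proof (rule integral_norm_bound[THEN order_trans], rule integral_mono)
      show "integrable lborel (\<lambda>\<gamma>. norm (I \<gamma> * e (- (\<gamma> * t0)) - indicat_real {-P..P} \<gamma> *\<^sub>R (I \<gamma> * e (- (\<gamma> * t0)))))"
        using intIe intP by (auto simp: set_integrable_def)
      show "integrable lborel (\<lambda>\<gamma>. C * P powr (-(1/4)) * (1 / (1 + \<gamma>\<^sup>2)))"
        using integrable_lorentz by (intro integrable_mult_right) auto
      fix \<gamma> :: real
      show "norm (I \<gamma> * e (- (\<gamma> * t0)) - indicat_real {-P..P} \<gamma> *\<^sub>R (I \<gamma> * e (- (\<gamma> * t0)))) \<le> C * P powr (-(1/4)) * (1 / (1 + \<gamma>\<^sup>2))"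
      proof (cases "\<gamma> \<in> {-P..P}")
        case True
        have "0 \<le> C * P powr (-(1/4)) * (1 / (1 + \<gamma>\<^sup>2))" using C0 by (intro mult_nonneg_nonneg) (auto simp: add_nonneg_nonneg)
        then show ?thesis using True by simp
      next
        case False
        then have "P \<le> \<bar>\<gamma>\<bar>" by auto
        then have "C * (1 + \<bar>\<gamma>\<bar>) powr (-(9/4)) \<le> C * (P powr (-(1/4)) * (1 / (1 + \<gamma>\<^sup>2)))"
          using powr_decay_le(2)[OF P] C0 by (intro mult_left_mono) auto
        then show ?thesis using False decay[of \<gamma>] by (simp add: norm_mult I_def)
      qed
    qed
    also have "\<dots> = C * P powr (-(1/4)) * pi" by (simp only: integral_mult_right_zero integral_lorentz)
    also have "\<dots> \<le> C * P powr (-(1/4)) * 4" using C0 pi_less_4 by (intro mult_left_mono) auto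
    finally show ?thesis unfolding Jd by (simp add: norm_minus_commute mult_ac)
  qed
  then show ?thesis using Glim unfolding G_def I_def by blast
qed

subsection \<open>Growth and equidistribution of the weights\<close>

lemma finite_nat_le_real [simp, intro]: "finite {x::nat. Suc 0 \<le> x \<and> real x \<le> X}"
  by (rule finite_subset[of _ "{..nat \<lfloor>X\<rfloor>}"]) (auto simp: le_nat_floor)

lemma A_mono:
  assumes "\<And>x. x \<ge> 1 \<Longrightarrow> 0 \<le> a x" "X \<le> Y"
  shows "A a X \<le> A a Y"
  unfolding A_def using assms by (intro sum_mono2) auto

lemma A_res_bounds:
  assumes "\<And>x. x \<ge> 1 \<Longrightarrow> 0 \<le> a x"
  shows "0 \<le> A_res a q h X" "A_res a q h X \<le> A a X"
proof -
  show "0 \<le> A_res a q h X" unfolding A_res_def using assms by (intro sum_nonneg) auto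
  show "A_res a q h X \<le> A a X" unfolding A_res_def A_def using assms
    by (intro sum_mono2) auto
qed

text \<open>\<open>Q\<close> is eventually above every fixed \<open>q\<close>, so condition D
  applies at all large X. There a residue class carries at most the full mass A(X), and the relative
  error tends to 0.\<close>

lemma kappa_bounds:
  assumes a: "\<And>x. x \<ge> 1 \<Longrightarrow> 0 \<le> a x" and A: "filterlim (A a) at_top at_top" and D: "cond_D a Q \<kappa>"
    and Q: "\<forall>\<^sub>F X in at_top. ln X powr B \<le> Q X" and B: "B > 0" and q: "q \<ge> 1"
  shows "0 \<le> \<kappa> q h" "\<kappa> q h \<le> 1"
proof -
  have lnB: "filterlim (\<lambda>X. ln X powr B) at_top at_top"
    by (rule filterlim_compose[OF real_powr_at_top[OF B] ln_at_top])
  have evq: "\<forall>\<^sub>F X in at_top. real q \<le> Q X"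
    using Q lnB[unfolded filterlim_at_top, rule_format, of "real q"] by eventually_elim linarith
  have ev: "\<forall>\<^sub>F X in at_top. real q \<le> Q X \<and> X > 1 \<and> A a X > 0"
    using evq eventually_gt_at_top[of 1] A[unfolded filterlim_at_top, rule_format, of 1]
    by eventually_elim auto
  obtain X0 where "real q \<le> Q X0" "X0 > 1" using eventually_happens'[OF _ ev] by auto
  then show "0 \<le> \<kappa> q h" using D q unfolding cond_D_def by blast
  obtain C where C: "\<And>X q h. X > 1 \<Longrightarrow> q \<ge> 1 \<Longrightarrow> real q \<le> Q X \<Longrightarrow> \<bar>A_res a q h X - \<kappa> q h * A a X\<bar> \<le> C * (A a X / ln X ^ 1)"
    using D unfolding cond_D_def by blast
  have "((\<lambda>X. 1 + C / ln X) \<longlongrightarrow> 1 + 0) at_top"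
    by (intro tendsto_add tendsto_const tendsto_divide_0[OF tendsto_const] filterlim_at_top_imp_at_infinity ln_at_top)
  moreover have "\<forall>\<^sub>F X in at_top. \<kappa> q h \<le> 1 + C / ln X"
    using ev
  proof eventually_elim
    case (elim X)
    then have X: "real q \<le> Q X" "X > 1" "A a X > 0" by auto
    have "\<kappa> q h * A a X \<le> A a X + C * (A a X / ln X)"
      using C[OF X(2) q X(1), of h] A_res_bounds(2)[of a q h X] a by (auto simp: abs_le_iff)
    also have "\<dots> = (1 + C / ln X) * A a X" by (simp add: distrib_right)
    finally show ?case using X(3) by simp
  qed
  ultimately show "\<kappa> q h \<le> 1" using tendsto_lowerbound[of "\<lambda>X. 1 + C / ln X" 1 at_top] by simp
qed

text \<open>Everything needed to compare the heights X v with the height X, with a single constant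
  \<open>G\<close> for all v between \<theta> and \<Lambda>.\<close>

definition regular_at :: "(nat \<Rightarrow> real) \<Rightarrow> (real \<Rightarrow> real) \<Rightarrow> nat \<Rightarrow> real \<Rightarrow> real \<Rightarrow> real \<Rightarrow> real \<Rightarrow> bool" where
  "regular_at a \<Psi> m \<theta> \<Lambda> G X \<longleftrightarrow> 1 \<le> A a X \<and> (\<forall>v. \<theta> \<le> v \<longrightarrow> v \<le> \<Lambda> \<longrightarrow>
     A a (X * v) \<le> G * A a X \<and> A a X \<le> G * A a (X * v) \<and>
     A a X / (G * X) \<le> deriv \<Psi> (X * v) \<and> deriv \<Psi> (X * v) \<le> G * A a X / X \<and>
     \<bar>A a (X * v) - \<Psi> (X * v)\<bar> \<le> G * A a X / ln X ^ m \<and> ln X / 2 \<le> ln (X * v))"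

lemma smooth_approximation_deriv:
  assumes "smooth_approximation a m \<Psi>" "x > 0"
  shows "(\<Psi> has_real_derivative deriv \<Psi> x) (at x)" "isCont (deriv \<Psi>) x"
proof -
  have "((deriv ^^ 0) \<Psi>) differentiable (at x)" "((deriv ^^ 1) \<Psi>) differentiable (at x)"
    using assms unfolding smooth_approximation_def smooth_pos_def by blast+
  then show "(\<Psi> has_real_derivative deriv \<Psi> x) (at x)" "isCont (deriv \<Psi>) x"
    by (auto simp: DERIV_deriv_iff_real_differentiable intro: differentiable_imp_continuous_within)
qed

text \<open>The point is that A(X\<Lambda>) is at most a constant times A(X\<theta>), although no
  doubling property is assumed. The upper bound for the derivative gives \<Psi>'/\<Psi> \<le>
  \<gamma>/x eventually, so \<Psi>(x) x^(-\<gamma>) is non-increasing and the growth is at most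
  polynomial; \<open>A\<close> inherits this because it agrees with \<Psi> up to a factor 2.\<close>

lemma eventually_regular:
  assumes a: "\<And>x. x \<ge> 1 \<Longrightarrow> 0 \<le> a x" and A: "filterlim (A a) at_top at_top"
    and \<Psi>: "smooth_approximation a m \<Psi>" and m: "m \<ge> 1" and \<theta>: "0 < \<theta>" "\<theta> \<le> 1" and \<Lambda>: "1 \<le> \<Lambda>"
  obtains G where "G \<ge> 1" "\<forall>\<^sub>F X in at_top. regular_at a \<Psi> m \<theta> \<Lambda> G X"
proof -
  obtain k k' where k: "k > 0" and kk: "\<forall>\<^sub>F X in at_top. k * (A a X / X) \<le> deriv \<Psi> X \<and> deriv \<Psi> X \<le> k' * (A a X / X)"
    using \<Psi> unfolding smooth_approximation_def by blast
  obtain c where c: "c > 0" and cc: "\<forall>\<^sub>F X in at_top. norm (\<Psi> X - A a X) \<le> c * norm (A a X / ln X ^ m)"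
    using \<Psi> unfolding smooth_approximation_def by (auto elim!: landau_o.bigE)
  have lnm: "filterlim (\<lambda>X::real. ln X ^ m) at_top at_top"
    using m by (intro filterlim_pow_at_top ln_at_top) auto
  have "\<forall>\<^sub>F X in at_top. 3 \<le> X \<and> 1 \<le> A a X \<and> k * (A a X / X) \<le> deriv \<Psi> X \<and> deriv \<Psi> X \<le> k' * (A a X / X) \<and>
      norm (\<Psi> X - A a X) \<le> c * norm (A a X / ln X ^ m) \<and> 2 * c \<le> ln X ^ m"
    using eventually_ge_at_top[of 3] A[unfolded filterlim_at_top, rule_format, of 1] kk cc
      lnm[unfolded filterlim_at_top, rule_format, of "2 * c"] by eventually_elim blast
  then obtain X0 where X0: "\<And>X. X \<ge> X0 \<Longrightarrow> 3 \<le> X \<and> 1 \<le> A a X \<and> k * (A a X / X) \<le> deriv \<Psi> X \<and> deriv \<Psi> X \<le> k' * (A a X / X) \<and>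
      norm (\<Psi> X - A a X) \<le> c * norm (A a X / ln X ^ m) \<and> 2 * c \<le> ln X ^ m"
    unfolding eventually_at_top_linorder by blast
  have err: "\<bar>\<Psi> x - A a x\<bar> \<le> c * (A a x / ln x ^ m)" and half: "A a x / 2 \<le> \<Psi> x" "\<Psi> x \<le> 2 * A a x" if "x \<ge> X0" for x
  proof -
    have h: "1 \<le> A a x" "norm (\<Psi> x - A a x) \<le> c * norm (A a x / ln x ^ m)" "2 * c \<le> ln x ^ m" "3 \<le> x"
      using X0[OF that] by auto
    have l: "ln x ^ m > 0" using h c by linarith
    show e1: "\<bar>\<Psi> x - A a x\<bar> \<le> c * (A a x / ln x ^ m)" using h l by simp
    have "c / ln x ^ m \<le> 1 / 2" using h l by (simp add: field_simps)
    then have "c / ln x ^ m * A a x \<le> 1 / 2 * A a x" using h by (intro mult_right_mono) auto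
    then have "c * (A a x / ln x ^ m) \<le> A a x / 2" by simp
    then show "A a x / 2 \<le> \<Psi> x" "\<Psi> x \<le> 2 * A a x" using e1 h unfolding abs_le_iff by linarith+
  qed
  have k': "k' \<ge> k"
  proof -
    have h: "k * (A a X0 / X0) \<le> k' * (A a X0 / X0)" "A a X0 / X0 > 0" using X0[of X0] by auto
    then show ?thesis by (rule mult_right_le_imp_le)
  qed
  \<comment> \<open>The factor 2 comes from A \<le> 2\<Psi>.\<close>
  define \<gamma> where "\<gamma> = 2 * k'"
  have \<gamma>: "\<gamma> > 0" using k k' by (simp add: \<gamma>_def)
  have grow: "\<Psi> y * y powr (-\<gamma>) \<le> \<Psi> x * x powr (-\<gamma>)" if "X0 \<le> x" "x \<le> y" for x y
  proof (rule DERIV_nonpos_imp_nonincreasing[OF that(2)])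
    fix z assume z: "x \<le> z" "z \<le> y"
    have h: "3 \<le> z" "deriv \<Psi> z \<le> k' * (A a z / z)" using X0[of z] z that by auto
    have "((\<lambda>z. \<Psi> z * z powr (-\<gamma>)) has_real_derivative (deriv \<Psi> z * z powr (-\<gamma>) + \<Psi> z * (-\<gamma> * z powr (-\<gamma> - 1)))) (at z)"
      using h(1) smooth_approximation_deriv(1)[OF \<Psi>, of z]
      by (auto intro!: derivative_eq_intros)
    moreover have "deriv \<Psi> z * z powr (-\<gamma>) + \<Psi> z * (-\<gamma> * z powr (-\<gamma> - 1)) \<le> 0"
    proof -
      have "deriv \<Psi> z \<le> k' * (A a z / z)" by (rule h)
      also have "\<dots> \<le> k' * (2 * \<Psi> z / z)"
        using half(1)[of z] z that k k' h by (intro mult_left_mono divide_right_mono) auto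
      finally have "deriv \<Psi> z * z powr (-\<gamma>) \<le> \<gamma> * \<Psi> z / z * z powr (-\<gamma>)"
        by (intro mult_right_mono) (auto simp: \<gamma>_def mult_ac)
      moreover have "z powr (-\<gamma> - 1) = z powr (-\<gamma>) / z" using h by (simp add: powr_diff)
      ultimately show ?thesis by (simp add: mult_ac)
    qed
    ultimately show "\<exists>D. ((\<lambda>z. \<Psi> z * z powr (-\<gamma>)) has_real_derivative D) (at z) \<and> D \<le> 0" by blast
  qed
  define G0 where "G0 = 4 * (\<Lambda> / \<theta>) powr \<gamma>"
  have r1: "\<Lambda> / \<theta> \<ge> 1" using \<theta> \<Lambda> by (simp add: field_simps)
  have G0: "G0 \<ge> 4" unfolding G0_def using r1 \<gamma> ge_one_powr_ge_zero[of "\<Lambda> / \<theta>" \<gamma>] by simp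
  have A\<Lambda>: "A a (X * \<Lambda>) \<le> G0 * A a (X * \<theta>)" if X: "X0 \<le> X * \<theta>" "X > 0" for X
  proof -
    have le: "X * \<theta> \<le> X * \<Lambda>" using X \<theta> \<Lambda> by (intro mult_left_mono) auto
    have "\<Psi> (X * \<Lambda>) * (X * \<Lambda>) powr (-\<gamma>) * (X * \<Lambda>) powr \<gamma> \<le> \<Psi> (X * \<theta>) * (X * \<theta>) powr (-\<gamma>) * (X * \<Lambda>) powr \<gamma>"
      using grow[OF X(1) le] by (intro mult_right_mono) auto
    moreover have "(X * \<Lambda>) powr (-\<gamma>) * (X * \<Lambda>) powr \<gamma> = 1" using X \<Lambda> by (simp flip: powr_add)
    moreover have "(X * \<theta>) powr (-\<gamma>) * (X * \<Lambda>) powr \<gamma> = (\<Lambda> / \<theta>) powr \<gamma>"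
      using X \<theta> \<Lambda> by (simp add: powr_mult powr_minus powr_divide field_simps)
    ultimately have "\<Psi> (X * \<Lambda>) \<le> \<Psi> (X * \<theta>) * (\<Lambda> / \<theta>) powr \<gamma>" by (simp add: mult.assoc)
    moreover have "A a (X * \<Lambda>) / 2 \<le> \<Psi> (X * \<Lambda>)" using half(1)[of "X * \<Lambda>"] X le by simp
    moreover have "\<Psi> (X * \<theta>) * (\<Lambda> / \<theta>) powr \<gamma> \<le> 2 * A a (X * \<theta>) * (\<Lambda> / \<theta>) powr \<gamma>"
      using half(2)[OF X(1)] by (intro mult_right_mono) auto
    ultimately show ?thesis by (simp add: G0_def mult_ac)
  qed
  define G where "G = max (max G0 (G0 * \<Lambda> / k)) (max (k' * G0 / \<theta>) (c * G0 * 2 ^ m))"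
  have G: "G0 \<le> G" "G0 * \<Lambda> / k \<le> G" "k' * G0 / \<theta> \<le> G" "c * G0 * 2 ^ m \<le> G" by (auto simp: G_def)
  have "\<forall>\<^sub>F X in at_top. regular_at a \<Psi> m \<theta> \<Lambda> G X"
    \<comment> \<open>X \<theta>^2 \<ge> 1 yields X \<le> (X v)^2, hence ln (X v) \<ge> ln X / 2;
      the bound with |X0|/\<theta> makes all heights X v admissible.\<close>
    using eventually_ge_at_top[of "max 2 (max (\<bar>X0\<bar> / \<theta>) (1 / \<theta>\<^sup>2))"]
  proof eventually_elim
    case (elim X)
    then have X2: "2 \<le> X" and X\<theta>: "X0 \<le> X * \<theta>" and X\<theta>2: "1 \<le> X * \<theta>\<^sup>2"
      using \<theta> by (auto simp: field_simps abs_le_iff)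
    have Xpos: "X > 0" using X2 by simp
    have XX0: "X0 \<le> X" using X\<theta> mult_left_mono[OF \<theta>(2), of X] Xpos by linarith
    have AX: "1 \<le> A a X" using X0[OF XX0] by simp
    have lnX: "ln X > 0" using X2 by simp
    show ?case
      unfolding regular_at_def
    proof (intro conjI allI impI AX)
      fix v assume v: "\<theta> \<le> v" "v \<le> \<Lambda>"
      have vpos: "v > 0" using v \<theta> by simp
      have le1: "X * \<theta> \<le> X * v" and le2: "X * v \<le> X * \<Lambda>" and le3: "X * \<theta> \<le> X" "X \<le> X * \<Lambda>"
        using Xpos v \<theta> \<Lambda> by (auto simp: mult_left_le intro!: mult_left_mono)
      have Xv: "X0 \<le> X * v" using X\<theta> le1 by linarith
      note h = X0[OF Xv]
      have Av: "A a (X * \<theta>) \<le> A a (X * v)" "A a (X * v) \<le> A a (X * \<Lambda>)" "A a (X * \<theta>) \<le> A a X" "A a X \<le> A a (X * \<Lambda>)"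
        using le1 le2 le3 A_mono[of a] a by auto
      have A\<theta>0: "A a (X * \<theta>) \<ge> 1" using X0[OF X\<theta>] by simp
      have up0: "A a (X * v) \<le> G0 * A a X" and lo0: "A a X \<le> G0 * A a (X * v)"
        using A\<Lambda>[OF X\<theta> Xpos] Av mult_left_mono[OF Av(3), of G0] mult_left_mono[OF Av(1), of G0] G0 by linarith+
      have AG: "G0 * A a X \<le> G * A a X" "G0 * A a (X * v) \<le> G * A a (X * v)"
        using G(1) AX h by (auto intro!: mult_right_mono)
      show "A a (X * v) \<le> G * A a X" using up0 AG by linarith
      show "A a X \<le> G * A a (X * v)" using lo0 AG by linarith
      have "A a X / (G * X) \<le> k * (A a (X * v) / (X * v))"
      proof -
        have "G0 * \<Lambda> \<le> G * k" using G(2) k by (simp add: field_simps)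
        have "A a X * (X * v) \<le> G0 * A a (X * v) * (X * \<Lambda>)"
          using lo0 le2 Xpos vpos AX h G0 by (intro mult_mono) auto
        also have "\<dots> = (G0 * \<Lambda>) * (A a (X * v) * X)" by simp
        also have "\<dots> \<le> (G * k) * (A a (X * v) * X)"
          using \<open>G0 * \<Lambda> \<le> G * k\<close> h Xpos by (intro mult_right_mono) auto
        finally show ?thesis using Xpos vpos G(1) G0 by (simp add: field_simps)
      qed
      then show "A a X / (G * X) \<le> deriv \<Psi> (X * v)" using h by linarith
      have "k' * (A a (X * v) / (X * v)) \<le> k' * (G0 * A a X / (X * \<theta>))"
        using k k' up0 le1 Xpos \<theta> h vpos AX G0 by (intro mult_left_mono frac_le) auto
      also have "\<dots> = (k' * G0 / \<theta>) * A a X / X" by (simp add: mult_ac)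
      also have "\<dots> \<le> G * A a X / X" using G(3) AX Xpos by (intro divide_right_mono mult_right_mono) auto
      finally show "deriv \<Psi> (X * v) \<le> G * A a X / X" using h by linarith
      show lnv: "ln X / 2 \<le> ln (X * v)"
      proof -
        have "X \<le> X * (X * \<theta>\<^sup>2)" using X\<theta>2 Xpos by simp
        also have "\<dots> \<le> X * (X * v\<^sup>2)" using v \<theta> Xpos by (intro mult_left_mono power_mono) auto
        also have "\<dots> = (X * v)\<^sup>2" by (simp add: power2_eq_square)
        finally have "ln X \<le> ln ((X * v)\<^sup>2)" using Xpos vpos by simp
        also have "\<dots> = 2 * ln (X * v)" using Xpos vpos by (simp add: ln_realpow)
        finally show ?thesis by simp
      qed
      have lm: "ln X ^ m / 2 ^ m \<le> ln (X * v) ^ m"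
        using power_mono[OF lnv, of m] lnX by (simp add: power_divide)
      have lm0: "ln X ^ m > 0" using lnX by simp
      have "\<bar>A a (X * v) - \<Psi> (X * v)\<bar> \<le> c * (A a (X * v) / ln (X * v) ^ m)"
        using err[OF Xv] by (simp add: abs_minus_commute)
      also have "\<dots> \<le> c * (G0 * A a X / (ln X ^ m / 2 ^ m))"
        using c up0 lm lm0 AX G0 by (intro mult_left_mono frac_le) auto
      also have "\<dots> = (c * G0 * 2 ^ m) * A a X / ln X ^ m" by simp
      also have "\<dots> \<le> G * A a X / ln X ^ m" using G(4) AX lm0 by (intro divide_right_mono mult_right_mono) auto
      finally show "\<bar>A a (X * v) - \<Psi> (X * v)\<bar> \<le> G * A a X / ln X ^ m" .
    qed
  qed
  moreover have "G \<ge> 1" using G(1) G0 by linarith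
  ultimately show ?thesis using that by blast
qed

text \<open>
  The moduli go up to \<open>(ln X / 2) powr B\<close> instead of \<open>ln X powr B\<close> because equidistribution is needed at all
  heights \<open>X * v\<close>, also for \<open>v < 1\<close>, where \<open>Q\<close> may be smaller than \<open>Q X\<close>.
\<close>

definition residue_at :: "(nat \<Rightarrow> real) \<Rightarrow> (nat \<Rightarrow> int \<Rightarrow> real) \<Rightarrow> (real \<Rightarrow> real) \<Rightarrow> nat \<Rightarrow> real \<Rightarrow> real \<Rightarrow> real \<Rightarrow> real \<Rightarrow> real \<Rightarrow> bool" where
  "residue_at a \<kappa> \<Psi> m \<theta> \<Lambda> B G X \<longleftrightarrow> (\<forall>q h v. 1 \<le> q \<longrightarrow> real q \<le> (ln X / 2) powr B \<longrightarrow> \<theta> \<le> v \<longrightarrow> v \<le> \<Lambda> \<longrightarrow>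
     \<bar>A_res a q h (X * v) - \<kappa> q h * \<Psi> (X * v)\<bar> \<le> G * A a X / ln X ^ m)"

text \<open>Condition D is applied at height X v, where ln (X v) \<ge> ln X / 2 costs the factor
  2^m; then \<open>A\<close> is exchanged for \<Psi>, which costs no more than the approximation
  error because \<kappa> \<le> 1.\<close>

lemma eventually_residue:
  assumes a: "\<And>x. x \<ge> 1 \<Longrightarrow> 0 \<le> a x" and A: "filterlim (A a) at_top at_top"
    and D: "cond_D a Q \<kappa>" and Q: "\<forall>\<^sub>F X in at_top. ln X powr B \<le> Q X" and B: "B > 0"
    and \<theta>: "0 < \<theta>" and G: "G \<ge> 1" and reg: "\<forall>\<^sub>F X in at_top. regular_at a \<Psi> m \<theta> \<Lambda> G X"
  obtains G' where "G' \<ge> 1" "\<forall>\<^sub>F X in at_top. residue_at a \<kappa> \<Psi> m \<theta> \<Lambda> B G' X"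
proof -
  obtain C where C: "\<And>X q h. X > 1 \<Longrightarrow> q \<ge> 1 \<Longrightarrow> real q \<le> Q X \<Longrightarrow> \<bar>A_res a q h X - \<kappa> q h * A a X\<bar> \<le> C * (A a X / ln X ^ m)"
    using D unfolding cond_D_def by blast
  obtain X1 where X1: "\<And>X. X \<ge> X1 \<Longrightarrow> ln X powr B \<le> Q X" using Q unfolding eventually_at_top_linorder by blast
  define G' where "G' = \<bar>C\<bar> * (G * 2 ^ m) + G"
  have "\<forall>\<^sub>F X in at_top. residue_at a \<kappa> \<Psi> m \<theta> \<Lambda> B G' X"
    using reg eventually_ge_at_top[of "max 2 (max (\<bar>X1\<bar> / \<theta>) (2 / \<theta>))"]
  proof eventually_elim
    case (elim X)
    then have X2: "2 \<le> X" and X\<theta>: "X1 \<le> X * \<theta>" "2 \<le> X * \<theta>"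
      using \<theta> by (auto simp: field_simps abs_le_iff)
    have lnX: "ln X > 0" using X2 by simp
    show ?case
      unfolding residue_at_def
    proof (intro allI impI)
      fix q h v assume q: "1 \<le> q" "real q \<le> (ln X / 2) powr B" and v: "\<theta> \<le> v" "v \<le> \<Lambda>"
      have r: "1 \<le> A a X" "A a (X * v) \<le> G * A a X" "A a X \<le> G * A a (X * v)" "\<bar>A a (X * v) - \<Psi> (X * v)\<bar> \<le> G * A a X / ln X ^ m"
         "ln X / 2 \<le> ln (X * v)" using elim(1) v unfolding regular_at_def by blast+
      have Av: "A a (X * v) > 0" using r G by (smt (verit) mult_nonneg_nonpos)
      have le: "X * \<theta> \<le> X * v" using v X2 by (intro mult_left_mono) auto
      have "real q \<le> (ln X / 2) powr B" by (rule q)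
      also have "\<dots> \<le> ln (X * v) powr B" using r B lnX by (intro powr_mono2) auto
      also have "\<dots> \<le> Q (X * v)" using X1[of "X * v"] X\<theta> le by linarith
      finally have qQ: "real q \<le> Q (X * v)" .
      have lm: "ln X ^ m / 2 ^ m \<le> ln (X * v) ^ m"
        using power_mono[OF r(5), of m] lnX by (simp add: power_divide)
      have lm0: "ln X ^ m > 0" using lnX by simp
      have "\<bar>A_res a q h (X * v) - \<kappa> q h * A a (X * v)\<bar> \<le> C * (A a (X * v) / ln (X * v) ^ m)"
        using X\<theta> le q qQ by (intro C) auto
      also have "\<dots> \<le> \<bar>C\<bar> * (A a (X * v) / ln (X * v) ^ m)"
        using Av lm lm0 by (intro mult_right_mono divide_nonneg_nonneg) (auto intro: order_trans[OF _ lm])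
      also have "\<dots> \<le> \<bar>C\<bar> * (G * A a X / (ln X ^ m / 2 ^ m))"
        using r lm lm0 Av G by (intro mult_left_mono frac_le) auto
      finally have 1: "\<bar>A_res a q h (X * v) - \<kappa> q h * A a (X * v)\<bar> \<le> \<bar>C\<bar> * (G * 2 ^ m) * A a X / ln X ^ m" by (simp add: mult_ac)
      have \<kappa>: "0 \<le> \<kappa> q h" "\<kappa> q h \<le> 1" using kappa_bounds[OF a A D Q B q(1)] by auto
      have "\<bar>\<kappa> q h * A a (X * v) - \<kappa> q h * \<Psi> (X * v)\<bar> = \<kappa> q h * \<bar>A a (X * v) - \<Psi> (X * v)\<bar>"
        using \<kappa> by (simp add: right_diff_distrib[symmetric] abs_mult)
      also have "\<dots> \<le> 1 * (G * A a X / ln X ^ m)" using \<kappa> r by (intro mult_mono) auto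
      finally have "\<bar>\<kappa> q h * A a (X * v) - \<kappa> q h * \<Psi> (X * v)\<bar> \<le> G * A a X / ln X ^ m" by simp
      then show "\<bar>A_res a q h (X * v) - \<kappa> q h * \<Psi> (X * v)\<bar> \<le> G' * A a X / ln X ^ m"
        using 1 by (simp add: G'_def distrib_right add_divide_distrib)
    qed
  qed
  moreover have "G' \<ge> 1" using G by (simp add: G'_def add_increasing)
  ultimately show ?thesis using that by blast
qed

subsection \<open>Weighted exponential sums over a dilated box\<close>

definition exp_sum :: "real^'n^'n \<Rightarrow> (nat \<Rightarrow> real) \<Rightarrow> real^'n \<Rightarrow> real^'n \<Rightarrow> real \<Rightarrow> real \<Rightarrow> complex" where
  "exp_sum F a l r X \<alpha> = (\<Sum>x\<in>vbox UNIV (\<lambda>i. {n. X * l $ i \<le> of_int n \<and> of_int n \<le> X * r $ i}).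
     of_real (\<Prod>i\<in>UNIV. a (nat (x $ i))) * e (\<alpha> * qform F (ivec x)))"

lemma sum_int_nat:
  assumes "\<And>n. n \<in> S \<Longrightarrow> 1 \<le> n"
  shows "(\<Sum>n\<in>S. f (nat n)) = (\<Sum>x\<in>{x. int x \<in> S}. f x)"
proof (rule sum.reindex_bij_witness[of _ int nat])
  fix n assume "n \<in> S"
  then show "int (nat n) = n" "nat n \<in> {x. int x \<in> S}" using assms[of n] by auto
qed auto

lemma sum_A: "(\<Sum>n\<in>{1..int N}. a (nat n)) = A a (real N)"
proof -
  have "(\<Sum>n\<in>{1..int N}. a (nat n)) = (\<Sum>x\<in>{x. int x \<in> {1..int N}}. a x)" by (rule sum_int_nat) auto
  also have "{x. int x \<in> {1..int N}} = {x. 1 \<le> x \<and> real x \<le> real N}" by auto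
  finally show ?thesis by (simp add: A_def)
qed

text \<open>The Weyl estimate on the cube of side N = floor (X\<Lambda>), with weights cut off to
  the box. Condition L2 turns the factor D2^5 N^5 into A(X)^10 times (ln X)^(5c), up to constants,
  so no power of X is lost; since N \<ge> X, the decay may be written with X.\<close>

lemma exp_sum_weyl:
  fixes F :: "real^'n^'n" and l r :: "real^'n" and \<Lambda> :: nat
  assumes weyl: "weyl_estimate F C0 H" and C0: "C0 \<ge> 0" and card: "CARD('n) \<ge> 10"
    and a: "\<And>x. x \<ge> 1 \<Longrightarrow> 0 \<le> a x" and l: "\<And>i. 0 < l $ i" and r: "\<And>i. r $ i \<le> real \<Lambda>" and \<Lambda>: "\<Lambda> \<ge> 2"
    and X: "X \<ge> 2" "X \<ge> real \<Lambda>" and AX: "A a X \<ge> 0" and G: "A a (X * real \<Lambda>) \<le> G * A a X"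
    and C2: "\<And>Y. Y \<ge> 2 \<Longrightarrow> (\<Sum>x | 1 \<le> x \<and> real x \<le> Y. (a x)\<^sup>2) \<le> C2 * ((A a Y)\<^sup>2 / Y * ln Y powr c)"
    and c: "c \<ge> 0"
  defines "N \<equiv> nat \<lfloor>X * real \<Lambda>\<rfloor>"
  assumes q: "coprime b (int q)" "q \<ge> 1" "q \<le> 2 * H * N" and \<beta>: "\<bar>\<beta>\<bar> \<le> 1 / (2 * real (H * N) * real q)"
  shows "norm (exp_sum F a l r X (of_int b / real q + \<beta>)) \<le>
    C0 * (G * A a X) ^ CARD('n) * (\<bar>C2\<bar> * (2 * ln X) powr c) ^ 5 * (real q * (1 + X\<^sup>2 * \<bar>\<beta>\<bar>)) powr (-(9/4))"
proof -
  have NX: "X \<le> real N" "real N \<le> X * real \<Lambda>"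
  proof -
    have "X * 2 \<le> X * real \<Lambda>" using X \<Lambda> by (intro mult_left_mono) auto
    then show "X \<le> real N" unfolding N_def using X by linarith
    show "real N \<le> X * real \<Lambda>" unfolding N_def using X by simp
  qed
  have N: "N \<ge> 1" "real N \<ge> 2" using NX X by auto
  define S where "S i = {n::int. X * l $ i \<le> of_int n \<and> of_int n \<le> X * r $ i}" for i
  have S: "S i \<subseteq> {1..int N}" for i
  proof
    fix n assume "n \<in> S i"
    then have n: "X * l $ i \<le> of_int n" "of_int n \<le> X * r $ i" by (auto simp: S_def)
    have "0 < X * l $ i" using X l by simp
    then have "(0::real) < of_int n" using n by linarith
    then have n0: "0 < n" by simp
    have "X * r $ i \<le> X * real \<Lambda>" using r X by (intro mult_left_mono) auto
    then have "n \<le> \<lfloor>X * real \<Lambda>\<rfloor>" using n by (simp add: le_floor_iff)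
    moreover have "0 \<le> X * real \<Lambda>" using X by simp
    ultimately show "n \<in> {1..int N}" using n0 by (simp add: N_def nat_le_iff)
  qed
  define w where "w i n = (if n \<in> S i then a (nat n) else 0)" for i n
  have w0: "0 \<le> w i n" for i n using a[of "nat n"] subsetD[OF S, of n i] by (auto simp: w_def)
  have wa: "w i n \<le> a (nat n)" if "n \<in> {1..int N}" for i n using a[of "nat n"] that by (auto simp: w_def)
  have "A a (real N) \<le> A a (X * real \<Lambda>)" using NX a by (intro A_mono) auto
  then have AN: "A a (real N) \<le> G * A a X" using G by linarith
  have AN0: "0 \<le> A a (real N)" unfolding A_def using a by (intro sum_nonneg) auto
  have lnN: "ln (real N) \<le> 2 * ln X"
  proof -
    have "real N \<le> X * X" using NX X mult_left_mono[of "real \<Lambda>" X X] by linarith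
    then have "ln (real N) \<le> ln (X * X)" using N X by (subst ln_le_cancel_iff) auto
    then show ?thesis using X by (simp add: ln_mult)
  qed
  define D2 where "D2 = \<bar>C2\<bar> * ((G * A a X)\<^sup>2 / real N * (2 * ln X) powr c)"
  have b1: "norm (\<Sum>x\<in>vbox UNIV (\<lambda>_. {1..int N}). of_real (\<Prod>i\<in>UNIV. w i (x $ i)) * e ((of_int b / real q + \<beta>) * qform F (ivec x)))
      \<le> C0 * (G * A a X) ^ (CARD('n) - 10) * D2 ^ 5 * real N ^ 5 * (real q * (1 + real N ^ 2 * \<bar>\<beta>\<bar>)) powr (-(9/4))"
  proof (rule weyl_estimateD[OF weyl N(1)])
    fix i
    have "(\<Sum>n\<in>{1..int N}. w i n) \<le> (\<Sum>n\<in>{1..int N}. a (nat n))" using wa by (intro sum_mono) auto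
    then show "(\<Sum>n\<in>{1..int N}. w i n) \<le> G * A a X" using AN by (simp only: sum_A)
    have "(\<Sum>n\<in>{1..int N}. (w i n)\<^sup>2) \<le> (\<Sum>n\<in>{1..int N}. (a (nat n))\<^sup>2)"
      using wa w0 by (intro sum_mono power_mono) auto
    also have "\<dots> = (\<Sum>x | 1 \<le> x \<and> real x \<le> real N. (a x)\<^sup>2)"
      using sum_A[of "\<lambda>x. (a x)\<^sup>2" N] by (simp add: A_def)
    also have "\<dots> \<le> C2 * ((A a (real N))\<^sup>2 / real N * ln (real N) powr c)" by (rule C2[OF N(2)])
    also have "\<dots> \<le> \<bar>C2\<bar> * ((A a (real N))\<^sup>2 / real N * ln (real N) powr c)"
      by (intro mult_right_mono) auto
    also have "\<dots> \<le> D2" unfolding D2_def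
      using AN AN0 lnN N c by (intro mult_left_mono mult_mono divide_right_mono power_mono powr_mono2) auto
    finally show "(\<Sum>n\<in>{1..int N}. (w i n)\<^sup>2) \<le> D2" .
  qed (use w0 q \<beta> in auto)
  have eqT: "(\<Sum>x\<in>vbox UNIV (\<lambda>_. {1..int N}). of_real (\<Prod>i\<in>UNIV. w i (x $ i)) * e ((of_int b / real q + \<beta>) * qform F (ivec x)))
     = exp_sum F a l r X (of_int b / real q + \<beta>)"
    unfolding w_def exp_sum_def S_def[symmetric] by (rule sum_vbox_restrict[OF S])
  have D25: "D2 ^ 5 * real N ^ 5 = (G * A a X) ^ 10 * (\<bar>C2\<bar> * (2 * ln X) powr c) ^ 5"
  proof -
    have "D2 * real N = (G * A a X)\<^sup>2 * (\<bar>C2\<bar> * (2 * ln X) powr c)" using N by (simp add: D2_def)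
    then have "(D2 * real N) ^ 5 = ((G * A a X)\<^sup>2 * (\<bar>C2\<bar> * (2 * ln X) powr c)) ^ 5" by simp
    then show ?thesis by (simp add: power_mult_distrib power_mult[symmetric])
  qed
  have GA: "G * A a X \<ge> 0" using AN AN0 by linarith
  have "(G * A a X) ^ CARD('n) = (G * A a X) ^ (CARD('n) - 10) * (G * A a X) ^ 10"
    using card by (simp flip: power_add)
  then have "C0 * (G * A a X) ^ (CARD('n) - 10) * D2 ^ 5 * real N ^ 5 = C0 * (G * A a X) ^ CARD('n) * (\<bar>C2\<bar> * (2 * ln X) powr c) ^ 5"
    using D25 by (simp add: mult.assoc)
  moreover have "(real q * (1 + real N ^ 2 * \<bar>\<beta>\<bar>)) powr (-(9/4)) \<le> (real q * (1 + X\<^sup>2 * \<bar>\<beta>\<bar>)) powr (-(9/4))"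
  proof (rule powr_mono2')
    show "real q * (1 + X\<^sup>2 * \<bar>\<beta>\<bar>) \<le> real q * (1 + real N ^ 2 * \<bar>\<beta>\<bar>)"
      using NX X by (intro mult_left_mono add_left_mono mult_right_mono power_mono) auto
    show "0 < real q * (1 + X\<^sup>2 * \<bar>\<beta>\<bar>)" using q by (auto intro!: mult_pos_pos add_pos_nonneg)
  qed auto
  moreover have "0 \<le> C0 * (G * A a X) ^ CARD('n) * (\<bar>C2\<bar> * (2 * ln X) powr c) ^ 5" using C0 GA by simp
  ultimately have "C0 * (G * A a X) ^ (CARD('n) - 10) * D2 ^ 5 * real N ^ 5 * (real q * (1 + real N ^ 2 * \<bar>\<beta>\<bar>)) powr (-(9/4))
    \<le> C0 * (G * A a X) ^ CARD('n) * (\<bar>C2\<bar> * (2 * ln X) powr c) ^ 5 * (real q * (1 + X\<^sup>2 * \<bar>\<beta>\<bar>)) powr (-(9/4))"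
    by (simp only: mult_left_mono)
  then show ?thesis using b1 unfolding eqT by linarith
qed

lemma A_res_diff:
  assumes "p \<le> y" "0 < p" "0 \<le> h" "h < int q"
  shows "(\<Sum>n | of_int n \<in> {p<..y} \<and> n mod int q = h. a (nat n)) = A_res a q h y - A_res a q h p"
proof -
  have cong: "[int x = h] (mod int q) \<longleftrightarrow> int x mod int q = h" for x using assms by (simp add: cong_def)
  have "(\<Sum>n | of_int n \<in> {p<..y} \<and> n mod int q = h. a (nat n)) = (\<Sum>x\<in>{x. int x \<in> {n. real_of_int n \<in> {p<..y} \<and> n mod int q = h}}. a x)"
  proof (rule sum_int_nat)
    fix n assume "n \<in> {n. real_of_int n \<in> {p<..y} \<and> n mod int q = h}"
    then have "real_of_int n > 0" using assms by auto
    then show "1 \<le> n" by linarith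
  qed
  also have "{x. int x \<in> {n. real_of_int n \<in> {p<..y} \<and> n mod int q = h}} =
     {x. 1 \<le> x \<and> real x \<le> y \<and> [int x = h] (mod int q)} - {x. 1 \<le> x \<and> real x \<le> p \<and> [int x = h] (mod int q)}"
    using assms by (auto simp: cong)
  also have "(\<Sum>x\<in>\<dots>. a x) = A_res a q h y - A_res a q h p"
    unfolding A_res_def
  proof (rule sum_diff)
    show "finite {x. 1 \<le> x \<and> real x \<le> y \<and> [int x = h] (mod int q)}"
      by (rule finite_subset[OF _ finite_nat_le_real[of y]]) auto
  qed (use assms in auto)
  finally show ?thesis .
qed

text \<open>Only cell 0 differs from a half-open interval, by the possible lattice point
  \<open>p\<close> itself. Its weight is bounded by the mass of an interval of length 1/2 ending at
  \<open>p\<close>, which the smooth approximation controls.\<close>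

lemma cell_mass:
  assumes a: "\<And>x. x \<ge> 1 \<Longrightarrow> 0 \<le> a x" and p: "p > 1" and \<delta>: "\<delta> > 0" and h: "0 \<le> h" "h < int q"
  shows "\<bar>(\<Sum>n | of_int n \<in> cell p \<delta> k \<and> n mod int q = h. a (nat n)) -
     (A_res a q h (p + (real k + 1) * \<delta>) - A_res a q h (p + real k * \<delta>))\<bar> \<le> A a p - A a (p - 1/2)"
proof (cases "k = 0")
  case False
  have "(\<Sum>n | of_int n \<in> {p + real k * \<delta><..p + (real k + 1) * \<delta>} \<and> n mod int q = h. a (nat n))
     = A_res a q h (p + (real k + 1) * \<delta>) - A_res a q h (p + real k * \<delta>)"
    using p \<delta> by (intro A_res_diff h) (auto simp: add_pos_nonneg intro!: mult_right_mono)
  then show ?thesis using False A_mono[of a "p - 1/2" p] a by (simp add: cell_def)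
next
  case True
  define U where "U = {n. of_int n \<in> {p<..p + \<delta>} \<and> n mod int q = h}"
  define V where "V = {n. of_int n = p \<and> n mod int q = h}"
  have UV: "{n. of_int n \<in> cell p \<delta> k \<and> n mod int q = h} = U \<union> V"
    using True \<delta> by (auto simp: cell_def U_def V_def)
  have fU: "finite U" unfolding U_def by (rule finite_subset[OF _ finite_int_between[of p "p + \<delta>"]]) auto
  have fV: "finite V" unfolding V_def by (rule finite_subset[OF _ finite_int_between[of p p]]) auto
  have "(\<Sum>n\<in>U \<union> V. a (nat n)) = (\<Sum>n\<in>U. a (nat n)) + (\<Sum>n\<in>V. a (nat n))"
    using fU fV by (intro sum.union_disjoint) (auto simp: U_def V_def)
  moreover have "(\<Sum>n\<in>U. a (nat n)) = A_res a q h (p + \<delta>) - A_res a q h p"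
    unfolding U_def using p \<delta> by (intro A_res_diff h) auto
  moreover have "0 \<le> (\<Sum>n\<in>V. a (nat n))" using p by (intro sum_nonneg a) (auto simp: V_def)
  moreover have "(\<Sum>n\<in>V. a (nat n)) \<le> A a p - A a (p - 1/2)"
  proof -
    have "(\<Sum>n\<in>V. a (nat n)) \<le> (\<Sum>n | of_int n \<in> {p - 1/2<..p} \<and> n mod int 1 = 0. a (nat n))"
    proof (rule sum_mono2)
      show "finite {n. of_int n \<in> {p - 1/2<..p} \<and> n mod int 1 = 0}"
        by (rule finite_subset[OF _ finite_int_between[of "p - 1/2" p]]) auto
      fix n assume "n \<in> {n. of_int n \<in> {p - 1/2<..p} \<and> n mod int 1 = 0} - V"
      then have "real_of_int n > 1/2" using p by auto
      then show "0 \<le> a (nat n)" by (intro a) linarith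
    qed (auto simp: V_def)
    also have "\<dots> = A_res a 1 0 p - A_res a 1 0 (p - 1/2)" using p by (intro A_res_diff) auto
    also have "\<dots> = A a p - A a (p - 1/2)" by (simp add: A_res_def A_def)
    finally show ?thesis .
  qed
  ultimately show ?thesis unfolding UV using True by simp
qed

lemma cell_integral:
  assumes \<Psi>: "smooth_approximation a m \<Psi>" and p: "p > 0" and \<delta>: "\<delta> > 0"
  shows "(LINT y:cell p \<delta> k|lborel. deriv \<Psi> y) = \<Psi> (p + (real k + 1) * \<delta>) - \<Psi> (p + real k * \<delta>)"
proof -
  define x where "x = p + real k * \<delta>"
  define z where "z = p + (real k + 1) * \<delta>"
  have xz: "0 < x" "x \<le> z" using p \<delta> by (auto simp: x_def z_def add_pos_nonneg algebra_simps)
  have cont: "continuous_on {x..z} (deriv \<Psi>)"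
    using smooth_approximation_deriv(2)[OF \<Psi>] xz by (intro continuous_at_imp_continuous_on) auto
  have int: "set_integrable lborel {x..z} (deriv \<Psi>)"
    unfolding set_integrable_def by (intro borel_integrable_compact cont) auto
  have "(deriv \<Psi> has_integral (\<Psi> z - \<Psi> x)) {x..z}"
  proof (rule fundamental_theorem_of_calculus[OF xz(2)])
    fix y assume "y \<in> {x..z}"
    then have "(\<Psi> has_real_derivative deriv \<Psi> y) (at y)" using xz by (intro smooth_approximation_deriv(1)[OF \<Psi>]) auto
    then show "(\<Psi> has_vector_derivative deriv \<Psi> y) (at y within {x..z})"
      by (simp add: has_real_derivative_iff_has_vector_derivative[symmetric] has_field_derivative_at_within)
  qed
  then have I: "(LINT y:{x..z}|lborel. deriv \<Psi> y) = \<Psi> z - \<Psi> x"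
    using set_borel_integral_eq_integral(2)[OF int] by (simp add: integral_unique)
  have "(LINT y:cell p \<delta> k|lborel. deriv \<Psi> y) = (LINT y:{x..z}|lborel. deriv \<Psi> y)"
  proof (cases "k = 0")
    case False
    then have "cell p \<delta> k = {x<..z}" by (simp add: cell_def x_def z_def)
    then show ?thesis using interval_integral_Icc[OF xz(2), of "deriv \<Psi>"] interval_integral_Ioc[OF xz(2), of "deriv \<Psi>"] by simp
  qed (simp add: cell_def x_def z_def)
  then show ?thesis using I by (simp add: x_def z_def)
qed

text \<open>Joins the discrete and the continuous comparison, with \<open>M\<close> cells per
  coordinate. The constant 5 collects two equidistribution errors at the ends of a cell and three
  for the lattice point in cell 0: two approximation errors and the growth of \<Psi> over half a
  unit, which is admissible since ln X ^ m \<le> X. The room between \<theta> and 2\<theta> keeps p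
  - 1/2 within the heights where the weights are controlled.\<close>

lemma exp_sum_major:
  fixes F :: "real^'n^'n" and l r :: "real^'n" and \<theta> \<Lambda> \<rho> G X B \<beta> :: real and M q b m :: nat
  assumes F: "integer_form F" and a: "\<And>x. x \<ge> 1 \<Longrightarrow> 0 \<le> a x" and \<Psi>: "smooth_approximation a m \<Psi>"
    and lr: "\<And>i. r $ i = l $ i + 2 * \<rho>" and \<rho>: "\<rho> > 0" and \<theta>: "0 < \<theta>" "\<And>i. 2 * \<theta> \<le> l $ i" and \<Lambda>: "\<And>i. r $ i \<le> \<Lambda>"
    and G: "G \<ge> 1" and reg: "regular_at a \<Psi> m \<theta> \<Lambda> G X" and res: "residue_at a \<kappa> \<Psi> m \<theta> \<Lambda> B G X"
    and \<kappa>: "\<And>h. 0 \<le> \<kappa> q h \<and> \<kappa> q h \<le> 1"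
    and X: "X \<ge> 2" "1 \<le> X * \<theta>" "ln X ^ m \<le> X" and M: "M \<ge> 1"
    and q: "1 \<le> q" "real q \<le> (ln X / 2) powr B"
  defines "D \<equiv> G * (1 + 2 * \<rho>) * A a X"
    and "\<epsilon> \<equiv> 2 * pi * \<bar>\<beta>\<bar> * (4 * \<Lambda> * \<rho> * X\<^sup>2 / real M * (\<Sum>i\<in>UNIV. \<Sum>j\<in>UNIV. \<bar>F $ i $ j\<bar>))"
  shows "norm (exp_sum F a l r X (real b / real q + \<beta>) - S_sum F \<kappa> q b *
       (LINT x:cbox (X *\<^sub>R l) (X *\<^sub>R r)|lborel. of_real (\<Prod>i\<in>UNIV. deriv \<Psi> (x $ i)) * e (\<beta> * qform F x)))
    \<le> (1 + real q ^ CARD('n)) * (\<epsilon> * D ^ CARD('n)) + (real M * real q) ^ CARD('n) * (real CARD('n) * (5 * G * A a X / ln X ^ m) * D ^ (CARD('n) - 1))"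
proof -
  define \<psi> where "\<psi> = deriv \<Psi>"
  define p where "p = X *\<^sub>R l"
  define \<delta> where "\<delta> = 2 * \<rho> * X / real M"
  define E where "E = 5 * G * A a X / ln X ^ m"
  define \<nu> where "\<nu> i k = (LINT y:cell (p $ i) \<delta> k|lborel. \<psi> y)" for i k
  have Xpos: "X > 0" using X by simp
  have \<delta>: "\<delta> > 0" using \<rho> Xpos M by (simp add: \<delta>_def)
  have M\<delta>: "real M * \<delta> = 2 * \<rho> * X" using M by (simp add: \<delta>_def)
  have lpos: "l $ i > 0" for i using \<theta>(1) \<theta>(2)[of i] by linarith
  have p0: "0 < p $ i" for i using lpos Xpos by (simp add: p_def)
  have p1: "1 < p $ i" for i
  proof -
    have "X * (2 * \<theta>) \<le> X * l $ i" using \<theta>(2)[of i] Xpos by (intro mult_left_mono) auto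
    then show ?thesis unfolding p_def vector_scaleR_component real_scaleR_def using X(2) by linarith
  qed
  have pr: "p $ i + real M * \<delta> = X * r $ i" for i unfolding M\<delta> p_def lr by (simp add: algebra_simps)
  have rg: "1 \<le> A a X" "\<And>v. \<theta> \<le> v \<Longrightarrow> v \<le> \<Lambda> \<Longrightarrow> A a (X * v) \<le> G * A a X"
     "\<And>v. \<theta> \<le> v \<Longrightarrow> v \<le> \<Lambda> \<Longrightarrow> A a X / (G * X) \<le> \<psi> (X * v)"
     "\<And>v. \<theta> \<le> v \<Longrightarrow> v \<le> \<Lambda> \<Longrightarrow> \<psi> (X * v) \<le> G * A a X / X"
     "\<And>v. \<theta> \<le> v \<Longrightarrow> v \<le> \<Lambda> \<Longrightarrow> \<bar>A a (X * v) - \<Psi> (X * v)\<bar> \<le> G * A a X / ln X ^ m"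
    using reg unfolding regular_at_def \<psi>_def by blast+
  have Dpos: "D > 0" using rg(1) G \<rho> by (simp add: D_def)
  have lnm: "ln X ^ m > 0" using X by simp
  have \<psi>y: "0 \<le> \<psi> y" "\<psi> y \<le> G * A a X / X" if "p $ i - 1/2 \<le> y" "y \<le> p $ i + real M * \<delta>" for i y
  proof -
    have "\<theta> \<le> y / X"
    proof -
      have "X * (2 * \<theta>) \<le> X * l $ i" using \<theta>(2)[of i] Xpos by (intro mult_left_mono) auto
      then have "X * \<theta> \<le> y" using that(1) X(2) by (simp add: p_def)
      then show ?thesis using Xpos by (simp add: field_simps)
    qed
    moreover have "y / X \<le> \<Lambda>"
    proof -
      have "y \<le> X * \<Lambda>" using that(2) mult_left_mono[OF \<Lambda>[of i], of X] Xpos unfolding pr by linarith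
      then show ?thesis using Xpos by (simp add: field_simps)
    qed
    ultimately have "A a X / (G * X) \<le> \<psi> (X * (y / X))" "\<psi> (X * (y / X)) \<le> G * A a X / X" by (rule rg)+
    moreover have "0 \<le> A a X / (G * X)" using rg(1) G Xpos by simp
    ultimately show "0 \<le> \<psi> y" "\<psi> y \<le> G * A a X / X" using Xpos by auto
  qed
  have cont: "continuous_on {0<..} \<psi>"
    unfolding \<psi>_def using smooth_approximation_deriv(2)[OF \<Psi>] by (intro continuous_at_imp_continuous_on) auto
  have mvt: "0 \<le> \<Psi> z - \<Psi> y \<and> \<Psi> z - \<Psi> y \<le> G * A a X / X * (z - y)" if yz: "p $ i - 1/2 \<le> y" "y \<le> z" "z \<le> p $ i + real M * \<delta>" for i y z
  proof (cases "y = z")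
    case False
    have "\<exists>t. y < t \<and> t < z \<and> \<Psi> z - \<Psi> y = (z - y) * \<psi> t"
      unfolding \<psi>_def
    proof (rule MVT2)
      fix t assume "y \<le> t"
      then have "t > 0" using yz p1[of i] by linarith
      then show "(\<Psi> has_real_derivative deriv \<Psi> t) (at t)" by (rule smooth_approximation_deriv(1)[OF \<Psi>])
    qed (use False yz in auto)
    then obtain t where t: "y < t" "t < z" "\<Psi> z - \<Psi> y = (z - y) * \<psi> t" by blast
    have t2: "0 \<le> \<psi> t" "\<psi> t \<le> G * A a X / X" using \<psi>y[of i t] t yz by auto
    have "0 \<le> (z - y) * \<psi> t" using t2 yz by (intro mult_nonneg_nonneg) auto
    moreover have "(z - y) * \<psi> t \<le> (z - y) * (G * A a X / X)" by (rule mult_left_mono[OF t2(2)]) (use yz in auto)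
    ultimately show ?thesis using t(3) by (simp add: mult.commute)
  qed simp
  have GD: "G * A a X / X * (2 * \<rho> * X) \<le> D"
  proof -
    have "G * A a X * (2 * \<rho>) \<le> G * A a X * (1 + 2 * \<rho>)" using G rg(1) by (intro mult_left_mono) auto
    then show ?thesis using Xpos by (simp add: D_def mult_ac)
  qed
  have kk: "0 \<le> real k * \<delta>" "real k * \<delta> \<le> (real k + 1) * \<delta>" "(real k + 1) * \<delta> \<le> real M * \<delta>" if "k < M" for k
    using that \<delta> by (auto intro!: mult_right_mono)
  have \<nu>eq: "\<nu> i k = \<Psi> (p $ i + (real k + 1) * \<delta>) - \<Psi> (p $ i + real k * \<delta>)" for i k
    unfolding \<nu>_def \<psi>_def by (rule cell_integral[OF \<Psi> p0 \<delta>])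
  have \<nu>: "0 \<le> \<nu> i k \<and> \<nu> i k \<le> D" if k: "k < M" for i k
  proof -
    have "0 \<le> \<nu> i k" "\<nu> i k \<le> G * A a X / X * (p $ i + (real k + 1) * \<delta> - (p $ i + real k * \<delta>))"
      unfolding \<nu>eq using mvt[of i "p $ i + real k * \<delta>" "p $ i + (real k + 1) * \<delta>"] kk[OF k] by auto
    moreover have "G * A a X / X * (p $ i + (real k + 1) * \<delta> - (p $ i + real k * \<delta>)) \<le> G * A a X / X * (2 * \<rho> * X)"
      using kk[OF k] G rg(1) Xpos by (intro mult_left_mono) (auto simp: M\<delta>)
    ultimately show ?thesis using GD by linarith
  qed
  have aD: "(\<Sum>n | p $ i \<le> of_int n \<and> of_int n \<le> p $ i + real M * \<delta>. a (nat n)) \<le> D" for i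
  proof -
    have lam: "\<theta> \<le> r $ i" using \<theta>(1) \<theta>(2)[of i] \<rho> lr[of i] by linarith
    have "(\<Sum>n | p $ i \<le> of_int n \<and> of_int n \<le> p $ i + real M * \<delta>. a (nat n)) \<le> (\<Sum>n | of_int n \<in> {1/2<..X * r $ i} \<and> n mod int 1 = 0. a (nat n))"
    proof (rule sum_mono2)
      show "finite {n. of_int n \<in> {1/2<..X * r $ i} \<and> n mod int 1 = 0}"
        by (rule finite_subset[OF _ finite_int_between[of "1/2" "X * r $ i"]]) auto
      show "{n. p $ i \<le> of_int n \<and> of_int n \<le> p $ i + real M * \<delta>} \<subseteq> {n. of_int n \<in> {1/2<..X * r $ i} \<and> n mod int 1 = 0}"
        using p1[of i] by (auto simp: pr)
      fix n assume "n \<in> {n. of_int n \<in> {1/2<..X * r $ i} \<and> n mod int 1 = 0} - {n. p $ i \<le> of_int n \<and> of_int n \<le> p $ i + real M * \<delta>}"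
      then have "real_of_int n > 1/2" by auto
      then show "0 \<le> a (nat n)" by (intro a) linarith
    qed
    also have "\<dots> = A_res a 1 0 (X * r $ i) - A_res a 1 0 (1/2)"
      using p1[of i] kk[of 0] M M\<delta> \<rho> Xpos by (intro A_res_diff) (auto simp: pr[symmetric])
    also have "\<dots> \<le> A_res a 1 0 (X * r $ i)" using A_res_bounds(1)[of a 1 0 "1/2"] a by simp
    also have "\<dots> = A a (X * r $ i)" by (simp add: A_res_def A_def)
    also have "\<dots> \<le> G * A a X" by (rule rg(2)[OF lam \<Lambda>])
    also have "\<dots> \<le> D" using G rg(1) \<rho> by (simp add: D_def mult_right_mono)
    finally show ?thesis .
  qed
  have resv: "\<bar>A_res a q h y - \<kappa> q h * \<Psi> y\<bar> \<le> G * A a X / ln X ^ m" if "p $ i \<le> y" "y \<le> p $ i + real M * \<delta>" for i y h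
  proof -
    have "\<theta> \<le> y / X"
    proof -
      have "X * \<theta> \<le> X * l $ i" using \<theta>(1) \<theta>(2)[of i] Xpos by (intro mult_left_mono) auto
      then have "X * \<theta> \<le> y" using that(1) unfolding p_def vector_scaleR_component real_scaleR_def by linarith
      then show ?thesis using Xpos by (simp add: field_simps)
    qed
    moreover have "y / X \<le> \<Lambda>"
    proof -
      have "y \<le> X * \<Lambda>" using that(2) mult_left_mono[OF \<Lambda>[of i], of X] Xpos unfolding pr by linarith
      then show ?thesis using Xpos by (simp add: field_simps)
    qed
    ultimately have "\<bar>A_res a q h (X * (y / X)) - \<kappa> q h * \<Psi> (X * (y / X))\<bar> \<le> G * A a X / ln X ^ m"
      using res q unfolding residue_at_def by blast
    then show ?thesis using Xpos by simp
  qed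
  have jump: "A a (p $ i) - A a (p $ i - 1/2) \<le> 3 * G * A a X / ln X ^ m" for i
  proof -
    have v1: "\<theta> \<le> l $ i" "l $ i \<le> \<Lambda>" using \<theta>(1) \<theta>(2)[of i] \<Lambda>[of i] lr[of i] \<rho> by linarith+
    have v2: "\<theta> \<le> l $ i - 1 / (2 * X)" "l $ i - 1 / (2 * X) \<le> \<Lambda>"
    proof -
      have "1 / (2 * X) \<le> \<theta>" using X Xpos \<theta> by (simp add: field_simps)
      then show "\<theta> \<le> l $ i - 1 / (2 * X)" using \<theta>(2)[of i] by linarith
      show "l $ i - 1 / (2 * X) \<le> \<Lambda>" using v1 Xpos by (smt (verit) divide_nonneg_pos)
    qed
    have X2: "X * (l $ i - 1 / (2 * X)) = p $ i - 1/2" using Xpos by (simp add: p_def right_diff_distrib)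
    have "\<bar>A a (p $ i) - \<Psi> (p $ i)\<bar> \<le> G * A a X / ln X ^ m" using rg(5)[OF v1] by (simp add: p_def)
    moreover have "\<bar>A a (p $ i - 1/2) - \<Psi> (p $ i - 1/2)\<bar> \<le> G * A a X / ln X ^ m" using rg(5)[OF v2] by (simp only: X2)
    moreover have "\<Psi> (p $ i) - \<Psi> (p $ i - 1/2) \<le> G * A a X / X * (1/2)"
      using mvt[of i "p $ i - 1/2" "p $ i"] M\<delta> \<rho> Xpos by auto
    moreover have "G * A a X / X * (1/2) \<le> G * A a X / ln X ^ m"
    proof -
      have "G * A a X / X \<le> G * A a X / ln X ^ m" using X lnm G rg(1) by (intro divide_left_mono) auto
      moreover have "G * A a X / X * (1/2) \<le> G * A a X / X * 1" using Xpos G rg(1) by (intro mult_left_mono) auto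
      ultimately show ?thesis by simp
    qed
    ultimately have "A a (p $ i) - A a (p $ i - 1/2) \<le> 3 * (G * A a X / ln X ^ m)" by (simp add: abs_le_iff)
    then show ?thesis by simp
  qed
  have Ebound: "\<bar>(\<Sum>n | of_int n \<in> cell (p $ i) \<delta> k \<and> n mod int q = h. a (nat n)) - \<kappa> q h * \<nu> i k\<bar> \<le> E"
    if k: "k < M" and h: "0 \<le> h" "h < int q" for i k h
  proof -
    define y where "y = p $ i + real k * \<delta>"
    define z where "z = p $ i + (real k + 1) * \<delta>"
    have "\<bar>A_res a q h y - \<kappa> q h * \<Psi> y\<bar> \<le> G * A a X / ln X ^ m" "\<bar>A_res a q h z - \<kappa> q h * \<Psi> z\<bar> \<le> G * A a X / ln X ^ m"
      using resv[of i y h] resv[of i z h] kk[OF k] by (auto simp: y_def z_def)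
    moreover have "\<bar>(\<Sum>n | of_int n \<in> cell (p $ i) \<delta> k \<and> n mod int q = h. a (nat n)) - (A_res a q h z - A_res a q h y)\<bar> \<le> 3 * G * A a X / ln X ^ m"
      using cell_mass[of a "p $ i" \<delta> h q k, OF a p1 \<delta> h] jump[of i] unfolding y_def z_def by linarith
    moreover have "\<kappa> q h * \<nu> i k = \<kappa> q h * \<Psi> z - \<kappa> q h * \<Psi> y" by (simp add: \<nu>eq y_def z_def right_diff_distrib)
    moreover have "E = 2 * (G * A a X / ln X ^ m) + 3 * G * A a X / ln X ^ m" by (simp add: E_def add_divide_distrib[symmetric])
    ultimately show ?thesis by linarith
  qed
  define R where "R = X * \<Lambda>"
  have pR: "p $ i + real M * \<delta> \<le> R" for i unfolding pr R_def using \<Lambda> Xpos by (intro mult_left_mono) auto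
  define SF where "SF = (\<Sum>i\<in>UNIV. \<Sum>j\<in>UNIV. \<bar>F $ i $ j\<bar>)"
  have \<epsilon>: "2 * pi * \<bar>\<beta>\<bar> * (2 * R * \<delta> * SF) = \<epsilon>"
    by (simp add: \<epsilon>_def R_def \<delta>_def SF_def power2_eq_square mult_ac)
  define Q where "Q = (\<Sum>k\<in>vbox UNIV (\<lambda>_. {..<M}). of_real (\<Prod>i\<in>UNIV. \<nu> i (k $ i)) * e (\<beta> * qform F (\<chi> i. p $ i + real (k $ i) * \<delta>)))"
  define V where "V = (LINT x:cbox (X *\<^sub>R l) (X *\<^sub>R r)|lborel. of_real (\<Prod>i\<in>UNIV. deriv \<Psi> (x $ i)) * e (\<beta> * qform F x))"
  have 1: "norm (exp_sum F a l r X (real b / real q + \<beta>) - S_sum F \<kappa> q b * Q) \<le> \<epsilon> * D ^ CARD('n)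
      + (real M * real q) ^ CARD('n) * (real CARD('n) * E * D ^ (CARD('n) - 1))"
    using major_arc_discrete[where F = F and p = p and \<delta> = \<delta> and R = R and D = D and E = E and \<beta> = \<beta> and M = M and q = q
        and b = b and a = a and \<kappa> = \<kappa> and \<nu> = \<nu>, OF F \<delta> M q(1) Dpos p0 pR a aD \<kappa> \<nu> Ebound]
    unfolding Q_def exp_sum_def pr \<epsilon>[unfolded SF_def] by (simp only: p_def vector_scaleR_component real_scaleR_def)
  have 2: "norm (Q - V) \<le> \<epsilon> * D ^ CARD('n)"
  proof -
    have "(LINT y:{p $ i..p $ i + real M * \<delta>}|lborel. \<psi> y) \<le> D" for i
    proof -
      have "(LINT y:cell (p $ i) (real M * \<delta>) 0|lborel. deriv \<Psi> y) = \<Psi> (p $ i + real M * \<delta>) - \<Psi> (p $ i)"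
        using cell_integral[OF \<Psi> p0, of "real M * \<delta>" i 0] M \<delta> by simp
      moreover have "\<Psi> (p $ i + real M * \<delta>) - \<Psi> (p $ i) \<le> G * A a X / X * (2 * \<rho> * X)"
        using mvt[of i "p $ i" "p $ i + real M * \<delta>"] M\<delta> \<rho> Xpos by simp
      ultimately show ?thesis using GD by (simp add: cell_def \<psi>_def)
    qed
    moreover have "0 \<le> \<psi> y" if "p $ i \<le> y" "y \<le> p $ i + real M * \<delta>" for i y using \<psi>y(1)[of i y] that by simp
    ultimately have "norm (Q - (LINT x:cbox p (\<chi> i. p $ i + real M * \<delta>)|lborel. of_real (\<Prod>i\<in>UNIV. \<psi> (x $ i)) * e (\<beta> * qform F x)))
      \<le> 2 * pi * \<bar>\<beta>\<bar> * (2 * R * \<delta> * SF) * D ^ CARD('n)"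
      unfolding Q_def \<nu>_def SF_def by (intro major_arc_integral[where p = p and R = R and M = M and \<delta> = \<delta> and \<psi> = \<psi>, OF \<delta> M p0 pR _ cont])
    moreover have "(\<chi> i. p $ i + real M * \<delta>) = X *\<^sub>R r" by (simp add: vec_eq_iff pr)
    ultimately show ?thesis by (simp add: V_def p_def \<psi>_def \<epsilon>)
  qed
  have S: "norm (S_sum F \<kappa> q b) \<le> real q ^ CARD('n)"
  proof -
    have set: "{h::int^'n. \<forall>i. 0 \<le> h $ i \<and> h $ i < int q} = vbox UNIV (\<lambda>_. {0..<int q})" by (auto simp: vbox_def)
    have "norm (S_sum F \<kappa> q b) \<le> (\<Sum>h\<in>(vbox UNIV (\<lambda>_. {0..<int q}) :: (int^'n) set). \<Prod>i\<in>(UNIV::'n set). 1)"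
      unfolding S_sum_def set
    proof (intro order_trans[OF norm_sum] sum_mono)
      fix h :: "int^'n"
      have "0 \<le> (\<Prod>i\<in>UNIV. \<kappa> q (h $ i))" using \<kappa> by (intro prod_nonneg) auto
      moreover have "(\<Prod>i\<in>UNIV. \<kappa> q (h $ i)) \<le> (\<Prod>i\<in>(UNIV::'n set). 1)" using \<kappa> by (intro prod_mono) auto
      ultimately show "norm (complex_of_real (\<Prod>i\<in>UNIV. \<kappa> q (h $ i)) * e (real b / real q * qform F (ivec h))) \<le> (\<Prod>i\<in>(UNIV::'n set). 1)"
        by (simp only: norm_mult norm_of_real norm_e mult_1_right abs_of_nonneg)
    qed
    also have "\<dots> = real (\<Prod>i\<in>(UNIV::'n set). q)"
    proof -
      have "(\<Sum>h\<in>(vbox UNIV (\<lambda>_. {0..<int q}) :: (int^'n) set). \<Prod>i\<in>(UNIV::'n set). (1::real)) = (\<Prod>i\<in>(UNIV::'n set). \<Sum>k\<in>{0..<int q}. 1)"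
        by (rule sum_vbox_prod) auto
      then show ?thesis by simp
    qed
    finally show ?thesis by simp
  qed
  have "norm (exp_sum F a l r X (real b / real q + \<beta>) - S_sum F \<kappa> q b * V)
    \<le> norm (exp_sum F a l r X (real b / real q + \<beta>) - S_sum F \<kappa> q b * Q) + norm (S_sum F \<kappa> q b * (Q - V))"
    using norm_triangle_ineq[of "exp_sum F a l r X (real b / real q + \<beta>) - S_sum F \<kappa> q b * Q" "S_sum F \<kappa> q b * (Q - V)"]
    by (simp add: right_diff_distrib)
  moreover have "norm (S_sum F \<kappa> q b * (Q - V)) \<le> real q ^ CARD('n) * (\<epsilon> * D ^ CARD('n))"
    unfolding norm_mult using S 2 by (intro mult_mono) auto
  ultimately have "norm (exp_sum F a l r X (real b / real q + \<beta>) - S_sum F \<kappa> q b * V)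
    \<le> (1 + real q ^ CARD('n)) * (\<epsilon> * D ^ CARD('n)) + (real M * real q) ^ CARD('n) * (real CARD('n) * E * D ^ (CARD('n) - 1))"
    using 1 by (simp add: distrib_right)
  then show ?thesis unfolding V_def E_def .
qed

subsection \<open>The singular series, the singular integral and the asymptotic formula\<close>

lemma eventually_ln_powr_le:
  assumes "d > 0"
  shows "\<forall>\<^sub>F X::real in at_top. ln X powr d \<le> X"
  using eventually_ge_at_top[of "max 2 ((2 * d) powr (2 * d))"]
proof eventually_elim
  case (elim X)
  then have X: "X \<ge> 2" "(2 * d) powr (2 * d) \<le> X" by auto
  have "ln X powr (2 * d) \<le> (2 * d) powr (2 * d) * X" using X assms by (intro ln_powr_bound2) auto
  also have "\<dots> \<le> X * X" using X by (intro mult_right_mono) auto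
  finally have "(ln X powr d)\<^sup>2 \<le> X\<^sup>2"
    using X by (simp add: power2_eq_square powr_add[symmetric])
  then show ?case by (rule power2_le_imp_le) (use X in auto)
qed

lemma regular_at_mono:
  assumes "regular_at a \<Psi> m \<theta> \<Lambda> G X" "1 \<le> G" "G \<le> G'" "X > 1"
  shows "regular_at a \<Psi> m \<theta> \<Lambda> G' X"
proof -
  have A1: "1 \<le> A a X" using assms(1) by (simp add: regular_at_def)
  have l: "ln X ^ m > 0" using assms(4) by simp
  show ?thesis
    unfolding regular_at_def
  proof (intro conjI allI impI A1)
    fix v assume v: "\<theta> \<le> v" "v \<le> \<Lambda>"
    have h: "A a (X * v) \<le> G * A a X" "A a X \<le> G * A a (X * v)" "A a X / (G * X) \<le> deriv \<Psi> (X * v)"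
      "deriv \<Psi> (X * v) \<le> G * A a X / X" "\<bar>A a (X * v) - \<Psi> (X * v)\<bar> \<le> G * A a X / ln X ^ m" "ln X / 2 \<le> ln (X * v)"
      using assms(1) v unfolding regular_at_def by blast+
    have Av: "A a (X * v) \<ge> 0"
    proof (rule ccontr)
      assume "\<not> A a (X * v) \<ge> 0"
      then have "G * A a (X * v) \<le> 0" using assms(2) by (simp add: mult_nonneg_nonpos)
      then show False using h(2) A1 by linarith
    qed
    have GA: "G * A a X \<le> G' * A a X" using assms(3) A1 by (intro mult_right_mono) auto
    show "A a (X * v) \<le> G' * A a X" using h(1) GA by linarith
    show "A a X \<le> G' * A a (X * v)" using h(2) mult_right_mono[OF assms(3) Av] by linarith
    have "A a X / (G' * X) \<le> A a X / (G * X)" using A1 assms by (intro divide_left_mono mult_right_mono) auto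
    then show "A a X / (G' * X) \<le> deriv \<Psi> (X * v)" using h(3) by linarith
    have "G * A a X / X \<le> G' * A a X / X" using GA assms(4) by (intro divide_right_mono) auto
    then show "deriv \<Psi> (X * v) \<le> G' * A a X / X" using h(4) by linarith
    have "G * A a X / ln X ^ m \<le> G' * A a X / ln X ^ m" using GA l by (intro divide_right_mono) auto
    then show "\<bar>A a (X * v) - \<Psi> (X * v)\<bar> \<le> G' * A a X / ln X ^ m" using h(5) by linarith
    show "ln X / 2 \<le> ln (X * v)" by (rule h(6))
  qed
qed

lemma residue_at_mono:
  assumes "residue_at a \<kappa> \<Psi> m \<theta> \<Lambda> B G X" "G \<le> G'" "X > 1" "A a X \<ge> 0"
  shows "residue_at a \<kappa> \<Psi> m \<theta> \<Lambda> B G' X"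
  unfolding residue_at_def
proof (intro allI impI)
  fix q h v assume "1 \<le> q" "real q \<le> (ln X / 2) powr B" "\<theta> \<le> v" "v \<le> \<Lambda>"
  then have "\<bar>A_res a q h (X * v) - \<kappa> q h * \<Psi> (X * v)\<bar> \<le> G * A a X / ln X ^ m"
    using assms(1) unfolding residue_at_def by blast
  also have "\<dots> \<le> G' * A a X / ln X ^ m" using assms by (intro divide_right_mono mult_right_mono) auto
  finally show "\<bar>A_res a q h (X * v) - \<kappa> q h * \<Psi> (X * v)\<bar> \<le> G' * A a X / ln X ^ m" .
qed

text \<open>The exponent is split as 9/8 = 1/16 + 17/16: the first part gives the decay of the tail,
  the second still converges.\<close>

lemma powr_tail_bound:
  fixes f :: "nat \<Rightarrow> complex"
  assumes C: "C \<ge> 0" and f: "\<And>q. q \<ge> q0 \<Longrightarrow> norm (f q) \<le> C * real q powr (-(9/8))"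
  shows "summable (\<lambda>q. f (Suc q))"
    and "\<exists>C'\<ge>0. \<forall>n\<ge>q0. norm ((\<Sum>q=1..n. f q) - (\<Sum>q. f (Suc q))) \<le> C' * real (n + 1) powr (-(1/16))"
proof -
  have sp: "summable (\<lambda>q. real (Suc q) powr s)" if "s < -1" for s
    using that summable_Suc_iff[of "\<lambda>q. real q powr s"] by (simp add: summable_real_powr_iff)
  have "summable (\<lambda>q. C * real (Suc q) powr (-(9/8)))" by (intro summable_mult sp) simp
  then have sn: "summable (\<lambda>q. norm (f (Suc q)))"
  proof (rule summable_comparison_test_ev[rotated])
    show "\<forall>\<^sub>F q in sequentially. norm (norm (f (Suc q))) \<le> C * real (Suc q) powr (-(9/8))"
      using eventually_ge_at_top[of q0]
    proof eventually_elim
      case (elim q)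
      then show ?case using f[of "Suc q"] by simp
    qed
  qed
  then show sf: "summable (\<lambda>q. f (Suc q))" by (rule summable_norm_cancel)
  define Z where "Z = (\<Sum>q. real (Suc q) powr (-(17/16)))"
  have Z0: "Z \<ge> 0" unfolding Z_def by (intro suminf_nonneg sp) auto
  have "norm ((\<Sum>q=1..n. f q) - (\<Sum>q. f (Suc q))) \<le> (C * Z) * real (n + 1) powr (-(1/16))" if n: "n \<ge> q0" for n
  proof -
    have "(\<Sum>q=1..n. f q) = (\<Sum>i<n. f (Suc i))" by (simp add: sum.atLeast1_atMost_eq)
    then have "norm ((\<Sum>q=1..n. f q) - (\<Sum>q. f (Suc q))) = norm (\<Sum>q. f (Suc (q + n)))"
      using suminf_minus_initial_segment[OF sf, of n] by (simp add: norm_minus_commute)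
    also have "\<dots> \<le> (\<Sum>q. norm (f (Suc (q + n))))"
      using summable_ignore_initial_segment[OF sn, of n] by (intro summable_norm) simp
    also have "\<dots> \<le> (\<Sum>q. (C * real (n + 1) powr (-(1/16))) * real (Suc q) powr (-(17/16)))"
    proof (rule suminf_le)
      fix q
      define k where "k = real (Suc (q + n))"
      have k: "k \<ge> real (n + 1)" "k \<ge> real (Suc q)" "k > 0" by (auto simp: k_def)
      have "norm (f (Suc (q + n))) \<le> C * k powr (-(9/8))" unfolding k_def using n by (intro f) simp
      also have "k powr (-(9/8)) = k powr (-(1/16)) * k powr (-(17/16))" unfolding powr_add[symmetric] by simp
      also have "C * (k powr (-(1/16)) * k powr (-(17/16))) \<le> C * (real (n + 1) powr (-(1/16)) * real (Suc q) powr (-(17/16)))"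
        using k C by (intro mult_left_mono mult_mono powr_mono2') auto
      finally show "norm (f (Suc (q + n))) \<le> (C * real (n + 1) powr (-(1/16))) * real (Suc q) powr (-(17/16))"
        by (simp add: mult.assoc)
    next
      show "summable (\<lambda>q. norm (f (Suc (q + n))))" using summable_ignore_initial_segment[OF sn, of n] by simp
      show "summable (\<lambda>q. (C * real (n + 1) powr (-(1/16))) * real (Suc q) powr (-(17/16)))"
        by (intro summable_mult sp) simp
    qed
    also have "\<dots> = (C * real (n + 1) powr (-(1/16))) * Z" unfolding Z_def by (intro suminf_mult sp) simp
    finally show ?thesis by (simp add: mult_ac)
  qed
  then show "\<exists>C'\<ge>0. \<forall>n\<ge>q0. norm ((\<Sum>q=1..n. f q) - (\<Sum>q. f (Suc q))) \<le> C' * real (n + 1) powr (-(1/16))"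
    using C Z0 by (intro exI[of _ "C * Z"]) auto
qed

text \<open>16K \<le> B lets the tail P^(-1/16) of the singular series save (ln X)^K. 40c \<le> B
  keeps the loss (ln X)^(5c) below q^(1/8), up to a constant, in the bound for complete sums. 4(K +
  5c + 1) \<le> B lets P^(-1/4) absorb (ln X)^(5c + 1) on the minor arcs. The bound for
  \<open>m\<close> beats the number of cells and residue classes on the major arcs.\<close>

locale circle_setup =
  fixes F :: "real^'n^'n" and l r :: "real^'n" and \<theta> \<rho> :: real and \<Lambda> :: nat
    and a :: "nat \<Rightarrow> real" and \<kappa> :: "nat \<Rightarrow> int \<Rightarrow> real" and Q \<Psi> :: "real \<Rightarrow> real" and B c K :: real and m :: nat
  assumes F: "integer_form F" and L1: "cond_L1 F"
    and lr: "\<And>i. r $ i = l $ i + 2 * \<rho>" and \<rho>: "\<rho> > 0"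
    and \<theta>: "0 < \<theta>" "\<theta> \<le> 1" "\<And>i. 2 * \<theta> \<le> l $ i" and \<Lambda>: "2 \<le> \<Lambda>" "\<And>i. r $ i \<le> real \<Lambda>"
    and a: "\<And>x. x \<ge> 1 \<Longrightarrow> 0 \<le> a x" and A: "filterlim (A a) at_top at_top"
    and D: "cond_D a Q \<kappa>" and Q: "\<forall>\<^sub>F X in at_top. ln X powr B \<le> Q X"
    and L2: "cond_L2 a c" and c: "c \<ge> 0" and \<Psi>: "smooth_approximation a m \<Psi>"
    and K: "K > 0" and B: "16 * K \<le> B" "40 * c \<le> B" "4 * (K + 5 * c + 1) \<le> B"
    and m: "3 * B + K + (3 * B + K + 2 * B + B * real CARD('n)) * real CARD('n) \<le> real m"
begin

text \<open>Size of the major arcs: q \<le> PX X and |\<beta>| \<le> PX X / X^2.\<close>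

definition "PX X = (ln X / 2) powr B"

text \<open>Exponent of ln X to be saved at each point of the major arcs: their total length is at
  most 2 P^3/X^2, which loses \<open>3 * B\<close>, and \<open>K\<close> must remain.\<close>

definition "err = 3 * B + K"

definition "VX X \<beta> = (LINT x:cbox (X *\<^sub>R l) (X *\<^sub>R r)|lborel. complex_of_real (\<Prod>i\<in>UNIV. deriv \<Psi> (x $ i)) * e (\<beta> * qform F x))"

lemma Bpos: "B > 0" using B(1) K by simp

lemma m1: "m \<ge> 1"
proof -
  have "0 < 3 * B + K" using Bpos K by simp
  moreover have "0 \<le> (3 * B + K + 2 * B + B * real CARD('n)) * real CARD('n)" using Bpos K by (intro mult_nonneg_nonneg) auto
  ultimately have "0 < real m" using m by linarith
  then show ?thesis by simp
qed

lemma l_pos: "l $ i > 0" using \<theta>(1) \<theta>(3)[of i] by linarith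

lemma \<kappa>: "q \<ge> 1 \<Longrightarrow> 0 \<le> \<kappa> q h \<and> \<kappa> q h \<le> 1"
  using kappa_bounds[OF a A D Q Bpos] by blast

lemma regular_residue:
  obtains G where "G \<ge> 1" "\<forall>\<^sub>F X in at_top. regular_at a \<Psi> m \<theta> (real \<Lambda>) G X \<and> residue_at a \<kappa> \<Psi> m \<theta> (real \<Lambda>) B G X"
proof -
  have \<Lambda>1: "1 \<le> real \<Lambda>" using \<Lambda> by simp
  obtain G1 where G1: "G1 \<ge> 1" "\<forall>\<^sub>F X in at_top. regular_at a \<Psi> m \<theta> (real \<Lambda>) G1 X"
    using eventually_regular[OF a A \<Psi> m1 \<theta>(1,2) \<Lambda>1] by blast
  obtain G2 where G2: "G2 \<ge> 1" "\<forall>\<^sub>F X in at_top. residue_at a \<kappa> \<Psi> m \<theta> (real \<Lambda>) B G2 X"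
    using eventually_residue[OF a A D Q Bpos \<theta>(1) G1] by blast
  have "\<forall>\<^sub>F X in at_top. regular_at a \<Psi> m \<theta> (real \<Lambda>) (max G1 G2) X \<and> residue_at a \<kappa> \<Psi> m \<theta> (real \<Lambda>) B (max G1 G2) X"
    using G1(2) G2(2) eventually_gt_at_top[of 1]
  proof eventually_elim
    case (elim X)
    then have "A a X \<ge> 0" unfolding regular_at_def by linarith
    then show ?case using elim G1(1) by (auto intro: regular_at_mono residue_at_mono)
  qed
  then show ?thesis using that[of "max G1 G2"] G1(1) by auto
qed

lemma PX_bounds:
  "\<forall>\<^sub>F X in at_top. 1 \<le> PX X \<and> PX X \<le> ln X powr B \<and> PX X \<le> X \<and> 4 * PX X ^ 3 \<le> X\<^sup>2 \<and> ln X \<ge> 2 \<and> X \<ge> 4 \<and> ln X ^ m \<le> X"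
proof -
  have "real m > 0" using m1 by simp
  then have ev: "\<forall>\<^sub>F X in at_top. ln X powr real m \<le> X" "\<forall>\<^sub>F X in at_top. ln X powr (3 * B) \<le> X" "\<forall>\<^sub>F X in at_top. ln X powr B \<le> X"
    using Bpos by (auto intro!: eventually_ln_powr_le)
  have "\<forall>\<^sub>F X in at_top. ln X \<ge> (2::real)" using ln_at_top by (simp add: filterlim_at_top)
  with ev eventually_ge_at_top[of 4] show ?thesis
  proof eventually_elim
    case (elim X)
    have P: "PX X \<le> ln X powr B" unfolding PX_def using elim Bpos by (intro powr_mono2) auto
    have "1 \<le> PX X" unfolding PX_def using elim Bpos by (intro ge_one_powr_ge_zero) auto
    moreover have "4 * PX X ^ 3 \<le> X\<^sup>2"
    proof -
      have "PX X ^ 3 \<le> (ln X powr B) ^ 3" using P by (intro power_mono) (auto simp: PX_def)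
      also have "\<dots> = ln X powr (3 * B)" using elim by (simp add: powr_powr mult.commute flip: powr_realpow)
      also have "\<dots> \<le> X" using elim by simp
      finally have "PX X ^ 3 \<le> X" .
      moreover have "0 \<le> PX X" by (simp add: PX_def)
      ultimately have "4 * PX X ^ 3 \<le> X * X" using elim by (intro mult_mono) auto
      then show ?thesis by (simp add: power2_eq_square)
    qed
    moreover have "ln X ^ m \<le> X" using elim by (simp add: powr_realpow)
    moreover have "PX X \<le> X" using P elim by linarith
    ultimately show ?case using elim P by blast
  qed
qed

lemma PX_at_top: "filterlim PX at_top at_top"
proof -
  have "filterlim (\<lambda>X. ln X / 2) at_top (at_top :: real filter)"
    using filterlim_tendsto_pos_mult_at_top[OF tendsto_const[of "1/2::real"] _ ln_at_top] by simp
  then show ?thesis unfolding PX_def by (rule filterlim_compose[OF real_powr_at_top[OF Bpos]])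
qed

text \<open>More cells make the phase error smaller but multiply the equidistribution error. The
  former fixes their number as a power of ln X; the latter is then beaten by the choice of
  \<open>m\<close>.\<close>

lemma major_estimate:
  obtains C where "C \<ge> 0" "\<forall>\<^sub>F X in at_top. \<forall>q b \<beta>. 1 \<le> q \<longrightarrow> real q \<le> PX X \<longrightarrow> \<bar>\<beta>\<bar> \<le> PX X / X\<^sup>2 \<longrightarrow>
     norm (exp_sum F a l r X (real b / real q + \<beta>) - S_sum F \<kappa> q b * VX X \<beta>) \<le> C * (A a X ^ CARD('n) * ln X powr (- err))"
proof -
  obtain G where G: "G \<ge> 1" and ev: "\<forall>\<^sub>F X in at_top. regular_at a \<Psi> m \<theta> (real \<Lambda>) G X \<and> residue_at a \<kappa> \<Psi> m \<theta> (real \<Lambda>) B G X"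
    by (rule regular_residue)
  define n where "n = CARD('n)"
  define SF where "SF = (\<Sum>i\<in>UNIV. \<Sum>j\<in>UNIV. \<bar>F $ i $ j\<bar>)"
  have SF0: "SF \<ge> 0" by (simp add: SF_def sum_nonneg)
  define C1 where "C1 = 2 * pi * (4 * real \<Lambda> * \<rho> * SF)"
  have C10: "C1 \<ge> 0" using \<rho> SF0 by (simp add: C1_def)
  define g where "g = G * (1 + 2 * \<rho>)"
  have g1: "g \<ge> 1" using G \<rho> mult_mono[of 1 G 1 "1 + 2 * \<rho>"] by (simp add: g_def)
  \<comment> \<open>Solves B n + (B - R) = - err: the complete sum may be as large as q^n \<le> (ln
    X)^(B n), and the phase error is of order (ln X)^(B - R).\<close>
  define R where "R = err + B + B * real n"
  have R0: "R \<ge> 0" using Bpos K by (simp add: R_def err_def)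
  define C where "C = 2 * C1 * g ^ n + 2 ^ n * (real n * (5 * G) * g ^ (n - 1))"
  have npos: "n \<ge> 1" by (simp add: n_def Suc_leI)
  have "\<forall>\<^sub>F X in at_top. \<forall>q b \<beta>. 1 \<le> q \<longrightarrow> real q \<le> PX X \<longrightarrow> \<bar>\<beta>\<bar> \<le> PX X / X\<^sup>2 \<longrightarrow>
     norm (exp_sum F a l r X (real b / real q + \<beta>) - S_sum F \<kappa> q b * VX X \<beta>) \<le> C * (A a X ^ CARD('n) * ln X powr (- err))"
    using ev PX_bounds eventually_ge_at_top[of "1 / \<theta>"]
  proof eventually_elim
    case (elim X)
    then have reg: "regular_at a \<Psi> m \<theta> (real \<Lambda>) G X" and res: "residue_at a \<kappa> \<Psi> m \<theta> (real \<Lambda>) B G X"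
      and P: "1 \<le> PX X" "PX X \<le> ln X powr B" "ln X \<ge> 2" "X \<ge> 4" "ln X ^ m \<le> X" and X\<theta>: "1 \<le> X * \<theta>"
      using \<theta>(1) by (auto simp: field_simps)
    have AX: "1 \<le> A a X" using reg by (simp add: regular_at_def)
    define L where "L = ln X"
    have L: "L \<ge> 2" using P by (simp add: L_def)
    define M where "M = nat \<lceil>L powr R\<rceil>"
    have LR1: "L powr R \<ge> 1" using L R0 by (intro ge_one_powr_ge_zero) auto
    have M: "M \<ge> 1" "L powr R \<le> real M" "real M \<le> 2 * L powr R" using LR1 unfolding M_def by linarith+
    show ?case
    proof (intro allI impI)
      fix q b \<beta> assume q: "1 \<le> q" "real q \<le> PX X" and \<beta>: "\<bar>\<beta>\<bar> \<le> PX X / X\<^sup>2"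
      define \<epsilon> where "\<epsilon> = 2 * pi * \<bar>\<beta>\<bar> * (4 * real \<Lambda> * \<rho> * X\<^sup>2 / real M * SF)"
      define Dd where "Dd = g * A a X"
      have main: "norm (exp_sum F a l r X (real b / real q + \<beta>) - S_sum F \<kappa> q b * VX X \<beta>)
        \<le> (1 + real q ^ n) * (\<epsilon> * Dd ^ n) + (real M * real q) ^ n * (real n * (5 * G * A a X / L ^ m) * Dd ^ (n - 1))"
        unfolding VX_def n_def \<epsilon>_def Dd_def g_def SF_def L_def
        by (rule exp_sum_major[where B = B and \<theta> = \<theta>, OF F a \<Psi> lr \<rho> \<theta>(1,3) \<Lambda>(2) G reg res])
          (use \<kappa> q P X\<theta> M in \<open>auto simp: PX_def\<close>)
      have qL: "real q \<le> L powr B" using q P by (simp add: L_def)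
      have q1: "1 \<le> real q" using q by simp
      have qn: "1 + real q ^ n \<le> 2 * L powr (B * real n)"
      proof -
        have "real q ^ n \<le> (L powr B) ^ n" using qL by (intro power_mono) auto
        also have "\<dots> = L powr (B * real n)" using L by (simp add: powr_powr flip: powr_realpow)
        finally have "real q ^ n \<le> L powr (B * real n)" .
        moreover have "1 \<le> real q ^ n" using q1 by (rule one_le_power)
        ultimately show ?thesis by linarith
      qed
      have \<epsilon>: "\<epsilon> \<le> C1 * L powr (B - R)"
      proof -
        have "\<epsilon> = C1 * (\<bar>\<beta>\<bar> * X\<^sup>2) / real M" by (simp add: \<epsilon>_def C1_def)
        also have "\<dots> \<le> C1 * (L powr B) / L powr R"
        proof (intro frac_le mult_left_mono C10)
          have "\<bar>\<beta>\<bar> * X\<^sup>2 \<le> PX X" using \<beta> P by (simp add: field_simps)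
          then show "\<bar>\<beta>\<bar> * X\<^sup>2 \<le> L powr B" using P by (simp add: L_def)
        qed (use M LR1 C10 in auto)
        also have "\<dots> = C1 * L powr (B - R)" by (simp add: powr_diff)
        finally show ?thesis .
      qed
      have \<epsilon>0: "\<epsilon> \<ge> 0" using \<rho> SF0 by (simp add: \<epsilon>_def)
      have t1: "(1 + real q ^ n) * (\<epsilon> * Dd ^ n) \<le> 2 * C1 * g ^ n * (A a X ^ n * L powr (- err))"
      proof -
        have "(1 + real q ^ n) * (\<epsilon> * Dd ^ n) \<le> (2 * L powr (B * real n)) * ((C1 * L powr (B - R)) * Dd ^ n)"
          using qn \<epsilon> \<epsilon>0 AX g1 by (intro mult_mono) (auto simp: Dd_def)
        also have "\<dots> = 2 * C1 * g ^ n * (A a X ^ n * (L powr (B * real n) * L powr (B - R)))"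
          by (simp add: Dd_def power_mult_distrib mult_ac)
        also have "L powr (B * real n) * L powr (B - R) = L powr (- err)"
          by (simp add: R_def powr_add[symmetric])
        finally show ?thesis .
      qed
      have t2: "(real M * real q) ^ n * (real n * (5 * G * A a X / L ^ m) * Dd ^ (n - 1)) \<le> 2 ^ n * (real n * (5 * G) * g ^ (n - 1)) * (A a X ^ n * L powr (- err))"
      proof -
        have "real M * real q \<le> (2 * L powr R) * L powr B" using M qL by (intro mult_mono) auto
        also have "\<dots> = 2 * L powr (R + B)" by (simp add: powr_add)
        finally have "(real M * real q) ^ n \<le> (2 * L powr (R + B)) ^ n" by (intro power_mono) auto
        also have "\<dots> = 2 ^ n * L powr ((R + B) * real n)"
          using L by (simp add: power_mult_distrib powr_powr flip: powr_realpow)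
        finally have Mq: "(real M * real q) ^ n \<le> 2 ^ n * L powr ((R + B) * real n)" .
        have "(real M * real q) ^ n * (real n * (5 * G * A a X / L ^ m) * Dd ^ (n - 1)) \<le> (2 ^ n * L powr ((R + B) * real n)) * (real n * (5 * G * A a X / L ^ m) * Dd ^ (n - 1))"
          using Mq G AX L g1 by (intro mult_right_mono mult_nonneg_nonneg) (auto simp: Dd_def)
        also have "\<dots> = 2 ^ n * (real n * (5 * G) * g ^ (n - 1)) * ((A a X * A a X ^ (n - 1)) * (L powr ((R + B) * real n) / L ^ m))"
          by (simp add: Dd_def power_mult_distrib mult_ac)
        also have "A a X * A a X ^ (n - 1) = A a X ^ n" using npos by (metis power_eq_if not_one_le_zero)
        also have "L powr ((R + B) * real n) / L ^ m = L powr ((R + B) * real n - real m)"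
          using L by (simp add: powr_diff powr_realpow)
        also have "2 ^ n * (real n * (5 * G) * g ^ (n - 1)) * (A a X ^ n * L powr ((R + B) * real n - real m))
          \<le> 2 ^ n * (real n * (5 * G) * g ^ (n - 1)) * (A a X ^ n * L powr (- err))"
        proof (intro mult_left_mono powr_mono)
          show "(R + B) * real n - real m \<le> - err" using m by (simp add: R_def err_def n_def algebra_simps)
        qed (use L G g1 AX in auto)
        finally show ?thesis .
      qed
      show "norm (exp_sum F a l r X (real b / real q + \<beta>) - S_sum F \<kappa> q b * VX X \<beta>) \<le> C * (A a X ^ CARD('n) * ln X powr (- err))"
        using main t1 t2 unfolding C_def distrib_right n_def[symmetric] L_def[symmetric] by linarith
    qed
  qed
  moreover have "C \<ge> 0" using C10 g1 G by (simp add: C_def)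
  ultimately show ?thesis using that by blast
qed

lemma weyl_estimate_eventually:
  obtains C and H :: nat where "C \<ge> 0" "H \<ge> 1" "\<forall>\<^sub>F X in at_top. \<forall>q b \<beta>. coprime b (int q) \<longrightarrow> 1 \<le> q \<longrightarrow> q \<le> 2 * H * nat \<lfloor>X * real \<Lambda>\<rfloor> \<longrightarrow>
     \<bar>\<beta>\<bar> \<le> 1 / (2 * real (H * nat \<lfloor>X * real \<Lambda>\<rfloor>) * real q) \<longrightarrow>
     norm (exp_sum F a l r X (of_int b / real q + \<beta>)) \<le> C * (A a X ^ CARD('n) * ln X powr (5 * c)) * (real q * (1 + X\<^sup>2 * \<bar>\<beta>\<bar>)) powr (-(9/4))"
proof -
  obtain C0 :: real and H :: nat where C0: "C0 \<ge> 0" and H: "H \<ge> 1" and weyl: "weyl_estimate F C0 H"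
    using weyl_bound[OF F L1] by blast
  obtain G where G: "G \<ge> 1" and ev: "\<forall>\<^sub>F X in at_top. regular_at a \<Psi> m \<theta> (real \<Lambda>) G X \<and> residue_at a \<kappa> \<Psi> m \<theta> (real \<Lambda>) B G X"
    by (rule regular_residue)
  obtain C2 where C2: "\<And>Y. Y \<ge> 2 \<Longrightarrow> (\<Sum>x | 1 \<le> x \<and> real x \<le> Y. (a x)\<^sup>2) \<le> C2 * ((A a Y)\<^sup>2 / Y * ln Y powr c)"
    using L2 unfolding cond_L2_def by blast
  define C where "C = C0 * G ^ CARD('n) * (\<bar>C2\<bar> * 2 powr c) ^ 5"
  have "\<forall>\<^sub>F X in at_top. \<forall>q b \<beta>. coprime b (int q) \<longrightarrow> 1 \<le> q \<longrightarrow> q \<le> 2 * H * nat \<lfloor>X * real \<Lambda>\<rfloor> \<longrightarrow>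
     \<bar>\<beta>\<bar> \<le> 1 / (2 * real (H * nat \<lfloor>X * real \<Lambda>\<rfloor>) * real q) \<longrightarrow>
     norm (exp_sum F a l r X (of_int b / real q + \<beta>)) \<le> C * (A a X ^ CARD('n) * ln X powr (5 * c)) * (real q * (1 + X\<^sup>2 * \<bar>\<beta>\<bar>)) powr (-(9/4))"
    using ev eventually_ge_at_top[of "real \<Lambda>"] eventually_ge_at_top[of 2]
  proof eventually_elim
    case (elim X)
    have AX: "1 \<le> A a X" and GA: "A a (X * real \<Lambda>) \<le> G * A a X"
      using elim \<theta> \<Lambda>(1) unfolding regular_at_def by auto
    have lnX: "ln X > 0" using elim by simp
    show ?case
    proof (intro allI impI)
      fix q b \<beta>
      assume h: "coprime b (int q)" "1 \<le> q" "q \<le> 2 * H * nat \<lfloor>X * real \<Lambda>\<rfloor>"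
        "\<bar>\<beta>\<bar> \<le> 1 / (2 * real (H * nat \<lfloor>X * real \<Lambda>\<rfloor>) * real q)"
      have "norm (exp_sum F a l r X (of_int b / real q + \<beta>)) \<le> C0 * (G * A a X) ^ CARD('n) * (\<bar>C2\<bar> * (2 * ln X) powr c) ^ 5 * (real q * (1 + X\<^sup>2 * \<bar>\<beta>\<bar>)) powr (-(9/4))"
        using elim AX by (intro exp_sum_weyl[OF weyl C0 cond_L1_card[OF L1] a l_pos \<Lambda>(2,1) _ _ _ GA C2 c h]) auto
      also have "C0 * (G * A a X) ^ CARD('n) * (\<bar>C2\<bar> * (2 * ln X) powr c) ^ 5 = C * (A a X ^ CARD('n) * ln X powr (5 * c))"
      proof -
        have "(ln X powr c) ^ 5 = ln X powr (5 * c)" using lnX by (simp add: powr_powr mult.commute flip: powr_realpow)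
        then show ?thesis using lnX by (simp add: C_def powr_mult power_mult_distrib mult_ac)
      qed
      finally show "norm (exp_sum F a l r X (of_int b / real q + \<beta>)) \<le> C * (A a X ^ CARD('n) * ln X powr (5 * c)) * (real q * (1 + X\<^sup>2 * \<bar>\<beta>\<bar>)) powr (-(9/4))" .
    qed
  qed
  moreover have "C \<ge> 0" using C0 G by (simp add: C_def)
  ultimately show ?thesis using that H by blast
qed

text \<open>Allows division by \<open>VX X 0\<close> when the bound for complete sums is extracted
  from two estimates of the same exponential sum.\<close>

lemma VX_lower:
  obtains v where "v > 0" "\<forall>\<^sub>F X in at_top. v * A a X ^ CARD('n) \<le> norm (VX X 0)"
proof -
  obtain G where G: "G \<ge> 1" and ev: "\<forall>\<^sub>F X in at_top. regular_at a \<Psi> m \<theta> (real \<Lambda>) G X \<and> residue_at a \<kappa> \<Psi> m \<theta> (real \<Lambda>) B G X"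
    by (rule regular_residue)
  have "\<forall>\<^sub>F X in at_top. (2 * \<rho> / G) ^ CARD('n) * A a X ^ CARD('n) \<le> norm (VX X 0)"
    using ev eventually_gt_at_top[of 0]
  proof eventually_elim
    case (elim X)
    have AX: "1 \<le> A a X" and lo: "\<And>v. \<theta> \<le> v \<Longrightarrow> v \<le> real \<Lambda> \<Longrightarrow> A a X / (G * X) \<le> deriv \<Psi> (X * v)"
      using elim unfolding regular_at_def by auto
    have lo': "A a X / (G * X) \<le> deriv \<Psi> y" if "X * l $ i \<le> y" "y \<le> X * r $ i" for i y
    proof -
      have "\<theta> \<le> l $ i" using \<theta>(1) \<theta>(3)[of i] by linarith
      moreover have "l $ i \<le> y / X" "y / X \<le> r $ i" using that elim by (auto simp: field_simps)
      ultimately have "A a X / (G * X) \<le> deriv \<Psi> (X * (y / X))" using \<Lambda>(2)[of i] by (intro lo) linarith+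
      then show ?thesis using elim by simp
    qed
    have pos: "0 \<le> A a X / (G * X)" using AX G elim by simp
    have int: "set_integrable lborel {X * l $ i..X * r $ i} (deriv \<Psi>)" for i
      unfolding set_integrable_def
    proof (intro borel_integrable_compact continuous_at_imp_continuous_on ballI)
      fix y assume "y \<in> {X * l $ i..X * r $ i}"
      moreover have "0 < X * l $ i" using elim l_pos by simp
      ultimately show "isCont (deriv \<Psi>) y" by (intro smooth_approximation_deriv(2)[OF \<Psi>]) auto
    qed auto
    have each: "2 * \<rho> / G * A a X \<le> (LINT y:{X * l $ i..X * r $ i}|lborel. deriv \<Psi> y)" for i
    proof -
      have pl: "0 < X * l $ i" and d: "0 < 2 * \<rho> * X" using elim l_pos \<rho> by auto
      have Xr: "X * l $ i + 2 * \<rho> * X = X * r $ i" by (simp add: lr algebra_simps)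
      have "(LINT y:{X * l $ i..X * r $ i}|lborel. deriv \<Psi> y) = \<Psi> (X * r $ i) - \<Psi> (X * l $ i)"
        using cell_integral[OF \<Psi> pl d, of 0] by (simp add: cell_def Xr)
      moreover have "\<exists>t. X * l $ i < t \<and> t < X * r $ i \<and> \<Psi> (X * r $ i) - \<Psi> (X * l $ i) = (X * r $ i - X * l $ i) * deriv \<Psi> t"
      proof (rule MVT2)
        fix t assume "X * l $ i \<le> t"
        then show "(\<Psi> has_real_derivative deriv \<Psi> t) (at t)" using pl by (intro smooth_approximation_deriv(1)[OF \<Psi>]) linarith
      qed (use d Xr in linarith)
      then obtain t where t: "X * l $ i < t" "t < X * r $ i" "\<Psi> (X * r $ i) - \<Psi> (X * l $ i) = (2 * \<rho> * X) * deriv \<Psi> t"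
        using Xr by (metis add_diff_cancel_left')
      moreover have "(2 * \<rho> * X) * (A a X / (G * X)) \<le> (2 * \<rho> * X) * deriv \<Psi> t"
        using lo'[of i t] t d by (intro mult_left_mono) auto
      ultimately show ?thesis using elim by simp
    qed
    have box: "cbox (X *\<^sub>R l) (X *\<^sub>R r) = {x. \<forall>i. x $ i \<in> {X * l $ i..X * r $ i}}"
      by (simp add: cbox_eq_Collect)
    have "VX X 0 = of_real (LINT x:cbox (X *\<^sub>R l) (X *\<^sub>R r)|lborel. \<Prod>i\<in>UNIV. deriv \<Psi> (x $ i))"
      unfolding VX_def by (simp add: set_integral_complex_of_real del: of_real_prod)
    also have "(LINT x:cbox (X *\<^sub>R l) (X *\<^sub>R r)|lborel. \<Prod>i\<in>UNIV. deriv \<Psi> (x $ i)) = (\<Prod>i\<in>UNIV. LINT y:{X * l $ i..X * r $ i}|lborel. deriv \<Psi> y)"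
      unfolding box
    proof (rule set_integral_vec_prod(2)[where \<phi> = "\<lambda>_. deriv \<Psi>" and S = "\<lambda>i. {X * l $ i..X * r $ i}"])
      fix i y assume "y \<in> {X * l $ i..X * r $ i}"
      then show "0 \<le> deriv \<Psi> y" using lo'[of i y] pos by auto
    qed (rule int)
    finally have V: "VX X 0 = of_real (\<Prod>i\<in>UNIV. LINT y:{X * l $ i..X * r $ i}|lborel. deriv \<Psi> y)" .
    have "(2 * \<rho> / G) ^ CARD('n) * A a X ^ CARD('n) = (\<Prod>i\<in>(UNIV::'n set). 2 * \<rho> / G * A a X)"
      unfolding power_mult_distrib[symmetric] by simp
    also have "\<dots> \<le> (\<Prod>i\<in>UNIV. LINT y:{X * l $ i..X * r $ i}|lborel. deriv \<Psi> y)"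
      using each \<rho> G AX by (intro prod_mono) auto
    also have "\<dots> \<le> norm (VX X 0)" unfolding V norm_of_real by simp
    finally show ?case .
  qed
  then show ?thesis using that[of "(2 * \<rho> / G) ^ CARD('n)"] \<rho> G by simp
qed

text \<open>
  For given \<open>q\<close> choose \<open>X\<close> with \<open>PX X = q\<close>.  Comparing the Weyl bound with the major arc approximation at the
  single point \<open>b/q\<close> bounds the complete sum.
\<close>

lemma S_sum_bound:
  obtains C q0 where "C \<ge> 0" "\<And>q b. q \<ge> q0 \<Longrightarrow> coprime b q \<Longrightarrow> norm (S_sum F \<kappa> q b) \<le> C * real q powr (-(17/8))"
proof -
  obtain Cm where Cm: "Cm \<ge> 0" and evm: "\<forall>\<^sub>F X in at_top. \<forall>q b \<beta>. 1 \<le> q \<longrightarrow> real q \<le> PX X \<longrightarrow> \<bar>\<beta>\<bar> \<le> PX X / X\<^sup>2 \<longrightarrow>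
     norm (exp_sum F a l r X (real b / real q + \<beta>) - S_sum F \<kappa> q b * VX X \<beta>) \<le> Cm * (A a X ^ CARD('n) * ln X powr (- err))"
    by (rule major_estimate)
  obtain Cw and H :: nat where Cw: "Cw \<ge> 0" "H \<ge> 1" and evw: "\<forall>\<^sub>F X in at_top. \<forall>q b \<beta>. coprime b (int q) \<longrightarrow> 1 \<le> q \<longrightarrow> q \<le> 2 * H * nat \<lfloor>X * real \<Lambda>\<rfloor> \<longrightarrow>
     \<bar>\<beta>\<bar> \<le> 1 / (2 * real (H * nat \<lfloor>X * real \<Lambda>\<rfloor>) * real q) \<longrightarrow>
     norm (exp_sum F a l r X (of_int b / real q + \<beta>)) \<le> Cw * (A a X ^ CARD('n) * ln X powr (5 * c)) * (real q * (1 + X\<^sup>2 * \<bar>\<beta>\<bar>)) powr (-(9/4))"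
    by (rule weyl_estimate_eventually)
  obtain v where v: "v > 0" and evv: "\<forall>\<^sub>F X in at_top. v * A a X ^ CARD('n) \<le> norm (VX X 0)"
    by (rule VX_lower)
  define C where "C = (Cw * 2 powr (5 * c) + Cm) / v"
  \<comment> \<open>The solution X of (ln X / 2)^B = q.\<close>
  define Y where "Y q = exp (2 * real q powr (1 / B))" for q :: nat
  have "filterlim (\<lambda>q::nat. real q powr (1 / B)) at_top sequentially"
    by (rule filterlim_compose[OF real_powr_at_top filterlim_real_sequentially]) (use Bpos in simp)
  then have "filterlim (\<lambda>q::nat. 2 * real q powr (1 / B)) at_top sequentially"
    by (rule filterlim_tendsto_pos_mult_at_top[OF tendsto_const, rotated]) simp
  then have Ylim: "filterlim Y at_top sequentially"
    unfolding Y_def by (rule filterlim_compose[OF exp_at_top])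
  have A1: "\<forall>\<^sub>F X in at_top. 1 \<le> A a X" using A by (simp add: filterlim_at_top)
  have "\<forall>\<^sub>F q in sequentially. \<forall>b. coprime b q \<longrightarrow> norm (S_sum F \<kappa> q b) \<le> C * real q powr (-(17/8))"
    using eventually_compose_filterlim[OF evm Ylim] eventually_compose_filterlim[OF evw Ylim]
      eventually_compose_filterlim[OF evv Ylim] eventually_compose_filterlim[OF PX_bounds Ylim]
      eventually_compose_filterlim[OF A1 Ylim] eventually_ge_at_top[of 1]
  proof eventually_elim
    case (elim q)
    define X where "X = Y q"
    have q: "1 \<le> q" using elim by simp
    have lnX: "ln X = 2 * real q powr (1 / B)" by (simp add: X_def Y_def)
    have PXq: "PX X = real q" using q Bpos by (simp add: PX_def lnX powr_powr)
    have b: "PX X \<le> X" "X \<ge> 4" using elim by (auto simp: X_def)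
    have AX: "A a X ^ CARD('n) > 0" using elim by (auto simp: X_def intro!: zero_less_power)
    show ?case
    proof (intro allI impI)
      fix b :: nat assume bq: "coprime b q"
      have "X * 2 \<le> X * real \<Lambda>" using b \<Lambda> by (intro mult_left_mono) auto
      then have "real q \<le> real (nat \<lfloor>X * real \<Lambda>\<rfloor>)" using b PXq by linarith
      then have "q \<le> nat \<lfloor>X * real \<Lambda>\<rfloor>" by simp
      also have "\<dots> \<le> 2 * H * nat \<lfloor>X * real \<Lambda>\<rfloor>" using Cw by simp
      finally have qH: "q \<le> 2 * H * nat \<lfloor>X * real \<Lambda>\<rfloor>" .
      have "norm (exp_sum F a l r X (of_int (int b) / real q + 0)) \<le> Cw * (A a X ^ CARD('n) * ln X powr (5 * c)) * (real q * (1 + X\<^sup>2 * \<bar>0\<bar>)) powr (-(9/4))"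
        using elim(2)[folded X_def, rule_format, of "int b" q 0] q bq qH by simp
      then have w: "norm (exp_sum F a l r X (real b / real q + 0)) \<le> Cw * (A a X ^ CARD('n) * ln X powr (5 * c)) * real q powr (-(9/4))"
        by simp
      have mj: "norm (exp_sum F a l r X (real b / real q + 0) - S_sum F \<kappa> q b * VX X 0) \<le> Cm * (A a X ^ CARD('n) * ln X powr (- err))"
        using elim(1)[folded X_def, rule_format, of q 0 b] q PXq by simp
      have vv: "v * A a X ^ CARD('n) \<le> norm (VX X 0)" using elim(3) by (simp add: X_def)
      have "norm (S_sum F \<kappa> q b) * (v * A a X ^ CARD('n)) \<le> norm (S_sum F \<kappa> q b) * norm (VX X 0)"
        using vv by (intro mult_left_mono) auto
      also have "\<dots> = norm (S_sum F \<kappa> q b * VX X 0)" by (simp add: norm_mult)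
      also have "\<dots> \<le> norm (exp_sum F a l r X (real b / real q + 0)) + norm (exp_sum F a l r X (real b / real q + 0) - S_sum F \<kappa> q b * VX X 0)"
        using norm_triangle_ineq4[of "exp_sum F a l r X (real b / real q + 0)" "exp_sum F a l r X (real b / real q + 0) - S_sum F \<kappa> q b * VX X 0"] by simp
      also have "\<dots> \<le> Cw * (A a X ^ CARD('n) * ln X powr (5 * c)) * real q powr (-(9/4)) + Cm * (A a X ^ CARD('n) * ln X powr (- err))"
        using w mj by linarith
      also have "\<dots> \<le> (Cw * 2 powr (5 * c) + Cm) * real q powr (-(17/8)) * A a X ^ CARD('n)"
      proof -
        \<comment> \<open>ln X is 2 q^(1/B), so the loss (ln X)^(5c) is a constant times q^(5c/B)
          \<le> q^(1/8), and 17/8 = 9/4 - 1/8.\<close>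
        have L5: "ln X powr (5 * c) * real q powr (-(9/4)) \<le> 2 powr (5 * c) * real q powr (-(17/8))"
        proof -
          have "ln X powr (5 * c) = 2 powr (5 * c) * real q powr (5 * c / B)"
            by (simp add: lnX powr_mult powr_powr)
          moreover have "real q powr (5 * c / B) * real q powr (-(9/4)) = real q powr (5 * c / B - 9/4)"
            by (simp add: powr_add[symmetric])
          moreover have "real q powr (5 * c / B - 9/4) \<le> real q powr (-(17/8))"
          proof (rule powr_mono)
            have "5 * c / B \<le> 1/8" using B(2) Bpos by (simp add: field_simps)
            then show "5 * c / B - 9/4 \<le> -(17/8)" by simp
          qed (use q in simp)
          ultimately show ?thesis by (simp add: mult.assoc)
        qed
        \<comment> \<open>err / B is at least 3, so the major arc error is well below the target
          exponent 17/8.\<close>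
        have Le: "ln X powr (- err) \<le> real q powr (-(17/8))"
        proof -
          have e0: "err \<ge> 0" "err / B \<ge> 17/8" using Bpos K by (auto simp: err_def field_simps)
          have "ln X powr (- err) \<le> (real q powr (1 / B)) powr (- err)"
            unfolding lnX using q e0 by (intro powr_mono2') auto
          also have "\<dots> = real q powr (- (err / B))" by (simp add: powr_powr)
          also have "\<dots> \<le> real q powr (-(17/8))" using q e0 by (intro powr_mono) auto
          finally show ?thesis .
        qed
        have "Cw * (A a X ^ CARD('n) * ln X powr (5 * c)) * real q powr (-(9/4)) = (Cw * A a X ^ CARD('n)) * (ln X powr (5 * c) * real q powr (-(9/4)))"
          by simp
        also have "\<dots> \<le> (Cw * A a X ^ CARD('n)) * (2 powr (5 * c) * real q powr (-(17/8)))"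
          using L5 Cw AX by (intro mult_left_mono) auto
        finally have 1: "Cw * (A a X ^ CARD('n) * ln X powr (5 * c)) * real q powr (-(9/4)) \<le> (Cw * A a X ^ CARD('n)) * (2 powr (5 * c) * real q powr (-(17/8)))" .
        have 2: "Cm * (A a X ^ CARD('n) * ln X powr (- err)) \<le> Cm * (A a X ^ CARD('n) * real q powr (-(17/8)))"
          using Le Cm AX by (intro mult_left_mono) auto
        show ?thesis using 1 2 by (simp add: algebra_simps)
      qed
      finally have "norm (S_sum F \<kappa> q b) * v * A a X ^ CARD('n) \<le> (Cw * 2 powr (5 * c) + Cm) * real q powr (-(17/8)) * A a X ^ CARD('n)"
        by (simp only: mult.assoc)
      then have "norm (S_sum F \<kappa> q b) * v \<le> (Cw * 2 powr (5 * c) + Cm) * real q powr (-(17/8))"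
        using AX by (rule mult_right_le_imp_le)
      then show "norm (S_sum F \<kappa> q b) \<le> C * real q powr (-(17/8))" using v by (simp add: C_def field_simps)
    qed
  qed
  then obtain q0 where "\<And>q b. q \<ge> q0 \<Longrightarrow> coprime b q \<Longrightarrow> norm (S_sum F \<kappa> q b) \<le> C * real q powr (-(17/8))"
    unfolding eventually_at_top_linorder by blast
  moreover have "C \<ge> 0" using Cw Cm v by (simp add: C_def)
  ultimately show ?thesis using that by blast
qed

text \<open>At most q numerators b turn the exponent 17/8 into 9/8, which is still summable.\<close>

lemma series:
  shows "summable (\<lambda>q. B_term F t \<kappa> (Suc q))"
    and "\<exists>C\<ge>0. \<forall>\<^sub>F P in at_top. norm ((\<Sum>q=1..nat \<lfloor>P\<rfloor>. B_term F t \<kappa> q) - sing_series F t \<kappa>) \<le> C * P powr (-(1/16))"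
proof -
  obtain C q0 where C: "C \<ge> 0" and S: "\<And>q b. q \<ge> q0 \<Longrightarrow> coprime b q \<Longrightarrow> norm (S_sum F \<kappa> q b) \<le> C * real q powr (-(17/8))"
    using S_sum_bound by blast
  have Bt: "norm (B_term F t \<kappa> q) \<le> C * real q powr (-(9/8))" if q: "q \<ge> max q0 1" for q
  proof -
    have "norm (B_term F t \<kappa> q) \<le> (\<Sum>b | 1 \<le> b \<and> b \<le> q \<and> coprime b q. C * real q powr (-(17/8)))"
      unfolding B_term_def using q S by (intro order_trans[OF norm_sum] sum_mono) (auto simp: norm_mult)
    also have "\<dots> = real (card {b. 1 \<le> b \<and> b \<le> q \<and> coprime b q}) * (C * real q powr (-(17/8)))" by simp
    also have "\<dots> \<le> real q * (C * real q powr (-(17/8)))"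
    proof (intro mult_right_mono)
      have "card {b. 1 \<le> b \<and> b \<le> q \<and> coprime b q} \<le> card {1..q}" by (intro card_mono) auto
      then show "real (card {b. 1 \<le> b \<and> b \<le> q \<and> coprime b q}) \<le> real q" by simp
    qed (use C in auto)
    also have "\<dots> = C * (real q powr 1 * real q powr (-(17/8)))" by simp
    also have "real q powr 1 * real q powr (-(17/8)) = real q powr (-(9/8))" unfolding powr_add[symmetric] by simp
    finally show ?thesis .
  qed
  show "summable (\<lambda>q. B_term F t \<kappa> (Suc q))" by (rule powr_tail_bound(1)[OF C Bt])
  obtain C' where C': "C' \<ge> 0" "\<And>n. n \<ge> max q0 1 \<Longrightarrow> norm ((\<Sum>q=1..n. B_term F t \<kappa> q) - (\<Sum>q. B_term F t \<kappa> (Suc q))) \<le> C' * real (n + 1) powr (-(1/16))"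
    using powr_tail_bound(2)[OF C Bt] by blast
  have "\<forall>\<^sub>F P in at_top. norm ((\<Sum>q=1..nat \<lfloor>P\<rfloor>. B_term F t \<kappa> q) - sing_series F t \<kappa>) \<le> C' * P powr (-(1/16))"
    using eventually_ge_at_top[of "real (max q0 1)"]
  proof eventually_elim
    case (elim P)
    have "max q0 1 \<le> nat \<lfloor>P\<rfloor>" using elim by (simp add: le_nat_floor)
    then have "norm ((\<Sum>q=1..nat \<lfloor>P\<rfloor>. B_term F t \<kappa> q) - sing_series F t \<kappa>) \<le> C' * real (nat \<lfloor>P\<rfloor> + 1) powr (-(1/16))"
      unfolding sing_series_def by (rule C'(2))
    also have "\<dots> \<le> C' * P powr (-(1/16))"
    proof (intro mult_left_mono powr_mono2')
      show "0 < P" using elim by (auto intro: less_le_trans[of 0 1])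
      show "P \<le> real (nat \<lfloor>P\<rfloor> + 1)" by linarith
    qed (use C' in auto)
    finally show ?case .
  qed
  then show "\<exists>C\<ge>0. \<forall>\<^sub>F P in at_top. norm ((\<Sum>q=1..nat \<lfloor>P\<rfloor>. B_term F t \<kappa> q) - sing_series F t \<kappa>) \<le> C * P powr (-(1/16))"
    using C' by blast
qed

text \<open>\<open>VX\<close> after the substitution x = X u, divided by A(X)^s; in this
  normalisation the bounds are uniform in X.\<close>

definition "IX X \<gamma> = (LINT u:cbox l r|lborel. complex_of_real (weight a (deriv \<Psi>) X u) * e (\<gamma> * qform F u))"

lemma weight_bounds:
  obtains w1 w2 where "w1 > 0" "w2 > 0" "\<forall>\<^sub>F X in at_top. \<forall>u\<in>cbox l r. w1 \<le> weight a (deriv \<Psi>) X u \<and> weight a (deriv \<Psi>) X u \<le> w2"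
    "\<forall>\<^sub>F X in at_top. \<forall>i y. l $ i \<le> y \<longrightarrow> y \<le> r $ i \<longrightarrow> 0 \<le> X * deriv \<Psi> (X * y) / A a X \<and> X * deriv \<Psi> (X * y) / A a X \<le> w2"
proof -
  obtain G where G: "G \<ge> 1" and ev: "\<forall>\<^sub>F X in at_top. regular_at a \<Psi> m \<theta> (real \<Lambda>) G X \<and> residue_at a \<kappa> \<Psi> m \<theta> (real \<Lambda>) B G X"
    by (rule regular_residue)
  have ev2: "\<forall>\<^sub>F X in at_top. \<forall>i y. l $ i \<le> y \<longrightarrow> y \<le> r $ i \<longrightarrow> 1 / G \<le> X * deriv \<Psi> (X * y) / A a X \<and> X * deriv \<Psi> (X * y) / A a X \<le> G"
    using ev eventually_gt_at_top[of 0]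
  proof eventually_elim
    case (elim X)
    have AX: "1 \<le> A a X" using elim unfolding regular_at_def by auto
    show ?case
    proof (intro allI impI)
      fix i y assume "l $ i \<le> y" "y \<le> r $ i"
      then have "\<theta> \<le> y" "y \<le> real \<Lambda>" using \<theta>(1) \<theta>(3)[of i] \<Lambda>(2)[of i] by linarith+
      then have "A a X / (G * X) \<le> deriv \<Psi> (X * y)" "deriv \<Psi> (X * y) \<le> G * A a X / X"
        using elim unfolding regular_at_def by blast+
      then show "1 / G \<le> X * deriv \<Psi> (X * y) / A a X \<and> X * deriv \<Psi> (X * y) / A a X \<le> G"
        using AX G elim by (simp add: field_simps)
    qed
  qed
  \<comment> \<open>G^s bounds the whole weight, and because G \<ge> 1 it also bounds each single
    factor, which is the form in which the decay estimate takes its hypothesis.\<close>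
  define w2 where "w2 = G ^ CARD('n)"
  have Gw: "G \<le> w2" unfolding w2_def using G by (intro self_le_power) auto
  have "\<forall>\<^sub>F X in at_top. \<forall>u\<in>cbox l r. (1 / G) ^ CARD('n) \<le> weight a (deriv \<Psi>) X u \<and> weight a (deriv \<Psi>) X u \<le> w2"
    using ev2
  proof eventually_elim
    case (elim X)
    show ?case
    proof
      fix u assume "u \<in> cbox l r"
      then have h: "1 / G \<le> X * deriv \<Psi> (X * u $ i) / A a X \<and> X * deriv \<Psi> (X * u $ i) / A a X \<le> G" for i
        using elim by (auto simp: mem_box_cart)
      have g0: "0 \<le> 1 / G" using G by simp
      have "(\<Prod>i\<in>(UNIV::'n set). 1 / G) \<le> weight a (deriv \<Psi>) X u"
        unfolding weight_def using h g0 by (intro prod_mono) auto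
      moreover have "weight a (deriv \<Psi>) X u \<le> (\<Prod>i\<in>(UNIV::'n set). G)"
        unfolding weight_def using h g0 by (intro prod_mono) (auto intro: order_trans[OF g0])
      ultimately show "(1 / G) ^ CARD('n) \<le> weight a (deriv \<Psi>) X u \<and> weight a (deriv \<Psi>) X u \<le> w2"
        by (simp add: w2_def)
    qed
  qed
  moreover have "\<forall>\<^sub>F X in at_top. \<forall>i y. l $ i \<le> y \<longrightarrow> y \<le> r $ i \<longrightarrow> 0 \<le> X * deriv \<Psi> (X * y) / A a X \<and> X * deriv \<Psi> (X * y) / A a X \<le> w2"
    using ev2
  proof eventually_elim
    case (elim X)
    have "0 \<le> 1 / G" using G by simp
    then show ?case using elim Gw by (meson order_trans)
  qed
  ultimately show ?thesis using that[of "(1 / G) ^ CARD('n)" w2] G by (simp add: w2_def)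
qed

lemma deriv_cont: "continuous_on {0<..} (deriv \<Psi>)"
  using smooth_approximation_deriv(2)[OF \<Psi>] by (intro continuous_at_imp_continuous_on) auto

lemma weight_cont:
  assumes X: "X > 0"
  shows "continuous_on (cbox l r) (weight a (deriv \<Psi>) X)"
proof -
  have h: "continuous_on (cbox l r) (\<lambda>u. X * deriv \<Psi> (X * u $ i) / A a X)" for i
  proof -
    have "continuous_on (cbox l r) (\<lambda>u. deriv \<Psi> (X * u $ i))"
    proof (rule continuous_on_compose2[OF deriv_cont])
      show "(\<lambda>u. X * u $ i) ` cbox l r \<subseteq> {0<..}"
      proof (rule image_subsetI)
        fix u assume "u \<in> cbox l r"
        then have "l $ i \<le> u $ i" by (simp add: mem_box_cart)
        then show "X * u $ i \<in> {0<..}" using X l_pos[of i] by simp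
      qed
    qed (intro continuous_intros)
    then show ?thesis unfolding divide_inverse by (intro continuous_intros)
  qed
  have eq: "weight a (deriv \<Psi>) X = (\<lambda>u. \<Prod>i\<in>UNIV. X * deriv \<Psi> (X * u $ i) / A a X)"
    by (rule ext) (simp add: weight_def)
  show ?thesis unfolding eq by (intro continuous_on_prod h)
qed

lemma IX_decay:
  obtains C where "C \<ge> 0" "\<forall>\<^sub>F X in at_top. \<forall>\<gamma>. norm (IX X \<gamma>) \<le> C * (1 + \<bar>\<gamma>\<bar>) powr (-(9/4))"
proof -
  obtain w1 w2 where w: "w1 > 0" "w2 > 0" "\<forall>\<^sub>F X in at_top. \<forall>u\<in>cbox l r. w1 \<le> weight a (deriv \<Psi>) X u \<and> weight a (deriv \<Psi>) X u \<le> w2"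
    and ev: "\<forall>\<^sub>F X in at_top. \<forall>i y. l $ i \<le> y \<longrightarrow> y \<le> r $ i \<longrightarrow> 0 \<le> X * deriv \<Psi> (X * y) / A a X \<and> X * deriv \<Psi> (X * y) / A a X \<le> w2"
    by (rule weight_bounds)
  have \<Lambda>1: "1 \<le> \<Lambda>" using \<Lambda>(1) by simp
  show thesis
  proof (rule fourier_decay[OF F L1 l_pos \<Lambda>(2) \<Lambda>1])
    fix C :: real
    assume C: "C \<ge> 0" and
      dec: "\<And>\<phi> K \<gamma>. continuous_on {0<..} \<phi> \<Longrightarrow> (\<And>i y. l $ i \<le> y \<Longrightarrow> y \<le> r $ i \<Longrightarrow> 0 \<le> \<phi> y \<and> \<phi> y \<le> K) \<Longrightarrow> K \<ge> 0 \<Longrightarrow>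
        norm (LINT x:cbox l r|lborel. of_real (\<Prod>i\<in>UNIV. \<phi> (x $ i)) * e (\<gamma> * qform F x)) \<le> C * K ^ CARD('n) * (1 + \<bar>\<gamma>\<bar>) powr (-(9/4))"
    have evI: "\<forall>\<^sub>F X in at_top. \<forall>\<gamma>. norm (IX X \<gamma>) \<le> (C * w2 ^ CARD('n)) * (1 + \<bar>\<gamma>\<bar>) powr (-(9/4))"
      using ev eventually_gt_at_top[of 0]
    proof eventually_elim
      case (elim X)
      show ?case
      proof
        fix \<gamma>
        have cont: "continuous_on {0<..} (\<lambda>y. X * deriv \<Psi> (X * y) / A a X)"
        proof -
          have "continuous_on {0<..} (\<lambda>y. deriv \<Psi> (X * y))"
            by (rule continuous_on_compose2[OF deriv_cont]) (use elim in \<open>auto intro!: continuous_intros\<close>)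
          then show ?thesis unfolding divide_inverse by (intro continuous_intros)
        qed
        have bd: "\<And>i y. l $ i \<le> y \<Longrightarrow> y \<le> r $ i \<Longrightarrow> 0 \<le> X * deriv \<Psi> (X * y) / A a X \<and> X * deriv \<Psi> (X * y) / A a X \<le> w2"
          using elim by blast
        show "norm (IX X \<gamma>) \<le> (C * w2 ^ CARD('n)) * (1 + \<bar>\<gamma>\<bar>) powr (-(9/4))"
          unfolding IX_def weight_def by (rule dec[OF cont bd less_imp_le[OF w(2)]])
      qed
    qed
    have "C * w2 ^ CARD('n) \<ge> 0" using C w by simp
    then show thesis using evI by (rule that)
  qed
qed

text \<open>The form is homogeneous of degree two, so x = X u changes \<beta> into \<beta> X^2; the
  Jacobian X^s cancels against the normalisation of the weight.\<close>

lemma VX_IX: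
  assumes X: "X > 0" and AX: "A a X > 0"
  shows "VX X \<beta> = of_real (A a X ^ CARD('n)) * IX X (\<beta> * X\<^sup>2)"
proof -
  define g where "g x = complex_of_real (\<Prod>i\<in>UNIV. deriv \<Psi> (x $ i)) * e (\<beta> * qform F x)" for x :: "real^'n"
  define h where "h u = complex_of_real (weight a (deriv \<Psi>) X u) * e (\<beta> * X\<^sup>2 * qform F u)" for u :: "real^'n"
  have gh: "g (X *\<^sub>R u) = of_real (A a X ^ CARD('n) / X ^ CARD('n)) * h u" for u
  proof -
    have "weight a (deriv \<Psi>) X u = (\<Prod>i\<in>UNIV. X / A a X * deriv \<Psi> (X * u $ i))" by (simp add: weight_def)
    also have "\<dots> = (X / A a X) ^ CARD('n) * (\<Prod>i\<in>UNIV. deriv \<Psi> (X * u $ i))" by (simp only: prod.distrib prod_constant)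
    finally have "A a X ^ CARD('n) / X ^ CARD('n) * weight a (deriv \<Psi>) X u = (\<Prod>i\<in>UNIV. deriv \<Psi> (X * u $ i))"
      using X AX by (simp add: power_divide)
    then have "complex_of_real (\<Prod>i\<in>UNIV. deriv \<Psi> (X * u $ i)) = of_real (A a X ^ CARD('n) / X ^ CARD('n)) * of_real (weight a (deriv \<Psi>) X u)"
      by (metis of_real_mult)
    then show ?thesis by (simp add: g_def h_def qform_scaleR mult.assoc del: of_real_prod)
  qed
  have conth: "continuous_on (cbox l r) h"
    unfolding h_def by (intro continuous_intros continuous_e weight_cont X)
  have inth: "set_integrable lborel (cbox l r) h"
    unfolding set_integrable_def by (intro borel_integrable_compact conth compact_cbox)
  have contg: "continuous_on (cbox (X *\<^sub>R l) (X *\<^sub>R r)) g"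
  proof -
    have "continuous_on (cbox (X *\<^sub>R l) (X *\<^sub>R r)) (\<lambda>x. deriv \<Psi> (x $ i))" for i
    proof (rule continuous_on_compose2[OF deriv_cont])
      show "(\<lambda>x. x $ i) ` cbox (X *\<^sub>R l) (X *\<^sub>R r) \<subseteq> {0<..}"
      proof (rule image_subsetI)
        fix x assume "x \<in> cbox (X *\<^sub>R l) (X *\<^sub>R r)"
        then have "X * l $ i \<le> x $ i" by (simp add: mem_box_cart)
        moreover have "0 < X * l $ i" using X l_pos by simp
        ultimately have "0 < x $ i" by linarith
        then show "x $ i \<in> {0<..}" by simp
      qed
    qed (intro continuous_intros)
    then show ?thesis unfolding g_def by (intro continuous_intros continuous_e)
  qed
  have intg: "set_integrable lborel (cbox (X *\<^sub>R l) (X *\<^sub>R r)) g"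
    unfolding set_integrable_def by (intro borel_integrable_compact contg compact_cbox)
  have "(h has_integral (integral (cbox l r) h)) (cbox l r)"
    using set_borel_integral_eq_integral(1)[OF inth] by (simp add: has_integral_integral)
  then have "((\<lambda>u. g (X *\<^sub>R u + 0)) has_integral of_real (A a X ^ CARD('n) / X ^ CARD('n)) * integral (cbox l r) h) (cbox l r)"
    unfolding add_0_right gh by (rule has_integral_mult_right)
  also have "of_real (A a X ^ CARD('n) / X ^ CARD('n)) * integral (cbox l r) h = (of_real (A a X ^ CARD('n)) * integral (cbox l r) h) /\<^sub>R X ^ DIM(real^'n)"
    by (simp add: scaleR_conv_of_real divide_inverse mult_ac)
  also have "cbox l r = cbox ((X *\<^sub>R l - 0) /\<^sub>R X) ((X *\<^sub>R r - 0) /\<^sub>R X)" using X by simp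
  finally have "(g has_integral (of_real (A a X ^ CARD('n)) * integral (cbox l r) h)) (cbox (X *\<^sub>R l) (X *\<^sub>R r))"
    unfolding has_integral_affinity_iff[OF X] using X by simp
  then have "VX X \<beta> = of_real (A a X ^ CARD('n)) * integral (cbox l r) h"
    unfolding VX_def g_def[symmetric] using set_borel_integral_eq_integral(2)[OF intg] by (simp add: integral_unique)
  then show ?thesis unfolding IX_def h_def[symmetric] using set_borel_integral_eq_integral(2)[OF inth] by simp
qed

lemma IX_cont:
  assumes X: "X > 0" and dec: "\<And>x. x \<in> cbox l r \<Longrightarrow> 0 \<le> weight a (deriv \<Psi>) X x"
  shows "continuous_on UNIV (IX X)"
proof -
  have cw: "continuous_on (cbox l r) (weight a (deriv \<Psi>) X)" by (rule weight_cont[OF X])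
  have I: "IX X \<gamma> = integral (cbox l r) (\<lambda>u. complex_of_real (weight a (deriv \<Psi>) X u) * e (\<gamma> * qform F u))" for \<gamma>
    unfolding IX_def
    by (rule set_borel_integral_eq_integral(2))
      (auto simp: set_integrable_def intro!: borel_integrable_compact continuous_intros continuous_e cw)
  have "continuous_on UNIV (\<lambda>\<gamma>. integral (cbox l r) (\<lambda>u. complex_of_real (weight a (deriv \<Psi>) X u) * e (\<gamma> * qform F u)))"
  proof (rule integral_continuous_on_param)
    have "continuous_on (UNIV \<times> cbox l r) (\<lambda>x. weight a (deriv \<Psi>) X (snd x))"
      by (rule continuous_on_compose2[OF cw]) (auto intro!: continuous_intros)
    then have "continuous_on (UNIV \<times> cbox l r) (\<lambda>x. complex_of_real (weight a (deriv \<Psi>) X (snd x)) * e (fst x * qform F (snd x)))"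
      by (intro continuous_intros continuous_e)
    then show "continuous_on (UNIV \<times> cbox l r) (\<lambda>(\<gamma>, u). complex_of_real (weight a (deriv \<Psi>) X u) * e (\<gamma> * qform F u))"
      by (simp add: case_prod_beta)
  qed
  then show ?thesis by (simp only: I[abs_def])
qed

text \<open>The cut-off \<open>P\<close> is a parameter because the circle method produces it at
  \<open>PX X\<close>, whereas \<open>sing_integral\<close> is truncated at
  \<open>ln X powr B\<close>.\<close>

definition "JX X t P = integral {-P..P} (\<lambda>\<gamma>. IX X \<gamma> * e (- (\<gamma> * (of_int t / X\<^sup>2))))"

lemma integral_VX:
  assumes X: "X > 0" and AX: "A a X > 0" and dec: "\<And>x. x \<in> cbox l r \<Longrightarrow> 0 \<le> weight a (deriv \<Psi>) X x"
  shows "integral {-(P/X\<^sup>2)..P/X\<^sup>2} (\<lambda>\<beta>. VX X \<beta> * e (- (\<beta> * of_int t))) = of_real (A a X ^ CARD('n) / X\<^sup>2) * JX X t P"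
proof -
  define h where "h \<gamma> = IX X \<gamma> * e (- (\<gamma> * (of_int t / X\<^sup>2)))" for \<gamma>
  have X2: "X\<^sup>2 > 0" using X by simp
  have conth: "continuous_on UNIV h" unfolding h_def by (intro continuous_intros continuous_e IX_cont X dec)
  have "(h has_integral JX X t P) {-P..P}"
    unfolding JX_def h_def[symmetric]
    by (intro integrable_integral integrable_continuous_interval continuous_on_subset[OF conth]) auto
  then have "(h has_integral JX X t P) (cbox (-P) P)" by simp
  then have "((\<lambda>\<beta>. h (X\<^sup>2 *\<^sub>R \<beta> + 0)) has_integral JX X t P /\<^sub>R (X\<^sup>2) ^ DIM(real)) (cbox ((- P - 0) /\<^sub>R X\<^sup>2) ((P - 0) /\<^sub>R X\<^sup>2))"
    by (rule has_integral_affinity'[OF _ X2])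
  then have "((\<lambda>\<beta>. h (X\<^sup>2 * \<beta>)) has_integral JX X t P /\<^sub>R X\<^sup>2) {-(P/X\<^sup>2)..P/X\<^sup>2}"
    by (simp add: divide_inverse mult.commute)
  then have "((\<lambda>\<beta>. of_real (A a X ^ CARD('n)) * h (X\<^sup>2 * \<beta>)) has_integral of_real (A a X ^ CARD('n)) * (JX X t P /\<^sub>R X\<^sup>2)) {-(P/X\<^sup>2)..P/X\<^sup>2}"
    by (rule has_integral_mult_right)
  moreover have "of_real (A a X ^ CARD('n)) * h (X\<^sup>2 * \<beta>) = VX X \<beta> * e (- (\<beta> * of_int t))" for \<beta>
    using X by (simp add: h_def VX_IX[OF X AX] mult_ac)
  moreover have "of_real (A a X ^ CARD('n)) * (JX X t P /\<^sub>R X\<^sup>2) = of_real (A a X ^ CARD('n) / X\<^sup>2) * JX X t P"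
    by (simp add: scaleR_conv_of_real divide_inverse mult_ac)
  ultimately show ?thesis by (simp add: integral_unique)
qed

lemma sing_integral_JX:
  assumes X: "X > 0" and AX: "A a X > 0"
  shows "sing_integral F t (deriv \<Psi>) B (cbox l r) X = of_real (A a X ^ CARD('n) / X\<^sup>2) * JX X t (ln X powr B)"
proof -
  have cw: "continuous_on (cbox l r) (weight a (deriv \<Psi>) X)" by (rule weight_cont[OF X])
  define k where "k = A a X ^ CARD('n) / X ^ CARD('n)"
  have wk: "(\<Prod>i\<in>UNIV. deriv \<Psi> (X * u $ i)) = k * weight a (deriv \<Psi>) X u" for u :: "real^'n"
  proof -
    have "weight a (deriv \<Psi>) X u = (\<Prod>i\<in>UNIV. X / A a X * deriv \<Psi> (X * u $ i))" by (simp add: weight_def)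
    also have "\<dots> = (X / A a X) ^ CARD('n) * (\<Prod>i\<in>UNIV. deriv \<Psi> (X * u $ i))" by (simp only: prod.distrib prod_constant)
    finally show ?thesis using X AX by (simp add: k_def power_divide)
  qed
  have I: "IX X \<gamma> = integral (cbox l r) (\<lambda>u. complex_of_real (weight a (deriv \<Psi>) X u) * e (\<gamma> * qform F u))" for \<gamma>
    unfolding IX_def
    by (rule set_borel_integral_eq_integral(2))
      (auto simp: set_integrable_def intro!: borel_integrable_compact continuous_intros continuous_e cw)
  have "integral (cbox l r) (\<lambda>u. complex_of_real (\<Prod>i\<in>UNIV. deriv \<Psi> (X * u $ i)) * e (\<gamma> * qform F u) * e (- (\<gamma> * (of_int t / X\<^sup>2))))
    = of_real k * (IX X \<gamma> * e (- (\<gamma> * (of_int t / X\<^sup>2))))" for \<gamma>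
  proof -
    have "integral (cbox l r) (\<lambda>u. complex_of_real (\<Prod>i\<in>UNIV. deriv \<Psi> (X * u $ i)) * e (\<gamma> * qform F u) * e (- (\<gamma> * (of_int t / X\<^sup>2))))
      = integral (cbox l r) (\<lambda>u. (of_real k * e (- (\<gamma> * (of_int t / X\<^sup>2)))) * (complex_of_real (weight a (deriv \<Psi>) X u) * e (\<gamma> * qform F u)))"
      by (intro integral_cong) (simp only: wk of_real_mult mult_ac)
    also have "\<dots> = (of_real k * e (- (\<gamma> * (of_int t / X\<^sup>2)))) * IX X \<gamma>" unfolding I by (rule integral_mult_right)
    finally show ?thesis by (simp add: mult_ac)
  qed
  then have "sing_integral F t (deriv \<Psi>) B (cbox l r) X = of_real (X ^ CARD('n) / X\<^sup>2) * integral {- (ln X powr B)..ln X powr B} (\<lambda>\<gamma>. of_real k * (IX X \<gamma> * e (- (\<gamma> * (of_int t / X\<^sup>2)))))"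
    unfolding sing_integral_def by (simp only:)
  also have "\<dots> = of_real (X ^ CARD('n) / X\<^sup>2) * (of_real k * JX X t (ln X powr B))"
    unfolding JX_def by (simp only: integral_mult_right)
  also have "\<dots> = of_real (X ^ CARD('n) / X\<^sup>2 * k) * JX X t (ln X powr B)" by simp
  also have "X ^ CARD('n) / X\<^sup>2 * k = A a X ^ CARD('n) / X\<^sup>2" using X by (simp add: k_def)
  finally show ?thesis .
qed

text \<open>The weight is real, so conjugation amounts to changing the sign of \<gamma>, and the
  range of integration is symmetric.\<close>

lemma JX_real: "P \<ge> 0 \<Longrightarrow> X > 0 \<Longrightarrow> (\<And>x. x \<in> cbox l r \<Longrightarrow> 0 \<le> weight a (deriv \<Psi>) X x) \<Longrightarrow> JX X t P \<in> \<real>"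
proof -
  assume P: "P \<ge> 0" and X: "X > 0" and dec: "\<And>x. x \<in> cbox l r \<Longrightarrow> 0 \<le> weight a (deriv \<Psi>) X x"
  define h where "h \<gamma> = IX X \<gamma> * e (- (\<gamma> * (of_int t / X\<^sup>2)))" for \<gamma>
  have conth: "continuous_on UNIV h" unfolding h_def by (intro continuous_intros continuous_e IX_cont X dec)
  have inth: "h integrable_on {-P..P}" by (intro integrable_continuous_interval continuous_on_subset[OF conth]) auto
  have IXc: "cnj (IX X \<gamma>) = IX X (- \<gamma>)" for \<gamma>
  proof -
    have "cnj (IX X \<gamma>) = (CLINT u|lborel. cnj (indicat_real (cbox l r) u *\<^sub>R (complex_of_real (weight a (deriv \<Psi>) X u) * e (\<gamma> * qform F u))))"
      unfolding IX_def set_lebesgue_integral_def by (rule Bochner_Integration.integral_cnj[symmetric])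
    also have "\<dots> = IX X (- \<gamma>)" unfolding IX_def set_lebesgue_integral_def
      by (intro Bochner_Integration.integral_cong refl) (simp add: e_neg[symmetric])
    finally show ?thesis .
  qed
  have hc: "cnj (h \<gamma>) = h (- \<gamma>)" for \<gamma> by (simp add: h_def IXc e_neg[symmetric])
  have "cnj (JX X t P) = integral {-P..P} (\<lambda>\<gamma>. cnj (h \<gamma>))"
    unfolding JX_def h_def[symmetric] by (rule integral_cnj)
  also have "\<dots> = integral {-P..P} (\<lambda>\<gamma>. h (- \<gamma>))" by (simp only: hc)
  also have "\<dots> = integral {-P..P} h" using Henstock_Kurzweil_Integration.integral_reflect_real[of P "-P" h] by simp
  also have "\<dots> = JX X t P" by (simp only: JX_def h_def[abs_def])
  finally show ?thesis by (simp add: Reals_cnj_iff)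
qed

lemma PX_powr:
  assumes "ln X \<ge> 2" "s \<ge> 0" "k \<le> B * s"
  shows "PX X powr (- s) \<le> 2 powr (B * s) * ln X powr (- k)"
proof -
  have "PX X powr (- s) = (ln X / 2) powr (- (B * s))" by (simp add: PX_def powr_powr)
  also have "\<dots> = 2 powr (B * s) * ln X powr (- (B * s))"
    using assms by (simp add: powr_divide powr_minus_divide)
  also have "\<dots> \<le> 2 powr (B * s) * ln X powr (- k)" using assms by (intro mult_left_mono powr_mono) auto
  finally show ?thesis .
qed

text \<open>\<open>circle_method\<close> with Y = X^2 and D = 2HN, the value for which Dirichlet
  approximation delivers exactly the range of the Weyl estimate. Integrality of the form on integer
  vectors makes its values admissible frequencies.\<close>

lemma R_count_estimate:
  obtains C where "C \<ge> 0" "\<forall>\<^sub>F X in at_top. norm (complex_of_real (R_count F t a X (cbox l r)) -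
      (\<Sum>q=1..nat \<lfloor>PX X\<rfloor>. B_term F t \<kappa> q) * (of_real (A a X ^ CARD('n) / X\<^sup>2) * JX X t (PX X)))
      \<le> C * (A a X ^ CARD('n) / X\<^sup>2 * ln X powr (- K))"
proof -
  obtain Cm where Cm: "Cm \<ge> 0" and evm: "\<forall>\<^sub>F X in at_top. \<forall>q b \<beta>. 1 \<le> q \<longrightarrow> real q \<le> PX X \<longrightarrow> \<bar>\<beta>\<bar> \<le> PX X / X\<^sup>2 \<longrightarrow>
     norm (exp_sum F a l r X (real b / real q + \<beta>) - S_sum F \<kappa> q b * VX X \<beta>) \<le> Cm * (A a X ^ CARD('n) * ln X powr (- err))"
    by (rule major_estimate)
  obtain Cw and H :: nat where Cw: "Cw \<ge> 0" "H \<ge> 1" and evw: "\<forall>\<^sub>F X in at_top. \<forall>q b \<beta>. coprime b (int q) \<longrightarrow> 1 \<le> q \<longrightarrow> q \<le> 2 * H * nat \<lfloor>X * real \<Lambda>\<rfloor> \<longrightarrow>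
     \<bar>\<beta>\<bar> \<le> 1 / (2 * real (H * nat \<lfloor>X * real \<Lambda>\<rfloor>) * real q) \<longrightarrow>
     norm (exp_sum F a l r X (of_int b / real q + \<beta>)) \<le> Cw * (A a X ^ CARD('n) * ln X powr (5 * c)) * (real q * (1 + X\<^sup>2 * \<bar>\<beta>\<bar>)) powr (-(9/4))"
    by (rule weyl_estimate_eventually)
  obtain w1 w2 where w1: "w1 > 0" and evweight: "\<forall>\<^sub>F X in at_top. \<forall>u\<in>cbox l r. w1 \<le> weight a (deriv \<Psi>) X u \<and> weight a (deriv \<Psi>) X u \<le> w2"
    by (rule weight_bounds)
  define C where "C = 2 * Cm + 36 * Cw * 2 powr (B * (1/4))"
  have evA: "\<forall>\<^sub>F X in at_top. 1 \<le> A a X" using A by (simp add: filterlim_at_top)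
  have "\<forall>\<^sub>F X in at_top. norm (complex_of_real (R_count F t a X (cbox l r)) -
      (\<Sum>q=1..nat \<lfloor>PX X\<rfloor>. B_term F t \<kappa> q) * (of_real (A a X ^ CARD('n) / X\<^sup>2) * JX X t (PX X)))
      \<le> C * (A a X ^ CARD('n) / X\<^sup>2 * ln X powr (- K))"
    using evm evw evweight evA PX_bounds eventually_ge_at_top[of "real (2 * H * \<Lambda>)"]
  proof eventually_elim
    case (elim X)
    have X: "X \<ge> 4" "X > 0" and L: "ln X \<ge> 2" and AX: "A a X \<ge> 1" "A a X > 0"
      and P: "1 \<le> PX X" "PX X \<le> ln X powr B" "4 * PX X ^ 3 \<le> X\<^sup>2" and XH: "real (2 * H * \<Lambda>) \<le> X" using elim by auto
    have w0: "\<And>u. u \<in> cbox l r \<Longrightarrow> 0 \<le> weight a (deriv \<Psi>) X u" using elim(3) w1 by fastforce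
    define \<Omega> :: "(int^'n) set" where "\<Omega> = vbox UNIV (\<lambda>i. {n. X * l $ i \<le> of_int n \<and> of_int n \<le> X * r $ i})"
    define g where "g x = complex_of_real (\<Prod>i\<in>UNIV. a (nat (x $ i)))" for x :: "int^'n"
    define k where "k x = \<lfloor>qform F (ivec x)\<rfloor>" for x
    define N where "N = nat \<lfloor>X * real \<Lambda>\<rfloor>"
    have kq: "of_int (k x) = qform F (ivec x)" for x
      using qform_ivec_Ints[OF F, of x] by (auto simp: k_def elim!: Ints_cases)
    have T: "(\<Sum>x\<in>\<Omega>. g x * e (\<alpha> * of_int (k x))) = exp_sum F a l r X \<alpha>" for \<alpha>
      unfolding exp_sum_def \<Omega>_def g_def kq by (rule refl)
    have N1: "1 \<le> N" "real N \<le> X * real \<Lambda>"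
    proof -
      have "4 * 2 \<le> X * real \<Lambda>" using X \<Lambda>(1) by (intro mult_mono) auto
      then show "1 \<le> N" "real N \<le> X * real \<Lambda>" unfolding N_def by linarith+
    qed
    have D1: "1 \<le> 2 * H * N" using Cw(2) N1 by (metis One_nat_def Suc_leI mult_pos_pos pos2 less_le_trans zero_less_one)
    have lnD0: "0 \<le> 1 + ln (real (2 * H * N))"
      using ln_ge_zero[of "real (2 * H * N)"] D1 by linarith
    have lnD: "1 + ln (real (2 * H * N)) \<le> 3 * ln X"
    proof -
      have "real (2 * H * N) = real (2 * H) * real N" by simp
      also have "\<dots> \<le> real (2 * H) * (X * real \<Lambda>)" using N1 by (intro mult_left_mono) auto
      also have "\<dots> = real (2 * H * \<Lambda>) * X" by simp
      also have "\<dots> \<le> X * X" using XH X by (intro mult_right_mono) auto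
      finally have "ln (real (2 * H * N)) \<le> ln (X * X)" using D1 by (subst ln_le_cancel_iff) (use X in auto)
      then show ?thesis using X L by (simp add: ln_mult)
    qed
    have "norm ((\<Sum>x | x \<in> \<Omega> \<and> k x = t. g x) -
      (\<Sum>q=1..nat \<lfloor>PX X\<rfloor>. \<Sum>b | 1 \<le> b \<and> b \<le> q \<and> coprime b q. S_sum F \<kappa> q b * e (- (real b / real q * of_int t)))
        * integral {-(PX X/X\<^sup>2)..PX X/X\<^sup>2} (\<lambda>\<beta>. VX X \<beta> * e (- (\<beta> * of_int t))))
      \<le> 2 * PX X ^ 3 / X\<^sup>2 * (Cm * (A a X ^ CARD('n) * ln X powr (- err)))
        + 12 * (Cw * (A a X ^ CARD('n) * ln X powr (5 * c))) * PX X powr (-(1/4)) * (1 + ln (real (2 * H * N))) / X\<^sup>2"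
    proof (rule circle_method)
      show "finite \<Omega>" unfolding \<Omega>_def by (intro finite_vbox finite_int_between)
      show "0 \<le> Cw * (A a X ^ CARD('n) * ln X powr (5 * c))" using Cw AX by simp
      show "0 \<le> Cm * (A a X ^ CARD('n) * ln X powr (- err))" using Cm AX by simp
      show "continuous_on UNIV (VX X)"
      proof -
        have "continuous_on UNIV (\<lambda>\<beta>. of_real (A a X ^ CARD('n)) * IX X (\<beta> * X\<^sup>2))"
          by (intro continuous_intros continuous_on_compose2[OF IX_cont[OF X(2) w0]]) auto
        moreover have "VX X = (\<lambda>\<beta>. of_real (A a X ^ CARD('n)) * IX X (\<beta> * X\<^sup>2))"
          by (rule ext) (rule VX_IX[OF X(2) AX(2)])
        ultimately show ?thesis by (simp only:)
      qed
    next
      fix q b \<beta> assume h: "1 \<le> q" "q \<le> 2 * H * N" "coprime b (int q)" "\<bar>\<beta>\<bar> \<le> 1 / (real (2 * H * N) * real q)"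
      have "real (2 * H * N) = 2 * real (H * N)" by simp
      then have "\<bar>\<beta>\<bar> \<le> 1 / (2 * real (H * N) * real q)" using h(4) by (simp only:)
      then show "norm (\<Sum>x\<in>\<Omega>. g x * e ((of_int b / real q + \<beta>) * of_int (k x)))
         \<le> Cw * (A a X ^ CARD('n) * ln X powr (5 * c)) * (real q * (1 + X\<^sup>2 * \<bar>\<beta>\<bar>)) powr (-(9/4))"
        unfolding T using elim(2) h(1-3) unfolding N_def by blast
    next
      fix q b \<beta> assume "1 \<le> q" "real q \<le> PX X" "\<bar>\<beta>\<bar> \<le> PX X / X\<^sup>2"
      then show "norm ((\<Sum>x\<in>\<Omega>. g x * e ((real b / real q + \<beta>) * of_int (k x))) - S_sum F \<kappa> q b * VX X \<beta>) \<le> Cm * (A a X ^ CARD('n) * ln X powr (- err))"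
        unfolding T using elim(1) by blast
    qed (use P D1 in auto)
    moreover have "(\<Sum>x | x \<in> \<Omega> \<and> k x = t. g x) = complex_of_real (R_count F t a X (cbox l r))"
    proof -
      have "ivec x \<in> (\<lambda>v. X *\<^sub>R v) ` cbox l r \<longleftrightarrow> x \<in> \<Omega>" for x
      proof
        assume "ivec x \<in> (\<lambda>v. X *\<^sub>R v) ` cbox l r"
        then obtain v where v: "v \<in> cbox l r" "ivec x = X *\<^sub>R v" by blast
        have "of_int (x $ i) = X * v $ i" for i using v(2) by (simp add: ivec_def vec_eq_iff)
        then show "x \<in> \<Omega>" using v(1) X by (auto simp: \<Omega>_def vbox_def mem_box_cart)
      next
        assume x: "x \<in> \<Omega>"
        have "(1 / X) *\<^sub>R ivec x \<in> cbox l r"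
          using x X by (auto simp: \<Omega>_def vbox_def mem_box_cart ivec_def field_simps)
        moreover have "ivec x = X *\<^sub>R ((1 / X) *\<^sub>R ivec x)" using X by simp
        ultimately show "ivec x \<in> (\<lambda>v. X *\<^sub>R v) ` cbox l r" by blast
      qed
      moreover have "k x = t \<longleftrightarrow> qform F (ivec x) = of_int t" for x
        unfolding kq[symmetric] by simp
      ultimately show ?thesis unfolding R_count_def g_def of_real_sum by simp
    qed
    moreover note integral_VX[OF X(2) AX(2) w0]
    moreover have "2 * PX X ^ 3 / X\<^sup>2 * (Cm * (A a X ^ CARD('n) * ln X powr (- err))) \<le> 2 * Cm * (A a X ^ CARD('n) / X\<^sup>2 * ln X powr (- K))"
    proof -
      have "PX X ^ 3 \<le> (ln X powr B) ^ 3" using P by (intro power_mono) auto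
      also have "\<dots> = ln X powr (3 * B)" using L by (simp add: powr_powr mult.commute flip: powr_realpow)
      finally have "2 * PX X ^ 3 / X\<^sup>2 * (Cm * (A a X ^ CARD('n) * ln X powr (- err))) \<le> 2 * ln X powr (3 * B) / X\<^sup>2 * (Cm * (A a X ^ CARD('n) * ln X powr (- err)))"
        using Cm AX by (intro mult_right_mono divide_right_mono mult_left_mono) auto
      also have "\<dots> = 2 * Cm * (A a X ^ CARD('n) / X\<^sup>2 * (ln X powr (3 * B) * ln X powr (- err)))" by simp
      also have "ln X powr (3 * B) * ln X powr (- err) = ln X powr (- K)"
        by (simp add: err_def powr_add[symmetric])
      finally show ?thesis .
    qed
    moreover have "12 * (Cw * (A a X ^ CARD('n) * ln X powr (5 * c))) * PX X powr (-(1/4)) * (1 + ln (real (2 * H * N))) / X\<^sup>2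
       \<le> 36 * Cw * 2 powr (B * (1/4)) * (A a X ^ CARD('n) / X\<^sup>2 * ln X powr (- K))"
    proof -
      \<comment> \<open>The summand 1 in the exponent pays for 1 + ln D \<le> 3 ln X.\<close>
      have "PX X powr (-(1/4)) \<le> 2 powr (B * (1/4)) * ln X powr (- (K + 5 * c + 1))"
        using L B(3) by (intro PX_powr) auto
      then have "12 * (Cw * (A a X ^ CARD('n) * ln X powr (5 * c))) * PX X powr (-(1/4)) * (1 + ln (real (2 * H * N))) / X\<^sup>2
        \<le> 12 * (Cw * (A a X ^ CARD('n) * ln X powr (5 * c))) * (2 powr (B * (1/4)) * ln X powr (- (K + 5 * c + 1))) * (3 * ln X) / X\<^sup>2"
        using lnD lnD0 Cw AX L by (intro divide_right_mono mult_mono mult_nonneg_nonneg) auto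
      also have "\<dots> = 36 * Cw * 2 powr (B * (1/4)) * (A a X ^ CARD('n) / X\<^sup>2 * (ln X powr (5 * c) * ln X powr (- (K + 5 * c + 1)) * ln X powr 1))"
        using L by simp
      also have "ln X powr (5 * c) * ln X powr (- (K + 5 * c + 1)) * ln X powr 1 = ln X powr (- K)"
        unfolding powr_add[symmetric] by simp
      finally show ?thesis .
    qed
    ultimately show ?case unfolding C_def B_term_def distrib_right by (simp only:)
  qed
  moreover have "C \<ge> 0" using Cm Cw by (simp add: C_def)
  ultimately show ?thesis using that by blast
qed

text \<open>The measures of the level sets, multiplied by the bounds for the weight, pass to the
  limit that defines the density. The lower bound applies because t/X^2 tends to 0 and is eventually
  below \<eta>; the upper bound also shows that exact level sets are null, so the distribution of
  values has no atoms.\<close>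

lemma density_estimate:
  assumes pos: "k1 > 0" "\<eta> > 0" "\<epsilon>0 > 0"
    and up: "\<And>t \<epsilon>. \<epsilon> > 0 \<Longrightarrow> measure lebesgue {u \<in> cbox l r. \<bar>qform F u - t\<bar> \<le> \<epsilon>} \<le> K1 * \<epsilon>"
    and lo: "\<And>t \<epsilon>. \<bar>t\<bar> \<le> \<eta> \<Longrightarrow> 0 < \<epsilon> \<Longrightarrow> \<epsilon> \<le> \<epsilon>0 \<Longrightarrow> k1 * \<epsilon> \<le> measure lebesgue {u \<in> cbox l r. \<bar>qform F u - t\<bar> \<le> \<epsilon>}"
  obtains d1 d2 C where "d1 > 0" "C \<ge> 0" "\<forall>\<^sub>F X in at_top. \<exists>d. has_real_density F (of_int t / X\<^sup>2) (weight a (deriv \<Psi>) X) (cbox l r) d \<and>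
    d1 \<le> d \<and> d \<le> d2 \<and> (\<forall>P>0. norm (JX X t P - of_real d) \<le> C * P powr (-(1/4)))"
proof -
  obtain w1 w2 where w1: "w1 > 0" "w2 > 0" and evweight: "\<forall>\<^sub>F X in at_top. \<forall>u\<in>cbox l r. w1 \<le> weight a (deriv \<Psi>) X u \<and> weight a (deriv \<Psi>) X u \<le> w2"
    by (rule weight_bounds)
  obtain C where C: "C \<ge> 0" and evI: "\<forall>\<^sub>F X in at_top. \<forall>\<gamma>. norm (IX X \<gamma>) \<le> C * (1 + \<bar>\<gamma>\<bar>) powr (-(9/4))"
    by (rule IX_decay)
  have fc: "continuous_on S (qform F)" for S using qform_continuous[of S "\<lambda>x. x" F] by (simp add: continuous_on_id)
  define Z where "Z \<epsilon> s = {u \<in> cbox l r. \<bar>qform F u - s\<bar> \<le> \<epsilon>}" for \<epsilon> s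
  have cZ: "compact (Z \<epsilon> s)" for \<epsilon> s
  proof -
    have "closed {u. \<bar>qform F u - s\<bar> \<le> \<epsilon>}" by (intro closed_Collect_le continuous_intros fc)
    then have "compact (cbox l r \<inter> {u. \<bar>qform F u - s\<bar> \<le> \<epsilon>})" by (intro compact_Int_closed compact_cbox)
    moreover have "cbox l r \<inter> {u. \<bar>qform F u - s\<bar> \<le> \<epsilon>} = Z \<epsilon> s" by (auto simp: Z_def)
    ultimately show ?thesis by (simp only:)
  qed
  have null: "{u \<in> cbox l r. qform F u = s} \<in> null_sets lborel" for s
  proof -
    have eq: "{u \<in> cbox l r. qform F u = s} = Z 0 s" by (auto simp: Z_def)
    \<comment> \<open>The exact level set lies in every thickened one, whose measure is at most K1
      \<epsilon>.\<close>
    have "measure lebesgue (Z 0 s) \<le> \<delta>" if "\<delta> > 0" for \<delta>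
    proof -
      define \<epsilon> where "\<epsilon> = \<delta> / (\<bar>K1\<bar> + 1)"
      have \<epsilon>: "\<epsilon> > 0" using that by (simp add: \<epsilon>_def)
      have "measure lebesgue (Z 0 s) \<le> measure lebesgue (Z \<epsilon> s)"
        by (rule measure_mono_fmeasurable[OF _ fmeasurableD[OF lmeasurable_compact[OF cZ]] lmeasurable_compact[OF cZ]])
          (use \<epsilon> in \<open>auto simp: Z_def\<close>)
      also have "\<dots> \<le> K1 * \<epsilon>" unfolding Z_def by (rule up[OF \<epsilon>])
      also have "\<dots> \<le> (\<bar>K1\<bar> + 1) * \<epsilon>" using \<epsilon> by (intro mult_right_mono) auto
      also have "\<dots> = \<delta>" by (simp add: \<epsilon>_def)
      finally show ?thesis .
    qed
    then have "measure lebesgue (Z 0 s) \<le> 0" by (rule dense_ge)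
    then have "measure lebesgue (Z 0 s) = 0" using measure_nonneg[of lebesgue "Z 0 s"] by linarith
    then have "negligible (Z 0 s)" using lmeasurable_compact[OF cZ] by (simp add: negligible_iff_measure)
    then have "Z 0 s \<in> null_sets lebesgue" by (simp add: negligible_iff_null_sets)
    moreover have "Z 0 s \<in> sets lborel" using borel_compact[OF cZ] by simp
    ultimately show ?thesis unfolding eq by (simp add: null_sets_completion_iff)
  qed
  have lim: "((\<lambda>X. of_int t / X\<^sup>2 :: real) \<longlongrightarrow> 0) at_top"
    by (intro tendsto_divide_0[OF tendsto_const] filterlim_at_top_imp_at_infinity filterlim_pow_at_top filterlim_ident) auto
  have evt: "\<forall>\<^sub>F X in at_top. \<bar>of_int t / X\<^sup>2 :: real\<bar> < \<eta>" using tendstoD[OF lim pos(2)] by (simp add: dist_norm)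
  have "\<forall>\<^sub>F X in at_top. \<exists>d. has_real_density F (of_int t / X\<^sup>2) (weight a (deriv \<Psi>) X) (cbox l r) d \<and>
    w1 * k1 / 2 \<le> d \<and> d \<le> w2 * K1 / 2 \<and> (\<forall>P>0. norm (JX X t P - of_real d) \<le> (4 * C) * P powr (-(1/4)))"
    using evweight evI evt eventually_gt_at_top[of 0]
  proof eventually_elim
    case (elim X)
    define w :: "real^'n \<Rightarrow> real" where "w = weight a (deriv \<Psi>) X"
    have X: "X > 0" using elim by simp
    have wb: "w1 \<le> w u" "w u \<le> w2" if "u \<in> cbox l r" for u using elim(1) that by (auto simp: w_def)
    have w0: "0 \<le> w u" if "u \<in> cbox l r" for u using wb(1)[OF that] w1 by linarith
    have cw: "continuous_on (cbox l r) w" unfolding w_def by (rule weight_cont[OF X])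
    have Wpos: "(LINT x:cbox l r|lborel. w x) > 0"
    proof -
      have "set_integrable lborel (cbox l r) w" unfolding set_integrable_def by (intro borel_integrable_compact cw compact_cbox)
      then have eq: "(LINT x:cbox l r|lborel. w x) = integral (cbox l r) w" and int: "w integrable_on cbox l r"
        by (auto simp: set_borel_integral_eq_integral)
      have ne: "cbox l r \<noteq> {}" unfolding interval_ne_empty_cart using lr \<rho> by simp
      have "0 < measure lborel (cbox l r) * w1"
        unfolding content_cbox_cart[OF ne] using lr \<rho> w1 by simp
      also have "\<dots> = integral (cbox l r) (\<lambda>_. w1)" by simp
      also have "\<dots> \<le> integral (cbox l r) w" by (intro integral_le int wb integrable_const)
      finally show ?thesis by (simp only: eq)
    qed
    have "\<exists>d. ((\<lambda>\<epsilon>. integral {x \<in> cbox l r. \<bar>qform F x - of_int t / X\<^sup>2\<bar> \<le> \<epsilon>} w / (2 * \<epsilon>)) \<longlongrightarrow> d) (at_right 0) \<and>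
      (\<forall>P>0. norm ((LINT \<gamma>:{-P..P}|lborel. (LINT x:cbox l r|lborel. of_real (w x) * e (\<gamma> * qform F x)) * e (- (\<gamma> * (of_int t / X\<^sup>2)))) - of_real d) \<le> 4 * C * P powr (-(1/4)))"
    proof (rule real_density_of_decay[OF compact_cbox fc cw w0 Wpos null])
      show "norm (LINT x:cbox l r|lborel. complex_of_real (w x) * e (\<gamma> * qform F x)) \<le> C * (1 + \<bar>\<gamma>\<bar>) powr (-(9/4))" for \<gamma>
        using elim(2) unfolding IX_def w_def by blast
    qed
    then obtain d where d: "((\<lambda>\<epsilon>. integral (Z \<epsilon> (of_int t / X\<^sup>2)) w / (2 * \<epsilon>)) \<longlongrightarrow> d) (at_right 0)"
      and dP: "\<And>P. P > 0 \<Longrightarrow> norm ((LINT \<gamma>:{-P..P}|lborel. IX X \<gamma> * e (- (\<gamma> * (of_int t / X\<^sup>2)))) - of_real d) \<le> 4 * C * P powr (-(1/4))"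
      unfolding Z_def IX_def w_def by blast
    have bounds: "w1 * k1 / 2 \<le> integral (Z \<epsilon> (of_int t / X\<^sup>2)) w / (2 * \<epsilon>)" "integral (Z \<epsilon> (of_int t / X\<^sup>2)) w / (2 * \<epsilon>) \<le> w2 * K1 / 2"
      if \<epsilon>: "0 < \<epsilon>" "\<epsilon> \<le> \<epsilon>0" for \<epsilon>
    proof -
      let ?Z = "Z \<epsilon> (of_int t / X\<^sup>2)"
      have sub: "?Z \<subseteq> cbox l r" by (auto simp: Z_def)
      have "set_integrable lborel ?Z w" unfolding set_integrable_def
        by (intro borel_integrable_compact cZ continuous_on_subset[OF cw sub])
      then have int: "w integrable_on ?Z" by (rule set_borel_integral_eq_integral(1))
      have meas: "?Z \<in> lmeasurable" by (rule lmeasurable_compact[OF cZ])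
      have ic: "(\<lambda>_. v) integrable_on ?Z" for v :: real by (rule integrable_on_const[OF meas])
      have cm: "integral ?Z (\<lambda>_. v) = v * measure lebesgue ?Z" for v :: real
        using lmeasure_integral[OF meas] integral_mult_right[of ?Z v "\<lambda>_. 1::real"] by simp
      have "w1 * (k1 * \<epsilon>) \<le> w1 * measure lebesgue ?Z"
        unfolding Z_def using lo[of "of_int t / X\<^sup>2" \<epsilon>] elim(3) \<epsilon> w1 by (intro mult_left_mono) auto
      also have "\<dots> = integral ?Z (\<lambda>_. w1)" by (simp only: cm)
      also have "\<dots> \<le> integral ?Z w" by (intro integral_le ic int) (use sub wb in auto)
      finally show "w1 * k1 / 2 \<le> integral ?Z w / (2 * \<epsilon>)" using \<epsilon> by (simp add: field_simps)
      have "integral ?Z w \<le> integral ?Z (\<lambda>_. w2)" by (intro integral_le ic int) (use sub wb in auto)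
      also have "\<dots> = w2 * measure lebesgue ?Z" by (simp only: cm)
      also have "\<dots> \<le> w2 * (K1 * \<epsilon>)" unfolding Z_def using up \<epsilon> w1 by (intro mult_left_mono) auto
      finally show "integral ?Z w / (2 * \<epsilon>) \<le> w2 * K1 / 2" using \<epsilon> by (simp add: field_simps)
    qed
    have ev\<epsilon>: "\<forall>\<^sub>F \<epsilon> in at_right 0. 0 < \<epsilon> \<and> \<epsilon> \<le> \<epsilon>0"
      unfolding eventually_at_right_field using pos(3) by (intro exI[of _ \<epsilon>0]) auto
    have "w1 * k1 / 2 \<le> d"
      by (rule tendsto_lowerbound[OF d eventually_mono[OF ev\<epsilon>]]) (use bounds(1) in auto)
    moreover have "d \<le> w2 * K1 / 2"
      by (rule tendsto_upperbound[OF d eventually_mono[OF ev\<epsilon>]]) (use bounds(2) in auto)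
    moreover have "has_real_density F (of_int t / X\<^sup>2) (weight a (deriv \<Psi>) X) (cbox l r) d"
      unfolding has_real_density_def using d unfolding Z_def w_def .
    moreover have "norm (JX X t P - of_real d) \<le> 4 * C * P powr (-(1/4))" if P: "P > 0" for P
    proof -
      have "set_integrable lborel {-P..P} (\<lambda>\<gamma>. IX X \<gamma> * e (- (\<gamma> * (of_int t / X\<^sup>2))))"
        unfolding set_integrable_def
        by (intro borel_integrable_compact continuous_intros continuous_e continuous_on_subset[OF IX_cont[OF X]]) (use w0 in \<open>auto simp: w_def\<close>)
      then have "(LINT \<gamma>:{-P..P}|lborel. IX X \<gamma> * e (- (\<gamma> * (of_int t / X\<^sup>2)))) = JX X t P"
        unfolding JX_def by (rule set_borel_integral_eq_integral(2))
      then show ?thesis using dP[OF P] by simp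
    qed
    ultimately show ?case by blast
  qed
  then show ?thesis by (rule that[rotated 2]) (use w1 pos C in auto)
qed

definition "asymptotic_at t C k k' X \<longleftrightarrow>
  norm (complex_of_real (R_count F t a X (cbox l r)) - sing_series F t \<kappa> * sing_integral F t (deriv \<Psi>) B (cbox l r) X)
    \<le> C * (A a X ^ CARD('n) / X\<^sup>2 * ln X powr (- K)) \<and>
  sing_integral F t (deriv \<Psi>) B (cbox l r) X \<in> \<real> \<and>
  k * (A a X ^ CARD('n) / X\<^sup>2) \<le> Re (sing_integral F t (deriv \<Psi>) B (cbox l r) X) \<and>
  Re (sing_integral F t (deriv \<Psi>) B (cbox l r) X) \<le> k' * (A a X ^ CARD('n) / X\<^sup>2) \<and>
  (\<exists>d. has_real_density F (of_int t / X\<^sup>2) (weight a (deriv \<Psi>) X) (cbox l r) d \<and>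
    \<bar>X\<^sup>2 / A a X ^ CARD('n) * Re (sing_integral F t (deriv \<Psi>) B (cbox l r) X) - d\<bar> \<le> C * ln X powr (- K))"

text \<open>Both truncations of the singular integral, at \<open>PX X\<close> and at
  \<open>ln X powr B\<close>, are close to the same density d, so one can be exchanged for the
  other; the partial singular series is then completed at the cost of its tail.\<close>

lemma asymptotics:
  assumes pos: "k1 > 0" "\<eta> > 0" "\<epsilon>0 > 0"
    and up: "\<And>t \<epsilon>. \<epsilon> > 0 \<Longrightarrow> measure lebesgue {u \<in> cbox l r. \<bar>qform F u - t\<bar> \<le> \<epsilon>} \<le> K1 * \<epsilon>"
    and lo: "\<And>t \<epsilon>. \<bar>t\<bar> \<le> \<eta> \<Longrightarrow> 0 < \<epsilon> \<Longrightarrow> \<epsilon> \<le> \<epsilon>0 \<Longrightarrow> k1 * \<epsilon> \<le> measure lebesgue {u \<in> cbox l r. \<bar>qform F u - t\<bar> \<le> \<epsilon>}"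
  shows "\<exists>C k k'. k > 0 \<and> (\<forall>\<^sub>F X in at_top. asymptotic_at t C k k' X)"
proof -
  obtain C1 where C1: "C1 \<ge> 0" and ev1: "\<forall>\<^sub>F X in at_top. norm (complex_of_real (R_count F t a X (cbox l r)) -
      (\<Sum>q=1..nat \<lfloor>PX X\<rfloor>. B_term F t \<kappa> q) * (of_real (A a X ^ CARD('n) / X\<^sup>2) * JX X t (PX X)))
      \<le> C1 * (A a X ^ CARD('n) / X\<^sup>2 * ln X powr (- K))"
    by (rule R_count_estimate)
  obtain C2 where C2: "C2 \<ge> 0" and ev2: "\<forall>\<^sub>F P in at_top. norm ((\<Sum>q=1..nat \<lfloor>P\<rfloor>. B_term F t \<kappa> q) - sing_series F t \<kappa>) \<le> C2 * P powr (-(1/16))"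
    using series(2)[of t] by blast
  obtain d1 d2 C3 where d1: "d1 > 0" and C3: "C3 \<ge> 0" and ev3: "\<forall>\<^sub>F X in at_top. \<exists>d. has_real_density F (of_int t / X\<^sup>2) (weight a (deriv \<Psi>) X) (cbox l r) d \<and>
    d1 \<le> d \<and> d \<le> d2 \<and> (\<forall>P>0. norm (JX X t P - of_real d) \<le> C3 * P powr (-(1/4)))"
    by (rule density_estimate[OF pos up lo])
  obtain w1 w2 where w1: "w1 > 0" and evweight: "\<forall>\<^sub>F X in at_top. \<forall>u\<in>cbox l r. w1 \<le> weight a (deriv \<Psi>) X u \<and> weight a (deriv \<Psi>) X u \<le> w2"
    by (rule weight_bounds)
  have ev2': "\<forall>\<^sub>F X in at_top. norm ((\<Sum>q=1..nat \<lfloor>PX X\<rfloor>. B_term F t \<kappa> q) - sing_series F t \<kappa>) \<le> C2 * PX X powr (-(1/16))"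
    by (rule eventually_compose_filterlim[OF ev2 PX_at_top])
  have evA: "\<forall>\<^sub>F X in at_top. 1 \<le> A a X" using A by (simp add: filterlim_at_top)
  have "((\<lambda>X. ln X powr (- K)) \<longlongrightarrow> 0) at_top"
    by (rule tendsto_neg_powr[OF _ ln_at_top]) (use K in simp)
  then have "((\<lambda>X. C3 * ln X powr (- K)) \<longlongrightarrow> C3 * 0) at_top" by (intro tendsto_mult tendsto_const)
  \<comment> \<open>Makes the truncation error smaller than half of the lower bound for the density,
    so that the singular integral inherits a positive lower bound.\<close>
  then have ev4: "\<forall>\<^sub>F X in at_top. C3 * ln X powr (- K) < d1 / 2"
    using d1 by (intro order_tendstoD(2)[of _ "C3 * 0"]) auto
  define S where "S = norm (sing_series F t \<kappa>)"
  define p where "p = 2 powr (B * (1/4))"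
  define p' where "p' = 2 powr (B * (1/16))"
  define C where "C = C1 + C2 * p' * (d2 + C3) + S * (C3 * p + C3) + C3"
  have "\<forall>\<^sub>F X in at_top. asymptotic_at t C (d1 / 2) (d2 + d1 / 2) X"
    using ev1 ev2' ev3 ev4 evweight evA PX_bounds
  proof eventually_elim
    case (elim X)
    have X: "X > 0" and L: "ln X \<ge> 2" and AX: "A a X > 0" and P: "1 \<le> PX X" using elim by auto
    have w0: "\<And>u. u \<in> cbox l r \<Longrightarrow> 0 \<le> weight a (deriv \<Psi>) X u" using elim(5) w1 by fastforce
    obtain d where d: "has_real_density F (of_int t / X\<^sup>2) (weight a (deriv \<Psi>) X) (cbox l r) d" "d1 \<le> d" "d \<le> d2"
      and dJ: "\<And>P. P > 0 \<Longrightarrow> norm (JX X t P - of_real d) \<le> C3 * P powr (-(1/4))" using elim(3) by blast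
    define Y where "Y = A a X ^ CARD('n) / X\<^sup>2"
    have Y: "Y > 0" using X AX by (simp add: Y_def)
    define T where "T = ln X powr (- K)"
    have T: "T \<ge> 0" by (simp add: T_def)
    define J where "J = JX X t (ln X powr B)"
    define J' where "J' = JX X t (PX X)"
    define \<Sigma> where "\<Sigma> = (\<Sum>q=1..nat \<lfloor>PX X\<rfloor>. B_term F t \<kappa> q)"
    define I where "I = sing_integral F t (deriv \<Psi>) B (cbox l r) X"
    have I: "I = of_real Y * J" unfolding I_def Y_def J_def by (rule sing_integral_JX[OF X AX])
    have "J \<in> \<real>" unfolding J_def by (rule JX_real[OF _ X w0]) auto
    then have Ir: "I \<in> \<real>" unfolding I by simp
    have ReI: "Re I = Y * Re J" by (simp add: I)
    have Jd: "norm (J - of_real d) \<le> C3 * T"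
    proof -
      have "norm (J - of_real d) \<le> C3 * (ln X powr B) powr (-(1/4))" unfolding J_def using L by (intro dJ) auto
      also have "(ln X powr B) powr (-(1/4)) = ln X powr (- (B / 4))" by (simp add: powr_powr)
      also have "C3 * \<dots> \<le> C3 * T" unfolding T_def using L B(1) K C3 by (intro mult_left_mono powr_mono) auto
      finally show ?thesis .
    qed
    have J'd: "norm (J' - of_real d) \<le> C3 * (p * T)"
    proof -
      have "norm (J' - of_real d) \<le> C3 * PX X powr (-(1/4))" unfolding J'_def using P by (intro dJ) auto
      also have "\<dots> \<le> C3 * (p * T)" unfolding p_def T_def using L B(1) K C3 by (intro mult_left_mono PX_powr) auto
      finally show ?thesis .
    qed
    have J'b: "norm J' \<le> d2 + C3"
    proof -
      have "norm (J' - of_real d) \<le> C3 * PX X powr (-(1/4))" unfolding J'_def using P by (intro dJ) auto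
      also have "\<dots> \<le> C3 * 1"
        using C3 P ge_one_powr_ge_zero[of "PX X" "1/4"] by (intro mult_left_mono) (auto simp: powr_minus_divide)
      finally have "norm (J' - of_real d) \<le> C3" by simp
      moreover have "norm J' \<le> norm (J' - of_real d) + norm (complex_of_real d)" using norm_triangle_sub[of J' "of_real d"] by linarith
      ultimately show ?thesis using d d1 by simp
    qed
    have \<Sigma>: "norm (\<Sigma> - sing_series F t \<kappa>) \<le> C2 * (p' * T)"
    proof -
      have "norm (\<Sigma> - sing_series F t \<kappa>) \<le> C2 * PX X powr (-(1/16))" using elim(2) by (simp add: \<Sigma>_def)
      also have "\<dots> \<le> C2 * (p' * T)" unfolding p'_def T_def using L B(1) C2 by (intro mult_left_mono PX_powr) auto
      finally show ?thesis .
    qed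
    have e1: "norm (complex_of_real (R_count F t a X (cbox l r)) - \<Sigma> * (of_real Y * J')) \<le> C1 * (Y * T)"
      using elim(1) unfolding Y_def T_def \<Sigma>_def J'_def .
    have e2: "norm ((\<Sigma> - sing_series F t \<kappa>) * J') \<le> C2 * (p' * T) * (d2 + C3)"
      unfolding norm_mult using \<Sigma> J'b C2 T by (intro mult_mono) (auto simp: p'_def)
    have e3: "norm (sing_series F t \<kappa> * (J' - J)) \<le> S * (C3 * (p * T) + C3 * T)"
    proof -
      have "norm (J' - J) \<le> norm (J' - of_real d) + norm (J - of_real d)" using norm_triangle_ineq4[of "J' - of_real d" "J - of_real d"] by simp
      also have "\<dots> \<le> C3 * (p * T) + C3 * T" by (intro add_mono J'd Jd)
      finally show ?thesis unfolding norm_mult S_def by (intro mult_left_mono) auto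
    qed
    have split: "complex_of_real (R_count F t a X (cbox l r)) - sing_series F t \<kappa> * I =
      (complex_of_real (R_count F t a X (cbox l r)) - \<Sigma> * (of_real Y * J')) + of_real Y * ((\<Sigma> - sing_series F t \<kappa>) * J' + sing_series F t \<kappa> * (J' - J))"
      by (simp add: I algebra_simps)
    have "norm (complex_of_real (R_count F t a X (cbox l r)) - sing_series F t \<kappa> * I)
      \<le> norm (complex_of_real (R_count F t a X (cbox l r)) - \<Sigma> * (of_real Y * J')) + Y * (norm ((\<Sigma> - sing_series F t \<kappa>) * J') + norm (sing_series F t \<kappa> * (J' - J)))"
      unfolding split
    proof (rule order_trans[OF norm_triangle_ineq add_left_mono])
      show "norm (of_real Y * ((\<Sigma> - sing_series F t \<kappa>) * J' + sing_series F t \<kappa> * (J' - J))) \<le> Y * (norm ((\<Sigma> - sing_series F t \<kappa>) * J') + norm (sing_series F t \<kappa> * (J' - J)))"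
        unfolding norm_mult[of "of_real Y"] norm_of_real using Y by (simp add: norm_triangle_ineq)
    qed
    also have "\<dots> \<le> C1 * (Y * T) + Y * (C2 * (p' * T) * (d2 + C3) + S * (C3 * (p * T) + C3 * T))"
      using Y by (intro add_mono e1 mult_left_mono e2 e3) auto
    also have "\<dots> = (C - C3) * (Y * T)" by (simp add: C_def algebra_simps)
    also have "\<dots> \<le> C * (Y * T)" using C3 Y T by (intro mult_right_mono) auto
    finally have main: "norm (complex_of_real (R_count F t a X (cbox l r)) - sing_series F t \<kappa> * I) \<le> C * (Y * T)" .
    have ReJ: "\<bar>Re J - d\<bar> \<le> C3 * T" using abs_Re_le_cmod[of "J - of_real d"] Jd by simp
    have ReJ2: "d1 / 2 \<le> Re J" "Re J \<le> d2 + d1 / 2" using ReJ d elim(4) unfolding T_def by linarith+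
    have "d1 / 2 * Y \<le> Re I" "Re I \<le> (d2 + d1 / 2) * Y"
      unfolding ReI mult.commute[of Y] using ReJ2 Y by (auto intro!: mult_right_mono)
    moreover have "\<bar>X\<^sup>2 / A a X ^ CARD('n) * Re I - d\<bar> \<le> C * T"
    proof -
      have "X\<^sup>2 / A a X ^ CARD('n) * Re I = Re J" unfolding ReI Y_def using X AX by simp
      moreover have "C3 * T \<le> C * T"
      proof (intro mult_right_mono T)
        have "0 \<le> d2" using d d1 by linarith
        then show "C3 \<le> C" using C1 C2 C3 by (simp add: C_def S_def p_def p'_def)
      qed
      ultimately show ?thesis using ReJ by linarith
    qed
    ultimately show ?case using main Ir d(1) unfolding asymptotic_at_def I_def Y_def T_def by blast
  qed
  moreover have "d1 / 2 > 0" using d1 by simp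
  ultimately show ?thesis by blast
qed

end

text \<open>The thresholds for \<open>B\<close> and \<open>m\<close> are quantified before the
  sequence, so they do not depend on it, nor on \<kappa>, \<open>Q\<close> or \<Psi>. The error and
  the bounds are with respect to A(X)^s/X^2, and the last clause makes the interpretation as a local
  density quantitative: the normalised singular integral approximates d up to (ln X)^(-K).\<close>

theorem theorem1p2:
  fixes F :: "real^'n^'n" and t :: int and K c1 c2 :: real
  assumes "integer_form F"
    and "det F \<noteq> 0"
    and "cond_L1 F"
    and "\<exists>x\<in>pos_orthant. qform F x = 0"
    and "K > 0" and "c1 \<ge> 0" and "c2 \<ge> 0"
  shows "\<exists>B0. \<forall>B\<ge>B0. \<exists>m0. \<forall>m\<ge>m0.
    \<forall>(a :: nat \<Rightarrow> real) (\<kappa> :: nat \<Rightarrow> int \<Rightarrow> real) (Q :: real \<Rightarrow> real) (\<Psi> :: real \<Rightarrow> real).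
      (\<forall>x\<ge>1. 0 \<le> a x) \<and> filterlim (A a) at_top at_top \<and>
      cond_C Q \<kappa> \<and> cond_D a Q \<kappa> \<and> cond_K \<kappa> c1 \<and> cond_L2 a c2 \<and>
      (\<forall>\<^sub>F X in at_top. ln X powr B \<le> Q X) \<and>
      smoothly_approximable a \<and> smooth_approximation a m \<Psi>
      \<longrightarrow>
      summable (\<lambda>q. B_term F t \<kappa> (Suc q)) \<and>
      (\<exists>\<CC>1 \<CC>2. compact \<CC>1 \<and> compact \<CC>2 \<and> \<CC>1 \<subseteq> \<CC>2 \<and> \<CC>2 \<subseteq> pos_orthant \<and>
        (\<exists>C k k'. k > 0 \<and> (\<forall>\<^sub>F X in at_top. \<exists>l u.
          \<CC>1 \<subseteq> cbox l u \<and> cbox l u \<subseteq> \<CC>2 \<and>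
          norm (complex_of_real (R_count F t a X (cbox l u))
                - sing_series F t \<kappa> * sing_integral F t (deriv \<Psi>) B (cbox l u) X)
            \<le> C * (A a X ^ CARD('n) / X\<^sup>2 * ln X powr (- K)) \<and>
          sing_integral F t (deriv \<Psi>) B (cbox l u) X \<in> \<real> \<and>
          k * (A a X ^ CARD('n) / X\<^sup>2) \<le> Re (sing_integral F t (deriv \<Psi>) B (cbox l u) X) \<and>
          Re (sing_integral F t (deriv \<Psi>) B (cbox l u) X) \<le> k' * (A a X ^ CARD('n) / X\<^sup>2) \<and>
          (\<exists>d. has_real_density F (of_int t / X\<^sup>2) (weight a (deriv \<Psi>) X) (cbox l u) d \<and>
            \<bar>X\<^sup>2 / A a X ^ CARD('n) * Re (sing_integral F t (deriv \<Psi>) B (cbox l u) X) - d\<bar>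
              \<le> C * ln X powr (- K)))))"
proof -
  obtain x0 where x0: "x0 \<in> pos_orthant" "qform F x0 = 0" using assms(4) by blast
  have sym: "transpose F = F" using assms(1) by (simp add: integer_form_def)
  show ?thesis
  proof (rule qform_level_measure[OF sym assms(2) x0])
    fix \<rho> k1 K1 \<eta> \<epsilon>0 :: real assume \<rho>: "\<rho> > 0" and pos: "k1 > 0" "K1 > 0" "\<eta> > 0" "\<epsilon>0 > 0" and \<rho>x: "\<And>i. \<rho> < x0 $ i"
      and up: "\<And>t \<epsilon>. \<epsilon> > 0 \<Longrightarrow> measure lebesgue {u \<in> cbox (\<chi> i. x0 $ i - \<rho>) (\<chi> i. x0 $ i + \<rho>). \<bar>qform F u - t\<bar> \<le> \<epsilon>} \<le> K1 * \<epsilon>"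
      and lo: "\<And>t \<epsilon>. \<bar>t\<bar> \<le> \<eta> \<Longrightarrow> 0 < \<epsilon> \<Longrightarrow> \<epsilon> \<le> \<epsilon>0 \<Longrightarrow>
         k1 * \<epsilon> \<le> measure lebesgue {u \<in> cbox (\<chi> i. x0 $ i - \<rho>) (\<chi> i. x0 $ i + \<rho>). \<bar>qform F u - t\<bar> \<le> \<epsilon>}"
    define l :: "real^'n" where "l = (\<chi> i. x0 $ i - \<rho>)"
    define r :: "real^'n" where "r = (\<chi> i. x0 $ i + \<rho>)"
    \<comment> \<open>Half of the smallest lower end point, so that there is room below the box for
      the points p - 1/2.\<close>
    define \<theta> where "\<theta> = min 1 (Min (range (\<lambda>i. l $ i)) / 2)"
    have lpos: "0 < l $ i" for i using \<rho>x[of i] by (simp add: l_def)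
    have Ml: "Min (range (\<lambda>i. l $ i)) \<le> l $ i" for i by (intro Min_le) auto
    have Mpos: "0 < Min (range (\<lambda>i. l $ i))" using lpos by (subst Min_gr_iff) auto
    have \<theta>: "0 < \<theta>" "\<theta> \<le> 1" using Mpos by (auto simp: \<theta>_def)
    have \<theta>l: "2 * \<theta> \<le> l $ i" for i using Ml[of i] by (simp add: \<theta>_def min_def)
    define \<Lambda> where "\<Lambda> = max 2 (nat \<lceil>Max (range (\<lambda>i. r $ i))\<rceil>)"
    have \<Lambda>2: "2 \<le> \<Lambda>" by (simp add: \<Lambda>_def)
    have \<Lambda>r: "r $ i \<le> real \<Lambda>" for i
    proof -
      have "r $ i \<le> Max (range (\<lambda>i. r $ i))" by (intro Max_ge) auto
      also have "\<dots> \<le> real (nat \<lceil>Max (range (\<lambda>i. r $ i))\<rceil>)" by (rule real_nat_ceiling_ge)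
      also have "\<dots> \<le> real \<Lambda>" by (simp add: \<Lambda>_def)
      finally show ?thesis .
    qed
    have box: "cbox l r \<subseteq> pos_orthant"
    proof
      fix u assume "u \<in> cbox l r"
      then have "l $ i \<le> u $ i" for i by (simp add: mem_box_cart)
      then show "u \<in> pos_orthant" unfolding pos_orthant_def using lpos less_le_trans by blast
    qed
    define B0 where "B0 = max (16 * K) (max (40 * c2) (4 * (K + 5 * c2 + 1)))"
    define m0 where "m0 B = nat \<lceil>3 * B + K + (3 * B + K + 2 * B + B * real CARD('n)) * real CARD('n)\<rceil>" for B
    show ?thesis
    proof (intro exI[of _ B0] allI impI, goal_cases)
      case (1 B)
      then have B: "B \<ge> B0" .
      show ?case
      proof (intro exI[of _ "m0 B"] allI impI, elim conjE, goal_cases)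
        case (1 m a \<kappa> Q \<Psi>)
        note m = 1(1) and a = 1(2) and A = 1(3) and D = 1(5) and L2 = 1(7) and Q = 1(8) and \<Psi> = 1(10)
        interpret circle_setup F l r \<theta> \<rho> \<Lambda> a \<kappa> Q \<Psi> B c2 K m
        proof (unfold_locales)
          show "r $ i = l $ i + 2 * \<rho>" for i by (simp add: l_def r_def)
          show "3 * B + K + (3 * B + K + 2 * B + B * real CARD('n)) * real CARD('n) \<le> real m"
            using m unfolding m0_def by (simp only: nat_le_iff ceiling_le_iff of_int_of_nat_eq)
        qed (use assms \<rho> \<theta> \<theta>l \<Lambda>2 \<Lambda>r a A D Q L2 \<Psi> B in \<open>auto simp: B0_def\<close>)
        have "\<exists>C k k'. k > 0 \<and> (\<forall>\<^sub>F X in at_top. asymptotic_at t C k k' X)"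
        proof (rule asymptotics[OF pos(1,3,4)])
          show "measure lebesgue {u \<in> cbox l r. \<bar>qform F u - t\<bar> \<le> \<epsilon>} \<le> K1 * \<epsilon>" if "\<epsilon> > 0" for t \<epsilon>
            unfolding l_def r_def by (rule up[OF that])
          show "k1 * \<epsilon> \<le> measure lebesgue {u \<in> cbox l r. \<bar>qform F u - t\<bar> \<le> \<epsilon>}" if "\<bar>t\<bar> \<le> \<eta>" "0 < \<epsilon>" "\<epsilon> \<le> \<epsilon>0" for t \<epsilon>
            unfolding l_def r_def by (rule lo[OF that])
        qed
        then obtain C k k' where "k > 0" and ev: "\<forall>\<^sub>F X in at_top. asymptotic_at t C k k' X"
          by (elim exE conjE)
        \<comment> \<open>The box itself serves as inner and as outer compact set, since the same
          box is used for all X.\<close>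
        show ?case
          by (rule conjI[OF series(1)], rule exI[of _ "cbox l r"], rule exI[of _ "cbox l r"], rule conjI[OF compact_cbox],
              rule conjI[OF compact_cbox], rule conjI[OF subset_refl], rule conjI[OF box], rule exI[of _ C], rule exI[of _ k],
              rule exI[of _ k'], rule conjI[OF \<open>k > 0\<close>], rule eventually_mono[OF ev[unfolded asymptotic_at_def]], rule exI[of _ l], rule exI[of _ r],
              rule conjI[OF subset_refl], rule conjI[OF subset_refl])
      qed
    qed
  qed
qed

end
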